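(* Let $0\le m\le n$ be integers. For $d\ge 0$, we have $$\mathrm{Frob}(R(\Pi_{n,m})_d)=\sum_{\substack{\lambda\vdash n\\ \lambda_1\le m\\ \ell(\lambda)=n-d}}SF_\lambda,$$ where $SF_\lambda=\prod_{i=1}^r h_{a_i}[h_{b_i}]$ if we write $\lambda=(b_1^{a_1},b_2^{a_2},\dots,b_r^{a_r})$ with $b_1>b_2>\dots>b_r>0$.
   Context: Let $[n]=\{1,\dots,n\}$ and let $\binom{[n]}{2}$ be the set of 2-element subsets of $[n]$. Let $\mathbb{C}\big[\mathbf{x}_{\binom{[n]}{2}}\big]$ be the polynomial ring in the variables $x_{\{i,j\}}=x_{\{j,i\}}$ indexed by $\binom{[n]}{2}$; it is the coordinate ring of $\mathbb{C}^{\binom{[n]}{2}}$. The symmetric group $\mathfrak{S}_n$ acts on it by the graded algebra automorphisms determined by $w\cdot x_{\{i,j\}}=x_{\{w(i),w(j)\}}$. An unordered set partition $\pi$ of $[n]$ is identified with the point $\mathbf{z}\in\mathbb{C}^{\binom{[n]}{2}}$ with $z_{\{i,j\}}=1$ if $i,j$ lie in the same block of $\pi$, and $z_{\{i,j\}}=0$ otherwise. $\Pi_{n,m}\subseteq\mathbb{C}^{\binom{[n]}{2}}$ is the finite set of (points identified with) unordered set partitions of $[n]$ all of whose blocks have size at most $m$. Orbit harmonics: for a finite set $\mathcal{Z}\subseteq\mathbb{C}^{\binom{[n]}{2}}$, $\mathbf{I}(\mathcal{Z})$ is the ideal of polynomials vanishing on $\mathcal{Z}$; for a nonzero polynomial $f$,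 $\tau(f)$ is its top-degree homogeneous component; $\mathrm{gr}\,\mathbf{I}(\mathcal{Z})=\langle\tau(f): 0\ne f\in\mathbf{I}(\mathcal{Z})\rangle$; and $R(\mathcal{Z})=\mathbb{C}\big[\mathbf{x}_{\binom{[n]}{2}}\big]/\mathrm{gr}\,\mathbf{I}(\mathcal{Z})$. If $\mathcal{Z}$ is $\mathfrak{S}_n$-stable, $R(\mathcal{Z})$ is a graded $\mathfrak{S}_n$-module, with degree $d$ component $R(\mathcal{Z})_d$. If an $\mathfrak{S}_n$-module $V\cong\bigoplus_{\lambda\vdash n}(V^\lambda)^{\oplus c_\lambda}$, with $V^\lambda$ the Specht modules (irreducibles), then $\mathrm{Frob}(V)=\sum_\lambda c_\lambda s_\lambda$ ($s_\lambda$ the Schur function). $h_k$ is the complete homogeneous symmetric function and $F[G]$ denotes plethysm of symmetric functions. $\ell(\lambda)$ is the number of nonzero parts of $\lambda$; in $(b_1^{a_1},\dots,b_r^{a_r})$ the exponent $a_i$ is the multiplicity of the part $b_i$. *)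

theory Defs
  imports
    Complex_Main
    "HOL-Library.Poly_Mapping"
    "HOL-Library.FuncSet"
    "HOL-Library.Disjoint_Sets"
    "HOL-Library.Function_Algebras"
    "HOL-Combinatorics.Permutations"
    "HOL-Algebra.Module"
    "HOL-Algebra.QuotRing"
    "HOL-Algebra.Sym_Groups"
begin

section \<open>Multivariate polynomials\<close>

text \<open>A monomial is a finitely supported exponent function, a polynomial is a finitely supported
  coefficient function on monomials; the type-class multiplication on
  \<^typ>\<open>'k \<Rightarrow>\<^sub>0 'a\<close> is convolution.\<close>

type_synonym ('v, 'a) mpoly = "('v \<Rightarrow>\<^sub>0 nat) \<Rightarrow>\<^sub>0 'a"

definition Const :: "'a::zero \<Rightarrow> ('v, 'a) mpoly" where
  "Const c = Poly_Mapping.single 0 c"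

definition Var :: "'v \<Rightarrow> ('v, 'a::zero_neq_one) mpoly" where
  "Var v = Poly_Mapping.single (Poly_Mapping.single v 1) 1"

text \<open>The image of a polynomial under the algebra homomorphism sending each variable \<open>v\<close> to
  \<open>z v\<close>, where \<open>\<kappa>\<close> embeds the coefficients into the target ring.\<close>

definition mpoly_eval ::
  "('a::zero \<Rightarrow> 'b::comm_ring_1) \<Rightarrow> ('v \<Rightarrow> 'b) \<Rightarrow> ('v, 'a) mpoly \<Rightarrow> 'b" where
  "mpoly_eval \<kappa> z p =
     (\<Sum>m\<in>Poly_Mapping.keys p. \<kappa> (Poly_Mapping.lookup p m) *
        (\<Prod>v\<in>Poly_Mapping.keys m. z v ^ Poly_Mapping.lookup m v))"

definition monom_deg :: "('v \<Rightarrow>\<^sub>0 nat) \<Rightarrow> nat" where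
  "monom_deg m = (\<Sum>v\<in>Poly_Mapping.keys m. Poly_Mapping.lookup m v)"

definition homogeneous :: "nat \<Rightarrow> ('v, 'a::zero) mpoly \<Rightarrow> bool" where
  "homogeneous d p \<longleftrightarrow> (\<forall>m\<in>Poly_Mapping.keys p. monom_deg m = d)"

definition hom_component :: "nat \<Rightarrow> ('v, 'a::comm_monoid_add) mpoly \<Rightarrow> ('v, 'a) mpoly" where
  "hom_component d p =
     (\<Sum>m\<in>{m \<in> Poly_Mapping.keys p. monom_deg m = d}.
        Poly_Mapping.single m (Poly_Mapping.lookup p m))"

text \<open>Only meaningful for nonzero polynomials.\<close>

definition total_deg :: "('v, 'a::zero) mpoly \<Rightarrow> nat" where
  "total_deg p = Max (monom_deg ` Poly_Mapping.keys p)"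

definition top_component :: "('v, 'a::comm_monoid_add) mpoly \<Rightarrow> ('v, 'a) mpoly" where
  "top_component p = hom_component (total_deg p) p"


section \<open>Modules over the symmetric group\<close>

text \<open>A complex vector space together with an action of permutations. Only the action of
  permutations of \<open>{1..n}\<close> is ever used. The fields \<open>mult\<close> and \<open>one\<close>, which every
  \<^typ>\<open>('a, 'b) module\<close> record inherits from rings, play no role.\<close>

record 'b sn_module = "(complex, 'b) module" +
  act :: "(nat \<Rightarrow> nat) \<Rightarrow> 'b \<Rightarrow> 'b"

definition sn_iso :: "nat \<Rightarrow> 'a sn_module \<Rightarrow> 'b sn_module \<Rightarrow> bool" where
  "sn_iso n V W \<longleftrightarrow>
     (\<exists>\<phi> \<in> iso (add_monoid V) (add_monoid W).
        (\<forall>c. \<forall>v\<in>carrier V. \<phi> (smult V c v) = smult W c (\<phi> v)) \<and>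
        (\<forall>w\<in>carrier (sym_group n). \<forall>v\<in>carrier V. \<phi> (act V w v) = act W w (\<phi> v)))"

text \<open>External direct sum; used for finite index sets only.\<close>

definition direct_sum :: "'i set \<Rightarrow> ('i \<Rightarrow> 'b sn_module) \<Rightarrow> ('i \<Rightarrow> 'b) sn_module" where
  "direct_sum I V =
     \<lparr>carrier = (\<Pi>\<^sub>E i\<in>I. carrier (V i)),
      monoid.mult = undefined, one = undefined,
      zero = (\<lambda>i\<in>I. zero (V i)),
      add = (\<lambda>x y. \<lambda>i\<in>I. add (V i) (x i) (y i)),
      smult = (\<lambda>c x. \<lambda>i\<in>I. smult (V i) c (x i)),
      act = (\<lambda>w x. \<lambda>i\<in>I. act (V i) w (x i))\<rparr>"


section \<open>Integer partitions and Specht modules\<close>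

definition int_partitions :: "nat \<Rightarrow> nat list set" where
  "int_partitions n = {la. sorted_wrt (\<ge>) la \<and> 0 \<notin> set la \<and> sum_list la = n}"

definition largest_part :: "nat list \<Rightarrow> nat" where
  "largest_part la = (case la of [] \<Rightarrow> 0 | b # _ \<Rightarrow> b)"

text \<open>Cells are pairs of row and column index, both counted from 0.\<close>

definition cells :: "nat list \<Rightarrow> (nat \<times> nat) set" where
  "cells la = {(i, j). i < length la \<and> j < la ! i}"

definition tableaux :: "nat list \<Rightarrow> (nat \<times> nat \<Rightarrow> nat) set" where
  "tableaux la = {T \<in> extensional (cells la). bij_betw T (cells la) {1..sum_list la}}"

text \<open>A tabloid (row equivalence class of a tableau) is the list of the sets of entries of its
  rows.\<close>

definition tabloid :: "nat list \<Rightarrow> (nat \<times> nat \<Rightarrow> nat) \<Rightarrow> nat set list" where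
  "tabloid la T = map (\<lambda>i. T ` {c \<in> cells la. fst c = i}) [0..<length la]"

definition column_stabilizer ::
  "nat list \<Rightarrow> (nat \<times> nat \<Rightarrow> nat) \<Rightarrow> (nat \<Rightarrow> nat) set" where
  "column_stabilizer la T =
     {\<sigma> \<in> carrier (sym_group (sum_list la)).
        \<forall>j. \<sigma> ` T ` {c \<in> cells la. snd c = j} = T ` {c \<in> cells la. snd c = j}}"

definition tabloid_act ::
  "(nat \<Rightarrow> nat) \<Rightarrow> (nat set list \<Rightarrow>\<^sub>0 complex) \<Rightarrow> (nat set list \<Rightarrow>\<^sub>0 complex)" where
  "tabloid_act w v =
     (\<Sum>t\<in>Poly_Mapping.keys v. Poly_Mapping.single (map ((`) w) t) (Poly_Mapping.lookup v t))"

definition polytabloid :: "nat list \<Rightarrow> (nat \<times> nat \<Rightarrow> nat) \<Rightarrow> (nat set list \<Rightarrow>\<^sub>0 complex)" where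
  "polytabloid la T =
     (\<Sum>\<sigma>\<in>column_stabilizer la T.
        Poly_Mapping.single (map ((`) \<sigma>) (tabloid la T)) (of_int (sign \<sigma>)))"

text \<open>The span of all polytabloids inside the permutation module on tabloids.\<close>

definition specht :: "nat list \<Rightarrow> (nat set list \<Rightarrow>\<^sub>0 complex) sn_module" where
  "specht la =
     \<lparr>carrier = {\<Sum>T\<in>tableaux la. Poly_Mapping.map ((*) (a T)) (polytabloid la T) | a. True},
      monoid.mult = undefined, one = undefined,
      zero = 0, add = (+),
      smult = (\<lambda>c. Poly_Mapping.map ((*) c)),
      act = tabloid_act\<rparr>"


section \<open>Symmetric functions\<close>

text \<open>The ring of symmetric functions over the rationals is realised inside an inverse limit: a
  symmetric function \<open>F\<close> is the sequence of its specialisations \<open>F N = F(x\<^sub>0, \<dots>, x\<^bsub>N-1\<^esub>, 0, 0, \<dots>)\<close>,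
  and the ring operations are the pointwise ones.\<close>

type_synonym symfun = "nat \<Rightarrow> (nat, rat) mpoly"

definition complete_hom :: "nat \<Rightarrow> symfun" where
  "complete_hom k N =
     (\<Sum>m\<in>{m. Poly_Mapping.keys m \<subseteq> {..<N} \<and> monom_deg m = k}. Poly_Mapping.single m 1)"

definition power_sum :: "nat \<Rightarrow> symfun" where
  "power_sum k N = (\<Sum>i<N. Var i ^ k)"

definition ssyt :: "nat list \<Rightarrow> nat \<Rightarrow> (nat \<times> nat \<Rightarrow> nat) set" where
  "ssyt la N =
     {T \<in> cells la \<rightarrow>\<^sub>E {..<N}.
        (\<forall>i j. (i, Suc j) \<in> cells la \<longrightarrow> T (i, j) \<le> T (i, Suc j)) \<and>
        (\<forall>i j. (Suc i, j) \<in> cells la \<longrightarrow> T (i, j) < T (Suc i, j))}"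

definition schur :: "nat list \<Rightarrow> symfun" where
  "schur la N = (\<Sum>T\<in>ssyt la N. \<Prod>c\<in>cells la. Var (T c))"

text \<open>The plethysm \<open>p\<^sub>k[G]\<close>, obtained from \<open>G\<close> by replacing every variable by its \<open>k\<close>-th power.\<close>

definition power_plethysm :: "nat \<Rightarrow> symfun \<Rightarrow> symfun" where
  "power_plethysm k G N = mpoly_eval Const (\<lambda>i. Var i ^ k) (G N)"

text \<open>\<open>F \<mapsto> F[G]\<close> is the algebra homomorphism on symmetric functions with \<open>p\<^sub>k \<mapsto> p\<^sub>k[G]\<close>. The power
  sums \<open>p\<^sub>1, p\<^sub>2, \<dots>\<close> generate the symmetric functions freely over the rationals, so \<open>F\<close> is
  \<open>P(p\<^sub>1, p\<^sub>2, \<dots>)\<close> for a unique polynomial \<open>P\<close>; variable \<open>k\<close> of \<open>P\<close> stands for \<open>p\<^bsub>k+1\<^esub>\<close>.\<close>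

definition plethysm :: "symfun \<Rightarrow> symfun \<Rightarrow> symfun" where
  "plethysm F G =
     (THE H. \<exists>P :: (nat, rat) mpoly.
        F = mpoly_eval (\<lambda>c N. Const c) (\<lambda>k. power_sum (Suc k)) P \<and>
        H = mpoly_eval (\<lambda>c N. Const c) (\<lambda>k. power_plethysm (Suc k) G) P)"

definition SF :: "nat list \<Rightarrow> symfun" where
  "SF la = (\<Prod>b\<in>set la. plethysm (complete_hom (count_list la b)) (complete_hom b))"

definition frobenius :: "nat \<Rightarrow> 'b sn_module \<Rightarrow> symfun" where
  "frobenius n V =
     (THE F. \<exists>c :: nat list \<Rightarrow> nat.
        sn_iso n V (direct_sum (SIGMA la : int_partitions n. {..<c la}) (\<lambda>(la, _). specht la)) \<and>
        F = (\<Sum>la\<in>int_partitions n. of_nat (c la) * schur la))"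


section \<open>Orbit harmonics\<close>

definition edges :: "nat \<Rightarrow> nat set set" where
  "edges n = {e. e \<subseteq> {1..n} \<and> card e = 2}"

definition edge_poly_ring :: "nat \<Rightarrow> (nat set, complex) mpoly ring" where
  "edge_poly_ring n =
     \<lparr>carrier = {p. \<forall>m\<in>Poly_Mapping.keys p. Poly_Mapping.keys m \<subseteq> edges n},
      monoid.mult = (*), one = 1, zero = 0, add = (+)\<rparr>"

definition poly_act ::
  "(nat \<Rightarrow> nat) \<Rightarrow> (nat set, complex) mpoly \<Rightarrow> (nat set, complex) mpoly" where
  "poly_act w = mpoly_eval Const (\<lambda>e. Var (w ` e))"

definition vanishing_ideal :: "nat \<Rightarrow> (nat set \<Rightarrow> complex) set \<Rightarrow> (nat set, complex) mpoly set" where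
  "vanishing_ideal n Z = {f \<in> carrier (edge_poly_ring n). \<forall>z\<in>Z. mpoly_eval (\<lambda>c. c) z f = 0}"

definition gr_ideal :: "nat \<Rightarrow> (nat set \<Rightarrow> complex) set \<Rightarrow> (nat set, complex) mpoly set" where
  "gr_ideal n Z = Idl\<^bsub>edge_poly_ring n\<^esub> (top_component ` (vanishing_ideal n Z - {0}))"

definition orbit_ring :: "nat \<Rightarrow> (nat set \<Rightarrow> complex) set \<Rightarrow> (nat set, complex) mpoly set ring" where
  "orbit_ring n Z = edge_poly_ring n Quot gr_ideal n Z"

text \<open>The degree \<open>d\<close> component of the orbit harmonics quotient. Elements are cosets of
  \<open>gr_ideal n Z\<close>. When \<open>Z\<close> is stable under the symmetric group, the image of the coset of \<open>f\<close>
  under \<open>poly_act w\<close> is the coset of \<open>poly_act w f\<close>.\<close>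

definition orbit_module ::
  "nat \<Rightarrow> (nat set \<Rightarrow> complex) set \<Rightarrow> nat \<Rightarrow> (nat set, complex) mpoly set sn_module" where
  "orbit_module n Z d =
     \<lparr>carrier = {gr_ideal n Z +>\<^bsub>edge_poly_ring n\<^esub> f | f.
                   f \<in> carrier (edge_poly_ring n) \<and> homogeneous d f},
      monoid.mult = monoid.mult (orbit_ring n Z), one = one (orbit_ring n Z),
      zero = zero (orbit_ring n Z), add = add (orbit_ring n Z),
      smult = (\<lambda>c C. (gr_ideal n Z +>\<^bsub>edge_poly_ring n\<^esub> Const c) \<otimes>\<^bsub>orbit_ring n Z\<^esub> C),
      act = (\<lambda>w C. poly_act w ` C)\<rparr>"

definition partition_point :: "nat \<Rightarrow> nat set set \<Rightarrow> nat set \<Rightarrow> complex" where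
  "partition_point n P = (\<lambda>e\<in>edges n. if \<exists>B\<in>P. e \<subseteq> B then 1 else 0)"

definition bounded_partition_points :: "nat \<Rightarrow> nat \<Rightarrow> (nat set \<Rightarrow> complex) set" where
  "bounded_partition_points n m =
     partition_point n ` {P. partition_on {1..n} P \<and> (\<forall>B\<in>P. card B \<le> m)}"

end

theory Submission imports Defs begin

text \<open>
  \<^emph>\<open>The graded ring.\<close> A monomial takes the value 1 at the point of a set partition \<open>Q\<close> if all edges of
  its support lie inside blocks of \<open>Q\<close>, that is, if the partition \<open>P\<close> of \<open>{1..n}\<close> into the connected
  components of the support refines \<open>Q\<close>; otherwise its value is 0. So as a function on \<open>Z = \<Pi>\<^bsub>n,m\<^esub>\<close> a
  monomial depends on \<open>P\<close> alone: it vanishes if \<open>P\<close> has a block of more than \<open>m\<close> elements, and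
  otherwise it agrees with the monomial of a spanning forest of \<open>P\<close>, of degree \<open>n - card P\<close>, which is
  at most its own degree. If that degree is smaller, the monomial lies in the associated graded ideal.
  So the degree \<open>d\<close> piece of the ring is spanned by the forest monomials of the partitions \<open>P\<close> with
  \<open>n - d\<close> blocks. They are linearly independent because the functions that test whether \<open>P\<close> refines
  \<open>Q\<close> are (\<open>refinement_independent\<close>), and the symmetric group permutes them, since two spanning
  forests of the same partition are equal modulo the ideal. Hence the piece is the permutation module
  on the set partitions with \<open>n - d\<close> blocks of size at most \<open>m\<close> (\<open>orbit_module_iso\<close>).

  \<^emph>\<open>Its Frobenius image.\<close> Coefficients of monomials are dimensions of invariants. Choose a colouring
  \<open>c\<close> of \<open>{1..n}\<close> in which colour \<open>k\<close> occurs \<open>\<nu>\<^sub>k\<close> times, and let \<open>H\<close> be the Young subgroup of the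
  permutations that preserve colours. The \<open>H\<close>-invariants of a Specht module have a coordinate system
  indexed by the semistandard tableaux of content \<open>\<nu>\<close> (\<open>specht_coords\<close>, \<open>colour_arrays_eq\<close>),
  and these are counted by the coefficient of \<open>x\<^sup>\<nu>\<close> in the Schur function. So for every module that is
  a sum of Specht modules the coefficient of \<open>x\<^sup>\<nu>\<close> in the Frobenius image is the dimension of
  the invariants. For a permutation module this dimension is the number of orbits of \<open>H\<close>. Two set
  partitions are in the same orbit if and only if their blocks have the same multiset of colour
  contents; such a multiset is a multiset of \<open>n - d\<close> monomials of degrees between 1 and \<open>m\<close> with
  product \<open>x\<^sup>\<nu>\<close> (\<open>level_partitions_coords\<close>). On the other side, \<open>h\<^sub>a[h\<^sub>b]\<close> is \<open>h\<^sub>a\<close> evaluated at the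
  monomials of degree \<open>b\<close>, so that \<open>SF\<^sub>\<lambda>\<close> enumerates the multisets of monomials whose degrees are the
  parts of \<open>\<lambda>\<close> (\<open>SF_expansion\<close>). Therefore both sides have the same coefficients.

  \<^emph>\<open>The representation theory behind it.\<close> All modules are spaces of functions. The span of the
  polytabloids is the space of functions on tabloids that satisfy the Garnir relations
  (\<open>specht_fun_eq\<close>). An \<open>H\<close>-invariant function with these relations is determined by its values at
  the semistandard tableaux (\<open>straightening\<close>), and these values are arbitrary, because the
  symmetrised polytabloids of semistandard tableaux are triangular with respect to the weight
  \<open>row_weight\<close> (\<open>invariants_take_values\<close>). For the row stabiliser of a tableau the invariants
  form a line, which makes the Specht modules irreducible (\<open>specht_irreducible\<close>).

  The coefficients also show that a decomposition into Specht modules determines the Frobenius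
  image. That a decomposition exists needs an argument as well (\<open>specht_decomposition\<close>). Let \<open>U\<close> be a
  nonzero invariant space of functions on a permuted set, and let \<open>v \<in> U\<close> be nonzero and invariant under a
  Young subgroup whose parts are as unequal as possible. The Garnir sums of the translates of \<open>v\<close> are
  invariant under Young subgroups with even more unequal parts, so they vanish. So pairing with the
  translates of \<open>v\<close> maps \<open>U\<close> to functions that satisfy the Garnir relations, hence onto a Specht
  module by irreducibility. Averaging splits this map, and the kernel has smaller dimension.
\<close>

(* the sets {1..n} are to keep their lower bound 1 instead of Suc 0 *)
declare One_nat_def [simp del]

section \<open>Homomorphisms and invariants of modules over the symmetric group\<close>

definition sn_hom :: "nat \<Rightarrow> 'a sn_module \<Rightarrow> 'b sn_module \<Rightarrow> ('a \<Rightarrow> 'b) \<Rightarrow> bool" where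
  "sn_hom n V W \<phi> \<longleftrightarrow> \<phi> \<in> carrier V \<rightarrow> carrier W \<and>
     (\<forall>x\<in>carrier V. \<forall>y\<in>carrier V. \<phi> (x \<oplus>\<^bsub>V\<^esub> y) = \<phi> x \<oplus>\<^bsub>W\<^esub> \<phi> y) \<and>
     (\<forall>c. \<forall>x\<in>carrier V. \<phi> (c \<odot>\<^bsub>V\<^esub> x) = c \<odot>\<^bsub>W\<^esub> \<phi> x) \<and>
     (\<forall>w. w permutes {1..n} \<longrightarrow> (\<forall>x\<in>carrier V. \<phi> (act V w x) = act W w (\<phi> x)))"

definition sn_closed :: "nat \<Rightarrow> 'a sn_module \<Rightarrow> bool" where
  "sn_closed n V \<longleftrightarrow> (\<forall>x\<in>carrier V. \<forall>y\<in>carrier V. x \<oplus>\<^bsub>V\<^esub> y \<in> carrier V) \<and>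
     (\<forall>c. \<forall>x\<in>carrier V. c \<odot>\<^bsub>V\<^esub> x \<in> carrier V) \<and>
     (\<forall>w. w permutes {1..n} \<longrightarrow> (\<forall>x\<in>carrier V. act V w x \<in> carrier V))"

lemma sn_iso_iff:
  "sn_iso n V W \<longleftrightarrow> (\<exists>\<phi>. sn_hom n V W \<phi> \<and> bij_betw \<phi> (carrier V) (carrier W))"
  unfolding sn_iso_def sn_hom_def iso_def hom_def sym_group_def
  by (auto simp: Pi_def)

lemma sn_iso_trans:
  assumes "sn_iso n U V" "sn_iso n V W"
  shows "sn_iso n U W"
proof -
  obtain f g where f: "sn_hom n U V f" "bij_betw f (carrier U) (carrier V)"
    and g: "sn_hom n V W g" "bij_betw g (carrier V) (carrier W)"
    using assms by (auto simp: sn_iso_iff)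
  have "bij_betw (g \<circ> f) (carrier U) (carrier W)"
    using f g by (auto intro: bij_betw_trans)
  moreover have "sn_hom n U W (g \<circ> f)"
    using f(1) g(1) by (simp add: sn_hom_def Pi_def)
  ultimately show ?thesis by (auto simp: sn_iso_iff)
qed

lemma sn_iso_sym:
  assumes "sn_iso n U V" "sn_closed n U"
  shows "sn_iso n V U"
proof -
  obtain f where f: "sn_hom n U V f" "bij_betw f (carrier U) (carrier V)"
    using assms by (auto simp: sn_iso_iff)
  let ?g = "inv_into (carrier U) f"
  have b: "bij_betw ?g (carrier V) (carrier U)" using f(2) by (rule bij_betw_inv_into)
  have mem: "?g y \<in> carrier U" if "y \<in> carrier V" for y
    using b that by (auto dest: bij_betwE)
  have fg: "f (?g y) = y" if "y \<in> carrier V" for y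
    using f(2) that by (rule bij_betw_inv_into_right)
  have gf: "?g y = x" if "x \<in> carrier U" "f x = y" for x y
    using f(2) that by (auto intro: bij_betw_inv_into_left)
  have "sn_hom n V U ?g"
    unfolding sn_hom_def
    using mem assms(2) f(1) by (auto intro!: gf simp: fg sn_hom_def sn_closed_def)
  with b show ?thesis by (auto simp: sn_iso_iff)
qed

definition invariants :: "(nat \<Rightarrow> nat) set \<Rightarrow> 'b sn_module \<Rightarrow> 'b set" where
  "invariants H V = {v \<in> carrier V. \<forall>h\<in>H. act V h v = v}"

definition supported_on :: "'i set \<Rightarrow> ('i \<Rightarrow> complex) set" where
  "supported_on I = {f. \<forall>i. i \<notin> I \<longrightarrow> f i = 0}"

text \<open>For finite \<open>I\<close> this says that the \<open>H\<close>-invariants of \<open>V\<close> have dimension \<open>card I\<close>. A coordinate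
  system is easy to transport along isomorphisms and to assemble for direct sums, which makes it more
  convenient than a dimension for modules that are given as records.\<close>

definition has_coords :: "(nat \<Rightarrow> nat) set \<Rightarrow> 'b sn_module \<Rightarrow> 'i set \<Rightarrow> bool" where
  "has_coords H V I \<longleftrightarrow> (\<exists>\<psi>. bij_betw \<psi> (supported_on I) (invariants H V) \<and>
     (\<forall>f\<in>supported_on I. \<forall>g\<in>supported_on I. \<psi> (\<lambda>i. f i + g i) = \<psi> f \<oplus>\<^bsub>V\<^esub> \<psi> g) \<and>
     (\<forall>c. \<forall>f\<in>supported_on I. \<psi> (\<lambda>i. c * f i) = c \<odot>\<^bsub>V\<^esub> \<psi> f))"

definition fscale :: "complex \<Rightarrow> ('x \<Rightarrow> complex) \<Rightarrow> 'x \<Rightarrow> complex" where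
  "fscale c f = (\<lambda>x. c * f x)"

lemma fscale_apply [simp]: "fscale c f x = c * f x" by (simp add: fscale_def)

interpretation fs: vector_space "fscale :: complex \<Rightarrow> ('x \<Rightarrow> complex) \<Rightarrow> 'x \<Rightarrow> complex"
  by unfold_locales (auto simp: fscale_def algebra_simps)

interpretation fsp: vector_space_pair "fscale :: complex \<Rightarrow> ('x \<Rightarrow> complex) \<Rightarrow> 'x \<Rightarrow> complex"
  "fscale :: complex \<Rightarrow> ('y \<Rightarrow> complex) \<Rightarrow> 'y \<Rightarrow> complex"
  by unfold_locales

lemma sum_fun_apply: "(\<Sum>i\<in>A. F i) x = (\<Sum>i\<in>A. F i x)" for F :: "'i \<Rightarrow> 'x \<Rightarrow> 'c::comm_monoid_add"
  by (induction A rule: infinite_finite_induct) auto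

definition delta :: "'x \<Rightarrow> 'x \<Rightarrow> complex" where
  "delta x y = (if y = x then 1 else 0)"

lemma supported_on_expansion:
  assumes "finite I" "f \<in> supported_on I"
  shows "f = (\<Sum>i\<in>I. fscale (f i) (delta i))"
proof
  fix x
  have "(\<Sum>i\<in>I. fscale (f i) (delta i)) x = (\<Sum>i\<in>I. if i = x then f i else 0)"
    by (simp add: sum_fun_apply delta_def eq_commute if_distrib cong: if_cong)
  also have "\<dots> = f x" using assms by (simp add: supported_on_def)
  finally show "f x = (\<Sum>i\<in>I. fscale (f i) (delta i)) x" ..
qed

lemma supported_on_subspace: "fs.subspace (supported_on I)"
  by (auto simp: fs.subspace_def supported_on_def)

lemma supported_on_span:
  assumes "finite I"
  shows "supported_on I \<subseteq> fs.span (delta ` I)"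
proof
  fix f assume "f \<in> supported_on I"
  with assms have "f = (\<Sum>i\<in>I. fscale (f i) (delta i))" by (rule supported_on_expansion)
  also have "\<dots> \<in> fs.span (delta ` I)"
    by (intro fs.span_sum fs.span_scale fs.span_base) auto
  finally show "f \<in> fs.span (delta ` I)" .
qed

lemma independent_card_le:
  assumes "finite X" "B \<subseteq> supported_on X" "fs.independent B"
  shows "finite B \<and> card B \<le> card X"
proof -
  have "finite B \<and> card B \<le> card (delta ` X)"
    using assms supported_on_span[OF assms(1)] by (intro fs.independent_span_bound) auto
  moreover have "card (delta ` X) \<le> card X" using assms(1) by (rule card_image_le)
  ultimately show ?thesis by linarith
qed

lemma delta_in_supported: "i \<in> I \<Longrightarrow> delta i \<in> supported_on I"
  by (auto simp: delta_def supported_on_def)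

lemma linear_injection_card_le:
  fixes g :: "('i \<Rightarrow> complex) \<Rightarrow> ('j \<Rightarrow> complex)"
  assumes I: "finite I" and J: "finite J"
    and g: "g \<in> supported_on I \<rightarrow> supported_on J" "inj_on g (supported_on I)"
    and add: "\<And>f f'. f \<in> supported_on I \<Longrightarrow> f' \<in> supported_on I \<Longrightarrow> g (f + f') = g f + g f'"
    and scale: "\<And>c f. f \<in> supported_on I \<Longrightarrow> g (fscale c f) = fscale c (g f)"
  shows "card I \<le> card J"
proof -
  have inS: "fscale c (delta i) \<in> supported_on I" if "i \<in> I" for c i
    using that by (auto simp: supported_on_def delta_def)
  have g0: "g 0 = 0"
    using scale[of 0 0] by (auto simp: supported_on_def fscale_def zero_fun_def)
  have gsum: "g (\<Sum>i\<in>K. fscale (a i) (delta i)) = (\<Sum>i\<in>K. fscale (a i) (g (delta i)))"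
    if "K \<subseteq> I" for K a
  proof -
    have "finite K" using that I finite_subset by blast
    then show ?thesis using that
    proof (induction K)
      case empty
      then show ?case using g0 by (simp add: zero_fun_def)
    next
      case (insert k K)
      have "(\<Sum>i\<in>K. fscale (a i) (delta i)) \<in> supported_on I"
        using insert.prems inS by (intro fs.subspace_sum supported_on_subspace) auto
      moreover have k: "k \<in> I" "k \<notin> K" "finite K" "K \<subseteq> I" using insert by auto
      ultimately have "g (fscale (a k) (delta k) + (\<Sum>i\<in>K. fscale (a i) (delta i)))
          = fscale (a k) (g (delta k)) + g (\<Sum>i\<in>K. fscale (a i) (delta i))"
        using add[OF inS[of k "a k"]] scale[OF delta_in_supported[of k I], of "a k"] by metis
      then show ?case
        unfolding insert.IH[OF k(4)] sum.insert[OF k(3,2)] .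
    qed
  qed
  have inj: "inj_on (\<lambda>i. g (delta i)) I"
  proof (rule inj_onI)
    fix i j assume "i \<in> I" "j \<in> I" "g (delta i) = g (delta j)"
    then have "delta i = delta j"
      using g(2) delta_in_supported by (metis inj_onD)
    from fun_cong[OF this, of i] show "i = j" by (simp add: delta_def split: if_splits)
  qed
  have "fs.independent ((\<lambda>i. g (delta i)) ` I)"
  proof (rule fs.independent_if_scalars_zero)
    fix a x
    assume *: "(\<Sum>x\<in>(\<lambda>i. g (delta i)) ` I. fscale (a x) x) = 0" and x: "x \<in> (\<lambda>i. g (delta i)) ` I"
    have "(\<Sum>i\<in>I. fscale (a (g (delta i))) (g (delta i))) = 0"
      using * by (simp add: sum.reindex[OF inj])
    then have "g (\<Sum>i\<in>I. fscale (a (g (delta i))) (delta i)) = g 0"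
      using gsum[of I "\<lambda>i. a (g (delta i))"] g0 by simp
    moreover have "(\<Sum>i\<in>I. fscale (a (g (delta i))) (delta i)) \<in> supported_on I"
      using inS by (intro fs.subspace_sum supported_on_subspace) auto
    moreover have "0 \<in> supported_on I" by (rule fs.subspace_0[OF supported_on_subspace])
    ultimately have z: "(\<Sum>i\<in>I. fscale (a (g (delta i))) (delta i)) = 0"
      using g(2) by (metis inj_onD)
    obtain i where i: "i \<in> I" "x = g (delta i)" using x by auto
    have "(\<Sum>j\<in>I. fscale (a (g (delta j))) (delta j)) i = (\<Sum>j\<in>I. if j = i then a (g (delta j)) else 0)"
      by (simp add: sum_fun_apply delta_def eq_commute if_distrib cong: if_cong)
    then show "a x = 0" using z i I by simp
  qed (use I in auto)
  moreover have "(\<lambda>i. g (delta i)) ` I \<subseteq> supported_on J"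
    using funcset_mem[OF g(1)] delta_in_supported by (meson image_subsetI)
  ultimately have "card ((\<lambda>i. g (delta i)) ` I) \<le> card J"
    using independent_card_le[OF J] by blast
  then show ?thesis by (simp add: card_image[OF inj])
qed

text \<open>Two coordinate systems for the same invariants compose to a linear injection between spaces of
  functions.\<close>

lemma has_coords_card_le:
  assumes I: "finite I" "has_coords H V I" and J: "finite J" "has_coords H V J"
  shows "card I \<le> card J"
proof -
  obtain \<psi> where \<psi>: "bij_betw \<psi> (supported_on I) (invariants H V)"
     "\<And>f g. f\<in>supported_on I \<Longrightarrow> g\<in>supported_on I \<Longrightarrow> \<psi> (\<lambda>i. f i + g i) = \<psi> f \<oplus>\<^bsub>V\<^esub> \<psi> g"
     "\<And>c f. f\<in>supported_on I \<Longrightarrow> \<psi> (\<lambda>i. c * f i) = c \<odot>\<^bsub>V\<^esub> \<psi> f"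
    using I(2) unfolding has_coords_def by blast
  obtain \<chi> where \<chi>: "bij_betw \<chi> (supported_on J) (invariants H V)"
     "\<And>f g. f\<in>supported_on J \<Longrightarrow> g\<in>supported_on J \<Longrightarrow> \<chi> (\<lambda>i. f i + g i) = \<chi> f \<oplus>\<^bsub>V\<^esub> \<chi> g"
     "\<And>c f. f\<in>supported_on J \<Longrightarrow> \<chi> (\<lambda>i. c * f i) = c \<odot>\<^bsub>V\<^esub> \<chi> f"
    using J(2) unfolding has_coords_def by blast
  define g where "g = inv_into (supported_on J) \<chi> \<circ> \<psi>"
  have gb: "bij_betw g (supported_on I) (supported_on J)"
    unfolding g_def using \<psi>(1) \<chi>(1) by (meson bij_betw_inv_into bij_betw_trans)
  have gS: "g f \<in> supported_on J" if "f \<in> supported_on I" for f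
    using gb that by (auto dest: bij_betwE)
  have \<chi>g: "\<chi> (g f) = \<psi> f" if "f \<in> supported_on I" for f
    using that \<psi>(1) \<chi>(1) unfolding g_def by (metis bij_betwE bij_betw_inv_into_right comp_apply)
  have geq: "g f = h" if "f \<in> supported_on I" "h \<in> supported_on J" "\<psi> f = \<chi> h" for f h
    using that \<chi>(1) unfolding g_def by (simp add: bij_betw_inv_into_left)
  have pl: "f + f' = (\<lambda>i. f i + f' i)" "fscale c f = (\<lambda>i. c * f i)"
    for f f' :: "'z \<Rightarrow> complex" and c by (auto simp: fscale_def)
  show ?thesis
  proof (rule linear_injection_card_le[of I J g])
    fix f f' assume *: "f \<in> supported_on I" "f' \<in> supported_on I"
    show "g (f + f') = g f + g f'"
    proof (rule geq)
      show "f + f' \<in> supported_on I" "g f + g f' \<in> supported_on J"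
        using * gS by (auto intro: fs.subspace_add[OF supported_on_subspace])
      show "\<psi> (f + f') = \<chi> (g f + g f')"
        using * gS by (simp add: pl \<psi>(2) \<chi>(2) \<chi>g)
    qed
  next
    fix c f assume *: "f \<in> supported_on I"
    show "g (fscale c f) = fscale c (g f)"
    proof (rule geq)
      show "fscale c f \<in> supported_on I" "fscale c (g f) \<in> supported_on J"
        using * gS by (auto intro: fs.subspace_scale[OF supported_on_subspace])
      show "\<psi> (fscale c f) = \<chi> (fscale c (g f))"
        using * gS by (simp add: pl \<psi>(3) \<chi>(3) \<chi>g)
    qed
  qed (use I J gb in \<open>auto simp: bij_betw_def\<close>)
qed

lemma has_coords_card_unique:
  assumes "finite I" "has_coords H V I" "finite J" "has_coords H V J"
  shows "card I = card J"
  using assms by (intro antisym has_coords_card_le)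

lemma has_coords_iso:
  assumes "has_coords H V I" "sn_iso n V W" "sn_closed n V" "H \<subseteq> {w. w permutes {1..n}}"
  shows "has_coords H W I"
proof -
  obtain \<psi> where \<psi>: "bij_betw \<psi> (supported_on I) (invariants H V)"
     "\<And>f g. f\<in>supported_on I \<Longrightarrow> g\<in>supported_on I \<Longrightarrow> \<psi> (\<lambda>i. f i + g i) = \<psi> f \<oplus>\<^bsub>V\<^esub> \<psi> g"
     "\<And>c f. f\<in>supported_on I \<Longrightarrow> \<psi> (\<lambda>i. c * f i) = c \<odot>\<^bsub>V\<^esub> \<psi> f"
    using assms(1) unfolding has_coords_def by blast
  obtain \<phi> where \<phi>: "sn_hom n V W \<phi>" "bij_betw \<phi> (carrier V) (carrier W)"
    using assms(2) by (auto simp: sn_iso_iff)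
  have inv: "\<psi> f \<in> carrier V" if "f \<in> supported_on I" for f
    using \<psi>(1) that by (auto dest: bij_betwE simp: invariants_def)
  have "bij_betw \<phi> (invariants H V) (invariants H W)"
  proof (intro bij_betw_imageI equalityI subsetI)
    show "inj_on \<phi> (invariants H V)"
      using \<phi>(2) by (auto simp: bij_betw_def invariants_def intro: inj_on_subset)
  next
    fix y assume "y \<in> \<phi> ` invariants H V"
    then obtain x where x: "x \<in> carrier V" "\<forall>h\<in>H. act V h x = x" "y = \<phi> x"
      by (auto simp: invariants_def)
    have "act W h y = y" if "h \<in> H" for h
      using \<phi>(1) x that assms(4) unfolding sn_hom_def by (metis mem_Collect_eq subsetD)
    moreover have "y \<in> carrier W" using \<phi>(2) x by (auto dest: bij_betwE)
    ultimately show "y \<in> invariants H W" by (auto simp: invariants_def)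
  next
    fix y assume y: "y \<in> invariants H W"
    then obtain x where x: "x \<in> carrier V" "y = \<phi> x"
      using \<phi>(2) by (auto simp: bij_betw_def invariants_def)
    have "act V h x = x" if "h \<in> H" for h
    proof -
      have hp: "h permutes {1..n}" using that assms(4) by auto
      have "\<phi> (act V h x) = \<phi> x"
        using \<phi>(1) x y that hp unfolding sn_hom_def invariants_def by auto
      moreover have "act V h x \<in> carrier V" using assms(3) hp x by (auto simp: sn_closed_def)
      ultimately show ?thesis using \<phi>(2) x by (auto simp: bij_betw_def dest: inj_onD)
    qed
    then show "y \<in> \<phi> ` invariants H V" using x by (auto simp: invariants_def)
  qed
  then have "bij_betw (\<phi> \<circ> \<psi>) (supported_on I) (invariants H W)"
    using \<psi>(1) by (auto intro: bij_betw_trans)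
  then show ?thesis
    unfolding has_coords_def using \<phi>(1) inv
    by (intro exI[of _ "\<phi> \<circ> \<psi>"]) (auto simp: \<psi>(2,3) sn_hom_def)
qed

lemma has_coords_direct_sum:
  assumes "\<And>j. j \<in> J \<Longrightarrow> has_coords H (V j) (K j)"
  shows "has_coords H (direct_sum J V) (SIGMA j:J. K j)"
proof -
  have "\<forall>j\<in>J. \<exists>\<psi>. bij_betw \<psi> (supported_on (K j)) (invariants H (V j)) \<and>
     (\<forall>f\<in>supported_on (K j). \<forall>g\<in>supported_on (K j). \<psi> (\<lambda>i. f i + g i) = \<psi> f \<oplus>\<^bsub>V j\<^esub> \<psi> g) \<and>
     (\<forall>c. \<forall>f\<in>supported_on (K j). \<psi> (\<lambda>i. c * f i) = c \<odot>\<^bsub>V j\<^esub> \<psi> f)"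
    using assms by (simp add: has_coords_def)
  then obtain \<psi> where "\<forall>j\<in>J. bij_betw (\<psi> j) (supported_on (K j)) (invariants H (V j)) \<and>
     (\<forall>f\<in>supported_on (K j). \<forall>g\<in>supported_on (K j). \<psi> j (\<lambda>i. f i + g i) = \<psi> j f \<oplus>\<^bsub>V j\<^esub> \<psi> j g) \<and>
     (\<forall>c. \<forall>f\<in>supported_on (K j). \<psi> j (\<lambda>i. c * f i) = c \<odot>\<^bsub>V j\<^esub> \<psi> j f)"
    by (rule bchoice[THEN exE])
  then have \<psi>: "\<And>j. j \<in> J \<Longrightarrow> bij_betw (\<psi> j) (supported_on (K j)) (invariants H (V j))"
    "\<And>j f g. j \<in> J \<Longrightarrow> f\<in>supported_on (K j) \<Longrightarrow> g\<in>supported_on (K j) \<Longrightarrow>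
        \<psi> j (\<lambda>i. f i + g i) = \<psi> j f \<oplus>\<^bsub>V j\<^esub> \<psi> j g"
    "\<And>j c f. j \<in> J \<Longrightarrow> f\<in>supported_on (K j) \<Longrightarrow> \<psi> j (\<lambda>i. c * f i) = c \<odot>\<^bsub>V j\<^esub> \<psi> j f"
    by auto
  define \<Psi> where "\<Psi> f = (\<lambda>j\<in>J. \<psi> j (\<lambda>k. f (j, k)))" for f :: "'a \<times> 'c \<Rightarrow> complex"
  let ?S = "SIGMA j:J. K j"
  have sl: "(\<lambda>k. f (j, k)) \<in> supported_on (K j)" if "f \<in> supported_on ?S" for f j
    using that by (auto simp: supported_on_def)
  have inv_iff: "x \<in> invariants H (direct_sum J V) \<longleftrightarrow>
      x \<in> extensional J \<and> (\<forall>j\<in>J. x j \<in> invariants H (V j))" for x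
    by (auto simp: invariants_def direct_sum_def PiE_def Pi_def fun_eq_iff extensional_def)
  have bij: "bij_betw \<Psi> (supported_on ?S) (invariants H (direct_sum J V))"
  proof (rule bij_betwI')
    fix f g assume fg: "f \<in> supported_on ?S" "g \<in> supported_on ?S"
    show "\<Psi> f = \<Psi> g \<longleftrightarrow> f = g"
    proof
      assume eq: "\<Psi> f = \<Psi> g"
      show "f = g"
      proof
        fix p :: "'a \<times> 'c" obtain j k where p: "p = (j, k)" by force
        show "f p = g p"
        proof (cases "j \<in> J")
          case True
          then have "\<psi> j (\<lambda>k. f (j, k)) = \<psi> j (\<lambda>k. g (j, k))"
            using fun_cong[OF eq, of j] by (simp add: \<Psi>_def)
          then have "(\<lambda>k. f (j, k)) = (\<lambda>k. g (j, k))"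
            using \<psi>(1)[OF True] sl fg by (auto simp: bij_betw_def dest: inj_onD)
          then show ?thesis using p by (auto dest: fun_cong)
        qed (use fg p in \<open>auto simp: supported_on_def\<close>)
      qed
    qed simp
  next
    fix f assume f: "f \<in> supported_on ?S"
    show "\<Psi> f \<in> invariants H (direct_sum J V)"
      unfolding inv_iff using sl[OF f] \<psi>(1) by (auto simp: \<Psi>_def dest: bij_betwE)
  next
    fix x assume x: "x \<in> invariants H (direct_sum J V)"
    have "\<forall>j\<in>J. \<exists>f\<in>supported_on (K j). \<psi> j f = x j"
      using x \<psi>(1) unfolding inv_iff bij_betw_def by (metis imageE)
    then obtain F where F: "\<And>j. j \<in> J \<Longrightarrow> F j \<in> supported_on (K j) \<and> \<psi> j (F j) = x j"
      by metis
    define f where "f = (\<lambda>(j,k). if j \<in> J then F j k else 0)"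
    have "f \<in> supported_on ?S" using F by (auto simp: f_def supported_on_def)
    moreover have "x = \<Psi> f"
    proof
      fix j show "x j = \<Psi> f j"
        using x F[of j] by (cases "j \<in> J") (auto simp: \<Psi>_def f_def inv_iff extensional_def)
    qed
    ultimately show "\<exists>f\<in>supported_on ?S. x = \<Psi> f" by blast
  qed
  show ?thesis
    unfolding has_coords_def
    using bij sl by (intro exI[of _ \<Psi>]) (auto simp: \<Psi>_def direct_sum_def fun_eq_iff restrict_def \<psi>(2,3))
qed

text \<open>Lets a direct sum grow by one summand, as in the induction that splits off Specht modules.\<close>

lemma direct_sum_insert_iso:
  assumes j: "j \<notin> I"
    and p: "sn_hom n V (W j) p" and q: "sn_hom n V (direct_sum I W) q"
    and bij: "bij_betw (\<lambda>v. (p v, q v)) (carrier V) (carrier (W j) \<times> carrier (direct_sum I W))"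
  shows "sn_iso n V (direct_sum (insert j I) W)"
proof -
  define \<phi> where "\<phi> v = (\<lambda>i\<in>insert j I. if i = j then p v else q v i)" for v
  have pS: "p v \<in> carrier (W j)" and qS: "q v \<in> carrier (direct_sum I W)" if "v \<in> carrier V" for v
    using p q that by (auto simp: sn_hom_def)
  have qi: "q v i \<in> carrier (W i)" if "v \<in> carrier V" "i \<in> I" for v i
    using qS[OF that(1)] that(2) by (auto simp: direct_sum_def)
  have "bij_betw \<phi> (carrier V) (carrier (direct_sum (insert j I) W))"
  proof (rule bij_betwI')
    fix x y assume xy: "x \<in> carrier V" "y \<in> carrier V"
    show "\<phi> x = \<phi> y \<longleftrightarrow> x = y"
    proof
      assume eq: "\<phi> x = \<phi> y"
      have "p x = p y" using fun_cong[OF eq, of j] by (simp add: \<phi>_def)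
      moreover have "q x = q y"
      proof (rule extensionalityI[of _ I])
        show "q x \<in> extensional I" "q y \<in> extensional I"
          using qS xy by (auto simp: direct_sum_def PiE_def)
        fix i assume "i \<in> I"
        moreover from this j have "i \<noteq> j" by blast
        ultimately show "q x i = q y i" using fun_cong[OF eq, of i] by (simp add: \<phi>_def)
      qed
      ultimately show "x = y" using bij xy by (auto simp: bij_betw_def dest: inj_onD)
    qed simp
  next
    fix x assume "x \<in> carrier V"
    then show "\<phi> x \<in> carrier (direct_sum (insert j I) W)"
      using pS qi by (auto simp: \<phi>_def direct_sum_def)
  next
    fix y assume y: "y \<in> carrier (direct_sum (insert j I) W)"
    have "(y j, restrict y I) \<in> carrier (W j) \<times> carrier (direct_sum I W)"
      using y by (auto simp: direct_sum_def)
    then obtain x where x: "x \<in> carrier V" "p x = y j" "q x = restrict y I"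
      using bij unfolding bij_betw_def by (metis (no_types, lifting) imageE prod.inject)
    have "y = \<phi> x"
      using y j x(2,3) by (auto simp: \<phi>_def direct_sum_def fun_eq_iff PiE_def extensional_def)
    with x show "\<exists>x\<in>carrier V. y = \<phi> x" by blast
  qed
  moreover have "sn_hom n V (direct_sum (insert j I) W) \<phi>"
    using p q j calculation unfolding sn_hom_def
    by (auto simp: \<phi>_def direct_sum_def fun_eq_iff dest: bij_betwE)
  ultimately show ?thesis by (auto simp: sn_iso_iff)
qed

section \<open>Modules of functions on a permuted set\<close>

locale perm_action =
  fixes n :: nat and X :: "'x set" and a :: "(nat \<Rightarrow> nat) \<Rightarrow> 'x \<Rightarrow> 'x"
  assumes finite_X: "finite X"
    and mem_X: "w permutes {1..n} \<Longrightarrow> x \<in> X \<Longrightarrow> a w x \<in> X"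
    and act_id: "a id x = x"
    and act_comp: "w permutes {1..n} \<Longrightarrow> v permutes {1..n} \<Longrightarrow> a (w \<circ> v) x = a w (a v x)"

definition fun_act :: "((nat \<Rightarrow> nat) \<Rightarrow> 'x \<Rightarrow> 'x) \<Rightarrow> (nat \<Rightarrow> nat) \<Rightarrow> ('x \<Rightarrow> complex) \<Rightarrow> 'x \<Rightarrow> complex" where
  "fun_act a w f = (\<lambda>x. f (a (inv' w) x))"

definition fun_module :: "((nat \<Rightarrow> nat) \<Rightarrow> 'x \<Rightarrow> 'x) \<Rightarrow> ('x \<Rightarrow> complex) set \<Rightarrow> ('x \<Rightarrow> complex) sn_module" where
  "fun_module a U = \<lparr>carrier = U, monoid.mult = undefined, one = undefined,
     zero = 0, add = (+), smult = fscale, act = fun_act a\<rparr>"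

lemma fun_module_simps [simp]:
  "carrier (fun_module a U) = U" "add (fun_module a U) = (+)"
  "zero (fun_module a U) = 0"
  "smult (fun_module a U) = fscale" "act (fun_module a U) = fun_act a"
  by (simp_all add: fun_module_def)

context perm_action
begin

lemma inv_cancel:
  assumes "w permutes {1..n}"
  shows "a w (a (inv' w) x) = x" "a (inv' w) (a w x) = x"
proof -
  have p: "inv' w permutes {1..n}" using assms by (rule permutes_inv)
  show "a w (a (inv' w) x) = x"
    using act_comp[OF assms p, of x] permutes_inv_o(1)[OF assms] act_id by simp
  show "a (inv' w) (a w x) = x"
    using act_comp[OF p assms, of x] permutes_inv_o(2)[OF assms] act_id by simp
qed

lemma mem_X_iff: "w permutes {1..n} \<Longrightarrow> a w x \<in> X \<longleftrightarrow> x \<in> X"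
  by (metis inv_cancel(2) mem_X permutes_inv)

lemma act_inj: "w permutes {1..n} \<Longrightarrow> a w x = a w y \<longleftrightarrow> x = y"
  by (metis inv_cancel(2))

lemma bij_betw_act: "w permutes {1..n} \<Longrightarrow> bij_betw (a w) X X"
  by (rule bij_betwI[where g = "a (inv' w)"]) (auto simp: inv_cancel mem_X permutes_inv)

lemma fun_act_apply_act: "w permutes {1..n} \<Longrightarrow> fun_act a w f (a w x) = f x"
  by (simp add: fun_act_def inv_cancel)

lemma fun_act_id [simp]: "fun_act a id f = f"
  by (simp add: fun_act_def act_id)

lemma fun_act_comp:
  assumes "w permutes {1..n}" "v permutes {1..n}"
  shows "fun_act a (w \<circ> v) f = fun_act a w (fun_act a v f)"
proof -
  have "inv' (w \<circ> v) = inv' v \<circ> inv' w"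
    using assms by (intro o_inv_distrib permutes_bij)
  then show ?thesis
    using assms by (simp add: fun_act_def act_comp permutes_inv)
qed

lemma fun_act_inverse:
  assumes "w permutes {1..n}"
  shows "fun_act a w (fun_act a (inv' w) f) = f" "fun_act a (inv' w) (fun_act a w f) = f"
  using assms fun_act_comp[of w "inv' w" f] fun_act_comp[of "inv' w" w f]
  by (simp_all add: permutes_inv permutes_inv_o)

lemma fun_act_add: "fun_act a w (f + g) = fun_act a w f + fun_act a w g"
  by (auto simp: fun_act_def)

lemma fun_act_scale: "fun_act a w (fscale c f) = fscale c (fun_act a w f)"
  by (auto simp: fun_act_def)

lemma fun_act_diff: "fun_act a w (f - g) = fun_act a w f - fun_act a w g"
  by (auto simp: fun_act_def fun_diff_def)

lemma fun_act_sum: "fun_act a w (\<Sum>i\<in>A. F i) = (\<Sum>i\<in>A. fun_act a w (F i))"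
  by (auto simp: fun_act_def sum_fun_apply)

lemma fun_act_supported:
  "w permutes {1..n} \<Longrightarrow> f \<in> supported_on X \<Longrightarrow> fun_act a w f \<in> supported_on X"
  by (auto simp: supported_on_def fun_act_def mem_X_iff permutes_inv)

definition submodule :: "('x \<Rightarrow> complex) set \<Rightarrow> bool" where
  "submodule U \<longleftrightarrow> fs.subspace U \<and> U \<subseteq> supported_on X \<and>
     (\<forall>w f. w permutes {1..n} \<longrightarrow> f \<in> U \<longrightarrow> fun_act a w f \<in> U)"

lemma submodule_closed: "submodule U \<Longrightarrow> sn_closed n (fun_module a U)"
  by (simp add: submodule_def sn_closed_def fs.subspace_def)

lemma submodule_supported: "submodule (supported_on X)"
  by (simp add: submodule_def supported_on_subspace fun_act_supported)

end

lemma linear_fun_iff: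
  "Vector_Spaces.linear fscale fscale g \<longleftrightarrow>
     (\<forall>f h. g (f + h) = g f + g h) \<and> (\<forall>c f. g (fscale c f) = fscale c (g f))"
  by (auto simp: Vector_Spaces.linear_iff fs.vector_space_axioms)

text \<open>Averaging a linear map over the group, the engine of Maschke's theorem.\<close>

definition average :: "nat \<Rightarrow> ((nat \<Rightarrow> nat) \<Rightarrow> 'x \<Rightarrow> 'x) \<Rightarrow> ((nat \<Rightarrow> nat) \<Rightarrow> 'y \<Rightarrow> 'y) \<Rightarrow>
    (('x \<Rightarrow> complex) \<Rightarrow> ('y \<Rightarrow> complex)) \<Rightarrow> ('x \<Rightarrow> complex) \<Rightarrow> ('y \<Rightarrow> complex)" where
  "average n a b g f = fscale (1 / of_nat (fact n :: nat))
     (\<Sum>w | w permutes {1..n}. fun_act b w (g (fun_act a (inv' w) f)))"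

locale perm_action_pair = A: perm_action n X a + B: perm_action n Y b
  for n :: nat and X :: "'x set" and a and Y :: "'y set" and b
begin

lemma average_linear:
  assumes "Vector_Spaces.linear fscale fscale g"
  shows "Vector_Spaces.linear fscale fscale (average n a b g)"
  using assms
  unfolding linear_fun_iff average_def A.fun_act_add A.fun_act_scale B.fun_act_add B.fun_act_scale
  by (simp add: A.fun_act_add A.fun_act_scale B.fun_act_add B.fun_act_scale sum.distrib
      fs.scale_right_distrib fs.scale_sum_right mult.commute)

lemma average_equivariant:
  assumes v: "v permutes {1..n}"
  shows "average n a b g (fun_act a v f) = fun_act b v (average n a b g f)"
proof -
  let ?G = "{w. w permutes {1..n}}"
  have "(\<Sum>w\<in>?G. fun_act b w (g (fun_act a (inv' w) (fun_act a v f))))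
      = (\<Sum>w\<in>?G. fun_act b (v \<circ> w) (g (fun_act a (inv' (v \<circ> w)) (fun_act a v f))))"
    by (intro sum.reindex_bij_betw[symmetric] bij_betwI[where g = "\<lambda>w. inv' v \<circ> w"])
       (auto simp: v permutes_compose permutes_inv o_assoc permutes_inv_o[OF v])
  also have "\<dots> = (\<Sum>w\<in>?G. fun_act b v (fun_act b w (g (fun_act a (inv' w) f))))"
  proof (rule sum.cong)
    fix w assume "w \<in> ?G"
    then have w: "w permutes {1..n}" by simp
    have "inv' (v \<circ> w) = inv' w \<circ> inv' v"
      using v w by (intro o_inv_distrib permutes_bij)
    then have "fun_act a (inv' (v \<circ> w)) (fun_act a v f) = fun_act a (inv' w) f"
      using v w by (simp add: A.fun_act_comp permutes_inv A.fun_act_inverse)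
    then show "fun_act b (v \<circ> w) (g (fun_act a (inv' (v \<circ> w)) (fun_act a v f)))
       = fun_act b v (fun_act b w (g (fun_act a (inv' w) f)))"
      using v w by (simp add: B.fun_act_comp)
  qed simp
  finally show ?thesis
    by (simp add: average_def B.fun_act_scale B.fun_act_sum)
qed

lemma average_mem:
  assumes "fs.subspace S" "\<And>w h. w permutes {1..n} \<Longrightarrow> h \<in> S \<Longrightarrow> fun_act b w h \<in> S"
    and "\<And>w. w permutes {1..n} \<Longrightarrow> g (fun_act a w f) \<in> S"
  shows "average n a b g f \<in> S"
  unfolding average_def
  using assms by (intro fs.subspace_scale fs.subspace_sum) (auto simp: permutes_inv)

text \<open>Where \<open>g\<close> commutes with the action, averaging does not change it. So the average of a projection or
  of a section is again one.\<close>

lemma average_eq: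
  assumes "\<And>w. w permutes {1..n} \<Longrightarrow> fun_act b w (g (fun_act a (inv' w) f)) = h"
  shows "average n a b g f = h"
proof
  fix y
  have "card {w. w permutes {1..n}} = fact n"
    by (subst card_permutations[of _ n]) auto
  then show "average n a b g f y = h y"
    using assms by (simp add: average_def sum_fun_apply del: of_nat_fact)
qed

end

section \<open>Tableaux and tabloids\<close>

definition semistandard :: "nat list \<Rightarrow> (nat \<times> nat \<Rightarrow> nat) \<Rightarrow> bool" where
  "semistandard la A \<longleftrightarrow> (\<forall>i j. (i, Suc j) \<in> cells la \<longrightarrow> A (i, j) \<le> A (i, Suc j)) \<and>
     (\<forall>i j. (Suc i, j) \<in> cells la \<longrightarrow> A (i, j) < A (Suc i, j))"

definition colour_stab :: "nat \<Rightarrow> (nat \<Rightarrow> 'k) \<Rightarrow> (nat \<Rightarrow> nat) set" where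
  "colour_stab n c = {h. h permutes {1..n} \<and> (\<forall>x. c (h x) = c x)}"

text \<open>Outside \<open>{1..n}\<close> the values are arbitrary. This is harmless when rows serve as colours, because a
  permutation of \<open>{1..n}\<close> fixes all other points.\<close>

definition row_of :: "nat list \<Rightarrow> (nat \<times> nat \<Rightarrow> nat) \<Rightarrow> nat \<Rightarrow> nat" where
  "row_of la T x = fst (inv_into (cells la) T x)"

definition col_of :: "nat list \<Rightarrow> (nat \<times> nat \<Rightarrow> nat) \<Rightarrow> nat \<Rightarrow> nat" where
  "col_of la T x = snd (inv_into (cells la) T x)"

definition tableau_act :: "nat list \<Rightarrow> (nat \<Rightarrow> nat) \<Rightarrow> (nat \<times> nat \<Rightarrow> nat) \<Rightarrow> nat \<times> nat \<Rightarrow> nat" where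
  "tableau_act la w T = restrict (w \<circ> T) (cells la)"

definition tabloids :: "nat list \<Rightarrow> nat set list set" where
  "tabloids la = tabloid la ` tableaux la"

abbreviation list_act :: "(nat \<Rightarrow> nat) \<Rightarrow> nat set list \<Rightarrow> nat set list" where
  "list_act w \<equiv> map ((`) w)"

lemma list_act_comp: "list_act (w \<circ> v) t = list_act w (list_act v t)"
  by (simp add: image_comp)

lemma list_act_id: "list_act id t = t"
  by (rule map_idI) simp

lemma finite_cells: "finite (cells la)"
proof -
  have "cells la = (SIGMA i:{..<length la}. {..<la ! i})" by (auto simp: cells_def)
  then show ?thesis by simp
qed

lemma card_cells: "card (cells la) = sum_list la"
proof -
  have "cells la = (SIGMA i:{..<length la}. {..<la ! i})" by (auto simp: cells_def)
  then have "card (cells la) = (\<Sum>i<length la. la ! i)" by simp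
  then show ?thesis by (simp add: sum_list_sum_nth atLeast0LessThan)
qed

locale shape =
  fixes n :: nat and la :: "nat list"
  assumes partition: "la \<in> int_partitions n"
begin

lemma sum_la: "sum_list la = n" and parts_pos: "i < length la \<Longrightarrow> 0 < la ! i"
  using partition by (auto simp: int_partitions_def in_set_conv_nth)

lemma parts_antimono: "i \<le> j \<Longrightarrow> j < length la \<Longrightarrow> la ! j \<le> la ! i"
  using partition by (cases "i = j") (auto simp: int_partitions_def sorted_wrt_iff_nth_less)

lemma cells_up: "(i, j) \<in> cells la \<Longrightarrow> i' \<le> i \<Longrightarrow> (i', j) \<in> cells la"
  using parts_antimono[of i' i] by (auto simp: cells_def)

lemma cells_left: "(i, j) \<in> cells la \<Longrightarrow> j' \<le> j \<Longrightarrow> (i, j') \<in> cells la"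
  by (auto simp: cells_def)

lemma tableau_bij: "T \<in> tableaux la \<Longrightarrow> bij_betw T (cells la) {1..n}"
  by (simp add: tableaux_def sum_la)

lemma tableau_mem: "T \<in> tableaux la \<Longrightarrow> p \<in> cells la \<Longrightarrow> T p \<in> {1..n}"
  using tableau_bij bij_betwE by blast

lemma tableau_eq_iff: "T \<in> tableaux la \<Longrightarrow> p \<in> cells la \<Longrightarrow> q \<in> cells la \<Longrightarrow> T p = T q \<longleftrightarrow> p = q"
  using tableau_bij by (auto simp: bij_betw_def dest: inj_onD)

lemma finite_tableaux: "finite (tableaux la)"
proof -
  have "tableaux la \<subseteq> cells la \<rightarrow>\<^sub>E {1..n}"
  proof
    fix T assume T: "T \<in> tableaux la"
    then have "T \<in> extensional (cells la)" by (simp add: tableaux_def)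
    with tableau_mem[OF T] show "T \<in> cells la \<rightarrow>\<^sub>E {1..n}" by (simp add: PiE_def Pi_def)
  qed
  then show ?thesis by (rule finite_subset) (simp add: finite_PiE finite_cells)
qed

lemma finite_tabloids: "finite (tabloids la)"
  by (simp add: tabloids_def finite_tableaux)

lemma tableaux_nonempty: "\<exists>T. T \<in> tableaux la"
proof -
  obtain f where "bij_betw f (cells la) {1..n}"
    using finite_same_card_bij[OF finite_cells, of "{1..n}" la] by (auto simp: card_cells sum_la)
  then have "bij_betw (restrict f (cells la)) (cells la) {1..n}"
    by (subst bij_betw_cong[where g = f]) auto
  then show ?thesis by (auto simp: tableaux_def sum_la)
qed

lemma inv_tableau:
  assumes "T \<in> tableaux la" "p \<in> cells la"
  shows "inv_into (cells la) T (T p) = p"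
  using tableau_bij[OF assms(1)] assms(2) by (rule bij_betw_inv_into_left)

lemma row_of_tableau [simp]: "T \<in> tableaux la \<Longrightarrow> (i, j) \<in> cells la \<Longrightarrow> row_of la T (T (i, j)) = i"
  and col_of_tableau [simp]: "T \<in> tableaux la \<Longrightarrow> (i, j) \<in> cells la \<Longrightarrow> col_of la T (T (i, j)) = j"
  by (simp_all add: row_of_def col_of_def inv_tableau)

lemma tableau_row_col:
  assumes "T \<in> tableaux la" "x \<in> {1..n}"
  shows "(row_of la T x, col_of la T x) \<in> cells la" "T (row_of la T x, col_of la T x) = x"
proof -
  have "x \<in> T ` cells la"
    using tableau_bij[OF assms(1)] assms(2) by (simp add: bij_betw_def)
  then obtain p where "p \<in> cells la" "x = T p" by blast
  then show "(row_of la T x, col_of la T x) \<in> cells la" "T (row_of la T x, col_of la T x) = x"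
    using assms(1) by (simp_all add: row_of_def col_of_def inv_tableau)
qed

lemma row_of_less: "T \<in> tableaux la \<Longrightarrow> x \<in> {1..n} \<Longrightarrow> row_of la T x < length la"
  using tableau_row_col(1) by (auto simp: cells_def)

lemma length_tabloid [simp]: "length (tabloid la T) = length la"
  by (simp add: tabloid_def)

lemma tabloid_nth: "i < length la \<Longrightarrow> tabloid la T ! i = T ` {c \<in> cells la. fst c = i}"
  by (simp add: tabloid_def)

lemma mem_tabloid_nth:
  assumes "T \<in> tableaux la" "i < length la"
  shows "x \<in> tabloid la T ! i \<longleftrightarrow> x \<in> {1..n} \<and> row_of la T x = i"
proof
  assume "x \<in> tabloid la T ! i"
  then show "x \<in> {1..n} \<and> row_of la T x = i"
    using assms tableau_mem[OF assms(1)] by (force simp: tabloid_nth)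
next
  assume "x \<in> {1..n} \<and> row_of la T x = i"
  then show "x \<in> tabloid la T ! i"
    using tableau_row_col[OF assms(1)] assms(2) by (force simp: tabloid_nth)
qed

lemma card_tabloid_nth:
  assumes "T \<in> tableaux la" "i < length la"
  shows "card (tabloid la T ! i) = la ! i"
proof -
  have eq: "{c \<in> cells la. fst c = i} = {i} \<times> {..<la ! i}"
    using assms(2) by (auto simp: cells_def)
  have "inj_on T {c \<in> cells la. fst c = i}"
    using tableau_bij[OF assms(1)] by (auto simp: bij_betw_def intro: inj_on_subset)
  from card_image[OF this] show ?thesis
    by (simp add: tabloid_nth[OF assms(2)] eq card_cartesian_product)
qed

lemma tabloid_eq_iff:
  assumes "T \<in> tableaux la" "T' \<in> tableaux la"
  shows "tabloid la T = tabloid la T' \<longleftrightarrow> (\<forall>x\<in>{1..n}. row_of la T x = row_of la T' x)"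
proof
  assume eq: "tabloid la T = tabloid la T'"
  show "\<forall>x\<in>{1..n}. row_of la T x = row_of la T' x"
  proof
    fix x assume x: "x \<in> {1..n}"
    then have "x \<in> tabloid la T ! row_of la T x"
      using assms row_of_less by (simp add: mem_tabloid_nth)
    then show "row_of la T x = row_of la T' x"
      using assms x row_of_less eq by (metis mem_tabloid_nth)
  qed
next
  assume "\<forall>x\<in>{1..n}. row_of la T x = row_of la T' x"
  then show "tabloid la T = tabloid la T'"
    using assms by (intro nth_equalityI) (auto simp: mem_tabloid_nth)
qed

lemma tableau_act_in:
  assumes "w permutes {1..n}" "T \<in> tableaux la"
  shows "tableau_act la w T \<in> tableaux la"
proof -
  have "bij_betw (w \<circ> T) (cells la) {1..n}"
    using bij_betw_trans[OF tableau_bij[OF assms(2)] permutes_imp_bij[OF assms(1)]] .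
  then have "bij_betw (restrict (w \<circ> T) (cells la)) (cells la) {1..n}"
    by (subst bij_betw_cong[where g = "w \<circ> T"]) auto
  then show ?thesis by (simp add: tableaux_def tableau_act_def sum_la)
qed

lemma tableau_act_apply: "p \<in> cells la \<Longrightarrow> tableau_act la w T p = w (T p)"
  by (simp add: tableau_act_def)

lemma tabloid_act_tableau: "tabloid la (tableau_act la w T) = list_act w (tabloid la T)"
  by (rule nth_equalityI) (auto simp: tabloid_nth image_image tableau_act_apply intro!: image_cong)

lemma tableau_act_transitive:
  assumes "T \<in> tableaux la" "T' \<in> tableaux la"
  obtains w where "w permutes {1..n}" "tableau_act la w T = T'" "\<And>p. p \<in> cells la \<Longrightarrow> w (T p) = T' p"
proof -
  define w where "w x = (if x \<in> {1..n} then T' (inv_into (cells la) T x) else x)" for x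
  have "bij_betw (T' \<circ> inv_into (cells la) T) {1..n} {1..n}"
    using bij_betw_trans[OF bij_betw_inv_into[OF tableau_bij[OF assms(1)]] tableau_bij[OF assms(2)]] .
  then have "bij_betw w {1..n} {1..n}"
    by (subst bij_betw_cong[where g = "T' \<circ> inv_into (cells la) T"]) (auto simp: w_def)
  then have w: "w permutes {1..n}" by (rule bij_imp_permutes) (auto simp: w_def)
  have app: "w (T p) = T' p" if "p \<in> cells la" for p
    using that assms tableau_mem[OF assms(1) that] by (simp add: w_def inv_tableau)
  have "tableau_act la w T = T'"
    using app assms(2) by (auto simp: tableau_act_def fun_eq_iff tableaux_def extensional_def)
  from that[OF w this app] show thesis .
qed

lemma row_of_act:
  assumes "w permutes {1..n}" "T \<in> tableaux la" "x \<in> {1..n}"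
  shows "row_of la (tableau_act la w T) (w x) = row_of la T x"
    and "col_of la (tableau_act la w T) (w x) = col_of la T x"
proof -
  note rc = tableau_row_col[OF assms(2,3)]
  have "w x = tableau_act la w T (row_of la T x, col_of la T x)"
    using rc by (simp add: tableau_act_apply)
  then show "row_of la (tableau_act la w T) (w x) = row_of la T x"
    "col_of la (tableau_act la w T) (w x) = col_of la T x"
    using rc(1) tableau_act_in[OF assms(1,2)] by simp_all
qed

lemma tabloid_perm_action: "perm_action n (tabloids la) list_act"
proof
  show "list_act w t \<in> tabloids la" if "w permutes {1..n}" "t \<in> tabloids la" for w t
    using that tableau_act_in by (auto simp: tabloids_def simp flip: tabloid_act_tableau)
qed (simp_all add: finite_tabloids list_act_comp list_act_id)

sublocale tab: perm_action n "tabloids la" list_act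
  by (rule tabloid_perm_action)

text \<open>A tableau up to colour-preserving permutations is the array of its colours. This is what
  relates invariants of Young subgroups to semistandard arrays with repeated entries.\<close>

lemma colour_stab_if_same_colours:
  assumes "T \<in> tableaux la" "T' \<in> tableaux la" "\<And>p. p \<in> cells la \<Longrightarrow> c (T p) = c (T' p)"
  obtains h where "h \<in> colour_stab n c" "tabloid la T' = list_act h (tabloid la T)"
proof -
  obtain w where w: "w permutes {1..n}" "tableau_act la w T = T'"
    "\<And>p. p \<in> cells la \<Longrightarrow> w (T p) = T' p"
    using tableau_act_transitive[OF assms(1,2)] by metis
  have "c (w x) = c x" for x
  proof (cases "x \<in> {1..n}")
    case True
    then show ?thesis using tableau_row_col[OF assms(1) True] w(3) assms(3) by metis
  next
    case False
    then show ?thesis using permutes_not_in[OF w(1)] by simp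
  qed
  then have "w \<in> colour_stab n c" using w(1) by (simp add: colour_stab_def)
  then show thesis using w(2) that tabloid_act_tableau by metis
qed

lemma row_sorted_tableau:
  fixes c :: "nat \<Rightarrow> nat"
  assumes "T \<in> tableaux la"
  obtains T' where "T' \<in> tableaux la" "tabloid la T' = tabloid la T"
    "\<And>i j j'. (i, j') \<in> cells la \<Longrightarrow> j \<le> j' \<Longrightarrow> c (T' (i, j)) \<le> c (T' (i, j'))"
proof -
  define l where "l i = sort_key c (sorted_list_of_set (tabloid la T ! i))" for i
  have fin: "finite (tabloid la T ! i)" if "i < length la" for i
    using that by (simp add: tabloid_nth finite_cells)
  have l: "set (l i) = tabloid la T ! i" "distinct (l i)" "length (l i) = la ! i"
    if "i < length la" for i
    using that fin[OF that] card_tabloid_nth[OF assms that] by (simp_all add: l_def)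
  define T' where "T' = (\<lambda>(i, j)\<in>cells la. l i ! j)"
  have app: "T' (i, j) = l i ! j" if "(i, j) \<in> cells la" for i j
    using that by (simp add: T'_def)
  have img: "T' ` {p \<in> cells la. fst p = i} = tabloid la T ! i" if "i < length la" for i
  proof -
    have "{p \<in> cells la. fst p = i} = Pair i ` {..<la ! i}"
      using that by (auto simp: cells_def)
    then have "T' ` {p \<in> cells la. fst p = i} = (\<lambda>j. l i ! j) ` {..<la ! i}"
      using that by (auto simp: image_image app cells_def intro!: image_cong)
    also have "\<dots> = set (l i)"
      using l(3)[OF that] by (auto simp: set_conv_nth)
    finally show ?thesis using l(1)[OF that] by simp
  qed
  have surj: "T' ` cells la = {1..n}"
  proof -
    have "T' ` cells la = (\<Union>i<length la. T' ` {p \<in> cells la. fst p = i})"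
      by (force simp: cells_def)
    also have "\<dots> = (\<Union>i<length la. tabloid la T ! i)" using img by simp
    also have "\<dots> = T ` cells la" by (force simp: tabloid_nth cells_def)
    finally show ?thesis using tableau_bij[OF assms] by (simp add: bij_betw_def)
  qed
  then have "bij_betw T' (cells la) {1..n}"
    using finite_cells[of la] by (intro bij_betw_imageI eq_card_imp_inj_on) (auto simp: card_cells sum_la)
  then have T': "T' \<in> tableaux la"
    by (auto simp: tableaux_def sum_la T'_def)
  have "tabloid la T' = tabloid la T"
    by (rule nth_equalityI) (simp_all add: tabloid_nth[of _ T'] img)
  moreover have "c (T' (i, j)) \<le> c (T' (i, j'))" if "(i, j') \<in> cells la" "j \<le> j'" for i j j'
  proof -
    have "(i, j) \<in> cells la" using that cells_left by blast
    moreover have "i < length la" using that(1) by (simp add: cells_def)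
    moreover have "sorted (map c (l i))" by (simp add: l_def)
    ultimately show ?thesis
      using that l(3)[of i] by (simp add: app) (auto simp: sorted_iff_nth_mono cells_def)
  qed
  ultimately show thesis using T' that by blast
qed

subsection \<open>Garnir relations and straightening\<close>

text \<open>The Garnir relations in symmetric form: summing over all rearrangements of a set of entries that
  lie in two adjacent rows, too many to fit into the upper row, gives zero. Unlike the form with
  signs and coset representatives, this one is stable under the symmetric group at first sight.\<close>

definition garnir :: "(nat set list \<Rightarrow> complex) \<Rightarrow> bool" where
  "garnir u \<longleftrightarrow> (\<forall>T\<in>tableaux la. \<forall>i X. Suc i < length la \<longrightarrow>
     X \<subseteq> tabloid la T ! i \<union> tabloid la T ! Suc i \<longrightarrow> la ! i < card X \<longrightarrow>
     (\<Sum>w | w permutes X. u (list_act w (tabloid la T))) = 0)"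

text \<open>The weight is large if large colours stand in low rows. It is the induction measure of
  straightening, and the order for which polytabloids are triangular.\<close>

definition row_weight :: "(nat \<Rightarrow> nat) \<Rightarrow> (nat \<times> nat \<Rightarrow> nat) \<Rightarrow> nat" where
  "row_weight c T = (\<Sum>x\<in>{1..n}. row_of la T x * c x)"

lemma row_weight_act:
  assumes "w permutes {1..n}" "T \<in> tableaux la"
  shows "row_weight c (tableau_act la w T) = (\<Sum>x\<in>{1..n}. row_of la T x * c (w x))"
  unfolding row_weight_def
  using sum.permute[OF assms(1), of "\<lambda>x. row_of la (tableau_act la w T) x * c x"] assms
  by (simp add: row_of_act comp_def)

lemma row_weight_tabloid:
  "T \<in> tableaux la \<Longrightarrow> T' \<in> tableaux la \<Longrightarrow> tabloid la T = tabloid la T' \<Longrightarrow>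
    row_weight c T = row_weight c T'"
  by (simp add: row_weight_def tabloid_eq_iff)

text \<open>Every entry of \<open>A\<close>, in the upper row, has at least the colour of every entry of \<open>B\<close>, in the next
  row. So an exchange moves larger colours down and increases the weight, unless only entries of
  equal colour change places; in that case the effect on the tabloid is that of a colour-preserving
  permutation.\<close>

lemma exchange_raises_weight:
  assumes T: "T \<in> tableaux la" and A: "A \<subseteq> tabloid la T ! i" and B: "B \<subseteq> tabloid la T ! Suc i"
    and i: "Suc i < length la" and AB: "\<And>x y. x \<in> A \<Longrightarrow> y \<in> B \<Longrightarrow> c y \<le> c x"
    and w: "w permutes A \<union> B"
  shows "row_weight c T < row_weight c (tableau_act la w T) \<or>
    (\<exists>h\<in>colour_stab n c. list_act w (tabloid la T) = list_act h (tabloid la T))"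
proof -
  have inA: "x \<in> {1..n} \<and> row_of la T x = i" if "x \<in> A" for x
    using that A T i mem_tabloid_nth[of T i] by auto
  have inB: "x \<in> {1..n} \<and> row_of la T x = Suc i" if "x \<in> B" for x
    using that B T i mem_tabloid_nth[of T "Suc i"] by auto
  have disj: "A \<inter> B = {}"
  proof (rule equals0I)
    fix x assume "x \<in> A \<inter> B"
    then show False using inA[of x] inB[of x] by simp
  qed
  have sub: "A \<union> B \<subseteq> {1..n}" using inA inB by blast
  have finA: "finite A" and finB: "finite B" using sub finite_subset by blast+
  have wn: "w permutes {1..n}" using w sub by (rule permutes_subset)
  have wAB: "w x \<in> A \<union> B \<longleftrightarrow> x \<in> A \<union> B" for x using w by (rule permutes_in_image)
  \<comment> \<open>the entries of \<open>A\<close> that are replaced by entries of \<open>B\<close>, and conversely\<close>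
  define D where "D = {x \<in> A. w x \<in> B}"
  define E where "E = {x \<in> B. w x \<in> A}"
  have "card A = card (w ` A)"
    using permutes_inj_on[OF w] by (simp add: card_image)
  also have "w ` A = (A - w ` E) \<union> w ` D"
  proof -
    have "x \<in> w ` A \<longleftrightarrow> x \<in> (A - w ` E) \<union> w ` D" for x
    proof -
      obtain y where y: "x = w y" using permutes_surj[OF w] by (metis surjD)
      show ?thesis
        using wAB[of y] disj inj_image_mem_iff[OF permutes_inj[OF w], of y] unfolding y D_def E_def
        by blast
    qed
    then show ?thesis by blast
  qed
  also have "card \<dots> = card A - card E + card D"
  proof -
    have "card (A - w ` E) = card A - card E"
      using finA finB permutes_inj_on[OF w]
      by (subst card_Diff_subset) (auto simp: E_def card_image)
    moreover have "card (w ` D) = card D"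
      using permutes_inj_on[OF w] by (simp add: card_image)
    moreover have "(A - w ` E) \<inter> w ` D = {}" using disj by (auto simp: D_def)
    ultimately show ?thesis using finA by (subst card_Un_disjoint) (auto simp: D_def)
  qed
  finally have "card A = card A - card E + card D" .
  moreover have "card E \<le> card A"
    using finA permutes_inj_on[OF w] card_mono[of A "w ` E"] by (auto simp: E_def card_image)
  ultimately have "card D = card E" by linarith
  then obtain \<beta> where \<beta>: "bij_betw \<beta> D E"
    using finA finB finite_same_card_bij[of D E] by (auto simp: D_def E_def)
  have DA: "D \<subseteq> A" and EB: "E \<subseteq> B" by (auto simp: D_def E_def)
  \<comment> \<open>\<open>w\<close> moves the entries of \<open>w D\<close> to the upper row, those of \<open>w E\<close> to the lower row\<close>
  have wt: "row_weight c (tableau_act la w T) + (\<Sum>x\<in>w ` D. c x) = row_weight c T + (\<Sum>x\<in>w ` E. c x)"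
  proof -
    have r: "row_of la T (w x) + (if x \<in> E then 1 else 0) = row_of la T x + (if x \<in> D then 1 else 0)"
      if "x \<in> {1..n}" for x
    proof (cases "x \<in> A \<union> B")
      case True
      then consider "x \<in> A" "w x \<in> A" | "x \<in> A" "w x \<in> B" | "x \<in> B" "w x \<in> A" | "x \<in> B" "w x \<in> B"
        using wAB[of x] by blast
      then show ?thesis
      proof cases
        case 1 then show ?thesis using inA[of x] inA[of "w x"] disj by (auto simp: D_def E_def)
      next
        case 2 then show ?thesis using inA[of x] inB[of "w x"] disj by (auto simp: D_def E_def)
      next
        case 3 then show ?thesis using inB[of x] inA[of "w x"] disj by (auto simp: D_def E_def)
      next
        case 4 then show ?thesis using inB[of x] inB[of "w x"] disj by (auto simp: D_def E_def)
      qed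
    next
      case False
      then show ?thesis using permutes_not_in[OF w False] DA EB by auto
    qed
    have "row_weight c T = (\<Sum>x\<in>{1..n}. row_of la T (w x) * c (w x))"
      unfolding row_weight_def
      using sum.permute[OF wn, of "\<lambda>x. row_of la T x * c x"] by (simp add: comp_def)
    then have "row_weight c T + (\<Sum>x\<in>{1..n}. (if x \<in> E then 1 else 0) * c (w x))
       = (\<Sum>x\<in>{1..n}. (row_of la T (w x) + (if x \<in> E then 1 else 0)) * c (w x))"
      by (simp add: sum.distrib algebra_simps)
    also have "\<dots> = (\<Sum>x\<in>{1..n}. (row_of la T x + (if x \<in> D then 1 else 0)) * c (w x))"
      by (intro sum.cong refl) (simp only: r)
    also have "\<dots> = row_weight c (tableau_act la w T) + (\<Sum>x\<in>{1..n}. (if x \<in> D then 1 else 0) * c (w x))"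
      by (simp add: row_weight_act[OF wn T] sum.distrib algebra_simps)
    finally have "row_weight c T + (\<Sum>x\<in>{1..n}. (if x \<in> E then 1 else 0) * c (w x))
       = row_weight c (tableau_act la w T) + (\<Sum>x\<in>{1..n}. (if x \<in> D then 1 else 0) * c (w x))" .
    moreover have "(\<Sum>x\<in>{1..n}. (if x \<in> F then 1 else 0) * c (w x)) = (\<Sum>x\<in>w ` F. c x)"
      if "F \<subseteq> {1..n}" for F
    proof -
      have "(\<Sum>x\<in>{1..n}. (if x \<in> F then 1 else 0) * c (w x)) = (\<Sum>x\<in>{1..n}. if x \<in> F then c (w x) else 0)"
        by (intro sum.cong) auto
      also have "\<dots> = (\<Sum>x\<in>F. c (w x))"
        using that by (simp add: sum.If_cases Int_absorb1)
      also have "\<dots> = (\<Sum>x\<in>w ` F. c x)"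
        using permutes_inj_on[OF w] by (simp add: sum.reindex)
      finally show ?thesis .
    qed
    moreover have "D \<subseteq> {1..n}" "E \<subseteq> {1..n}" using DA EB sub by blast+
    ultimately show ?thesis by simp
  qed
  define \<gamma> where "\<gamma> = (\<lambda>y. w (\<beta> (inv_into D w y)))"
  have \<gamma>: "bij_betw \<gamma> (w ` D) (w ` E)"
  proof -
    have "bij_betw (inv_into D w) (w ` D) D"
      using permutes_inj_on[OF w] by (intro bij_betw_inv_into) (simp add: bij_betw_def)
    moreover have "bij_betw w E (w ` E)"
      using permutes_inj_on[OF w] by (simp add: bij_betw_def)
    ultimately have "bij_betw (w \<circ> (\<beta> \<circ> inv_into D w)) (w ` D) (w ` E)"
      using \<beta> by (intro bij_betw_trans)
    then show ?thesis by (simp add: \<gamma>_def comp_def)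
  qed
  have wDB: "w ` D \<subseteq> B" and wEA: "w ` E \<subseteq> A" by (auto simp: D_def E_def)
  have sumE: "(\<Sum>x\<in>w ` E. c x) = (\<Sum>x\<in>w ` D. c (\<gamma> x))"
    using sum.reindex_bij_betw[OF \<gamma>, of c] by simp
  have le: "c x \<le> c (\<gamma> x)" if "x \<in> w ` D" for x
  proof -
    have "\<gamma> x \<in> w ` E" using \<gamma> that by (blast dest: bij_betwE)
    then show ?thesis using AB wDB wEA that by blast
  qed
  have finD: "finite (w ` D)" using finA by (simp add: D_def)
  show ?thesis
  proof (cases "\<forall>x\<in>w ` D. c (\<gamma> x) = c x")
    case False
    then obtain x where "x \<in> w ` D" "c x < c (\<gamma> x)" using le by (metis order_le_less)
    then have "(\<Sum>x\<in>w ` D. c x) < (\<Sum>x\<in>w ` E. c x)"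
      unfolding sumE using le finD by (intro sum_strict_mono_ex1) auto
    then show ?thesis using wt by linarith
  next
    case True
    \<comment> \<open>only entries of equal colour are exchanged: exchange them back\<close>
    define h where "h x = (if x \<in> w ` D then \<gamma> x else if x \<in> w ` E then inv_into (w ` D) \<gamma> x else x)" for x
    have disj': "w ` D \<inter> w ` E = {}" using wDB wEA disj by blast
    have \<gamma>i: "bij_betw (inv_into (w ` D) \<gamma>) (w ` E) (w ` D)" using \<gamma> by (rule bij_betw_inv_into)
    have hh: "h (h x) = x" for x
    proof -
      consider "x \<in> w ` D" | "x \<in> w ` E" | "x \<notin> w ` D" "x \<notin> w ` E" by blast
      then show ?thesis
      proof cases
        case 1
        then have "\<gamma> x \<in> w ` E" using \<gamma> by (auto dest: bij_betwE)
        then show ?thesis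
          using 1 disj' \<gamma> by (auto simp: h_def bij_betw_inv_into_left)
      next
        case 2
        then have "inv_into (w ` D) \<gamma> x \<in> w ` D" using \<gamma>i by (auto dest: bij_betwE)
        then show ?thesis
          using 2 disj' \<gamma> by (auto simp: h_def bij_betw_inv_into_right)
      next
        case 3
        then show ?thesis by (simp add: h_def)
      qed
    qed
    have hX: "h x = x" if "x \<notin> {1..n}" for x
    proof -
      have "x \<notin> w ` D" "x \<notin> w ` E" using that wDB wEA sub by blast+
      then show ?thesis by (simp add: h_def)
    qed
    have hp: "h permutes {1..n}"
      unfolding permutes_def
    proof (intro conjI allI impI)
      show "\<exists>!x. h x = y" for y using hh by (intro ex1I[of _ "h y"]) (auto dest: arg_cong[of _ _ h])
    qed (rule hX)
    have hc: "c (h x) = c x" for x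
    proof -
      have "c (inv_into (w ` D) \<gamma> x) = c x" if "x \<in> w ` E"
      proof -
        have "inv_into (w ` D) \<gamma> x \<in> w ` D" using \<gamma>i that by (blast dest: bij_betwE)
        then have "c (\<gamma> (inv_into (w ` D) \<gamma> x)) = c (inv_into (w ` D) \<gamma> x)" using True by blast
        then show ?thesis using bij_betw_inv_into_right[OF \<gamma> that] by simp
      qed
      then show ?thesis using True by (auto simp: h_def)
    qed
    have "list_act w (tabloid la T) = list_act h (tabloid la T)"
      unfolding tabloid_act_tableau[symmetric]
    proof (subst tabloid_eq_iff)
      show "tableau_act la w T \<in> tableaux la" "tableau_act la h T \<in> tableaux la"
        using tableau_act_in T wn hp by blast+
      show "\<forall>x\<in>{1..n}. row_of la (tableau_act la w T) x = row_of la (tableau_act la h T) x"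
      proof
        fix x assume x: "x \<in> {1..n}"
        then have hx: "h x \<in> {1..n}" using permutes_in_image[OF hp] by blast
        have 1: "row_of la (tableau_act la h T) x = row_of la T (h x)"
          using row_of_act(1)[OF hp T hx] hh by simp
        obtain y where y: "x = w y" using permutes_surj[OF w] by (metis surjD)
        have yn: "y \<in> {1..n}" using permutes_in_image[OF wn] x y by simp
        have 2: "row_of la (tableau_act la w T) x = row_of la T y"
          using row_of_act(1)[OF wn T yn] y by simp
        have mem: "w y \<in> w ` F \<longleftrightarrow> y \<in> F" for F by (rule inj_image_mem_iff[OF permutes_inj[OF w]])
        consider "y \<in> D" | "y \<in> E" | "y \<notin> D" "y \<notin> E" by blast
        then have "row_of la T (h x) = row_of la T y"
        proof cases
          case 1
          then have "x \<in> w ` D" using y by blast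
          then have "h x = \<gamma> x" "\<gamma> x \<in> w ` E" using bij_betw_apply[OF \<gamma>] by (simp_all add: h_def)
          then have "h x \<in> A" using wEA by auto
          then show ?thesis using 1 DA inA[of "h x"] inA[of y] by auto
        next
          case 2
          then have xE: "x \<in> w ` E" using y by blast
          then have "x \<notin> w ` D" using disj' by blast
          then have "h x = inv_into (w ` D) \<gamma> x" using xE by (simp add: h_def)
          then have "h x \<in> B" using bij_betw_apply[OF \<gamma>i xE] wDB by auto
          then show ?thesis using 2 EB inB[of "h x"] inB[of y] by auto
        next
          case 3
          then have "h x = x" using y mem by (simp add: h_def)
          moreover have "row_of la T (w y) = row_of la T y"
          proof (cases "y \<in> A \<union> B")
            case True
            then consider "y \<in> A" "w y \<in> A" | "y \<in> B" "w y \<in> B"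
              using wAB[of y] 3 by (auto simp: D_def E_def)
            then show ?thesis using inA[of y] inA[of "w y"] inB[of y] inB[of "w y"] by cases auto
          qed (simp add: permutes_not_in[OF w])
          ultimately show ?thesis using y by simp
        qed
        then show "row_of la (tableau_act la w T) x = row_of la (tableau_act la h T) x"
          using 1 2 by simp
      qed
    qed
    then show ?thesis using hp hc by (auto simp: colour_stab_def)
  qed
qed

text \<open>Downward induction on the weight. A row-sorted tableau that is not semistandard has a column
  with a descent \<open>c (T (Suc i, j)) \<le> c (T (i, j))\<close>. The Garnir relation for the entries from \<open>(i, j)\<close>
  to the right and from \<open>(Suc i, j)\<close> to the left expresses a positive multiple of the value at \<open>T\<close> by
  values at tableaux of larger weight, which vanish by induction.\<close>

lemma straightening:
  assumes inv: "\<And>h t. h \<in> colour_stab n c \<Longrightarrow> t \<in> tabloids la \<Longrightarrow> u (list_act h t) = u t"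
    and garnir: "garnir u"
    and zero: "\<And>T. T \<in> tableaux la \<Longrightarrow> semistandard la (c \<circ> T) \<Longrightarrow> u (tabloid la T) = 0"
    and T: "T \<in> tableaux la"
  shows "u (tabloid la T) = 0"
proof -
  define M where "M = (\<Sum>x\<in>{1..n}. length la * c x)"
  have bound: "row_weight c T \<le> M" if "T \<in> tableaux la" for T
    unfolding row_weight_def M_def using row_of_less[OF that] by (intro sum_mono) (simp add: less_imp_le)
  show ?thesis using T
  proof (induction "M - row_weight c T" arbitrary: T rule: less_induct)
    case (less T)
    obtain T' where T': "T' \<in> tableaux la" "tabloid la T' = tabloid la T"
      and sorted: "\<And>i j j'. (i, j') \<in> cells la \<Longrightarrow> j \<le> j' \<Longrightarrow> c (T' (i, j)) \<le> c (T' (i, j'))"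
      using row_sorted_tableau[OF less.prems, of c] by metis
    show ?case
    proof (cases "semistandard la (c \<circ> T')")
      case True
      then show ?thesis using zero T' by metis
    next
      case False
      then obtain i j where ij: "(Suc i, j) \<in> cells la" "c (T' (Suc i, j)) \<le> c (T' (i, j))"
        using sorted by (auto simp: semistandard_def not_less)
      have i: "Suc i < length la" and ij': "(i, j) \<in> cells la"
        using ij(1) cells_up[of "Suc i" j i] by (auto simp: cells_def)
      define A where "A = T' ` ({i} \<times> {j..<la ! i})"
      define B where "B = T' ` ({Suc i} \<times> {..j})"
      have cA: "{i} \<times> {j..<la ! i} \<subseteq> cells la" and cB: "{Suc i} \<times> {..j} \<subseteq> cells la"
        using i ij(1) by (auto simp: cells_def)
      have inj: "inj_on T' (cells la)" using tableau_bij[OF T'(1)] by (simp add: bij_betw_def)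
      have subA: "A \<subseteq> tabloid la T' ! i"
        using i cA by (auto simp: A_def tabloid_nth)
      have subB: "B \<subseteq> tabloid la T' ! Suc i"
        using i cB by (auto simp: B_def tabloid_nth)
      have "card (A \<union> B) = card A + card B"
      proof (rule card_Un_disjoint)
        show "A \<inter> B = {}"
        proof (rule equals0I)
          fix x assume "x \<in> A \<inter> B"
          then have "x \<in> tabloid la T' ! i" "x \<in> tabloid la T' ! Suc i" using subA subB by auto
          then show False using mem_tabloid_nth[OF T'(1)] i by (metis Suc_lessD n_not_Suc_n)
        qed
      qed (auto simp: A_def B_def)
      also have "card A = la ! i - j"
        using inj_on_subset[OF inj cA] by (simp add: A_def card_image card_cartesian_product)
      also have "card B = Suc j"
        using inj_on_subset[OF inj cB] by (simp add: B_def card_image card_cartesian_product)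
      finally have "la ! i < card (A \<union> B)" using ij' by (auto simp: cells_def)
      then have G: "(\<Sum>w | w permutes (A \<union> B). u (list_act w (tabloid la T'))) = 0"
        using garnir T'(1) i subA subB unfolding garnir_def by (metis Un_mono)
      have AB: "c y \<le> c x" if xA: "x \<in> A" and yB: "y \<in> B" for x y
      proof -
        obtain j1 where *: "x = T' (i, j1)" "j \<le> j1" "j1 < la ! i"
          using xA unfolding A_def by fastforce
        obtain j2 where "y = T' (Suc i, j2)" "j2 \<le> j"
          using yB unfolding B_def by fastforce
        note * = * this
        have "c y \<le> c (T' (Suc i, j))" using * ij(1) sorted by blast
        also have "\<dots> \<le> c (T' (i, j))" by (rule ij(2))
        also have "\<dots> \<le> c x" using * i sorted by (simp add: cells_def)
        finally show ?thesis .
      qed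
      have sub: "A \<union> B \<subseteq> {1..n}"
        using cA cB tableau_mem[OF T'(1)] unfolding A_def B_def by blast
      have fin: "finite {w. w permutes (A \<union> B)}"
        using sub finite_subset by (intro finite_permutations) blast
      \<comment> \<open>the rearrangements that reproduce the value at \<open>T'\<close>; all others contribute zero\<close>
      define P where "P = {w. w permutes (A \<union> B) \<and> u (list_act w (tabloid la T')) = u (tabloid la T')}"
      have other: "u (list_act w (tabloid la T')) = 0" if w: "w permutes (A \<union> B)" "w \<notin> P" for w
      proof -
        have wn: "w permutes {1..n}" using w(1) sub by (rule permutes_subset)
        have tw: "tableau_act la w T' \<in> tableaux la" using tableau_act_in[OF wn T'(1)] .
        have "\<not> (\<exists>h\<in>colour_stab n c. list_act w (tabloid la T') = list_act h (tabloid la T'))"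
        proof
          assume "\<exists>h\<in>colour_stab n c. list_act w (tabloid la T') = list_act h (tabloid la T')"
          then obtain h where "h \<in> colour_stab n c" "list_act w (tabloid la T') = list_act h (tabloid la T')"
            by blast
          moreover have "tabloid la T' \<in> tabloids la" using T'(1) by (simp add: tabloids_def)
          ultimately have "u (list_act w (tabloid la T')) = u (tabloid la T')"
            using inv by metis
          then show False using w by (simp add: P_def)
        qed
        then have "row_weight c T' < row_weight c (tableau_act la w T')"
          using exchange_raises_weight[of T' A i B c w, OF T'(1) subA subB i AB w(1)] by blast
        then have "M - row_weight c (tableau_act la w T') < M - row_weight c T"
          using bound[OF tw] row_weight_tabloid[OF T'(1) less.prems T'(2), of c] by linarith
        from less.hyps[OF this tw] show ?thesis by (simp add: tabloid_act_tableau)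
      qed
      have "(\<Sum>w | w permutes (A \<union> B). u (list_act w (tabloid la T')))
          = (\<Sum>w\<in>P. u (list_act w (tabloid la T')))"
        by (rule sum.mono_neutral_right) (use fin other in \<open>auto simp: P_def\<close>)
      also have "\<dots> = of_nat (card P) * u (tabloid la T')"
        by (simp add: P_def)
      finally have "of_nat (card P) * u (tabloid la T') = 0" using G by simp
      moreover have "id \<in> P" "finite P"
        using fin by (auto simp: P_def permutes_id)
      then have "card P \<noteq> 0" by auto
      ultimately show ?thesis using T'(2) by simp
    qed
  qed
qed

end

section \<open>Specht modules\<close>

text \<open>Polytabloids and Specht modules as functions on tabloids. The isomorphism with the finitely
  supported formulation is \<open>specht_iso\<close>.\<close>

definition polytab :: "nat list \<Rightarrow> (nat \<times> nat \<Rightarrow> nat) \<Rightarrow> nat set list \<Rightarrow> complex" where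
  "polytab la T t = (\<Sum>\<sigma>\<in>column_stabilizer la T.
     if list_act \<sigma> (tabloid la T) = t then of_int (sign \<sigma>) else 0)"

definition specht_fun :: "nat list \<Rightarrow> (nat set list \<Rightarrow> complex) set" where
  "specht_fun la = fs.span (polytab la ` tableaux la)"

lemma lookup_polytabloid: "Poly_Mapping.lookup (polytabloid la T) t = polytab la T t"
  by (simp add: polytabloid_def polytab_def lookup_sum lookup_single when_def)

context shape
begin

lemma column_stabilizer_iff:
  assumes T: "T \<in> tableaux la"
  shows "\<sigma> \<in> column_stabilizer la T \<longleftrightarrow>
    \<sigma> permutes {1..n} \<and> (\<forall>x\<in>{1..n}. col_of la T (\<sigma> x) = col_of la T x)"
proof -
  have col: "T ` {c \<in> cells la. snd c = j} = {x \<in> {1..n}. col_of la T x = j}" for j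
  proof (intro equalityI subsetI)
    fix x assume "x \<in> T ` {c \<in> cells la. snd c = j}"
    then obtain i where "(i, j) \<in> cells la" "x = T (i, j)" by auto
    then show "x \<in> {x \<in> {1..n}. col_of la T x = j}" using T tableau_mem[OF T, of "(i, j)"] by simp
  next
    fix x assume "x \<in> {x \<in> {1..n}. col_of la T x = j}"
    then show "x \<in> T ` {c \<in> cells la. snd c = j}"
      using tableau_row_col[OF T, of x] by (auto intro: rev_image_eqI)
  qed
  have "(\<forall>j. \<sigma> ` {x \<in> {1..n}. col_of la T x = j} = {x \<in> {1..n}. col_of la T x = j}) \<longleftrightarrow>
      (\<forall>x\<in>{1..n}. col_of la T (\<sigma> x) = col_of la T x)" (is "?L \<longleftrightarrow> ?R") if p: "\<sigma> permutes {1..n}"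
  proof
    assume L: ?L
    show ?R
    proof
      fix x assume "x \<in> {1..n}"
      then have "\<sigma> x \<in> \<sigma> ` {y \<in> {1..n}. col_of la T y = col_of la T x}" by simp
      then show "col_of la T (\<sigma> x) = col_of la T x" using L by simp
    qed
  next
    assume R: ?R
    show ?L
    proof
      fix j
      have "\<sigma> ` {x \<in> {1..n}. col_of la T x = j} \<subseteq> {x \<in> {1..n}. col_of la T x = j}"
        using R permutes_in_image[OF p] by auto
      then show "\<sigma> ` {x \<in> {1..n}. col_of la T x = j} = {x \<in> {1..n}. col_of la T x = j}"
        by (rule endo_inj_surj[rotated]) (use permutes_inj_on[OF p] in auto)
    qed
  qed
  then show ?thesis
    unfolding column_stabilizer_def sym_group_def by (auto simp: col sum_la)
qed

lemma finite_column_stabilizer: "T \<in> tableaux la \<Longrightarrow> finite (column_stabilizer la T)"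
  by (rule finite_subset[of _ "{\<sigma>. \<sigma> permutes {1..n}}"])
     (auto simp: column_stabilizer_iff finite_permutations)

lemma column_stabilizer_comp:
  assumes T: "T \<in> tableaux la" and "\<sigma> \<in> column_stabilizer la T" "\<tau> \<in> column_stabilizer la T"
  shows "\<sigma> \<circ> \<tau> \<in> column_stabilizer la T"
proof -
  have "\<tau> x \<in> {1..n}" if "x \<in> {1..n}" for x
    using assms(3) that permutes_in_image by (fastforce simp: column_stabilizer_iff[OF T])
  then show ?thesis using assms by (auto simp: column_stabilizer_iff permutes_compose)
qed

lemma column_stabilizer_id: "T \<in> tableaux la \<Longrightarrow> id \<in> column_stabilizer la T"
  by (simp add: column_stabilizer_iff permutes_id)

lemma column_stabilizer_inv:
  assumes T: "T \<in> tableaux la" and "\<sigma> \<in> column_stabilizer la T"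
  shows "inv' \<sigma> \<in> column_stabilizer la T"
proof -
  have p: "\<sigma> permutes {1..n}" using assms by (simp add: column_stabilizer_iff)
  have "col_of la T (inv' \<sigma> x) = col_of la T x" if "x \<in> {1..n}" for x
  proof -
    have "inv' \<sigma> x \<in> {1..n}" using that permutes_in_image[OF permutes_inv[OF p]] by blast
    then have "col_of la T (\<sigma> (inv' \<sigma> x)) = col_of la T (inv' \<sigma> x)"
      using assms by (simp add: column_stabilizer_iff)
    then show ?thesis by (simp add: permutes_inverses[OF p])
  qed
  then show ?thesis using T p by (simp add: column_stabilizer_iff permutes_inv)
qed

lemma column_stabilizer_transpose:
  assumes T: "T \<in> tableaux la" and "a \<in> {1..n}" "b \<in> {1..n}" "col_of la T a = col_of la T b"
  shows "transpose a b \<in> column_stabilizer la T"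
  using assms by (auto simp: column_stabilizer_iff permutes_swap_id transpose_def)

lemma permutes_n_permutation: "w permutes {1..n} \<Longrightarrow> permutation w"
  by (rule permutes_imp_permutation) simp_all

lemma polytab_column:
  assumes T: "T \<in> tableaux la" and \<tau>: "\<tau> \<in> column_stabilizer la T"
  shows "polytab la T (list_act \<tau> t) = of_int (sign \<tau>) * polytab la T t"
proof -
  let ?C = "column_stabilizer la T"
  have p: "\<sigma> permutes {1..n}" if "\<sigma> \<in> ?C" for \<sigma>
    using that T by (simp add: column_stabilizer_iff)
  have bij: "bij_betw (\<lambda>\<sigma>. \<tau> \<circ> \<sigma>) ?C ?C"
    by (rule bij_betwI[where g = "\<lambda>\<sigma>. inv' \<tau> \<circ> \<sigma>"])
       (auto simp: column_stabilizer_comp column_stabilizer_inv T \<tau> o_assoc permutes_inv_o[OF p[OF \<tau>]])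
  have "polytab la T (list_act \<tau> t) = (\<Sum>\<sigma>\<in>?C.
      if list_act (\<tau> \<circ> \<sigma>) (tabloid la T) = list_act \<tau> t then of_int (sign (\<tau> \<circ> \<sigma>)) else 0)"
    unfolding polytab_def
    by (rule sum.reindex_bij_betw[OF bij, symmetric])
  also have "\<dots> = (\<Sum>\<sigma>\<in>?C. of_int (sign \<tau>) *
      (if list_act \<sigma> (tabloid la T) = t then of_int (sign \<sigma>) else 0))"
  proof (rule sum.cong)
    fix \<sigma> assume \<sigma>: "\<sigma> \<in> ?C"
    have "sign (\<tau> \<circ> \<sigma>) = sign \<tau> * sign \<sigma>"
      using p \<tau> \<sigma> by (intro sign_compose permutes_n_permutation)
    moreover have "list_act (\<tau> \<circ> \<sigma>) (tabloid la T) = list_act \<tau> t \<longleftrightarrow> list_act \<sigma> (tabloid la T) = t"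
      unfolding list_act_comp by (rule tab.act_inj[OF p[OF \<tau>]])
    ultimately show "(if list_act (\<tau> \<circ> \<sigma>) (tabloid la T) = list_act \<tau> t
        then of_int (sign (\<tau> \<circ> \<sigma>)) else 0) = of_int (sign \<tau>) *
      (if list_act \<sigma> (tabloid la T) = t then of_int (sign \<sigma>) else (0::complex))"
      by simp
  qed simp
  finally show ?thesis by (simp add: polytab_def sum_distrib_left)
qed

lemma polytab_act:
  assumes w: "w permutes {1..n}" and T: "T \<in> tableaux la"
  shows "polytab la (tableau_act la w T) = fun_act list_act w (polytab la T)"
proof
  fix t
  let ?C = "column_stabilizer la T" and ?C' = "column_stabilizer la (tableau_act la w T)"
  note T' = tableau_act_in[OF w T]
  have iw: "inv' w permutes {1..n}" using w by (rule permutes_inv)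
  have p: "\<sigma> permutes {1..n}" if "\<sigma> \<in> ?C" for \<sigma>
    using that T by (simp add: column_stabilizer_iff)
  have mem: "w \<circ> \<sigma> \<circ> inv' w \<in> ?C' \<longleftrightarrow> \<sigma> \<in> ?C" if s: "\<sigma> permutes {1..n}" for \<sigma>
  proof -
    have "(\<forall>x\<in>{1..n}. col_of la (tableau_act la w T) (w (\<sigma> (inv' w x))) = col_of la (tableau_act la w T) x)
      \<longleftrightarrow> (\<forall>x\<in>{1..n}. col_of la (tableau_act la w T) (w (\<sigma> x)) = col_of la (tableau_act la w T) (w x))"
      using permutes_in_image[OF w] permutes_in_image[OF iw] permutes_inverses[OF w] by metis
    also have "\<dots> \<longleftrightarrow> (\<forall>x\<in>{1..n}. col_of la T (\<sigma> x) = col_of la T x)"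
      using permutes_in_image[OF s] by (auto simp: row_of_act(2)[OF w T])
    finally show ?thesis
      using s w iw by (simp add: column_stabilizer_iff T T' permutes_compose)
  qed
  have bij: "bij_betw (\<lambda>\<sigma>. w \<circ> \<sigma> \<circ> inv' w) ?C ?C'"
  proof (rule bij_betwI[where g = "\<lambda>\<sigma>. inv' w \<circ> \<sigma> \<circ> w"])
    show "(\<lambda>\<sigma>. w \<circ> \<sigma> \<circ> inv' w) \<in> ?C \<rightarrow> ?C'" using mem p by auto
    have c: "w \<circ> (inv' w \<circ> \<sigma> \<circ> w) \<circ> inv' w = \<sigma>" for \<sigma>
      by (simp add: fun_eq_iff permutes_inverses[OF w])
    show "(\<lambda>\<sigma>. inv' w \<circ> \<sigma> \<circ> w) \<in> ?C' \<rightarrow> ?C"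
    proof
      fix \<sigma> assume s: "\<sigma> \<in> ?C'"
      then have "\<sigma> permutes {1..n}" using T' by (simp add: column_stabilizer_iff)
      then have "inv' w \<circ> \<sigma> \<circ> w permutes {1..n}" using w iw by (intro permutes_compose)
      from mem[OF this] s show "inv' w \<circ> \<sigma> \<circ> w \<in> ?C" unfolding c by simp
    qed
    show "w \<circ> (inv' w \<circ> \<sigma> \<circ> w) \<circ> inv' w = \<sigma>" for \<sigma> by (rule c)
    show "inv' w \<circ> (w \<circ> \<sigma> \<circ> inv' w) \<circ> w = \<sigma>" for \<sigma>
      by (simp add: fun_eq_iff permutes_inverses[OF w])
  qed
  have "polytab la (tableau_act la w T) t = (\<Sum>\<sigma>\<in>?C.
      if list_act (w \<circ> \<sigma> \<circ> inv' w) (tabloid la (tableau_act la w T)) = t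
      then of_int (sign (w \<circ> \<sigma> \<circ> inv' w)) else 0)"
    unfolding polytab_def by (rule sum.reindex_bij_betw[OF bij, symmetric])
  also have "\<dots> = (\<Sum>\<sigma>\<in>?C.
      if list_act \<sigma> (tabloid la T) = list_act (inv' w) t then of_int (sign \<sigma>) else 0)"
  proof (rule sum.cong)
    fix \<sigma> assume \<sigma>: "\<sigma> \<in> ?C"
    have "sign (w \<circ> \<sigma> \<circ> inv' w) = sign w * sign \<sigma> * sign w"
      using w iw p[OF \<sigma>]
      by (simp add: sign_compose sign_inverse permutes_n_permutation permutes_compose)
    also have "\<dots> = sign \<sigma>" by (simp add: sign_def)
    finally have s: "sign (w \<circ> \<sigma> \<circ> inv' w) = sign \<sigma>" .
    have "list_act (w \<circ> \<sigma> \<circ> inv' w) (tabloid la (tableau_act la w T))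
        = list_act w (list_act \<sigma> (tabloid la T))"
    proof -
      have "list_act (w \<circ> \<sigma> \<circ> inv' w) (tabloid la (tableau_act la w T))
        = list_act ((w \<circ> \<sigma> \<circ> inv' w) \<circ> w) (tabloid la T)"
        unfolding tabloid_act_tableau list_act_comp ..
      also have "(w \<circ> \<sigma> \<circ> inv' w) \<circ> w = w \<circ> \<sigma>"
        by (simp add: fun_eq_iff permutes_inverses[OF w])
      finally show ?thesis unfolding list_act_comp .
    qed
    moreover have "list_act w (list_act \<sigma> (tabloid la T)) = t \<longleftrightarrow>
        list_act \<sigma> (tabloid la T) = list_act (inv' w) t"
      using tab.inv_cancel[OF w] by metis
    ultimately show "(if list_act (w \<circ> \<sigma> \<circ> inv' w) (tabloid la (tableau_act la w T)) = t
      then of_int (sign (w \<circ> \<sigma> \<circ> inv' w)) else 0) =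
      (if list_act \<sigma> (tabloid la T) = list_act (inv' w) t then of_int (sign \<sigma>) else (0::complex))"
      by (simp only: s)
  qed simp
  finally show "polytab la (tableau_act la w T) t = fun_act list_act w (polytab la T) t"
    by (simp add: fun_act_def polytab_def)
qed

lemma polytab_supported:
  assumes T: "T \<in> tableaux la"
  shows "polytab la T \<in> supported_on (tabloids la)"
  unfolding supported_on_def
proof (intro CollectI allI impI)
  fix t assume t: "t \<notin> tabloids la"
  have "list_act \<sigma> (tabloid la T) \<in> tabloids la" if "\<sigma> \<in> column_stabilizer la T" for \<sigma>
    using that T by (intro tab.mem_X) (auto simp: column_stabilizer_iff tabloids_def)
  then show "polytab la T t = 0" unfolding polytab_def using t by (intro sum.neutral) auto
qed

lemma specht_submodule: "tab.submodule (specht_fun la)"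
proof -
  have "fun_act list_act w f \<in> specht_fun la" if w: "w permutes {1..n}" and "f \<in> specht_fun la" for w f
  proof -
    have "fs.subspace {f. fun_act list_act w f \<in> specht_fun la}"
      unfolding fs.subspace_def specht_fun_def
      by (auto simp: tab.fun_act_add tab.fun_act_scale fs.span_add fs.span_scale)
         (simp add: fun_act_def fs.span_zero flip: zero_fun_def)
    moreover have "polytab la ` tableaux la \<subseteq> {f. fun_act list_act w f \<in> specht_fun la}"
      using tableau_act_in[OF w] by (auto simp: specht_fun_def polytab_act[OF w, symmetric] intro!: fs.span_base)
    ultimately have "specht_fun la \<subseteq> {f. fun_act list_act w f \<in> specht_fun la}"
      unfolding specht_fun_def by (rule fs.span_minimal[rotated])
    then show ?thesis using that by blast
  qed
  moreover have "specht_fun la \<subseteq> supported_on (tabloids la)"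
    unfolding specht_fun_def using polytab_supported
    by (intro fs.span_minimal supported_on_subspace) auto
  ultimately show ?thesis by (auto simp: tab.submodule_def specht_fun_def)
qed

lemma garnir_subspace: "fs.subspace {u. garnir u}"
  unfolding fs.subspace_def garnir_def
  by (simp add: sum.distrib flip: sum_distrib_left)

text \<open>Pigeonhole on the columns of \<open>T\<close>. Otherwise the entries of \<open>X\<close> and those of the rows of \<open>T'\<close>
  above row \<open>i\<close> form \<open>Suc i\<close> classes, each of which meets every column of \<open>T\<close> at most once. So these
  entries are at most as many as the cells in rows \<open>0, \<dots>, i\<close>, but \<open>X\<close> has more elements than row \<open>i\<close>.\<close>

lemma column_entries_collide:
  assumes T: "T \<in> tableaux la" and T': "T' \<in> tableaux la" and i: "Suc i < length la"
    and X: "X \<subseteq> tabloid la T' ! i \<union> tabloid la T' ! Suc i" "la ! i < card X"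
  shows "\<exists>a\<in>{1..n}. \<exists>b\<in>{1..n}. a \<noteq> b \<and> col_of la T a = col_of la T b \<and>
    (a \<in> X \<and> b \<in> X \<or> (\<exists>k<i. a \<in> tabloid la T' ! k \<and> b \<in> tabloid la T' ! k))"
proof (rule ccontr)
  assume no: "\<not> ?thesis"
  define r where "r = row_of la T'"
  have mem: "x \<in> tabloid la T' ! k \<longleftrightarrow> x \<in> {1..n} \<and> r x = k" if "k < length la" for x k
    using mem_tabloid_nth[OF T' that] by (simp add: r_def)
  have Xn: "x \<in> {1..n} \<and> i \<le> r x" if "x \<in> X" for x
    using that X(1) i mem[of i x] mem[of "Suc i" x] by auto
  define Y where "Y = {x\<in>{1..n}. r x < i} \<union> X"
  have Yn: "Y \<subseteq> {1..n}" using Xn by (auto simp: Y_def)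
  define blk where "blk x = (if x \<in> X then i else r x)" for x
  have blk: "blk x \<in> {..i}" if "x \<in> Y" for x
    using that by (auto simp: Y_def blk_def)
  have inj: "inj_on blk {x \<in> Y. col_of la T x = j}" for j
  proof (rule inj_onI, rule ccontr)
    fix a b assume ab: "a \<in> {x \<in> Y. col_of la T x = j}" "b \<in> {x \<in> Y. col_of la T x = j}"
      "blk a = blk b" "a \<noteq> b"
    then have "a \<in> X \<and> b \<in> X \<or> (r a < i \<and> r b = r a)"
      by (auto simp: blk_def Y_def split: if_splits)
    moreover have abn: "a \<in> {1..n}" "b \<in> {1..n}" "col_of la T a = col_of la T b" using ab Yn by auto
    moreover have "a \<in> tabloid la T' ! r a \<and> b \<in> tabloid la T' ! r a" if "r a < i \<and> r b = r a"
      using abn that i by (simp add: mem)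
    ultimately have "a \<in> X \<and> b \<in> X \<or> (\<exists>k<i. a \<in> tabloid la T' ! k \<and> b \<in> tabloid la T' ! k)"
      by blast
    moreover note abn
    ultimately show False using no ab(4) by blast
  qed
  have finX: "finite X" using Xn by (rule_tac finite_subset[of _ "{1..n}"]) auto
  have col_bound: "card {x \<in> Y. col_of la T x = j} \<le> card {k. k \<le> i \<and> j < la ! k}" for j
  proof (cases "\<exists>k0\<le>i. la ! k0 \<le> j")
    case False
    then have "j < la ! k" if "k \<le> i" for k using that not_le by blast
    then have "{k. k \<le> i \<and> j < la ! k} = {..i}" by auto
    moreover have "card {x \<in> Y. col_of la T x = j} \<le> card {..i}"
      using blk by (intro card_inj_on_le[OF inj]) auto
    ultimately show ?thesis by simp
  next
    case True
    then obtain k0 where k0: "k0 \<le> i" "la ! k0 \<le> j" by blast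
    have "row_of la T x \<in> {k. k \<le> i \<and> j < la ! k}" if "x \<in> Y" "col_of la T x = j" for x
    proof -
      have c: "(row_of la T x, j) \<in> cells la" using tableau_row_col(1)[OF T, of x] that Yn by auto
      have "row_of la T x < k0"
      proof (rule ccontr)
        assume "\<not> row_of la T x < k0"
        then have "(k0, j) \<in> cells la" using c cells_up by auto
        then show False using k0 by (simp add: cells_def)
      qed
      then show ?thesis using k0 c by (auto simp: cells_def)
    qed
    moreover have "inj_on (row_of la T) {x \<in> Y. col_of la T x = j}"
    proof (rule inj_onI)
      fix x y assume "x \<in> {x \<in> Y. col_of la T x = j}" "y \<in> {x \<in> Y. col_of la T x = j}"
        "row_of la T x = row_of la T y"
      then show "x = y" using tableau_row_col(2)[OF T] Yn by (metis (mono_tags) mem_Collect_eq subsetD)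
    qed
    ultimately show ?thesis by (intro card_inj_on_le) auto
  qed
  have "Y = (\<Union>j<la ! 0. {x \<in> Y. col_of la T x = j})"
  proof -
    have "col_of la T x < la ! 0" if "x \<in> Y" for x
    proof -
      have "(row_of la T x, col_of la T x) \<in> cells la" using tableau_row_col(1)[OF T] that Yn by blast
      then have "(0, col_of la T x) \<in> cells la" using cells_up by blast
      then show ?thesis by (simp add: cells_def)
    qed
    then show ?thesis by auto
  qed
  then have "card Y = card (\<Union>j<la ! 0. {x \<in> Y. col_of la T x = j})"
    by (rule arg_cong)
  also have "\<dots> \<le> (\<Sum>j<la ! 0. card {x \<in> Y. col_of la T x = j})"
    by (rule card_UN_le) simp
  also have "\<dots> \<le> (\<Sum>j<la ! 0. card {k. k \<le> i \<and> j < la ! k})"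
    by (intro sum_mono col_bound)
  also have "\<dots> = (\<Sum>j<la ! 0. \<Sum>k\<le>i. if j < la ! k then 1 else 0)"
  proof (intro sum.cong refl)
    fix j
    have "{k. k \<le> i \<and> j < la ! k} = {..i} \<inter> {k. j < la ! k}" by auto
    then show "card {k. k \<le> i \<and> j < la ! k} = (\<Sum>k\<le>i. if j < la ! k then 1 else 0)"
      by (simp add: sum.If_cases)
  qed
  also have "\<dots> = (\<Sum>k\<le>i. \<Sum>j<la ! 0. if j < la ! k then 1 else 0)"
    by (rule sum.swap)
  also have "\<dots> = (\<Sum>k\<le>i. la ! k)"
  proof (rule sum.cong)
    fix k assume "k \<in> {..i}"
    then have "la ! k \<le> la ! 0" using i parts_antimono[of 0 k] by simp
    then have "{..<la ! 0} \<inter> {j. j < la ! k} = {..<la ! k}" by auto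
    then show "(\<Sum>j<la ! 0. if j < la ! k then 1 else 0) = la ! k" by (simp add: sum.If_cases)
  qed simp
  finally have le: "card Y \<le> (\<Sum>k\<le>i. la ! k)" .
  have "card Y = card {x\<in>{1..n}. r x < i} + card X"
    unfolding Y_def using Xn finX by (intro card_Un_disjoint) fastforce+
  also have "{x\<in>{1..n}. r x < i} = (\<Union>k<i. tabloid la T' ! k)"
    using mem i by auto
  also have "card \<dots> = (\<Sum>k<i. card (tabloid la T' ! k))"
  proof (rule card_UN_disjoint)
    show "\<forall>k\<in>{..<i}. finite (tabloid la T' ! k)"
      using i by (auto simp: tabloid_nth finite_cells)
    show "\<forall>k\<in>{..<i}. \<forall>l\<in>{..<i}. k \<noteq> l \<longrightarrow> tabloid la T' ! k \<inter> tabloid la T' ! l = {}"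
      using i mem by auto
  qed simp
  also have "\<dots> = (\<Sum>k<i. la ! k)"
    using i card_tabloid_nth[OF T'] by simp
  finally show False using le X(2) by (simp add: lessThan_Suc_atMost[symmetric])
qed

text \<open>The transposition of two entries of one column of \<open>T\<close> changes the sign of the polytabloid. If both
  entries lie in \<open>X\<close>, it permutes the summands of the Garnir relation; if both lie in one of the rows
  above, it fixes every tabloid that occurs.\<close>

lemma polytab_garnir:
  assumes T: "T \<in> tableaux la"
  shows "garnir (polytab la T)"
  unfolding garnir_def
proof (intro ballI allI impI)
  fix T' i X
  assume T': "T' \<in> tableaux la" and i: "Suc i < length la"
    and X: "X \<subseteq> tabloid la T' ! i \<union> tabloid la T' ! Suc i" "la ! i < card X"
  obtain a b where ab: "a \<in> {1..n}" "b \<in> {1..n}" "a \<noteq> b" "col_of la T a = col_of la T b"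
    and blk: "a \<in> X \<and> b \<in> X \<or> (\<exists>k<i. a \<in> tabloid la T' ! k \<and> b \<in> tabloid la T' ! k)"
    using column_entries_collide[OF T T' i X] by blast
  define \<tau> where "\<tau> = transpose a b"
  have "\<tau> \<in> column_stabilizer la T"
    unfolding \<tau>_def using T ab by (intro column_stabilizer_transpose) auto
  then have neg: "polytab la T (list_act \<tau> t) = - polytab la T t" for t
    using polytab_column[OF T, of \<tau> t] ab(3) by (simp add: \<tau>_def sign_swap_id)
  show "(\<Sum>w | w permutes X. polytab la T (list_act w (tabloid la T'))) = 0" (is "?S = 0")
  proof (cases "a \<in> X \<and> b \<in> X")
    case True
    then have "\<tau> permutes X" by (simp add: \<tau>_def permutes_swap_id)
    then have "?S = (\<Sum>w | w permutes X. polytab la T (list_act (\<tau> \<circ> w) (tabloid la T')))"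
      by (rule setum_permutations_compose_left)
    also have "\<dots> = - ?S" unfolding list_act_comp neg by (simp add: sum_negf)
    finally show ?thesis by simp
  next
    case False
    then obtain k where k: "k < i" "a \<in> tabloid la T' ! k" "b \<in> tabloid la T' ! k" using blk by blast
    show ?thesis
    proof (intro sum.neutral ballI)
      fix w assume "w \<in> {w. w permutes X}"
      then have w: "w permutes X" by simp
      have row: "row_of la T' a = k" "row_of la T' b = k"
        using k i mem_tabloid_nth[OF T', of k] by auto
      have "x \<notin> X" if "row_of la T' x = k" for x
        using that k(1) i X(1) mem_tabloid_nth[OF T', of i] mem_tabloid_nth[OF T', of "Suc i"] by fastforce
      then have fix_ab: "w a = a" "w b = b" using row permutes_not_in[OF w] by auto
      have "X \<subseteq> {1..n}"
        using X(1) i mem_tabloid_nth[OF T', of i] mem_tabloid_nth[OF T', of "Suc i"] by auto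
      then have wn: "w permutes {1..n}" using w permutes_subset by blast
      have "\<tau> ` (list_act w (tabloid la T') ! l) = list_act w (tabloid la T') ! l" if l: "l < length la" for l
      proof -
        have "x \<in> {a, b} \<longrightarrow> (x \<in> w ` (tabloid la T' ! l) \<longleftrightarrow> l = k)" for x
          using fix_ab row ab l mem_tabloid_nth[OF T' l] inj_image_mem_iff[OF permutes_inj[OF w]]
          by (metis insertE singletonD)
        then have "a \<in> w ` (tabloid la T' ! l) \<longleftrightarrow> b \<in> w ` (tabloid la T' ! l)" by blast
        then show ?thesis using l by (simp add: \<tau>_def transpose_image_eq)
      qed
      then have "list_act \<tau> (list_act w (tabloid la T')) = list_act w (tabloid la T')"
        by (intro nth_equalityI) auto
      then have "polytab la T (list_act w (tabloid la T')) = - polytab la T (list_act w (tabloid la T'))"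
        using neg[of "list_act w (tabloid la T')"] by metis
      then show "polytab la T (list_act w (tabloid la T')) = 0" by simp
    qed
  qed
qed

lemma specht_garnir: "specht_fun la \<subseteq> {u. garnir u}"
  unfolding specht_fun_def using polytab_garnir by (intro fs.span_minimal garnir_subspace) auto

lemma semistandard_column:
  assumes "semistandard la A" "(i', j) \<in> cells la" "i < i'"
  shows "A (i, j) < A (i', j)"
  using assms(2,3)
proof (induction i')
  case (Suc k)
  have c: "(k, j) \<in> cells la" using Suc.prems cells_up by auto
  have "A (k, j) < A (Suc k, j)" using assms(1) Suc.prems by (auto simp: semistandard_def)
  moreover have "A (i, j) \<le> A (k, j)" using Suc c by (cases "i = k") auto
  ultimately show ?case by simp
qed simp

text \<open>In a semistandard tableau the colours increase strictly down each column, so the weight is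
  maximal among all column permutations, and only there (rearrangement inequality).\<close>

lemma column_perm_lowers_weight:
  assumes T: "T \<in> tableaux la" and ss: "semistandard la (c \<circ> T)"
    and \<sigma>: "\<sigma> \<in> column_stabilizer la T" "\<sigma> \<noteq> id"
  shows "row_weight c (tableau_act la \<sigma> T) < row_weight c T"
proof -
  let ?C = "column_stabilizer la T"
  define W where "W \<sigma> = row_weight c (tableau_act la \<sigma> T)" for \<sigma>
  have W: "W \<sigma> = (\<Sum>x\<in>{1..n}. row_of la T x * c (\<sigma> x))" if "\<sigma> \<in> ?C" for \<sigma>
    using that T row_weight_act unfolding W_def by (simp add: column_stabilizer_iff)
  have strict: "c x < c y" if "x \<in> {1..n}" "y \<in> {1..n}" "col_of la T x = col_of la T y"
    "row_of la T x < row_of la T y" for x y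
    using semistandard_column[OF ss, of "row_of la T y" "col_of la T y" "row_of la T x"]
      tableau_row_col[OF T that(1)] tableau_row_col[OF T that(2)] that(3,4) by simp
  have row_neq: "row_of la T x \<noteq> row_of la T y"
    if "x \<in> {1..n}" "y \<in> {1..n}" "col_of la T x = col_of la T y" "x \<noteq> y" for x y
    using tableau_row_col(2)[OF T] that by metis
  \<comment> \<open>a nontrivial column permutation has an inversion, and removing it raises the weight\<close>
  have step: "\<exists>\<sigma>'\<in>?C. W \<sigma> < W \<sigma>'" if \<sigma>: "\<sigma> \<in> ?C" "\<sigma> \<noteq> id" for \<sigma>
  proof -
    have p: "\<sigma> permutes {1..n}" and col: "\<And>x. x \<in> {1..n} \<Longrightarrow> col_of la T (\<sigma> x) = col_of la T x"
      using \<sigma>(1) T by (auto simp: column_stabilizer_iff)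
    have "\<exists>x. \<sigma> x \<noteq> x" using \<sigma>(2) by (auto simp: fun_eq_iff)
    then obtain x where x: "\<sigma> x \<noteq> x" and min: "\<And>z. \<sigma> z \<noteq> z \<Longrightarrow> row_of la T x \<le> row_of la T z"
      using ex_has_least_nat[of "\<lambda>x. \<sigma> x \<noteq> x" _ "row_of la T"] by metis
    have xn: "x \<in> {1..n}" using x permutes_not_in[OF p] by blast
    have sxn: "\<sigma> x \<in> {1..n}" using xn permutes_in_image[OF p] by blast
    obtain y where y: "\<sigma> y = x" using permutes_surj[OF p] by (metis surjD)
    have yx: "y \<noteq> x" using y x by auto
    have yn: "y \<in> {1..n}" using y xn permutes_in_image[OF p] by metis
    have coly: "col_of la T y = col_of la T x" using col[OF yn] y by simp
    have "row_of la T x \<le> row_of la T y" using min[of y] y yx by auto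
    then have rxy: "row_of la T x < row_of la T y" using row_neq[OF xn yn] coly yx by simp
    have "\<sigma> (\<sigma> x) \<noteq> \<sigma> x" using x permutes_inj[OF p] by (auto dest: injD)
    then have "row_of la T x \<le> row_of la T (\<sigma> x)" by (rule min)
    then have "row_of la T x < row_of la T (\<sigma> x)" using row_neq[OF xn sxn] col[OF xn] x by simp
    then have cx: "c (\<sigma> y) < c (\<sigma> x)" using strict[OF xn sxn] col[OF xn] y by simp
    define \<sigma>' where "\<sigma>' = \<sigma> \<circ> transpose x y"
    have \<sigma>': "\<sigma>' \<in> ?C"
      unfolding \<sigma>'_def using T \<sigma>(1) xn yn coly
      by (intro column_stabilizer_comp column_stabilizer_transpose) auto
    have split: "(\<Sum>z\<in>{1..n}. g z) = g x + (g y + (\<Sum>z\<in>{1..n} - {x} - {y}. g z))" for g :: "nat \<Rightarrow> nat"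
      using xn yn yx by (subst sum.remove[of _ x], simp, simp, subst sum.remove[of _ y]) auto
    have rest: "(\<Sum>z\<in>{1..n} - {x} - {y}. row_of la T z * c (\<sigma>' z)) =
        (\<Sum>z\<in>{1..n} - {x} - {y}. row_of la T z * c (\<sigma> z))"
      by (intro sum.cong) (auto simp: \<sigma>'_def transpose_def)
    have "row_of la T x * c (\<sigma> x) + row_of la T y * c (\<sigma> y)
        < row_of la T x * c (\<sigma> y) + row_of la T y * c (\<sigma> x)"
    proof -
      obtain d e where "row_of la T y = row_of la T x + Suc d" "c (\<sigma> x) = c (\<sigma> y) + Suc e"
        using rxy cx by (metis add_Suc_right less_imp_Suc_add)
      then show ?thesis by (simp add: algebra_simps)
    qed
    then have "W \<sigma> < W \<sigma>'"
      unfolding W[OF \<sigma>(1)] W[OF \<sigma>'] split rest by (simp add: \<sigma>'_def)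
    then show ?thesis using \<sigma>' by blast
  qed
  obtain B where B: "\<And>\<sigma>. \<sigma> \<in> ?C \<Longrightarrow> W \<sigma> \<le> B"
    using finite_column_stabilizer[OF T] finite_nat_set_iff_bounded_le[of "W ` ?C"] by auto
  have "W \<sigma> < W id" if "\<sigma> \<in> ?C" "\<sigma> \<noteq> id" for \<sigma>
    using that
  proof (induction "B - W \<sigma>" arbitrary: \<sigma> rule: less_induct)
    case (less \<sigma>)
    obtain \<sigma>' where \<sigma>': "\<sigma>' \<in> ?C" "W \<sigma> < W \<sigma>'" using step less.prems by blast
    show ?case
    proof (cases "\<sigma>' = id")
      case False
      have "B - W \<sigma>' < B - W \<sigma>" using \<sigma>' B[of \<sigma>'] by linarith
      from less.hyps[OF this \<sigma>'(1) False] show ?thesis using \<sigma>'(2) by simp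
    qed (use \<sigma>' in simp)
  qed
  from this[OF \<sigma>] show ?thesis
    unfolding W_def[of \<sigma>] W[OF column_stabilizer_id[OF T]] by (simp add: row_weight_def)
qed

end

context shape
begin

definition ssyt_tableaux :: "(nat \<Rightarrow> nat) \<Rightarrow> (nat \<times> nat \<Rightarrow> nat) set" where
  "ssyt_tableaux c = {T \<in> tableaux la. semistandard la (c \<circ> T)}"

definition colour_array :: "(nat \<Rightarrow> nat) \<Rightarrow> (nat \<times> nat \<Rightarrow> nat) \<Rightarrow> nat \<times> nat \<Rightarrow> nat" where
  "colour_array c T = restrict (c \<circ> T) (cells la)"

text \<open>These are the semistandard arrays with the content of the colouring (\<open>colour_arrays_eq\<close>). Each
  is represented by one tableau, \<open>array_tableau\<close>.\<close>

definition colour_arrays :: "(nat \<Rightarrow> nat) \<Rightarrow> (nat \<times> nat \<Rightarrow> nat) set" where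
  "colour_arrays c = colour_array c ` ssyt_tableaux c"

definition array_tableau :: "(nat \<Rightarrow> nat) \<Rightarrow> (nat \<times> nat \<Rightarrow> nat) \<Rightarrow> nat \<times> nat \<Rightarrow> nat" where
  "array_tableau c A = (SOME T. T \<in> ssyt_tableaux c \<and> colour_array c T = A)"

definition symmetrise :: "(nat \<Rightarrow> nat) \<Rightarrow> (nat set list \<Rightarrow> complex) \<Rightarrow> nat set list \<Rightarrow> complex" where
  "symmetrise c u t = (\<Sum>h\<in>colour_stab n c. u (list_act h t))"

lemma array_tableau:
  assumes "A \<in> colour_arrays c"
  shows "array_tableau c A \<in> tableaux la" "semistandard la (c \<circ> array_tableau c A)"
    "colour_array c (array_tableau c A) = A"
proof -
  have "\<exists>T. T \<in> ssyt_tableaux c \<and> colour_array c T = A"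
    using assms by (auto simp: colour_arrays_def)
  from someI_ex[OF this] show "array_tableau c A \<in> tableaux la" "semistandard la (c \<circ> array_tableau c A)"
    "colour_array c (array_tableau c A) = A"
    by (auto simp: array_tableau_def ssyt_tableaux_def)
qed

lemma finite_colour_arrays: "finite (colour_arrays c)"
  by (simp add: colour_arrays_def ssyt_tableaux_def finite_tableaux)

end

lemma colour_stab_perm: "h \<in> colour_stab n c \<Longrightarrow> h permutes {1..n}"
  by (simp add: colour_stab_def)

lemma finite_colour_stab: "finite (colour_stab n c)"
  by (rule finite_subset[of _ "{\<sigma>. \<sigma> permutes {1..n}}"]) (auto simp: colour_stab_def finite_permutations)

lemma colour_stab_id: "id \<in> colour_stab n c"
  by (simp add: colour_stab_def permutes_id)

lemma colour_stab_comp: "h \<in> colour_stab n c \<Longrightarrow> g \<in> colour_stab n c \<Longrightarrow> h \<circ> g \<in> colour_stab n c"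
  by (auto simp: colour_stab_def permutes_compose)

lemma colour_stab_inv: "h \<in> colour_stab n c \<Longrightarrow> inv' h \<in> colour_stab n c"
  by (simp add: colour_stab_def permutes_inv) (metis permutes_inverses(1))

lemma colour_stab_bij:
  assumes "h \<in> colour_stab n c"
  shows "bij_betw (\<lambda>g. g \<circ> h) (colour_stab n c) (colour_stab n c)"
  by (rule bij_betwI[where g = "\<lambda>g. g \<circ> inv' h"])
     (use assms in \<open>auto simp: colour_stab_comp colour_stab_inv comp_assoc
        permutes_inv_o[OF colour_stab_perm[OF assms]]\<close>)

text \<open>Forward substitution: a function that belongs to an index of least weight vanishes at all other
  indices, so its coefficient can be adjusted last.\<close>

lemma triangular_solve:
  fixes E :: "'i \<Rightarrow> 'i \<Rightarrow> complex" and W :: "'i \<Rightarrow> nat"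
  assumes "finite I" "\<And>A. A \<in> I \<Longrightarrow> E A A \<noteq> 0"
    and "\<And>A B. A \<in> I \<Longrightarrow> B \<in> I \<Longrightarrow> E A B \<noteq> 0 \<Longrightarrow> A = B \<or> W B < W A"
  shows "\<exists>a. \<forall>B\<in>I. (\<Sum>A\<in>I. a A * E A B) = y B"
  using assms
proof (induction "card I" arbitrary: I)
  case (Suc k)
  then have "I \<noteq> {}" by auto
  then obtain A0 where A0: "A0 \<in> I" "\<And>B. B \<in> I \<Longrightarrow> W A0 \<le> W B"
    using ex_has_least_nat[of "\<lambda>A. A \<in> I" _ W] by blast
  have "\<exists>a. \<forall>B\<in>I - {A0}. (\<Sum>A\<in>I - {A0}. a A * E A B) = y B"
    using Suc A0 by (intro Suc.hyps(1)) auto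
  then obtain a where a: "\<And>B. B \<in> I - {A0} \<Longrightarrow> (\<Sum>A\<in>I - {A0}. a A * E A B) = y B" by blast
  define a' where "a' = a(A0 := (y A0 - (\<Sum>A\<in>I - {A0}. a A * E A A0)) / E A0 A0)"
  have split: "(\<Sum>A\<in>I. a' A * E A B) = a' A0 * E A0 B + (\<Sum>A\<in>I - {A0}. a A * E A B)" for B
    unfolding sum.remove[OF Suc.prems(1) A0(1)] by (simp add: a'_def)
  have "(\<Sum>A\<in>I. a' A * E A B) = y B" if B: "B \<in> I" for B
  proof (cases "B = A0")
    case True
    then show ?thesis unfolding split using Suc.prems(2)[OF A0(1)] by (simp add: a'_def)
  next
    case False
    then have "E A0 B = 0" using Suc.prems(3)[OF A0(1) B] A0(2)[OF B] by force
    then show ?thesis unfolding split using a B False by simp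
  qed
  then show ?case by blast
qed simp

lemma has_coords_fun_moduleI:
  assumes U: "fs.subspace U" and bij: "bij_betw ev (invariants H (fun_module a U)) (supported_on I)"
    and add: "\<And>f g. f \<in> U \<Longrightarrow> g \<in> U \<Longrightarrow> ev (f + g) = ev f + ev g"
    and scale: "\<And>c f. f \<in> U \<Longrightarrow> ev (fscale c f) = fscale c (ev f)"
  shows "has_coords H (fun_module a U) I"
proof -
  let ?V = "invariants H (fun_module a U)"
  let ?\<psi> = "inv_into ?V ev"
  have b: "bij_betw ?\<psi> (supported_on I) ?V" using bij by (rule bij_betw_inv_into)
  have mem: "?\<psi> f \<in> ?V" if "f \<in> supported_on I" for f using bij_betw_apply[OF b that] .
  have V: "f \<in> ?V \<longleftrightarrow> f \<in> U \<and> (\<forall>h\<in>H. fun_act a h f = f)" for f by (simp add: invariants_def)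
  have VU: "f \<in> U" if "f \<in> ?V" for f using that V by blast
  have ev: "ev (?\<psi> f) = f" if "f \<in> supported_on I" for f using bij that by (rule bij_betw_inv_into_right)
  have eq: "?\<psi> f = g" if "g \<in> ?V" "ev g = f" for f g
    using bij_betw_inv_into_left[OF bij that(1)] that(2) by simp
  have Vadd: "f + g \<in> ?V" if "f \<in> ?V" "g \<in> ?V" for f g
    using that fs.subspace_add[OF U] unfolding V by (auto simp: fun_act_def fun_eq_iff)
  have Vscale: "fscale c f \<in> ?V" if "f \<in> ?V" for c f
    using that fs.subspace_scale[OF U] unfolding V by (auto simp: fun_act_def fun_eq_iff)
  have "?\<psi> (\<lambda>i. f i + g i) = ?\<psi> f + ?\<psi> g" if "f \<in> supported_on I" "g \<in> supported_on I" for f g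
  proof (rule eq)
    have pl: "(\<lambda>i. f i + g i) = f + g" by (simp add: plus_fun_def)
    show "ev (?\<psi> f + ?\<psi> g) = (\<lambda>i. f i + g i)"
      unfolding pl using that by (simp only: add[OF VU[OF mem] VU[OF mem]] ev)
  qed (intro Vadd mem that)
  moreover have "?\<psi> (\<lambda>i. c * f i) = fscale c (?\<psi> f)" if "f \<in> supported_on I" for c f
  proof (rule eq)
    have sc: "(\<lambda>i. c * f i) = fscale c f" by (simp add: fscale_def)
    show "ev (fscale c (?\<psi> f)) = (\<lambda>i. c * f i)"
      unfolding sc using that by (simp only: scale[OF VU[OF mem]] ev)
  qed (intro Vscale mem that)
  ultimately show ?thesis
    unfolding has_coords_def by (intro exI[of _ ?\<psi>]) (simp add: b)
qed

context shape
begin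

lemma symmetrise_invariant:
  assumes "h \<in> colour_stab n c"
  shows "symmetrise c u (list_act h t) = symmetrise c u t"
  unfolding symmetrise_def
  using sum.reindex_bij_betw[OF colour_stab_bij[OF assms], of "\<lambda>g. u (list_act g t)"]
  by (simp only: list_act_comp)

lemma symmetrise_mem:
  assumes M: "tab.submodule M" "u \<in> M"
  shows "symmetrise c u \<in> M"
proof -
  have "symmetrise c u = (\<Sum>h\<in>colour_stab n c. fun_act list_act (inv' h) u)"
    by (rule ext) (simp add: symmetrise_def sum_fun_apply fun_act_def
        permutes_inv_inv[OF colour_stab_perm])
  also have "\<dots> \<in> M"
  proof (rule fs.subspace_sum)
    fix h assume "h \<in> colour_stab n c"
    from permutes_inv[OF colour_stab_perm[OF this]]
    show "fun_act list_act (inv' h) u \<in> M" using M by (simp add: tab.submodule_def)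
  qed (use M in \<open>simp add: tab.submodule_def\<close>)
  finally show ?thesis .
qed

lemma row_weight_colour_stab:
  assumes "h \<in> colour_stab n c" "T \<in> tableaux la"
  shows "row_weight c (tableau_act la h T) = row_weight c T"
  using assms by (simp add: row_weight_act colour_stab_def) (simp add: row_weight_def)

text \<open>A tabloid in the support of the polytabloid arises from \<open>T\<close> by a column permutation, which lowers
  the weight unless it is the identity; colour-preserving permutations do not change the weight.\<close>

lemma polytab_triangular:
  assumes T: "T \<in> tableaux la" "semistandard la (c \<circ> T)" and T': "T' \<in> tableaux la"
    and h: "h \<in> colour_stab n c" and nz: "polytab la T (list_act h (tabloid la T')) \<noteq> 0"
  shows "tabloid la T = list_act h (tabloid la T') \<or> row_weight c T' < row_weight c T"
proof -
  obtain \<sigma> where \<sigma>: "\<sigma> \<in> column_stabilizer la T"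
    "list_act \<sigma> (tabloid la T) = list_act h (tabloid la T')"
    using nz unfolding polytab_def by (auto elim!: sum.not_neutral_contains_not_neutral split: if_splits)
  show ?thesis
  proof (cases "\<sigma> = id")
    case True
    then show ?thesis using \<sigma>(2) by (simp only: list_act_id) simp
  next
    case False
    have p: "\<sigma> permutes {1..n}" using \<sigma>(1) T(1) by (simp add: column_stabilizer_iff)
    have "row_weight c (tableau_act la \<sigma> T) = row_weight c (tableau_act la h T')"
      using \<sigma>(2) tableau_act_in[OF p T(1)] tableau_act_in[OF colour_stab_perm[OF h] T']
      by (intro row_weight_tabloid) (simp_all only: tabloid_act_tableau)
    then show ?thesis
      using column_perm_lowers_weight[OF T \<sigma>(1) False] row_weight_colour_stab[OF h T'] by simp
  qed
qed

lemma polytab_self: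
  assumes T: "T \<in> tableaux la" "semistandard la (c \<circ> T)"
  shows "polytab la T (tabloid la T) = 1"
proof -
  have "(if list_act \<sigma> (tabloid la T) = tabloid la T then of_int (sign \<sigma>) else (0::complex)) =
      (if \<sigma> = id then 1 else 0)" if \<sigma>: "\<sigma> \<in> column_stabilizer la T" for \<sigma>
  proof (cases "\<sigma> = id")
    case True
    then show ?thesis by (simp only: list_act_id) simp
  next
    case False
    have p: "\<sigma> permutes {1..n}" using \<sigma> T(1) by (simp add: column_stabilizer_iff)
    have "list_act \<sigma> (tabloid la T) \<noteq> tabloid la T"
      using row_weight_tabloid[OF tableau_act_in[OF p T(1)] T(1), of c]
        column_perm_lowers_weight[OF T \<sigma> False] by (simp only: tabloid_act_tableau) force
    then show ?thesis using False by (simp only: if_False)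
  qed
  then have "polytab la T (tabloid la T) = (\<Sum>\<sigma>\<in>column_stabilizer la T. if \<sigma> = id then 1 else 0)"
    unfolding polytab_def by (rule sum.cong[OF refl])
  then show ?thesis
    using finite_column_stabilizer[OF T(1)] column_stabilizer_id[OF T(1)] by simp
qed

text \<open>A row of a semistandard array is sorted, so it is determined by the multiset of its colours, which
  colour-preserving permutations do not affect.\<close>

lemma equal_colour_rows:
  assumes T: "T \<in> tableaux la" "semistandard la (c \<circ> T)" and T': "T' \<in> tableaux la" "semistandard la (c \<circ> T')"
    and h: "h \<in> colour_stab n c" and eq: "tabloid la T = list_act h (tabloid la T')"
  shows "colour_array c T = colour_array c T'"
proof -
  define L where "L T i = map (\<lambda>j. c (T (i, j))) [0..<la ! i]" for T i
  have sorted: "sorted (L T i)" if "i < length la" "semistandard la (c \<circ> T)" for T i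
    using that by (auto simp: L_def sorted_iff_nth_Suc semistandard_def cells_def)
  have mset: "mset (L T i) = image_mset c (mset_set (tabloid la T ! i))"
    if i: "i < length la" and T: "T \<in> tableaux la" for T i
  proof -
    have row: "{c \<in> cells la. fst c = i} = Pair i ` {0..<la ! i}" using i by (auto simp: cells_def)
    have inj: "inj_on (\<lambda>j. T (i, j)) {0..<la ! i}"
      using tableau_eq_iff[OF T] i by (auto simp: inj_on_def cells_def)
    have "image_mset c (mset_set (tabloid la T ! i))
        = image_mset c (image_mset (\<lambda>j. T (i, j)) (mset_set {0..<la ! i}))"
      unfolding image_mset_mset_set[OF inj] tabloid_nth[OF i] row by (simp add: image_image)
    then show ?thesis by (simp add: L_def multiset.map_comp comp_def)
  qed
  have "L T i = L T' i" if i: "i < length la" for i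
  proof -
    have "tabloid la T ! i = h ` (tabloid la T' ! i)" using eq i by simp
    then have "image_mset c (mset_set (tabloid la T ! i)) = image_mset c (mset_set (tabloid la T' ! i))"
      using h image_mset_mset_set[OF permutes_inj_on[OF colour_stab_perm[OF h]], of "tabloid la T' ! i", symmetric]
      by (simp add: multiset.map_comp comp_def colour_stab_def)
    then have "mset (L T i) = mset (L T' i)" using mset i T T' by simp
    then show ?thesis using sorted[OF i T(2)] sorted[OF i T'(2)] by (metis properties_for_sort)
  qed
  then have "c (T (i, j)) = c (T' (i, j))" if "(i, j) \<in> cells la" for i j
    using that unfolding L_def cells_def by (auto simp: list_eq_iff_nth_eq)
  then show ?thesis by (auto simp: colour_array_def fun_eq_iff restrict_def)
qed

text \<open>The symmetrised polytabloids of the semistandard tableaux are triangular. The diagonal entries do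
  not vanish: by triangularity only the tabloid of the tableau itself contributes, with positive
  coefficients.\<close>

lemma invariants_take_values:
  "\<exists>u\<in>specht_fun la. (\<forall>h\<in>colour_stab n c. \<forall>t. u (list_act h t) = u t) \<and>
     (\<forall>A\<in>colour_arrays c. u (tabloid la (array_tableau c A)) = y A)"
proof -
  define E where "E A B = symmetrise c (polytab la (array_tableau c A)) (tabloid la (array_tableau c B))" for A B
  have "E A A \<noteq> 0" if A: "A \<in> colour_arrays c" for A
  proof -
    let ?T = "array_tableau c A" and ?H = "colour_stab n c"
    note T = array_tableau(1,2)[OF A]
    have "polytab la ?T (list_act h (tabloid la ?T)) =
        (if list_act h (tabloid la ?T) = tabloid la ?T then 1 else 0)" if "h \<in> ?H" for h
    proof (cases "list_act h (tabloid la ?T) = tabloid la ?T")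
      case False
      then have "polytab la ?T (list_act h (tabloid la ?T)) = 0"
        using polytab_triangular[OF T T(1) that] by (metis less_irrefl)
      with False show ?thesis by (simp only: if_False)
    qed (simp add: polytab_self[OF T])
    then have "E A A = (\<Sum>h\<in>?H. if list_act h (tabloid la ?T) = tabloid la ?T then 1 else 0)"
      unfolding E_def symmetrise_def by (rule sum.cong[OF refl])
    also have "\<dots> = of_nat (card {h \<in> ?H. list_act h (tabloid la ?T) = tabloid la ?T})"
      using finite_colour_stab[of n c] by (simp add: sum.If_cases Int_def)
    also have "\<dots> \<noteq> 0"
    proof -
      have "id \<in> {h \<in> ?H. list_act h (tabloid la ?T) = tabloid la ?T}"
        using colour_stab_id[of n c] list_act_id by simp
      then have "card {h \<in> ?H. list_act h (tabloid la ?T) = tabloid la ?T} \<noteq> 0"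
        using finite_colour_stab[of n c] by auto
      then show ?thesis by simp
    qed
    finally show ?thesis .
  qed
  moreover have "A = B \<or> row_weight c (array_tableau c B) < row_weight c (array_tableau c A)"
    if A: "A \<in> colour_arrays c" and B: "B \<in> colour_arrays c" and nz: "E A B \<noteq> 0" for A B
  proof -
    obtain h where h: "h \<in> colour_stab n c"
      "polytab la (array_tableau c A) (list_act h (tabloid la (array_tableau c B))) \<noteq> 0"
      using nz unfolding E_def symmetrise_def by (auto elim: sum.not_neutral_contains_not_neutral)
    from polytab_triangular[OF array_tableau(1,2)[OF A] array_tableau(1)[OF B] h]
    show ?thesis
      using equal_colour_rows[OF array_tableau(1,2)[OF A] array_tableau(1,2)[OF B] h(1)]
        array_tableau(3)[OF A] array_tableau(3)[OF B] by auto
  qed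
  ultimately obtain a where a: "\<forall>B\<in>colour_arrays c. (\<Sum>A\<in>colour_arrays c. a A * E A B) = y B"
    using triangular_solve[of "colour_arrays c" E "\<lambda>A. row_weight c (array_tableau c A)" y,
        OF finite_colour_arrays] by blast
  define u where "u = (\<Sum>A\<in>colour_arrays c. fscale (a A) (symmetrise c (polytab la (array_tableau c A))))"
  have app: "u t = (\<Sum>A\<in>colour_arrays c. a A * symmetrise c (polytab la (array_tableau c A)) t)" for t
    by (simp add: u_def sum_fun_apply)
  have "polytab la (array_tableau c A) \<in> specht_fun la" if "A \<in> colour_arrays c" for A
    unfolding specht_fun_def using array_tableau(1)[OF that] by (intro fs.span_base) auto
  then have "u \<in> specht_fun la"
    unfolding u_def using specht_submodule
    by (intro fs.subspace_sum fs.subspace_scale symmetrise_mem) (auto simp: tab.submodule_def)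
  moreover have "u (list_act h t) = u t" if "h \<in> colour_stab n c" for h t
    unfolding app symmetrise_invariant[OF that] ..
  moreover have "u (tabloid la (array_tableau c A)) = y A" if "A \<in> colour_arrays c" for A
    using a that by (simp add: app E_def)
  ultimately show ?thesis by blast
qed

lemma invariants_determined:
  assumes "garnir u" "u \<in> supported_on (tabloids la)"
    and inv: "\<And>h t. h \<in> colour_stab n c \<Longrightarrow> t \<in> tabloids la \<Longrightarrow> u (list_act h t) = u t"
    and zero: "\<And>A. A \<in> colour_arrays c \<Longrightarrow> u (tabloid la (array_tableau c A)) = 0"
  shows "u = 0"
proof
  fix t show "u t = 0 t"
  proof (cases "t \<in> tabloids la")
    case True
    then obtain T where T: "T \<in> tableaux la" "t = tabloid la T" by (auto simp: tabloids_def)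
    have "u (tabloid la T) = 0"
    proof (rule straightening[OF inv assms(1) _ T(1)])
      fix T assume T: "T \<in> tableaux la" "semistandard la (c \<circ> T)"
      define A where "A = colour_array c T"
      have A: "A \<in> colour_arrays c" using T by (auto simp: A_def colour_arrays_def ssyt_tableaux_def)
      have "c (T p) = c (array_tableau c A p)" if "p \<in> cells la" for p
        using array_tableau(3)[OF A] that unfolding A_def colour_array_def
        by (metis comp_apply restrict_apply')
      then obtain h where "h \<in> colour_stab n c"
        "tabloid la (array_tableau c A) = list_act h (tabloid la T)"
        using colour_stab_if_same_colours[OF T(1) array_tableau(1)[OF A]] by metis
      then have "u (tabloid la (array_tableau c A)) = u (tabloid la T)"
        using inv T(1) by (metis imageI tabloids_def)
      then show "u (tabloid la T) = 0" using zero[OF A] by simp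
    qed
    then show ?thesis using T by simp
  qed (use assms(2) in \<open>simp add: supported_on_def\<close>)
qed

text \<open>For the colouring in which all colours differ the invariants are all functions. There is a
  function in the span of the polytabloids with the same values at the standard tableaux, and
  straightening shows that it is the same function.\<close>

lemma garnir_imp_specht:
  assumes u: "garnir u" "u \<in> supported_on (tabloids la)"
  shows "u \<in> specht_fun la"
proof -
  have id: "h = id" if "h \<in> colour_stab n id" for h :: "nat \<Rightarrow> nat"
    using that by (auto simp: colour_stab_def)
  obtain v where v: "v \<in> specht_fun la"
    "\<And>A. A \<in> colour_arrays id \<Longrightarrow> v (tabloid la (array_tableau id A)) = u (tabloid la (array_tableau id A))"
    using invariants_take_values[of id "\<lambda>A. u (tabloid la (array_tableau id A))"] by blast
  have "garnir v" "v \<in> supported_on (tabloids la)"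
    using v(1) specht_garnir specht_submodule by (auto simp: tab.submodule_def)
  then have "garnir (u - v)" "u - v \<in> supported_on (tabloids la)"
    using fs.subspace_diff[OF garnir_subspace, of u v] fs.subspace_diff[OF supported_on_subspace] u by auto
  then have "u - v = 0"
  proof (rule invariants_determined[where c = id])
    fix h t assume "h \<in> colour_stab n (id :: nat \<Rightarrow> nat)"
    then have "h = id" by (rule id)
    then show "(u - v) (list_act h t) = (u - v) t" by (simp only: list_act_id)
  qed (simp add: v(2) fun_diff_def)
  then show ?thesis using v(1) by simp
qed

lemma specht_fun_eq: "specht_fun la = {u \<in> supported_on (tabloids la). garnir u}"
  using garnir_imp_specht specht_garnir specht_submodule by (auto simp: tab.submodule_def)

lemma fun_act_stab_iff:
  "(\<forall>h\<in>colour_stab n c. fun_act list_act h u = u) \<longleftrightarrow>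
   (\<forall>h\<in>colour_stab n c. \<forall>t. u (list_act h t) = u t)"
proof
  assume L: "\<forall>h\<in>colour_stab n c. fun_act list_act h u = u"
  show "\<forall>h\<in>colour_stab n c. \<forall>t. u (list_act h t) = u t"
  proof (intro ballI allI)
    fix h t assume h: "h \<in> colour_stab n c"
    then have "fun_act list_act h u (list_act h t) = u t"
      by (intro tab.fun_act_apply_act colour_stab_perm)
    then show "u (list_act h t) = u t" using L h by metis
  qed
next
  assume R: "\<forall>h\<in>colour_stab n c. \<forall>t. u (list_act h t) = u t"
  show "\<forall>h\<in>colour_stab n c. fun_act list_act h u = u"
    using R colour_stab_inv unfolding fun_act_def by blast
qed

text \<open>The coordinates are the values at the representatives of the semistandard arrays.\<close>

lemma specht_has_coords:
  "has_coords (colour_stab n c) (fun_module list_act (specht_fun la)) (colour_arrays c)"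
proof (rule has_coords_fun_moduleI)
  let ?S = "specht_fun la" and ?H = "colour_stab n c" and ?I = "colour_arrays c"
  define ev where "ev u A = (if A \<in> ?I then u (tabloid la (array_tableau c A)) else 0)"
    for u :: "nat set list \<Rightarrow> complex" and A
  show S: "fs.subspace ?S" using specht_submodule by (simp add: tab.submodule_def)
  show add: "ev (f + g) = ev f + ev g" for f g by (auto simp: ev_def fun_eq_iff)
  show "ev (fscale k f) = fscale k (ev f)" for k f by (auto simp: ev_def fun_eq_iff)
  have inv: "u \<in> invariants ?H (fun_module list_act ?S) \<longleftrightarrow>
      u \<in> ?S \<and> (\<forall>h\<in>?H. \<forall>t. u (list_act h t) = u t)" for u
    by (simp add: invariants_def fun_act_stab_iff)
  show "bij_betw ev (invariants ?H (fun_module list_act ?S)) (supported_on ?I)"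
  proof (rule bij_betwI')
    fix u v assume uv: "u \<in> invariants ?H (fun_module list_act ?S)"
      "v \<in> invariants ?H (fun_module list_act ?S)"
    show "ev u = ev v \<longleftrightarrow> u = v"
    proof
      assume eq: "ev u = ev v"
      have "u - v \<in> ?S" using uv S by (auto simp: inv intro: fs.subspace_diff)
      then have "garnir (u - v)" "u - v \<in> supported_on (tabloids la)"
        by (auto simp: specht_fun_eq)
      then have "u - v = 0"
      proof (rule invariants_determined[where c = c])
        fix A assume "A \<in> ?I"
        then show "(u - v) (tabloid la (array_tableau c A)) = 0"
          using fun_cong[OF eq, of A] by (simp add: ev_def fun_diff_def)
      qed (use uv inv in \<open>simp add: fun_diff_def\<close>)
      then show "u = v" by simp
    qed simp
  next
    fix u show "ev u \<in> supported_on ?I" by (simp add: ev_def supported_on_def)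
  next
    fix y assume y: "y \<in> supported_on ?I"
    obtain u where "u \<in> ?S" "\<forall>h\<in>?H. \<forall>t. u (list_act h t) = u t"
      "\<forall>A\<in>?I. u (tabloid la (array_tableau c A)) = y A"
      using invariants_take_values[of c y] by blast
    moreover from this(3) y have "y = ev u" by (auto simp: ev_def supported_on_def fun_eq_iff)
    ultimately show "\<exists>u\<in>invariants ?H (fun_module list_act ?S). y = ev u" using inv by blast
  qed
qed

subsection \<open>Irreducibility\<close>

text \<open>If the colour of an entry is its row in \<open>T\<close>, there is only one semistandard array, namely the one
  whose row \<open>i\<close> consists of the colour \<open>i\<close>.\<close>

lemma row_invariant_determined:
  assumes T: "T \<in> tableaux la" and u: "u \<in> specht_fun la" "u (tabloid la T) = 0"
    and inv: "\<And>h t. h \<in> colour_stab n (row_of la T) \<Longrightarrow> u (list_act h t) = u t"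
  shows "u = 0"
proof
  fix t show "u t = 0 t"
  proof (cases "t \<in> tabloids la")
    case True
    then obtain T1 where T1: "T1 \<in> tableaux la" "t = tabloid la T1" by (auto simp: tabloids_def)
    have "u (tabloid la T1) = 0"
    proof (rule straightening[of "row_of la T" u, OF inv _ _ T1(1)])
      show "garnir u" using u(1) by (simp add: specht_fun_eq)
    next
      fix T' assume T': "T' \<in> tableaux la" "semistandard la (row_of la T \<circ> T')"
      have ge: "fst p \<le> row_of la T (T' p)" if "p \<in> cells la" for p
      proof -
        have "i \<le> row_of la T (T' (i, j))" if "(i, j) \<in> cells la" for i j
          using that
        proof (induction i)
          case (Suc i)
          have "(i, j) \<in> cells la" using Suc.prems cells_up by auto
          then show ?case using Suc T'(2) by (fastforce simp: semistandard_def)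
        qed simp
        then show ?thesis using that by (cases p) auto
      qed
      have "(\<Sum>p\<in>cells la. row_of la T (T' p)) = (\<Sum>x\<in>{1..n}. row_of la T x)"
        by (rule sum.reindex_bij_betw[OF tableau_bij[OF T'(1)]])
      also have "\<dots> = (\<Sum>p\<in>cells la. row_of la T (T p))"
        by (rule sum.reindex_bij_betw[OF tableau_bij[OF T], symmetric])
      also have "\<dots> = (\<Sum>p\<in>cells la. fst p)"
        using T by (intro sum.cong) auto
      finally have "(\<Sum>p\<in>cells la. fst p) = (\<Sum>p\<in>cells la. row_of la T (T' p))" by simp
      then have eq: "fst p = row_of la T (T' p)" if "p \<in> cells la" for p
        using sum_mono_inv[of fst "cells la" "\<lambda>p. row_of la T (T' p)", OF _ ge that finite_cells] by blast
      have "tabloid la T' = tabloid la T"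
        unfolding tabloid_eq_iff[OF T'(1) T]
      proof
        fix x assume x: "x \<in> {1..n}"
        show "row_of la T' x = row_of la T x"
          using eq[OF tableau_row_col(1)[OF T'(1) x]] tableau_row_col(2)[OF T'(1) x] by simp
      qed
      then show "u (tabloid la T') = 0" using u(2) by simp
    qed
    then show ?thesis using T1 by simp
  qed (use u in \<open>simp add: specht_fun_eq supported_on_def\<close>)
qed

text \<open>Translate \<open>f\<close> such that its value at \<open>T\<close> is not zero, and symmetrise over the row stabiliser of \<open>T\<close>,
  which fixes this tabloid.\<close>

lemma submodule_row_invariant:
  assumes M: "tab.submodule M" and f: "f \<in> M" "f \<noteq> 0" and T: "T \<in> tableaux la"
  obtains u where "u \<in> M" "u (tabloid la T) \<noteq> 0"
    "\<And>h t. h \<in> colour_stab n (row_of la T) \<Longrightarrow> u (list_act h t) = u t"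
proof -
  obtain t1 where t1: "f t1 \<noteq> 0" using f(2) by (auto simp: fun_eq_iff)
  then have "t1 \<in> tabloids la" using M f(1) by (auto simp: tab.submodule_def supported_on_def)
  then obtain T1 where T1: "T1 \<in> tableaux la" "t1 = tabloid la T1" by (auto simp: tabloids_def)
  obtain w where w: "w permutes {1..n}" "tableau_act la w T1 = T"
    using tableau_act_transitive[OF T1(1) T] by metis
  define g where "g = fun_act list_act w f"
  have g: "g \<in> M" using M f(1) w(1) by (simp add: g_def tab.submodule_def)
  have "tabloid la T = list_act w t1" using w(2) T1(2) tabloid_act_tableau by metis
  then have gT: "g (tabloid la T) = f t1"
    unfolding g_def using tab.fun_act_apply_act[OF w(1)] by metis
  let ?c = "row_of la T"
  define u where "u = symmetrise ?c g"
  have "list_act h (tabloid la T) = tabloid la T" if h: "h \<in> colour_stab n ?c" for h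
    unfolding tabloid_act_tableau[symmetric]
  proof (subst tabloid_eq_iff[OF tableau_act_in[OF colour_stab_perm[OF h] T] T], intro ballI)
    fix x assume x: "x \<in> {1..n}"
    have p: "h permutes {1..n}" using h by (rule colour_stab_perm)
    have ix: "inv' h x \<in> {1..n}" using x permutes_in_image[OF permutes_inv[OF p]] by blast
    have "row_of la (tableau_act la h T) (h (inv' h x)) = ?c (inv' h x)"
      by (rule row_of_act(1)[OF p T ix])
    also have "\<dots> = ?c x"
      using colour_stab_inv[OF h] by (simp add: colour_stab_def)
    finally show "row_of la (tableau_act la h T) x = ?c x"
      by (simp add: permutes_inverses[OF p])
  qed
  then have "u (tabloid la T) = of_nat (card (colour_stab n ?c)) * f t1"
    by (simp add: u_def symmetrise_def gT)
  moreover have "card (colour_stab n ?c) \<noteq> 0"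
    using finite_colour_stab[of n ?c] colour_stab_id[of n ?c] by auto
  ultimately have "u (tabloid la T) \<noteq> 0" using t1 by simp
  moreover have "u \<in> M" unfolding u_def using M g by (rule symmetrise_mem)
  moreover have "u (list_act h t) = u t" if "h \<in> colour_stab n ?c" for h t
    unfolding u_def using that by (rule symmetrise_invariant)
  ultimately show thesis using that by blast
qed

text \<open>A proper submodule \<open>L\<close> has a complement, the kernel of an averaged projection \<open>q\<close>. Both contain a
  function that is invariant under the row stabiliser of \<open>T\<close> and does not vanish at \<open>T\<close>. But these two
  functions are proportional.\<close>

lemma specht_irreducible:
  assumes L: "tab.submodule L" "L \<subseteq> specht_fun la" "f \<in> L" "f \<noteq> 0"
  shows "L = specht_fun la"
proof (rule ccontr)
  assume "L \<noteq> specht_fun la"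
  then obtain s where s: "s \<in> specht_fun la" "s \<notin> L" using L(2) by blast
  interpret pair: perm_action_pair n "tabloids la" list_act "tabloids la" list_act ..
  have subL: "fs.subspace L" using L(1) by (simp add: tab.submodule_def)
  have "Vector_Spaces.linear fscale fscale (id :: (nat set list \<Rightarrow> complex) \<Rightarrow> _)"
    by (simp add: linear_fun_iff)
  from fsp.linear_exists_left_inverse_on[OF this subL]
  obtain g where g: "g ` UNIV \<subseteq> L" "Vector_Spaces.linear fscale fscale g" "\<And>v. v \<in> L \<Longrightarrow> g v = v"
    by auto
  define q where "q = average n list_act list_act g"
  have q_lin: "Vector_Spaces.linear fscale fscale q" unfolding q_def by (rule pair.average_linear[OF g(2)])
  then have q_add: "q (f + h) = q f + q h" and q_scale: "q (fscale c f) = fscale c (q f)" for f h c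
    by (auto simp: linear_fun_iff)
  have q_act: "q (fun_act list_act w f) = fun_act list_act w (q f)" if "w permutes {1..n}" for w f
    unfolding q_def by (rule pair.average_equivariant[OF that])
  have q_mem: "q f \<in> L" for f
    unfolding q_def using L(1) g(1) by (intro pair.average_mem) (auto simp: tab.submodule_def)
  have q_id: "q f = f" if "f \<in> L" for f
    unfolding q_def
  proof (rule pair.average_eq)
    fix w :: "nat \<Rightarrow> nat" assume w: "w permutes {1..n}"
    have "fun_act list_act (inv' w) f \<in> L"
      using L(1) that permutes_inv[OF w] by (simp add: tab.submodule_def)
    then show "fun_act list_act w (g (fun_act list_act (inv' w) f)) = f"
      using w by (simp add: g(3) tab.fun_act_inverse)
  qed
  define L' where "L' = {f \<in> specht_fun la. q f = 0}"
  have S: "tab.submodule (specht_fun la)" by (rule specht_submodule)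
  have q0: "q 0 = 0" using q_scale[of 0 0] by (simp add: fs.scale_zero_left)
  have act0: "fun_act list_act w 0 = 0" for w by (simp add: fun_act_def zero_fun_def)
  have L': "tab.submodule L'"
    using S unfolding tab.submodule_def L'_def fs.subspace_def
    by (auto simp: q_add q_scale q0 q_act act0 fs.scale_zero_right)
  have q_diff: "q (f - h) = q f - q h" for f h
    using q_add[of "f - h" h] by (simp add: algebra_simps)
  have "s - q s \<in> L'"
    using S s(1) q_mem[of s] L(2) q_id[OF q_mem[of s]]
    by (auto simp: L'_def q_diff tab.submodule_def intro!: fs.subspace_diff)
  moreover have "s - q s \<noteq> 0" using q_mem[of s] s(2) by auto
  moreover obtain T where T: "T \<in> tableaux la" using tableaux_nonempty by blast
  ultimately obtain u' where u': "u' \<in> L'" "u' (tabloid la T) \<noteq> 0"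
    "\<And>h t. h \<in> colour_stab n (row_of la T) \<Longrightarrow> u' (list_act h t) = u' t"
    using submodule_row_invariant[OF L' _ _ T] by blast
  obtain u where u: "u \<in> L" "u (tabloid la T) \<noteq> 0"
    "\<And>h t. h \<in> colour_stab n (row_of la T) \<Longrightarrow> u (list_act h t) = u t"
    using submodule_row_invariant[OF L(1,3,4) T] by blast
  define k where "k = u (tabloid la T) / u' (tabloid la T)"
  have "u - fscale k u' = 0"
  proof (rule row_invariant_determined[OF T])
    show "u - fscale k u' \<in> specht_fun la"
      using u(1) L(2) u'(1) S unfolding L'_def tab.submodule_def
      by (intro fs.subspace_diff fs.subspace_scale) auto
    show "(u - fscale k u') (tabloid la T) = 0"
      using u'(2) by (simp add: k_def fun_diff_def)
  qed (simp add: u(3) u'(3) fun_diff_def)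
  then have "u = fscale k u'" by simp
  then have "q u = 0" using u'(1) by (simp add: L'_def q_scale fs.scale_zero_right)
  then show False using q_id[OF u(1)] u(2) by simp
qed

end

lemma lookup_map_times [simp]:
  "Poly_Mapping.lookup (Poly_Mapping.map ((*) c) p) t = (c::complex) * Poly_Mapping.lookup p t"
  by (simp add: Poly_Mapping.map.rep_eq when_def)

context shape
begin

lemma lookup_tabloid_act:
  assumes "w permutes {1..n}"
  shows "Poly_Mapping.lookup (tabloid_act w v) = fun_act list_act w (Poly_Mapping.lookup v)"
proof
  fix t
  have "Poly_Mapping.lookup (tabloid_act w v) t
      = (\<Sum>s\<in>Poly_Mapping.keys v. if s = list_act (inv' w) t then Poly_Mapping.lookup v s else 0)"
    unfolding tabloid_act_def lookup_sum lookup_single when_def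
    using tab.inv_cancel[OF assms] by (intro sum.cong if_cong) auto
  also have "\<dots> = Poly_Mapping.lookup v (list_act (inv' w) t)"
    by (simp add: sum.delta' in_keys_iff)
  finally show "Poly_Mapping.lookup (tabloid_act w v) t = fun_act list_act w (Poly_Mapping.lookup v) t"
    by (simp only: fun_act_def)
qed

lemma carrier_specht: "carrier (specht la) = {p. Poly_Mapping.lookup p \<in> specht_fun la}"
proof (intro equalityI subsetI)
  fix p assume "p \<in> carrier (specht la)"
  then obtain a where p: "p = (\<Sum>T\<in>tableaux la. Poly_Mapping.map ((*) (a T)) (polytabloid la T))"
    by (auto simp: specht_def)
  have "Poly_Mapping.lookup p = (\<Sum>T\<in>tableaux la. fscale (a T) (polytab la T))"
    by (rule ext) (simp add: p lookup_sum sum_fun_apply lookup_polytabloid)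
  also have "\<dots> \<in> specht_fun la"
    unfolding specht_fun_def by (intro fs.span_sum fs.span_scale fs.span_base) auto
  finally show "p \<in> {p. Poly_Mapping.lookup p \<in> specht_fun la}" by simp
next
  fix p assume "p \<in> {p. Poly_Mapping.lookup p \<in> specht_fun la}"
  then have p: "Poly_Mapping.lookup p \<in> specht_fun la" by simp
  let ?R = "{u. \<exists>a. u = (\<Sum>T\<in>tableaux la. fscale (a T) (polytab la T))}"
  have "fs.subspace ?R"
    unfolding fs.subspace_def
  proof (intro conjI ballI allI)
    show "0 \<in> ?R" by (auto intro!: exI[of _ "\<lambda>_. 0"])
    fix x y assume "x \<in> ?R" "y \<in> ?R"
    then obtain a b where "x = (\<Sum>T\<in>tableaux la. fscale (a T) (polytab la T))"
      "y = (\<Sum>T\<in>tableaux la. fscale (b T) (polytab la T))" by auto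
    then have "x + y = (\<Sum>T\<in>tableaux la. fscale (a T + b T) (polytab la T))"
      by (simp only: fs.scale_left_distrib sum.distrib)
    then show "x + y \<in> ?R" by (intro CollectI exI[of _ "\<lambda>T. a T + b T"])
  next
    fix k x assume "x \<in> ?R"
    then obtain a where "x = (\<Sum>T\<in>tableaux la. fscale (a T) (polytab la T))" by auto
    then have "fscale k x = (\<Sum>T\<in>tableaux la. fscale (k * a T) (polytab la T))"
      by (simp only: fs.scale_sum_right fs.scale_scale)
    then show "fscale k x \<in> ?R" by (intro CollectI exI[of _ "\<lambda>T. k * a T"])
  qed
  moreover have "polytab la ` tableaux la \<subseteq> ?R"
  proof safe
    fix T assume T: "T \<in> tableaux la"
    have "polytab la T = (\<Sum>S\<in>tableaux la. fscale (if S = T then 1 else 0) (polytab la S))"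
    proof
      fix t
      have "(\<Sum>S\<in>tableaux la. fscale (if S = T then 1 else 0) (polytab la S)) t
          = (\<Sum>S\<in>tableaux la. if S = T then polytab la S t else 0)"
        unfolding sum_fun_apply by (intro sum.cong) auto
      then show "polytab la T t = (\<Sum>S\<in>tableaux la. fscale (if S = T then 1 else 0) (polytab la S)) t"
        using T finite_tableaux by simp
    qed
    then show "\<exists>a. polytab la T = (\<Sum>T\<in>tableaux la. fscale (a T) (polytab la T))"
      by (rule exI[of _ "\<lambda>S. if S = T then 1 else 0"])
  qed
  ultimately have "specht_fun la \<subseteq> ?R" unfolding specht_fun_def by (rule fs.span_minimal[rotated])
  then obtain a where a: "Poly_Mapping.lookup p = (\<Sum>T\<in>tableaux la. fscale (a T) (polytab la T))"
    using p by blast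
  have "p = (\<Sum>T\<in>tableaux la. Poly_Mapping.map ((*) (a T)) (polytabloid la T))"
    by (rule poly_mapping_eqI) (simp add: a lookup_sum sum_fun_apply lookup_polytabloid)
  then show "p \<in> carrier (specht la)" by (auto simp: specht_def)
qed

lemma specht_ops:
  "x \<oplus>\<^bsub>specht la\<^esub> y = x + y" "c \<odot>\<^bsub>specht la\<^esub> x = Poly_Mapping.map ((*) c) x"
  "act (specht la) = tabloid_act"
  by (simp_all add: specht_def)

lemma lookup_specht_ops:
  "Poly_Mapping.lookup (x + y) = Poly_Mapping.lookup x + Poly_Mapping.lookup y"
  "Poly_Mapping.lookup (Poly_Mapping.map ((*) c) x) = fscale c (Poly_Mapping.lookup x)"
  by (auto simp: fun_eq_iff lookup_add)

lemma specht_closed: "sn_closed n (specht la)"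
  using specht_submodule
  by (simp add: sn_closed_def carrier_specht specht_ops lookup_specht_ops lookup_tabloid_act
      tab.submodule_def fs.subspace_def)

lemma finite_support_lookup:
  assumes "f \<in> supported_on (tabloids la)"
  shows "Poly_Mapping.lookup (Poly_Mapping.Abs_poly_mapping f) = f"
  by (rule lookup_Abs_poly_mapping, rule finite_subset[OF _ finite_tabloids])
     (use assms in \<open>auto simp: supported_on_def\<close>)

lemma specht_iso: "sn_iso n (specht la) (fun_module list_act (specht_fun la))"
  unfolding sn_iso_iff
proof (intro exI conjI)
  show "sn_hom n (specht la) (fun_module list_act (specht_fun la)) Poly_Mapping.lookup"
    by (simp add: sn_hom_def carrier_specht specht_ops lookup_specht_ops lookup_tabloid_act)
  show "bij_betw Poly_Mapping.lookup (carrier (specht la)) (carrier (fun_module list_act (specht_fun la)))"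
  proof (rule bij_betwI')
    fix f assume "f \<in> carrier (fun_module list_act (specht_fun la))"
    then have f: "f \<in> specht_fun la" by simp
    then have "f \<in> supported_on (tabloids la)" using specht_fun_eq by blast
    then show "\<exists>p\<in>carrier (specht la). f = Poly_Mapping.lookup p"
      using f finite_support_lookup by (intro bexI[of _ "Poly_Mapping.Abs_poly_mapping f"]) (auto simp: carrier_specht)
  next
    fix p q :: "nat set list \<Rightarrow>\<^sub>0 complex"
    show "Poly_Mapping.lookup p = Poly_Mapping.lookup q \<longleftrightarrow> p = q"
      by (rule poly_mapping_eq_iff[symmetric])
  qed (simp only: carrier_specht mem_Collect_eq fun_module_simps)
qed

lemma iso_specht: "sn_iso n (fun_module list_act (specht_fun la)) (specht la)"
  using specht_iso specht_closed by (rule sn_iso_sym)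

lemma specht_coords: "has_coords (colour_stab n c) (specht la) (colour_arrays c)"
  using specht_has_coords iso_specht tab.submodule_closed[OF specht_submodule]
  by (rule has_coords_iso) (auto simp: colour_stab_perm)

end

section \<open>Every permutation module is a sum of Specht modules\<close>

text \<open>Measures how unequal the parts are. With base 3 a single part of size \<open>b + 1\<close> outweighs two parts
  of size at most \<open>b\<close>, which is the comparison needed in \<open>merged_colour_weight\<close>.\<close>

definition part_weight :: "nat list \<Rightarrow> nat" where
  "part_weight la = (\<Sum>b\<leftarrow>la. 3 ^ b)"

text \<open>Every colouring has the same Young subgroup as the rows of a tableau: sort the colour classes by
  size.\<close>

lemma tableau_with_colour_rows:
  fixes c :: "nat \<Rightarrow> nat"
  obtains la T where "la \<in> int_partitions n" "T \<in> tableaux la"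
    "\<And>x y. x \<in> {1..n} \<Longrightarrow> y \<in> {1..n} \<Longrightarrow> row_of la T x = row_of la T y \<longleftrightarrow> c x = c y"
    "part_weight la = (\<Sum>k\<in>c ` {1..n}. 3 ^ card {x \<in> {1..n}. c x = k})"
proof -
  define F where "F k = {x \<in> {1..n}. c x = k}" for k
  define ks where "ks = rev (sort_key (\<lambda>k. card (F k)) (sorted_list_of_set (c ` {1..n})))"
  define la where "la = map (\<lambda>k. card (F k)) ks"
  have ks: "set ks = c ` {1..n}" "distinct ks" by (simp_all add: ks_def)
  have finF: "finite (F k)" for k by (simp add: F_def)
  have sl: "(\<Sum>k\<leftarrow>ks. g k) = (\<Sum>k\<in>c ` {1..n}. g k)" for g :: "nat \<Rightarrow> nat"
    using sum_list_distinct_conv_sum_set[OF ks(2), of g] ks(1) by simp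
  have sum: "sum_list la = n"
  proof -
    have "sum_list la = (\<Sum>k\<in>c ` {1..n}. card (F k))" unfolding la_def by (rule sl)
    also have "\<dots> = card (\<Union>k\<in>c ` {1..n}. F k)"
      by (rule card_UN_disjoint[symmetric]) (auto simp: F_def)
    also have "(\<Union>k\<in>c ` {1..n}. F k) = {1..n}" by (auto simp: F_def)
    finally show ?thesis by simp
  qed
  have "sorted (rev la)" by (simp add: la_def ks_def rev_map)
  then have "sorted_wrt (\<ge>) la" by (simp add: sorted_wrt_rev)
  moreover have "0 \<notin> set la" using finF by (auto simp: la_def ks(1) F_def)
  ultimately have la: "la \<in> int_partitions n" by (simp add: int_partitions_def sum)
  interpret shape n la by unfold_locales (rule la)
  define T where "T = (\<lambda>(i, j)\<in>cells la. sorted_list_of_set (F (ks ! i)) ! j)"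
  have len: "length la = length ks" by (simp add: la_def)
  have T: "T (i, j) \<in> F (ks ! i)" if "(i, j) \<in> cells la" for i j
  proof -
    have "j < length (sorted_list_of_set (F (ks ! i)))"
      using that by (auto simp: cells_def la_def)
    then have "sorted_list_of_set (F (ks ! i)) ! j \<in> set (sorted_list_of_set (F (ks ! i)))"
      by (rule nth_mem)
    then show ?thesis using that finF by (simp add: T_def)
  qed
  have "{1..n} \<subseteq> T ` cells la"
  proof
    fix x assume x: "x \<in> {1..n}"
    then have "c x \<in> set ks" by (simp add: ks(1))
    then obtain i where i: "i < length ks" "ks ! i = c x" by (auto simp: in_set_conv_nth)
    have "x \<in> set (sorted_list_of_set (F (ks ! i)))" using x i finF by (simp add: F_def)
    then obtain j where j: "j < length (sorted_list_of_set (F (ks ! i)))" "sorted_list_of_set (F (ks ! i)) ! j = x"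
      by (auto simp: in_set_conv_nth)
    have "(i, j) \<in> cells la" using i j by (simp add: cells_def la_def)
    then show "x \<in> T ` cells la" using j(2) by (force simp: T_def)
  qed
  moreover have "T ` cells la \<subseteq> {1..n}" using T by (auto simp: F_def)
  ultimately have img: "T ` cells la = {1..n}" by blast
  then have "bij_betw T (cells la) {1..n}"
    using finite_cells[of la] by (intro bij_betw_imageI eq_card_imp_inj_on) (auto simp: card_cells sum)
  then have Tt: "T \<in> tableaux la" by (auto simp: tableaux_def sum T_def)
  have c: "c x = ks ! row_of la T x" if "x \<in> {1..n}" for x
    using T[OF tableau_row_col(1)[OF Tt that]] tableau_row_col(2)[OF Tt that] by (simp add: F_def)
  have "row_of la T x = row_of la T y \<longleftrightarrow> c x = c y" if "x \<in> {1..n}" "y \<in> {1..n}" for x y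
    using c[OF that(1)] c[OF that(2)] row_of_less[OF Tt that(1)] row_of_less[OF Tt that(2)]
      nth_eq_iff_index_eq[OF ks(2)] len by auto
  moreover have "part_weight la = (\<Sum>k\<in>c ` {1..n}. 3 ^ card {x \<in> {1..n}. c x = k})"
    unfolding part_weight_def la_def map_map comp_def using sl[of "\<lambda>k. 3 ^ card (F k)"] by (simp add: F_def)
  ultimately show thesis using la Tt that by blast
qed

context shape
begin

text \<open>The rows of \<open>T\<close> as colours, with a new colour for \<open>X\<close>, the set of entries of a Garnir relation.\<close>

definition merged_colour :: "(nat \<times> nat \<Rightarrow> nat) \<Rightarrow> nat set \<Rightarrow> nat \<Rightarrow> nat" where
  "merged_colour T X x = (if x \<in> X then length la else row_of la T x)"

text \<open>The new class is larger than each of the two rows from which it takes its elements.\<close>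

lemma merged_colour_weight:
  assumes T: "T \<in> tableaux la" and i: "Suc i < length la"
    and X: "X \<subseteq> tabloid la T ! i \<union> tabloid la T ! Suc i" "la ! i < card X"
  shows "part_weight la < (\<Sum>k\<in>merged_colour T X ` {1..n}. 3 ^ card {x \<in> {1..n}. merged_colour T X x = k})"
proof -
  let ?c = "merged_colour T X"
  have rX: "row_of la T x = i \<or> row_of la T x = Suc i" if "x \<in> X" for x
    using X(1) i mem_tabloid_nth[OF T, of i] mem_tabloid_nth[OF T, of "Suc i"] that by auto
  have Xn: "X \<subseteq> {1..n}"
    using X(1) i mem_tabloid_nth[OF T, of i] mem_tabloid_nth[OF T, of "Suc i"] by auto
  have fibX: "{x \<in> {1..n}. ?c x = length la} = X"
  proof (intro equalityI subsetI)
    fix x assume "x \<in> {x \<in> {1..n}. ?c x = length la}"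
    then show "x \<in> X" using row_of_less[OF T, of x] by (auto simp: merged_colour_def split: if_splits)
  next
    fix x assume "x \<in> X"
    then show "x \<in> {x \<in> {1..n}. ?c x = length la}" using Xn by (auto simp: merged_colour_def)
  qed
  define R where "R = {..<length la} - {i, Suc i}"
  have fib: "{x \<in> {1..n}. ?c x = k} = tabloid la T ! k" if "k \<in> R" for k
  proof (rule Set.set_eqI)
    fix x
    have "x \<notin> X" if "row_of la T x = k" using rX[of x] that \<open>k \<in> R\<close> by (auto simp: R_def)
    then show "x \<in> {x \<in> {1..n}. ?c x = k} \<longleftrightarrow> x \<in> tabloid la T ! k"
      using that by (auto simp: merged_colour_def R_def mem_tabloid_nth[OF T])
  qed
  have sub: "insert (length la) R \<subseteq> ?c ` {1..n}"
  proof safe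
    have "X \<noteq> {}" using X(2) by auto
    then obtain x where "x \<in> {x \<in> {1..n}. ?c x = length la}" unfolding fibX by blast
    then show "length la \<in> ?c ` {1..n}" by (auto intro: rev_image_eqI)
    fix k assume k: "k \<in> R"
    have "card (tabloid la T ! k) > 0" using k card_tabloid_nth[OF T, of k] parts_pos by (simp add: R_def)
    then have "tabloid la T ! k \<noteq> {}" by auto
    then obtain x where "x \<in> {x \<in> {1..n}. ?c x = k}" unfolding fib[OF k] by blast
    then show "k \<in> ?c ` {1..n}" by (auto intro: rev_image_eqI)
  qed
  have "part_weight la = (\<Sum>k<length la. 3 ^ (la ! k))"
    by (simp add: part_weight_def sum_list_sum_nth atLeast0LessThan)
  also have "{..<length la} = insert i (insert (Suc i) R)" using i by (auto simp: R_def)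
  also have "(\<Sum>k\<in>insert i (insert (Suc i) R). (3::nat) ^ (la ! k)) = 3 ^ (la ! i) + (3 ^ (la ! Suc i) + (\<Sum>k\<in>R. 3 ^ (la ! k)))"
    by (simp add: R_def)
  also have "\<dots> < 3 ^ card X + (\<Sum>k\<in>R. 3 ^ (la ! k))"
  proof -
    have "(3::nat) ^ (la ! Suc i) \<le> 3 ^ (la ! i)"
      using i parts_antimono[of i "Suc i"] by (intro power_increasing) auto
    moreover have "(3::nat) ^ Suc (la ! i) \<le> 3 ^ card X" using X(2) by (intro power_increasing) auto
    moreover have "(3::nat) ^ (la ! i) > 0" by simp
    ultimately show ?thesis unfolding power_Suc by linarith
  qed
  also have "\<dots> = 3 ^ card {x \<in> {1..n}. ?c x = length la} + (\<Sum>k\<in>R. 3 ^ card {x \<in> {1..n}. ?c x = k})"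
    unfolding fibX using fib card_tabloid_nth[OF T] by (simp add: R_def)
  also have "\<dots> = (\<Sum>k\<in>insert (length la) R. 3 ^ card {x \<in> {1..n}. ?c x = k})"
    by (simp add: R_def)
  also have "\<dots> \<le> (\<Sum>k\<in>?c ` {1..n}. 3 ^ card {x \<in> {1..n}. ?c x = k})"
    using sub by (intro sum_mono2) auto
  finally show ?thesis .
qed

text \<open>On a tabloid a permutation that preserves the merged colours acts only through its effect on \<open>X\<close>;
  so the sum of a Garnir relation is invariant under all of them.\<close>

lemma merged_colour_stab_acts:
  assumes T: "T \<in> tableaux la" and X: "X \<subseteq> {1..n}" and h: "h \<in> colour_stab n (merged_colour T X)"
  obtains g where "g permutes X"
    "\<And>w. w permutes X \<Longrightarrow> list_act (h \<circ> w) (tabloid la T) = list_act (g \<circ> w) (tabloid la T)"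
proof -
  have hp: "h permutes {1..n}" using h by (rule colour_stab_perm)
  have hc: "merged_colour T X (h x) = merged_colour T X x" for x using h by (simp add: colour_stab_def)
  have len: "row_of la T x \<noteq> length la" if "x \<in> {1..n}" for x using row_of_less[OF T that] by simp
  have hX: "h x \<in> X \<longleftrightarrow> x \<in> X" if "x \<in> {1..n}" for x
  proof -
    have "h x \<in> {1..n}" using that permutes_in_image[OF hp] by blast
    then show ?thesis
      using hc[of x] len[OF that] len[of "h x"] by (auto simp: merged_colour_def split: if_splits)
  qed
  define g where "g x = (if x \<in> X then h x else x)" for x
  have "h ` X \<subseteq> X" using hX X by blast
  then have "h ` X = X"
    using finite_subset[OF X] permutes_inj_on[OF hp] by (intro endo_inj_surj) auto
  then have "bij_betw h X X" using permutes_inj_on[OF hp] by (simp add: bij_betw_def)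
  then have "bij_betw g X X" by (subst bij_betw_cong[where g = h]) (auto simp: g_def)
  then have g: "g permutes X" by (rule bij_imp_permutes) (simp add: g_def)
  have gn: "g permutes {1..n}" using g X by (rule permutes_subset)
  show thesis
  proof (rule that[OF g])
    fix w assume w: "w permutes X"
    have wn: "w permutes {1..n}" using w X by (rule permutes_subset)
    show "list_act (h \<circ> w) (tabloid la T) = list_act (g \<circ> w) (tabloid la T)"
    proof (rule nth_equalityI)
      fix k assume "k < length (list_act (h \<circ> w) (tabloid la T))"
      then have k: "k < length la" by simp
      let ?B = "tabloid la T ! k"
      have B: "x \<in> ?B \<longleftrightarrow> x \<in> {1..n} \<and> row_of la T x = k" for x by (rule mem_tabloid_nth[OF T k])
      have hB: "h x \<in> ?B - X" if "x \<in> ?B - X" for x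
      proof -
        have "x \<in> {1..n}" "x \<notin> X" "row_of la T x = k" using that B by auto
        moreover from this have "h x \<in> {1..n}" "h x \<notin> X"
          using permutes_in_image[OF hp] hX by blast+
        ultimately show ?thesis using hc[of x] B by (simp add: merged_colour_def)
      qed
      have fin: "finite (?B - X)" using k by (simp add: tabloid_nth finite_cells)
      have hBX: "h ` (?B - X) = ?B - X"
        using fin hB permutes_inj_on[OF hp] by (intro endo_inj_surj) auto
      have split: "f ` w ` ?B = f ` (w ` (?B \<inter> X)) \<union> f ` (?B - X)" for f :: "nat \<Rightarrow> nat"
      proof -
        have "w ` (?B - X) = ?B - X" using permutes_not_in[OF w] by force
        moreover have "w ` ?B = w ` (?B \<inter> X) \<union> w ` (?B - X)" by blast
        ultimately show ?thesis by (simp add: image_Un)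
      qed
      have "w ` (?B \<inter> X) \<subseteq> X" using permutes_in_image[OF w] by blast
      then have "h ` (w ` (?B \<inter> X)) = g ` (w ` (?B \<inter> X))" by (intro image_cong) (auto simp: g_def)
      moreover have "g ` (?B - X) = ?B - X" by (force simp: g_def)
      ultimately have "h ` w ` ?B = g ` w ` ?B" unfolding split using hBX by simp
      then show "list_act (h \<circ> w) (tabloid la T) ! k = list_act (g \<circ> w) (tabloid la T) ! k"
        using k by (simp only: list_act_comp nth_map length_map length_tabloid)
    qed simp
  qed
qed

end

lemma colour_stab_mono:
  assumes "\<And>x y. x \<in> {1..n} \<Longrightarrow> y \<in> {1..n} \<Longrightarrow> r x = r y \<Longrightarrow> c x = c y"
  shows "colour_stab n r \<subseteq> colour_stab n c"
proof
  fix h assume h: "h \<in> colour_stab n r"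
  have p: "h permutes {1..n}" using h by (rule colour_stab_perm)
  have "c (h x) = c x" for x
  proof (cases "x \<in> {1..n}")
    case True
    then show ?thesis
      using assms[of "h x" x] h permutes_in_image[OF p] by (simp add: colour_stab_def)
  next
    case False
    then show ?thesis using permutes_not_in[OF p] by simp
  qed
  then show "h \<in> colour_stab n c" using p by (simp add: colour_stab_def)
qed

context perm_action
begin

text \<open>Choose a shape \<open>la\<close> of maximal \<open>part_weight\<close> such that \<open>U\<close> has a nonzero vector \<open>v\<close> that is
  invariant under the row stabiliser of a tableau \<open>T\<close> of this shape. The translates of \<open>v\<close> are
  indexed by tabloids. By maximality they satisfy the Garnir relations, and so do the functions
  \<open>t \<mapsto> \<langle>f, V t\<rangle>\<close>.\<close>

lemma maps_onto_some_specht: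
  assumes U: "submodule U" and f: "f \<in> U" "f \<noteq> 0"
  obtains la \<theta> where "la \<in> int_partitions n" "Vector_Spaces.linear fscale fscale \<theta>"
    "\<And>w f. w permutes {1..n} \<Longrightarrow> \<theta> (fun_act a w f) = fun_act list_act w (\<theta> f)"
    "\<theta> ` U = specht_fun la"
proof -
  have subU: "fs.subspace U" and actU: "\<And>w f. w permutes {1..n} \<Longrightarrow> f \<in> U \<Longrightarrow> fun_act a w f \<in> U"
    and suppU: "U \<subseteq> supported_on X"
    using U by (auto simp: submodule_def)
  define P where "P = (\<lambda>(la, T). la \<in> int_partitions n \<and> T \<in> tableaux la \<and>
    (\<exists>v\<in>U. v \<noteq> 0 \<and> (\<forall>h\<in>colour_stab n (row_of la T). fun_act a h v = v)))"
  have Pstep: "\<exists>la T. P (la, T) \<and> part_weight la = (\<Sum>k\<in>c ` {1..n}. 3 ^ card {x \<in> {1..n}. c x = k})"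
    if v: "v \<in> U" "v \<noteq> 0" "\<And>h. h \<in> colour_stab n c \<Longrightarrow> fun_act a h v = v" for v and c :: "nat \<Rightarrow> nat"
  proof -
    obtain la T where lT: "la \<in> int_partitions n" "T \<in> tableaux la"
      "\<And>x y. x \<in> {1..n} \<Longrightarrow> y \<in> {1..n} \<Longrightarrow> row_of la T x = row_of la T y \<longleftrightarrow> c x = c y"
      "part_weight la = (\<Sum>k\<in>c ` {1..n}. 3 ^ card {x \<in> {1..n}. c x = k})"
      by (rule tableau_with_colour_rows[of n c]) blast
    have "colour_stab n (row_of la T) \<subseteq> colour_stab n c" using lT(3) by (intro colour_stab_mono) blast
    then have "P (la, T)" using lT(1,2) v by (auto simp: P_def)
    then show ?thesis using lT(4) by blast
  qed
  \<comment> \<open>the trivial Young subgroup is a candidate, so the maximum exists\<close>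
  have "fun_act a h f = f" if "h \<in> colour_stab n id" for h :: "nat \<Rightarrow> nat"
  proof -
    have "h = id" using that by (auto simp: colour_stab_def)
    then show ?thesis by simp
  qed
  then obtain la0 T0 where P0: "P (la0, T0)" using Pstep[of f id] f by blast
  have bound: "part_weight la \<le> n * 3 ^ n" if "P (la, T)" for la T
  proof -
    have la: "la \<in> int_partitions n" using that by (simp add: P_def)
    interpret shape n la by unfold_locales (rule la)
    have 1: "b \<le> n" if "b \<in> set la" for b using member_le_sum_list[of b la] that sum_la by simp
    have "length la \<le> n"
    proof -
      have "(\<Sum>b\<leftarrow>la. 1) \<le> (\<Sum>b\<leftarrow>la. b)"
      proof (rule sum_list_mono)
        fix b assume "b \<in> set la"
        then have "b \<noteq> 0" using la by (cases "b = 0") (auto simp: int_partitions_def)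
        then show "1 \<le> b" by simp
      qed
      then show ?thesis using sum_la by (simp add: sum_list_triv)
    qed
    have "part_weight la \<le> (\<Sum>b\<leftarrow>la. 3 ^ n)"
      unfolding part_weight_def using 1 by (intro sum_list_mono power_increasing) auto
    also have "\<dots> = length la * 3 ^ n" by (simp add: sum_list_triv)
    also have "\<dots> \<le> n * 3 ^ n" using \<open>length la \<le> n\<close> by simp
    finally show ?thesis .
  qed
  have "\<forall>q. P q \<longrightarrow> part_weight (fst q) < Suc (n * 3 ^ n)"
    using bound by (simp only: split_paired_All fst_conv less_Suc_eq_le) blast
  from ex_has_greatest_nat[of P, OF P0 this]
  obtain p where p: "P p" "\<And>q. P q \<Longrightarrow> part_weight (fst q) \<le> part_weight (fst p)"
    by (elim exE conjE) (simp only:)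
  obtain la T where lT: "p = (la, T)" by (cases p)
  have PT: "P (la, T)" using p(1) by (simp only: lT)
  have max: "part_weight la' \<le> part_weight la" if "P (la', T')" for la' T'
    using p(2)[OF that] by (simp only: lT fst_conv)
  have la: "la \<in> int_partitions n" and T: "T \<in> tableaux la" using PT by (auto simp: P_def)
  obtain v where v: "v \<in> U" "v \<noteq> 0" "\<And>h. h \<in> colour_stab n (row_of la T) \<Longrightarrow> fun_act a h v = v"
    using PT by (auto simp: P_def)
  interpret shape n la by unfold_locales (rule la)
  let ?t = "tabloid la T"
  \<comment> \<open>the translate of \<open>v\<close> that belongs to the tabloid \<open>t\<close>; the choice of \<open>w\<close> does not matter\<close>
  define V where "V t = fun_act a (SOME w. w permutes {1..n} \<and> list_act w ?t = t) v" for t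
  have V: "V (list_act w ?t) = fun_act a w v" if w: "w permutes {1..n}" for w
  proof -
    define w' where "w' = (SOME w'. w' permutes {1..n} \<and> list_act w' ?t = list_act w ?t)"
    have "w' permutes {1..n} \<and> list_act w' ?t = list_act w ?t"
      unfolding w'_def by (rule someI[of _ w]) (use w in blast)
    then have w': "w' permutes {1..n}" "list_act w' ?t = list_act w ?t" by blast+
    define h where "h = inv' w \<circ> w'"
    have hp: "h permutes {1..n}" unfolding h_def using w w' by (intro permutes_compose permutes_inv)
    have ht: "list_act h ?t = ?t"
      unfolding h_def list_act_comp w'(2) by (rule tab.inv_cancel(2)[OF w])
    have "row_of la T (h x) = row_of la T x" for x
    proof (cases "x \<in> {1..n}")
      case True
      have k: "row_of la T x < length la" using row_of_less[OF T True] .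
      have "x \<in> ?t ! row_of la T x" using mem_tabloid_nth[OF T k] True by simp
      then have "h x \<in> list_act h ?t ! row_of la T x" using k by simp
      then show ?thesis unfolding ht using mem_tabloid_nth[OF T k] by simp
    qed (simp add: permutes_not_in[OF hp])
    then have "fun_act a h v = v" using v(3) hp by (simp add: colour_stab_def)
    moreover have "w' = w \<circ> h" by (simp add: h_def o_assoc permutes_inv_o[OF w])
    ultimately have "fun_act a w' v = fun_act a w v" using fun_act_comp[OF w hp] by simp
    then show ?thesis unfolding V_def w'_def .
  qed
  have Vt: "\<exists>w. w permutes {1..n} \<and> t = list_act w ?t" if t: "t \<in> tabloids la" for t
  proof -
    obtain T' where T': "T' \<in> tableaux la" "t = tabloid la T'" using t by (auto simp: tabloids_def)
    obtain w where "w permutes {1..n}" "tableau_act la w T = T'"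
      using tableau_act_transitive[OF T T'(1)] by metis
    then show ?thesis using T'(2) tabloid_act_tableau by metis
  qed
  have VU: "V t \<in> U" if "t \<in> tabloids la" for t
    using Vt[OF that] V actU v(1) by metis
  have Vact: "V (list_act g t) = fun_act a g (V t)" if t: "t \<in> tabloids la" and g: "g permutes {1..n}" for g t
  proof -
    obtain w where w: "w permutes {1..n}" "t = list_act w ?t" using Vt[OF t] by blast
    have "V (list_act (g \<circ> w) ?t) = fun_act a (g \<circ> w) v" using V[OF permutes_compose[OF w(1) g]] .
    then show ?thesis unfolding list_act_comp using w V[OF w(1)] fun_act_comp[OF g w(1)] by simp
  qed
  have V_garnir: "(\<Sum>w | w permutes Y. V (list_act w (tabloid la T'))) = 0"
    if T': "T' \<in> tableaux la" and i: "Suc i < length la"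
      and Y: "Y \<subseteq> tabloid la T' ! i \<union> tabloid la T' ! Suc i" "la ! i < card Y" for T' i Y
  proof (rule ccontr)
    define s where "s = (\<Sum>w | w permutes Y. V (list_act w (tabloid la T')))"
    assume "\<not> ?thesis"
    then have nz: "s \<noteq> 0" by (simp add: s_def)
    have Yn: "Y \<subseteq> {1..n}"
      using Y(1) i mem_tabloid_nth[OF T', of i] mem_tabloid_nth[OF T', of "Suc i"] by auto
    have T't: "list_act w (tabloid la T') \<in> tabloids la" if "w permutes Y" for w
      using tab.mem_X[OF permutes_subset[OF that Yn]] T' by (simp add: tabloids_def)
    have sU: "s \<in> U" unfolding s_def using VU T't by (intro fs.subspace_sum subU) auto
    have "fun_act a h s = s" if h: "h \<in> colour_stab n (merged_colour T' Y)" for h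
    proof -
      obtain g where g: "g permutes Y"
        "\<And>w. w permutes Y \<Longrightarrow> list_act (h \<circ> w) (tabloid la T') = list_act (g \<circ> w) (tabloid la T')"
        using merged_colour_stab_acts[OF T' Yn h] by metis
      have "fun_act a h s = (\<Sum>w | w permutes Y. V (list_act (h \<circ> w) (tabloid la T')))"
        unfolding s_def fun_act_sum list_act_comp using Vact[OF T't colour_stab_perm[OF h]]
        by (intro sum.cong) auto
      also have "\<dots> = (\<Sum>w | w permutes Y. V (list_act (g \<circ> w) (tabloid la T')))"
        by (rule sum.cong) (simp_all only: mem_Collect_eq g(2))
      also have "\<dots> = s"
        unfolding s_def by (rule setum_permutations_compose_left[OF g(1), symmetric])
      finally show ?thesis .
    qed
    then obtain la' T'' where "P (la', T'')"
      "part_weight la' = (\<Sum>k\<in>merged_colour T' Y ` {1..n}. 3 ^ card {x \<in> {1..n}. merged_colour T' Y x = k})"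
      using Pstep[OF sU nz] by blast
    then show False using max merged_colour_weight[OF T' i Y] by fastforce
  qed
  \<comment> \<open>the Hermitian pairing with the translates of \<open>v\<close>; it is positive at \<open>f = v\<close>, \<open>t = ?t\<close>\<close>
  define \<theta> where "\<theta> f t = (if t \<in> tabloids la then \<Sum>x\<in>X. f x * cnj (V t x) else 0)"
    for f :: "'x \<Rightarrow> complex" and t
  have lin: "Vector_Spaces.linear fscale fscale \<theta>"
    unfolding linear_fun_iff
    by (auto simp: \<theta>_def fun_eq_iff algebra_simps sum.distrib sum_distrib_left)
  have equi: "\<theta> (fun_act a w f) = fun_act list_act w (\<theta> f)" if w: "w permutes {1..n}" for w f
  proof
    fix t
    have iw: "inv' w permutes {1..n}" using w by (rule permutes_inv)
    show "\<theta> (fun_act a w f) t = fun_act list_act w (\<theta> f) t"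
    proof (cases "t \<in> tabloids la")
      case True
      have t': "list_act (inv' w) t \<in> tabloids la" using tab.mem_X[OF iw True] .
      have "\<theta> (fun_act a w f) t = (\<Sum>x\<in>X. fun_act a w f x * cnj (V t x))"
        using True by (simp add: \<theta>_def)
      also have "\<dots> = (\<Sum>y\<in>X. fun_act a w f (a w y) * cnj (V t (a w y)))"
        by (rule sum.reindex_bij_betw[OF bij_betw_act[OF w], symmetric])
      also have "\<dots> = (\<Sum>y\<in>X. f y * cnj (V (list_act (inv' w) t) y))"
        using w by (intro sum.cong refl) (simp add: fun_act_apply_act Vact[OF True iw],
            simp add: fun_act_def permutes_inv_inv)
      finally show ?thesis using t' by (simp only: \<theta>_def fun_act_def if_True)
    next
      case False
      then have "list_act (inv' w) t \<notin> tabloids la" using tab.mem_X_iff[OF iw] by simp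
      with False show ?thesis by (simp only: \<theta>_def fun_act_def if_False)
    qed
  qed
  have "garnir (\<theta> f)" for f
    unfolding garnir_def
  proof (intro ballI allI impI)
    fix T' i Y assume T': "T' \<in> tableaux la" and i: "Suc i < length la"
      and Y: "Y \<subseteq> tabloid la T' ! i \<union> tabloid la T' ! Suc i" "la ! i < card Y"
    have Yn: "Y \<subseteq> {1..n}"
      using Y(1) i mem_tabloid_nth[OF T', of i] mem_tabloid_nth[OF T', of "Suc i"] by auto
    have T't: "list_act w (tabloid la T') \<in> tabloids la" if "w permutes Y" for w
      using tab.mem_X[OF permutes_subset[OF that Yn]] T' by (simp add: tabloids_def)
    have "(\<Sum>w | w permutes Y. \<theta> f (list_act w (tabloid la T')))
        = (\<Sum>w | w permutes Y. \<Sum>x\<in>X. f x * cnj (V (list_act w (tabloid la T')) x))"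
    proof (rule sum.cong[OF refl])
      fix w assume "w \<in> {w. w permutes Y}"
      then have "list_act w (tabloid la T') \<in> tabloids la" using T't by blast
      then show "\<theta> f (list_act w (tabloid la T')) = (\<Sum>x\<in>X. f x * cnj (V (list_act w (tabloid la T')) x))"
        by (simp only: \<theta>_def if_True)
    qed
    also have "\<dots> = (\<Sum>x\<in>X. \<Sum>w | w permutes Y. f x * cnj (V (list_act w (tabloid la T')) x))"
      by (rule sum.swap)
    also have "\<dots> = (\<Sum>x\<in>X. f x * cnj ((\<Sum>w | w permutes Y. V (list_act w (tabloid la T'))) x))"
      by (simp only: sum_fun_apply cnj_sum sum_distrib_left)
    also have "\<dots> = 0" unfolding V_garnir[OF T' i Y] by simp
    finally show "(\<Sum>w | w permutes Y. \<theta> f (list_act w (tabloid la T'))) = 0" .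
  qed
  then have mem: "\<theta> f \<in> specht_fun la" for f
    by (intro garnir_imp_specht) (simp_all add: supported_on_def \<theta>_def)
  have "\<theta> v \<noteq> 0"
  proof
    assume "\<theta> v = 0"
    then have "\<theta> v ?t = 0" by simp
    moreover have tt: "?t \<in> tabloids la" using T by (simp add: tabloids_def)
    moreover have "V ?t = v" using V[OF permutes_id] by (simp only: list_act_id fun_act_id)
    ultimately have "(\<Sum>x\<in>X. v x * cnj (v x)) = 0" by (simp add: \<theta>_def)
    then have "(\<Sum>x\<in>X. (cmod (v x))\<^sup>2) = 0"
      by (simp only: complex_norm_square[symmetric] of_real_sum[symmetric] of_real_eq_0_iff)
    then have "v x = 0" if "x \<in> X" for x
      using that finite_X by (simp add: sum_nonneg_eq_0_iff)
    then have "v = 0" using v(1) suppU by (fastforce simp: supported_on_def fun_eq_iff)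
    then show False using v(2) by simp
  qed
  moreover have "tab.submodule (\<theta> ` U)"
    unfolding tab.submodule_def
  proof (intro conjI allI impI)
    interpret L: Vector_Spaces.linear fscale fscale \<theta> by (rule lin)
    show "fs.subspace (\<theta> ` U)" by (rule L.subspace_image[OF subU])
    show "\<theta> ` U \<subseteq> supported_on (tabloids la)" by (auto simp: supported_on_def \<theta>_def)
    fix w h assume "w permutes {1..n}" "h \<in> \<theta> ` U"
    then show "fun_act list_act w h \<in> \<theta> ` U" using actU equi by (metis imageE imageI)
  qed
  ultimately have "\<theta> ` U = specht_fun la"
    using v(1) mem by (intro specht_irreducible[of _ "\<theta> v"]) auto
  then show thesis using that la lin equi by blast
qed


lemma submodule_kernel:
  assumes "submodule U" "Vector_Spaces.linear fscale fscale \<theta>"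
    and "\<And>w f. w permutes {1..n} \<Longrightarrow> \<theta> (fun_act a w f) = fun_act b w (\<theta> f)"
  shows "submodule {f \<in> U. \<theta> f = 0}"
proof -
  interpret L: Vector_Spaces.linear fscale fscale \<theta> by (rule assms(2))
  have "fun_act b w 0 = 0" for w by (simp add: fun_act_def zero_fun_def)
  then show ?thesis
    using assms(1,3) by (auto simp: submodule_def fs.subspace_def L.zero L.add L.scale fs.scale_zero_right)
qed

lemma dim_kernel_less:
  assumes U: "submodule U" and K: "submodule K" "K \<subseteq> U" and f: "f \<in> U" "f \<notin> K"
  shows "fs.dim K < fs.dim U"
proof -
  obtain B where B: "B \<subseteq> K" "fs.independent B" "K \<subseteq> fs.span B" "card B = fs.dim K"
    by (rule fs.basis_exists)
  obtain C where C: "C \<subseteq> U" "fs.independent C" "U \<subseteq> fs.span C" "card C = fs.dim U"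
    by (rule fs.basis_exists)
  have "fs.span B \<subseteq> K" using B(1) K(1) by (intro fs.span_minimal) (auto simp: submodule_def)
  then have f': "f \<notin> fs.span B" using f(2) by blast
  then have "fs.independent (insert f B)" using B(2) by (intro fs.independent_insertI)
  moreover have "C \<subseteq> supported_on X" "B \<subseteq> supported_on X" using B(1) C(1) K(2) U by (auto simp: submodule_def)
  then have "finite C" "finite B" using independent_card_le[OF finite_X] B(2) C(2) by blast+
  moreover have "insert f B \<subseteq> fs.span C" using B(1) K(2) f(1) C(3) by auto
  ultimately have "card (insert f B) \<le> card C" using fs.independent_span_bound by blast
  moreover have "f \<notin> B" using f' fs.span_base by blast
  ultimately show ?thesis using B(4) C(4) \<open>finite B\<close> by simp
qed

text \<open>Maschke's theorem: average a linear section.\<close>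

lemma equivariant_section:
  assumes U: "submodule U" and la: "la \<in> int_partitions n"
    and \<theta>: "Vector_Spaces.linear fscale fscale \<theta>"
      "\<And>w f. w permutes {1..n} \<Longrightarrow> \<theta> (fun_act a w f) = fun_act list_act w (\<theta> f)"
      "\<theta> ` U = specht_fun la"
  obtains g where "Vector_Spaces.linear fscale fscale g"
    "\<And>w s. w permutes {1..n} \<Longrightarrow> g (fun_act list_act w s) = fun_act a w (g s)"
    "\<And>s. s \<in> specht_fun la \<Longrightarrow> g s \<in> U" "\<And>s. s \<in> specht_fun la \<Longrightarrow> \<theta> (g s) = s"
proof -
  interpret shape n la by unfold_locales (rule la)
  interpret pair: perm_action_pair n "tabloids la" list_act X a ..
  interpret L: Vector_Spaces.linear fscale fscale \<theta> by (rule \<theta>(1))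
  have subU: "fs.subspace U" and actU: "\<And>w f. w permutes {1..n} \<Longrightarrow> f \<in> U \<Longrightarrow> fun_act a w f \<in> U"
    using U by (auto simp: submodule_def)
  obtain g0 where g0: "g0 ` UNIV \<subseteq> U" "Vector_Spaces.linear fscale fscale g0"
    "\<And>s. s \<in> specht_fun la \<Longrightarrow> \<theta> (g0 s) = s"
    using fsp.linear_exists_right_inverse_on[OF \<theta>(1) subU] \<theta>(3) by metis
  define g where "g = average n list_act a g0"
  show thesis
  proof (rule that)
    show "Vector_Spaces.linear fscale fscale g"
      unfolding g_def by (rule pair.average_linear[OF g0(2)])
    show "g (fun_act list_act w s) = fun_act a w (g s)" if "w permutes {1..n}" for w s
      unfolding g_def by (rule pair.average_equivariant[OF that])
    show "g s \<in> U" for s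
      unfolding g_def using g0(1) by (intro pair.average_mem subU actU) auto
    show "\<theta> (g s) = s" if s: "s \<in> specht_fun la" for s
    proof -
      have "\<theta> (g s) = fscale (1 / of_nat (fact n))
          (\<Sum>w | w permutes {1..n}. fun_act list_act w (\<theta> (g0 (fun_act list_act (inv' w) s))))"
        unfolding g_def average_def L.scale L.sum
        by (intro arg_cong[of _ _ "fscale _"] sum.cong refl) (simp only: mem_Collect_eq \<theta>(2))
      also have "\<dots> = average n list_act list_act (\<theta> \<circ> g0) s"
        by (simp only: average_def comp_apply)
      also have "\<dots> = s"
      proof -
        interpret p2: perm_action_pair n "tabloids la" list_act "tabloids la" list_act ..
        show ?thesis
        proof (rule p2.average_eq)
          fix w :: "nat \<Rightarrow> nat" assume w: "w permutes {1..n}"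
          have "fun_act list_act (inv' w) s \<in> specht_fun la"
            using specht_submodule s permutes_inv[OF w] by (simp add: tab.submodule_def)
          then show "fun_act list_act w ((\<theta> \<circ> g0) (fun_act list_act (inv' w) s)) = s"
            using tab.fun_act_inverse(1)[OF w] by (simp only: comp_apply g0(3))
        qed
      qed
      finally show ?thesis .
    qed
  qed
qed

text \<open>Induction on the dimension: \<open>U\<close> is the direct sum of the kernel of a map onto a Specht module and
  of the image of an equivariant section.\<close>

theorem specht_decomposition:
  assumes "submodule U"
  shows "\<exists>c :: nat list \<Rightarrow> nat. sn_iso n (fun_module a U) (direct_sum (SIGMA la : int_partitions n. {..<c la}) (\<lambda>(la, _). specht la))"
  using assms
proof (induction "fs.dim U" arbitrary: U rule: less_induct)
  case (less U)
  let ?W = "\<lambda>(la :: nat list, _ :: nat). specht la"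
  have subU: "fs.subspace U" and actU: "\<And>w f. w permutes {1..n} \<Longrightarrow> f \<in> U \<Longrightarrow> fun_act a w f \<in> U"
    using less.prems by (auto simp: submodule_def)
  show ?case
  proof (cases "U = {0}")
    case True
    have "bij_betw (\<lambda>_ _. undefined) U (carrier (direct_sum {} ?W))"
      unfolding True by (simp add: bij_betw_def direct_sum_def)
    moreover have "sn_hom n (fun_module a U) (direct_sum {} ?W) (\<lambda>_ _. undefined)"
      by (simp add: sn_hom_def direct_sum_def restrict_def)
    ultimately have "sn_iso n (fun_module a U) (direct_sum {} ?W)"
      by (auto simp: sn_iso_iff)
    then show ?thesis by (intro exI[of _ "\<lambda>_. 0"]) simp
  next
    case False
    have "0 \<in> U" using subU by (rule fs.subspace_0)
    then obtain f where f: "f \<in> U" "f \<noteq> 0" using False by blast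
    obtain la \<theta> where la: "la \<in> int_partitions n" and \<theta>: "Vector_Spaces.linear fscale fscale \<theta>"
      "\<And>w f. w permutes {1..n} \<Longrightarrow> \<theta> (fun_act a w f) = fun_act list_act w (\<theta> f)"
      "\<theta> ` U = specht_fun la"
      using maps_onto_some_specht[OF less.prems f] by metis
    interpret shape n la by unfold_locales (rule la)
    interpret L: Vector_Spaces.linear fscale fscale \<theta> by (rule \<theta>(1))
    obtain g where g: "Vector_Spaces.linear fscale fscale g"
      "\<And>w s. w permutes {1..n} \<Longrightarrow> g (fun_act list_act w s) = fun_act a w (g s)"
      "\<And>s. s \<in> specht_fun la \<Longrightarrow> g s \<in> U" "\<And>s. s \<in> specht_fun la \<Longrightarrow> \<theta> (g s) = s"
      using equivariant_section[OF less.prems la \<theta>] by metis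
    interpret Lg: Vector_Spaces.linear fscale fscale g by (rule g(1))
    define K where "K = {f \<in> U. \<theta> f = 0}"
    have K: "submodule K" unfolding K_def using less.prems \<theta>(1,2) by (rule submodule_kernel)
    obtain T where "T \<in> tableaux la" using tableaux_nonempty by blast
    then have "polytab la T \<in> specht_fun la" unfolding specht_fun_def by (intro fs.span_base) simp
    moreover have "polytab la T \<noteq> 0"
    proof -
      have "semistandard la (row_of la T \<circ> T)"
        unfolding semistandard_def
      proof (intro conjI allI impI)
        fix i j assume c: "(i, Suc j) \<in> cells la"
        then have "(i, j) \<in> cells la" by (rule cells_left) simp
        then show "(row_of la T \<circ> T) (i, j) \<le> (row_of la T \<circ> T) (i, Suc j)"
          using c \<open>T \<in> tableaux la\<close> by simp
      next
        fix i j assume c: "(Suc i, j) \<in> cells la"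
        then have "(i, j) \<in> cells la" by (rule cells_up) simp
        then show "(row_of la T \<circ> T) (i, j) < (row_of la T \<circ> T) (Suc i, j)"
          using c \<open>T \<in> tableaux la\<close> by simp
      qed
      then have "polytab la T (tabloid la T) = 1"
        using polytab_self \<open>T \<in> tableaux la\<close> by blast
      then show ?thesis by auto
    qed
    ultimately obtain f1 where f1: "f1 \<in> U" "\<theta> f1 \<noteq> 0" using \<theta>(3) by (metis imageE)
    have "fs.dim K < fs.dim U"
      using f1 by (intro dim_kernel_less[OF less.prems K]) (auto simp: K_def)
    then obtain c where "sn_iso n (fun_module a K) (direct_sum (SIGMA la : int_partitions n. {..<c la}) ?W)"
      using less.hyps K by blast
    then obtain \<chi> where \<chi>: "sn_hom n (fun_module a K) (direct_sum (SIGMA la : int_partitions n. {..<c la}) ?W) \<chi>"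
      "bij_betw \<chi> K (carrier (direct_sum (SIGMA la : int_partitions n. {..<c la}) ?W))"
      by (auto simp: sn_iso_iff)
    obtain \<phi> where \<phi>: "sn_hom n (fun_module list_act (specht_fun la)) (specht la) \<phi>"
      "bij_betw \<phi> (specht_fun la) (carrier (specht la))"
      using iso_specht by (auto simp: sn_iso_iff)
    define r where "r f = f - g (\<theta> f)" for f
    have \<theta>S: "\<theta> f \<in> specht_fun la" if "f \<in> U" for f using \<theta>(3) that by blast
    have rK: "r f \<in> K" if "f \<in> U" for f
      using that \<theta>S[OF that] g(3,4) subU by (auto simp: K_def r_def L.diff intro: fs.subspace_diff)
    have r_add: "r (f + h) = r f + r h" for f h
      by (simp only: r_def L.add Lg.add) simp
    have r_scale: "r (fscale k f) = fscale k (r f)" for k f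
      by (simp only: r_def L.scale Lg.scale fs.scale_right_diff_distrib)
    have r_act: "r (fun_act a w f) = fun_act a w (r f)" if "w permutes {1..n}" for w f
      using that by (simp only: r_def \<theta>(2) g(2) fun_act_diff)
    define j where "j = (la, c la)"
    define I where "I = (SIGMA la : int_partitions n. {..<c la})"
    have ins: "insert j I = (SIGMA la' : int_partitions n. {..<(c(la := Suc (c la))) la'})"
      using la by (auto simp: I_def j_def split: if_splits)
    have "sn_iso n (fun_module a U) (direct_sum (insert j I) ?W)"
    proof (rule direct_sum_insert_iso)
      show "j \<notin> I" by (simp add: j_def I_def)
      show "sn_hom n (fun_module a U) (?W j) (\<lambda>f. \<phi> (\<theta> f))"
        using \<phi>(1) \<theta>S by (simp add: sn_hom_def j_def L.add L.scale \<theta>(2) Pi_def)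
      show "sn_hom n (fun_module a U) (direct_sum I ?W) (\<lambda>f. \<chi> (r f))"
        using \<chi>(1) rK unfolding I_def[symmetric] by (simp add: sn_hom_def r_add r_scale r_act Pi_def)
      have \<phi>': "bij_betw \<phi> (specht_fun la) (carrier (?W j))" using \<phi>(2) by (simp add: j_def)
      have \<chi>': "bij_betw \<chi> K (carrier (direct_sum I ?W))" using \<chi>(2) by (simp only: I_def)
      show "bij_betw (\<lambda>f. (\<phi> (\<theta> f), \<chi> (r f))) (carrier (fun_module a U))
        (carrier (?W j) \<times> carrier (direct_sum I ?W))"
      proof (rule bij_betwI')
        fix f h assume fh: "f \<in> carrier (fun_module a U)" "h \<in> carrier (fun_module a U)"
        show "(\<phi> (\<theta> f), \<chi> (r f)) = (\<phi> (\<theta> h), \<chi> (r h)) \<longleftrightarrow> f = h"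
        proof
          assume eq: "(\<phi> (\<theta> f), \<chi> (r f)) = (\<phi> (\<theta> h), \<chi> (r h))"
          have "\<theta> f = \<theta> h"
            using eq fh \<theta>S bij_betw_imp_inj_on[OF \<phi>'] by (simp add: inj_on_eq_iff)
          moreover have "r f = r h"
            using eq fh rK bij_betw_imp_inj_on[OF \<chi>'] by (simp add: inj_on_eq_iff)
          ultimately have "f - g (\<theta> h) = h - g (\<theta> h)" by (simp only: r_def)
          then show "f = h" by (metis diff_add_cancel)
        qed simp
      next
        fix f assume "f \<in> carrier (fun_module a U)"
        then show "(\<phi> (\<theta> f), \<chi> (r f)) \<in> carrier (?W j) \<times> carrier (direct_sum I ?W)"
          using bij_betw_apply[OF \<phi>' \<theta>S] bij_betw_apply[OF \<chi>' rK] by simp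
      next
        fix y assume "y \<in> carrier (?W j) \<times> carrier (direct_sum I ?W)"
        then obtain y1 y2 where y: "y = (y1, y2)" "y1 \<in> carrier (?W j)" "y2 \<in> carrier (direct_sum I ?W)"
          by (cases y) simp
        have "y1 \<in> \<phi> ` specht_fun la" "y2 \<in> \<chi> ` K"
          using y(2,3) by (simp_all only: bij_betw_imp_surj_on[OF \<phi>'] bij_betw_imp_surj_on[OF \<chi>'])
        then obtain s k where s: "s \<in> specht_fun la" "\<phi> s = y1" and k: "k \<in> K" "\<chi> k = y2"
          by (elim imageE) (simp only:)
        have k': "k \<in> U" "\<theta> k = 0" using k(1) by (simp_all add: K_def)
        have \<theta>x: "\<theta> (g s + k) = s" using k'(2) g(4)[OF s(1)] by (simp only: L.add) simp
        have rx: "r (g s + k) = k" by (simp only: r_def \<theta>x) simp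
        have "g s + k \<in> U" using g(3)[OF s(1)] k'(1) subU by (intro fs.subspace_add)
        then show "\<exists>f\<in>carrier (fun_module a U). y = (\<phi> (\<theta> f), \<chi> (r f))"
          using \<theta>x rx s k y(1) by (intro bexI[of _ "g s + k"]) simp_all
      qed
    qed
    then show ?thesis unfolding ins by blast
  qed
qed

end

section \<open>Evaluation of polynomials\<close>

definition ring_map :: "('a::comm_ring_1 \<Rightarrow> 'b::comm_ring_1) \<Rightarrow> bool" where
  "ring_map k \<longleftrightarrow> k 0 = 0 \<and> k 1 = 1 \<and> (\<forall>a b. k (a + b) = k a + k b) \<and> (\<forall>a b. k (a * b) = k a * k b)"

lemma ring_map_sum: "ring_map k \<Longrightarrow> k (\<Sum>i\<in>A. f i) = (\<Sum>i\<in>A. k (f i))"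
  by (induction A rule: infinite_finite_induct) (auto simp: ring_map_def)

lemma ring_map_prod: "ring_map k \<Longrightarrow> k (\<Prod>i\<in>A. f i) = (\<Prod>i\<in>A. k (f i))"
  by (induction A rule: infinite_finite_induct) (auto simp: ring_map_def)

lemma ring_map_power: "ring_map k \<Longrightarrow> k (a ^ e) = k a ^ e"
  by (induction e) (auto simp: ring_map_def)

definition monom_value :: "('v \<Rightarrow> 'b::comm_ring_1) \<Rightarrow> ('v \<Rightarrow>\<^sub>0 nat) \<Rightarrow> 'b" where
  "monom_value z m = (\<Prod>v\<in>Poly_Mapping.keys m. z v ^ Poly_Mapping.lookup m v)"

lemma mpoly_eval_alt:
  "mpoly_eval k z p = (\<Sum>m\<in>Poly_Mapping.keys p. k (Poly_Mapping.lookup p m) * monom_value z m)"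
  by (simp add: mpoly_eval_def monom_value_def)

lemma monom_value_superset:
  assumes "finite S" "Poly_Mapping.keys m \<subseteq> S"
  shows "monom_value z m = (\<Prod>v\<in>S. z v ^ Poly_Mapping.lookup m v)"
  unfolding monom_value_def
  by (rule prod.mono_neutral_left[OF assms]) (simp add: in_keys_iff)

lemma monom_value_add: "monom_value z (m + m') = monom_value z m * monom_value z m'"
proof -
  let ?S = "Poly_Mapping.keys m \<union> Poly_Mapping.keys m'"
  have "Poly_Mapping.keys (m + m') \<subseteq> ?S" by (rule keys_add)
  then show ?thesis
    using monom_value_superset[of ?S "m + m'" z] monom_value_superset[of ?S m z]
      monom_value_superset[of ?S m' z]
    by (simp add: lookup_add power_add prod.distrib)
qed

lemma monom_value_zero [simp]: "monom_value z 0 = 1"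
  by (simp add: monom_value_def)

lemma monom_value_single [simp]: "monom_value z (Poly_Mapping.single v e) = z v ^ e"
  by (simp add: monom_value_def)

lemma monom_deg_add: "monom_deg (e + e') = monom_deg e + monom_deg e'"
  unfolding monom_deg_def by (rule setsum_keys_plus_distrib) auto

lemma mpoly_eval_superset:
  assumes "k 0 = 0" "finite S" "Poly_Mapping.keys p \<subseteq> S"
  shows "mpoly_eval k z p = (\<Sum>m\<in>S. k (Poly_Mapping.lookup p m) * monom_value z m)"
  unfolding mpoly_eval_alt
  by (rule sum.mono_neutral_left[OF assms(2,3)]) (simp add: in_keys_iff assms(1))

lemma mpoly_eval_add:
  assumes "ring_map k"
  shows "mpoly_eval k z (p + q) = mpoly_eval k z p + mpoly_eval k z q"
proof -
  let ?S = "Poly_Mapping.keys p \<union> Poly_Mapping.keys q"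
  have k0: "k 0 = 0" using assms by (simp add: ring_map_def)
  have "Poly_Mapping.keys (p + q) \<subseteq> ?S" by (rule keys_add)
  then show ?thesis
    using mpoly_eval_superset[where k = k and S = ?S and z = z and p = "p + q", OF k0]
      mpoly_eval_superset[where k = k and S = ?S and z = z and p = p, OF k0]
      mpoly_eval_superset[where k = k and S = ?S and z = z and p = q, OF k0] assms
    by (simp add: lookup_add ring_map_def sum.distrib algebra_simps)
qed

lemma mpoly_eval_zero [simp]: "mpoly_eval k z 0 = 0"
  by (simp add: mpoly_eval_alt)

lemma mpoly_eval_sum:
  "ring_map k \<Longrightarrow> mpoly_eval k z (\<Sum>i\<in>A. f i) = (\<Sum>i\<in>A. mpoly_eval k z (f i))"
  by (induction A rule: infinite_finite_induct) (auto simp: mpoly_eval_add)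

lemma mpoly_eval_single:
  "k 0 = 0 \<Longrightarrow> mpoly_eval k z (Poly_Mapping.single m a) = k a * monom_value z m"
  by (cases "a = 0") (simp_all add: mpoly_eval_alt)

lemma sum_singles:
  "p = (\<Sum>m\<in>Poly_Mapping.keys p. Poly_Mapping.single m (Poly_Mapping.lookup p m))"
  by (rule poly_mapping_eqI) (simp add: lookup_sum lookup_single when_def in_keys_iff)

lemma mpoly_eval_mult:
  assumes "ring_map k"
  shows "mpoly_eval k z (p * q) = mpoly_eval k z p * mpoly_eval k z q"
proof -
  have k0: "k 0 = 0" using assms by (simp add: ring_map_def)
  let ?s = "\<lambda>p m. Poly_Mapping.single m (Poly_Mapping.lookup p m)"
  have "p * q = (\<Sum>m\<in>Poly_Mapping.keys p. ?s p m) * (\<Sum>m\<in>Poly_Mapping.keys q. ?s q m)"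
    using sum_singles[of p] sum_singles[of q] by simp
  also have "\<dots> = (\<Sum>m\<in>Poly_Mapping.keys p. \<Sum>m'\<in>Poly_Mapping.keys q. ?s p m * ?s q m')"
    by (rule sum_product)
  finally have "mpoly_eval k z (p * q)
      = (\<Sum>m\<in>Poly_Mapping.keys p. \<Sum>m'\<in>Poly_Mapping.keys q. mpoly_eval k z (?s p m * ?s q m'))"
    by (simp add: mpoly_eval_sum[OF assms])
  also have "\<dots> = (\<Sum>m\<in>Poly_Mapping.keys p. \<Sum>m'\<in>Poly_Mapping.keys q.
      (k (Poly_Mapping.lookup p m) * monom_value z m) * (k (Poly_Mapping.lookup q m') * monom_value z m'))"
    using assms by (intro sum.cong refl)
      (simp add: mult_single mpoly_eval_single[where k = k, OF k0] monom_value_add ring_map_def algebra_simps)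
  also have "\<dots> = mpoly_eval k z p * mpoly_eval k z q"
    unfolding mpoly_eval_alt by (rule sum_product[symmetric])
  finally show ?thesis .
qed

lemma mpoly_eval_one: "ring_map k \<Longrightarrow> mpoly_eval k z 1 = 1"
  by (simp add: mpoly_eval_alt ring_map_def lookup_one)

lemma ring_map_mpoly_eval: "ring_map k \<Longrightarrow> ring_map (mpoly_eval k z)"
  unfolding ring_map_def[of "mpoly_eval k z"]
  by (simp add: mpoly_eval_add mpoly_eval_mult mpoly_eval_one)

lemma mpoly_eval_Var: "ring_map k \<Longrightarrow> mpoly_eval k z (Var v) = z v"
  by (simp add: Var_def mpoly_eval_single ring_map_def)

lemma mpoly_eval_Const: "ring_map k \<Longrightarrow> mpoly_eval k z (Const c) = k c"
  by (simp add: Const_def mpoly_eval_single ring_map_def)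

lemma ring_map_Const: "ring_map Const"
  by (simp add: ring_map_def Const_def single_add mult_single)

lemma ring_map_mpoly_eval_comp:
  assumes "ring_map h"
  shows "h (mpoly_eval k y p) = mpoly_eval (\<lambda>c. h (k c)) (\<lambda>v. h (y v)) p"
  using assms by (simp add: mpoly_eval_def ring_map_sum ring_map_prod ring_map_power ring_map_def)

lemma mpoly_eval_cong:
  assumes "\<And>m v. m \<in> Poly_Mapping.keys p \<Longrightarrow> v \<in> Poly_Mapping.keys m \<Longrightarrow> z v = z' v"
  shows "mpoly_eval k z p = mpoly_eval k z' p"
  unfolding mpoly_eval_def using assms by (intro sum.cong prod.cong arg_cong2[of _ _ _ _ "(*)"]) auto

text \<open>Distinct monomials are distinct characters of the multiplicative monoid of points, so they are
  linearly independent (Dedekind's argument).\<close>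

lemma monomials_independent:
  fixes c :: "('v \<Rightarrow>\<^sub>0 nat) \<Rightarrow> complex"
  assumes "finite S" "\<And>z. (\<Sum>m\<in>S. c m * monom_value z m) = 0"
  shows "\<forall>m\<in>S. c m = 0"
  using assms
proof (induction S arbitrary: c)
  case (insert m1 S)
  have S0: "c m2 = 0" if m2: "m2 \<in> S" for m2
  proof -
    have "m2 \<noteq> m1" using m2 insert.hyps by blast
    then obtain v where v: "Poly_Mapping.lookup m2 v \<noteq> Poly_Mapping.lookup m1 v"
      by (auto simp: poly_mapping_eq_iff fun_eq_iff)
    have mv: "monom_value (z(v := z v * 2)) m = monom_value z m * 2 ^ Poly_Mapping.lookup m v" for z :: "'v \<Rightarrow> complex" and m
    proof -
      let ?S = "insert v (Poly_Mapping.keys m)"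
      have "monom_value (z(v := z v * 2)) m = (\<Prod>u\<in>?S. (z(v := z v * 2)) u ^ Poly_Mapping.lookup m u)"
        by (rule monom_value_superset) auto
      also have "\<dots> = (\<Prod>u\<in>?S. z u ^ Poly_Mapping.lookup m u * (if u = v then 2 ^ Poly_Mapping.lookup m v else 1))"
        by (rule prod.cong) (auto simp: power_mult_distrib)
      also have "\<dots> = monom_value z m * 2 ^ Poly_Mapping.lookup m v"
        unfolding prod.distrib by (subst monom_value_superset[of ?S m z]) auto
      finally show ?thesis .
    qed
    let ?d = "\<lambda>m. c m * (2 ^ Poly_Mapping.lookup m v - 2 ^ Poly_Mapping.lookup m1 v)"
    have "(\<Sum>m\<in>S. ?d m * monom_value z m) = 0" for z
    proof -
      have "(\<Sum>m\<in>insert m1 S. ?d m * monom_value z m)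
        = (\<Sum>m\<in>insert m1 S. c m * monom_value (z(v := z v * 2)) m)
          - 2 ^ Poly_Mapping.lookup m1 v * (\<Sum>m\<in>insert m1 S. c m * monom_value z m)"
        unfolding mv sum_distrib_left sum_subtractf[symmetric] by (intro sum.cong) (auto simp: algebra_simps)
      also have "\<dots> = 0" by (simp only: insert.prems) simp
      finally show ?thesis using insert.hyps by simp
    qed
    then have "?d m2 = 0" using insert.IH[of ?d] m2 by blast
    moreover have "(2::complex) ^ Poly_Mapping.lookup m2 v \<noteq> 2 ^ Poly_Mapping.lookup m1 v"
    proof
      assume "(2::complex) ^ Poly_Mapping.lookup m2 v = 2 ^ Poly_Mapping.lookup m1 v"
      then have "cmod (2 ^ Poly_Mapping.lookup m2 v) = cmod (2 ^ Poly_Mapping.lookup m1 v)" by (rule arg_cong)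
      then show False using v by (simp add: norm_power)
    qed
    ultimately show ?thesis by simp
  qed
  have "c m1 * monom_value (\<lambda>_. 1) m1 = 0"
    using insert.prems[of "\<lambda>_. 1"] insert.hyps S0 by simp
  then have "c m1 = 0" by (simp add: monom_value_def)
  then show ?case using S0 by simp
qed simp

lemma ring_map_of_rat: "ring_map (of_rat :: rat \<Rightarrow> complex)"
  by (simp add: ring_map_def of_rat_add of_rat_mult)

text \<open>Reduces identities between polynomials to complex points, where roots of unity are available.\<close>

lemma polynomial_eqI:
  fixes P Q :: "('v, rat) mpoly"
  assumes "\<And>z :: 'v \<Rightarrow> complex. mpoly_eval of_rat z P = mpoly_eval of_rat z Q"
  shows "P = Q"
proof -
  have "mpoly_eval of_rat z (P - Q) = 0" for z :: "'v \<Rightarrow> complex"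
    using mpoly_eval_add[OF ring_map_of_rat, of z "P - Q" Q] assms[of z] by simp
  then have "\<forall>m\<in>Poly_Mapping.keys (P - Q). (of_rat (Poly_Mapping.lookup (P - Q) m) :: complex) = 0"
    by (intro monomials_independent) (simp_all add: mpoly_eval_alt)
  then have "Poly_Mapping.lookup (P - Q) m = 0" for m
    by (cases "m \<in> Poly_Mapping.keys (P - Q)") (auto simp: in_keys_iff)
  then have "P - Q = 0" by (intro poly_mapping_eqI) simp
  then show ?thesis by simp
qed

section \<open>Power sums and plethysm\<close>

lemma root_of_unity_power_sum:
  fixes \<zeta> :: complex
  assumes "0 < k" "k < m" and \<zeta>: "\<zeta> = cis (2 * pi / real m)"
  shows "(\<Sum>j<m. (\<zeta> ^ j) ^ k) = 0"
proof -
  have \<zeta>k: "\<zeta> ^ k = cis (2 * pi * real k / real m)" by (simp add: \<zeta> DeMoivre algebra_simps)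
  have "inj_on (\<lambda>k. cis (2 * pi * real k / real m)) {..<m}"
    using bij_betw_roots_unity[of m] assms by (simp add: bij_betw_def)
  from inj_onD[OF this, of k 0]
  have "cis (2 * pi * real k / real m) \<noteq> cis (2 * pi * real 0 / real m)"
    using assms(1,2) by (metis lessThan_iff less_irrefl less_trans)
  then have "\<zeta> ^ k \<noteq> 1" unfolding \<zeta>k by simp
  moreover have "(\<zeta> ^ k) ^ m = 1"
  proof -
    have "\<zeta> ^ m = 1" using assms by (simp add: \<zeta> DeMoivre)
    then show ?thesis by (metis power_commutes power_mult power_one mult.commute)
  qed
  moreover have "(\<Sum>j<m. (\<zeta> ^ j) ^ k) = (\<Sum>j<m. (\<zeta> ^ k) ^ j)"
    by (simp add: power_mult[symmetric] mult.commute)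
  ultimately show ?thesis by (simp add: geometric_sum)
qed

lemma complex_root_exists:
  assumes "0 < m"
  shows "\<exists>y::complex. y ^ m = w"
proof -
  have "rcis (root m (cmod w)) (Arg w / real m) ^ m = rcis (cmod w) (Arg w)"
    using assms by (simp add: DeMoivre2 real_root_pow_pos2)
  then show ?thesis by (auto simp: rcis_cmod_Arg)
qed

text \<open>Adjoining the alphabet \<open>y, \<zeta> y, \<dots>, \<zeta>\<^bsup>m-1\<^esup> y\<close> for a primitive \<open>m\<close>-th root of unity \<open>\<zeta>\<close> leaves
  the power sums of index below \<open>m\<close> alone and adds \<open>m y\<^sup>m\<close> to the \<open>m\<close>-th one. So power sums take
  arbitrary values.\<close>

lemma power_sums_arbitrary:
  fixes q :: "nat \<Rightarrow> complex"
  shows "\<exists>(N::nat) z. \<forall>k<K. (\<Sum>i<N. z i ^ Suc k) = q k"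
proof (induction K)
  case (Suc K)
  then obtain N and z :: "nat \<Rightarrow> complex" where Nz: "\<And>k. k < K \<Longrightarrow> (\<Sum>i<N. z i ^ Suc k) = q k" by blast
  define \<zeta> where "\<zeta> = cis (2 * pi / real (Suc K))"
  obtain y where y: "y ^ Suc K = (q K - (\<Sum>i<N. z i ^ Suc K)) / of_nat (Suc K)"
    using complex_root_exists[of "Suc K"] by blast
  define z' where "z' i = (if i < N then z i else \<zeta> ^ (i - N) * y)" for i
  have split: "(\<Sum>i<N + Suc K. z' i ^ e) = (\<Sum>i<N. z i ^ e) + y ^ e * (\<Sum>j<Suc K. (\<zeta> ^ j) ^ e)" for e
  proof -
    have "(\<Sum>i<N + Suc K. z' i ^ e) = (\<Sum>i<N. z' i ^ e) + (\<Sum>j<Suc K. z' (N + j) ^ e)"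
      by (simp only: lessThan_atLeast0 sum.atLeastLessThan_concat[symmetric, of 0 N "N + Suc K"]
          le0 le_add1 sum.shift_bounds_nat_ivl[of _ 0 N "Suc K", simplified add.commute add_0_left add_0_right])
         (simp add: sum.atLeastLessThan_shift_0[of _ N "N + Suc K"] add.commute)
    also have "(\<Sum>i<N. z' i ^ e) = (\<Sum>i<N. z i ^ e)" by (simp add: z'_def)
    also have "(\<Sum>j<Suc K. z' (N + j) ^ e) = y ^ e * (\<Sum>j<Suc K. (\<zeta> ^ j) ^ e)"
      unfolding sum_distrib_left by (intro sum.cong) (simp_all add: z'_def power_mult_distrib)
    finally show ?thesis .
  qed
  have "(\<Sum>i<N + Suc K. z' i ^ Suc k) = q k" if "k < Suc K" for k
  proof (cases "k = K")
    case True
    have "\<zeta> ^ Suc K = 1" by (simp only: \<zeta>_def DeMoivre) simp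
    then have "(\<zeta> ^ j) ^ Suc K = 1" for j by (metis power_commutes power_mult power_one mult.commute)
    then have "(\<Sum>j<Suc K. (\<zeta> ^ j) ^ Suc K) = of_nat (Suc K)" by simp
    then show ?thesis unfolding split True y by (simp del: of_nat_Suc)
  next
    case False
    then have "(\<Sum>j<Suc K. (\<zeta> ^ j) ^ Suc k) = 0"
      using that by (intro root_of_unity_power_sum) (simp_all add: \<zeta>_def)
    then show ?thesis unfolding split using Nz[of k] False that by simp
  qed
  then show ?case by blast
qed simp

lemma ring_map_apply: "ring_map (\<lambda>F :: symfun. F N)"
  by (simp add: ring_map_def)

lemma symfun_eval_apply:
  "mpoly_eval (\<lambda>c N. Const c) F P N = mpoly_eval Const (\<lambda>k. F k N) P"
  for F :: "nat \<Rightarrow> symfun"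
  by (rule ring_map_mpoly_eval_comp[OF ring_map_apply])

text \<open>Two polynomials in the power sums that agree for every number of variables agree at all points,
  because the power sums can be given arbitrary values.\<close>

lemma power_sums_algebraically_independent:
  assumes "mpoly_eval (\<lambda>c N. Const c) (\<lambda>k. power_sum (Suc k)) P =
    mpoly_eval (\<lambda>c N. Const c) (\<lambda>k. power_sum (Suc k)) Q"
  shows "P = Q"
proof (rule polynomial_eqI)
  fix q :: "nat \<Rightarrow> complex"
  define vars where "vars = (\<Union>m\<in>Poly_Mapping.keys P \<union> Poly_Mapping.keys Q. Poly_Mapping.keys m)"
  have "finite vars" by (simp add: vars_def)
  then obtain K where K: "\<And>v. v \<in> vars \<Longrightarrow> v < K" using finite_nat_set_iff_bounded[of vars] by auto
  obtain N and z :: "nat \<Rightarrow> complex" where Nz: "\<And>k. k < K \<Longrightarrow> (\<Sum>i<N. z i ^ Suc k) = q k"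
    using power_sums_arbitrary[of K q] by blast
  have ev: "mpoly_eval of_rat z (mpoly_eval (\<lambda>c N. Const c) (\<lambda>k. power_sum (Suc k)) R N)
      = mpoly_eval of_rat q R" if R: "R = P \<or> R = Q" for R
  proof -
    note hom = ring_map_mpoly_eval[OF ring_map_of_rat, of z]
    have p: "mpoly_eval of_rat z (power_sum (Suc k) N) = (\<Sum>i<N. z i ^ Suc k)" for k
      by (simp only: power_sum_def ring_map_sum[OF hom] ring_map_power[OF hom] mpoly_eval_Var[OF ring_map_of_rat])
    have "mpoly_eval of_rat z (mpoly_eval (\<lambda>c N. Const c) (\<lambda>k. power_sum (Suc k)) R N)
        = mpoly_eval of_rat (\<lambda>k. \<Sum>i<N. z i ^ Suc k) R"
      unfolding symfun_eval_apply ring_map_mpoly_eval_comp[OF hom] p mpoly_eval_Const[OF ring_map_of_rat] ..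
    also have "\<dots> = mpoly_eval of_rat q R"
      using R K Nz by (intro mpoly_eval_cong) (auto simp: vars_def)
    finally show ?thesis .
  qed
  show "mpoly_eval of_rat q P = mpoly_eval of_rat q Q"
    using ev[of P] ev[of Q] assms by simp
qed

text \<open>\<open>h\<^sub>a\<close> evaluated at an arbitrary finite family of elements of a ring.\<close>

definition complete_at :: "nat \<Rightarrow> 'i set \<Rightarrow> ('i \<Rightarrow> 'b::comm_ring_1) \<Rightarrow> 'b" where
  "complete_at a I y = (\<Sum>M\<in>multisets_of_size I a. \<Prod>i\<in>#M. y i)"

text \<open>Newton's identity: a multiset of size \<open>a\<close> with a marked copy of one of its elements is an
  element, the multiplicity up to the mark, and the multiset of the other copies.\<close>

lemma newton_identity:
  fixes y :: "'i \<Rightarrow> 'b::comm_ring_1"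
  assumes I: "finite I"
  shows "of_nat a * complete_at a I y = (\<Sum>r<a. (\<Sum>i\<in>I. y i ^ Suc r) * complete_at (a - Suc r) I y)"
proof -
  let ?M = "multisets_of_size I"
  have fin: "finite (?M k)" for k using I by (rule finite_multisets_of_size)
  have size: "size M = (\<Sum>i\<in>I. count M i)" if "set_mset M \<subseteq> I" for M
    unfolding size_multiset_overloaded_eq using that I
    by (intro sum.mono_neutral_left) (auto simp: not_in_iff)
  have cnt: "count M i \<le> size M" for M :: "'i multiset" and i
    by (simp add: count_le_size)
  have "of_nat a * complete_at a I y = (\<Sum>M\<in>?M a. of_nat a * (\<Prod>i\<in>#M. y i))"
    by (simp add: complete_at_def sum_distrib_left)
  also have "\<dots> = (\<Sum>M\<in>?M a. \<Sum>i\<in>I. \<Sum>r<count M i. \<Prod>i\<in>#M. y i)"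
  proof (rule sum.cong[OF refl])
    fix M assume "M \<in> ?M a"
    then have "a = (\<Sum>i\<in>I. count M i)" using size[of M] by (simp add: multisets_of_size_def)
    then show "of_nat a * (\<Prod>i\<in>#M. y i) = (\<Sum>i\<in>I. \<Sum>r<count M i. \<Prod>i\<in>#M. y i)"
      by (simp add: sum_distrib_right)
  qed
  also have "\<dots> = (\<Sum>(M, i, r)\<in>(SIGMA M:?M a. SIGMA i:I. {..<count M i}). \<Prod>i\<in>#M. y i)"
    using I fin by (simp add: sum.Sigma case_prod_beta del: sum_constant)
  also have "\<dots> = (\<Sum>(r, i, M)\<in>(SIGMA r:{..<a}. SIGMA i:I. ?M (a - Suc r)). y i ^ Suc r * (\<Prod>i\<in>#M. y i))"
  proof (rule sum.reindex_bij_witness[where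
        i = "\<lambda>(r, i, M). (M + replicate_mset (Suc r) i, i, r)" and
        j = "\<lambda>(M, i, r). (r, i, M - replicate_mset (Suc r) i)"])
    fix x assume "x \<in> (SIGMA M:?M a. SIGMA i:I. {..<count M i})"
    then obtain M i r where x: "x = (M, i, r)" "M \<in> ?M a" "i \<in> I" "r < count M i" by auto
    have sub: "replicate_mset (Suc r) i \<subseteq># M" using x(4) count_le_replicate_mset_subset_eq[of "Suc r" M i] by simp
    then have add: "M - replicate_mset (Suc r) i + replicate_mset (Suc r) i = M" by (rule subset_mset.diff_add)
    then show "(\<lambda>(r, i, M). (M + replicate_mset (Suc r) i, i, r))
        ((\<lambda>(M, i, r). (r, i, M - replicate_mset (Suc r) i)) x) = x"
      by (simp add: x(1))
    have "size (M - replicate_mset (Suc r) i) = size M - Suc r"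
      using sub by (simp add: size_Diff_submset del: replicate_mset_Suc)
    moreover have "set_mset (M - replicate_mset (Suc r) i) \<subseteq> set_mset M" by (meson in_diffD subsetI)
    moreover have "r < a" using x cnt[of M i] by (auto simp: multisets_of_size_def)
    ultimately show "(\<lambda>(M, i, r). (r, i, M - replicate_mset (Suc r) i)) x
        \<in> (SIGMA r:{..<a}. SIGMA i:I. ?M (a - Suc r))"
      using x by (auto simp: multisets_of_size_def)
    have "(\<Prod>i\<in>#M. y i) = (\<Prod>i\<in>#M - replicate_mset (Suc r) i + replicate_mset (Suc r) i. y i)"
      by (simp only: add)
    then show "(case (\<lambda>(M, i, r). (r, i, M - replicate_mset (Suc r) i)) x of
        (r, i, M) \<Rightarrow> y i ^ Suc r * (\<Prod>i\<in>#M. y i)) = (case x of (M, i, r) \<Rightarrow> \<Prod>i\<in>#M. y i)"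
      by (simp add: x(1) mult.commute mult.left_commute)
  next
    fix x assume "x \<in> (SIGMA r:{..<a}. SIGMA i:I. ?M (a - Suc r))"
    then obtain r i M where x: "x = (r, i, M)" "r < a" "i \<in> I" "M \<in> ?M (a - Suc r)" by auto
    show "(\<lambda>(M, i, r). (r, i, M - replicate_mset (Suc r) i))
        ((\<lambda>(r, i, M). (M + replicate_mset (Suc r) i, i, r)) x) = x"
      by (simp add: x(1) del: replicate_mset_Suc)
    show "(\<lambda>(r, i, M). (M + replicate_mset (Suc r) i, i, r)) x \<in> (SIGMA M:?M a. SIGMA i:I. {..<count M i})"
      using x by (auto simp: multisets_of_size_def)
  qed
  also have "\<dots> = (\<Sum>r<a. \<Sum>i\<in>I. \<Sum>M\<in>?M (a - Suc r). y i ^ Suc r * (\<Prod>i\<in>#M. y i))"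
    using I fin by (simp add: sum.Sigma)
  also have "\<dots> = (\<Sum>r<a. (\<Sum>i\<in>I. y i ^ Suc r) * complete_at (a - Suc r) I y)"
    by (simp only: complete_at_def sum_product)
  finally show ?thesis .
qed

lemma Const_mult_of_nat:
  assumes "0 < a"
  shows "Const (1 / of_nat a) * of_nat a = (1 :: ('v, rat) mpoly)"
proof -
  have "Const (1 / of_nat a) * of_nat a = (Poly_Mapping.single 0 (1 / of_nat a) * Poly_Mapping.single 0 (of_nat a) :: ('v, rat) mpoly)"
    by (simp add: Const_def)
  also have "\<dots> = 1" using assms by (simp add: mult_single del: single_of_nat)
  finally show ?thesis .
qed

text \<open>By Newton's identity and division by \<open>a\<close>. The same polynomial has to serve for two index types: the
  variables that define \<open>h\<^sub>a\<close>, and the monomials at which the plethysm evaluates it.\<close>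

lemma complete_at_polynomial_in_power_sums:
  "\<exists>P :: (nat, rat) mpoly. \<forall>(I :: 'i set) (y :: 'i \<Rightarrow> (nat, rat) mpoly) (J :: 'j set) (x :: 'j \<Rightarrow> (nat, rat) mpoly).
     finite I \<longrightarrow> finite J \<longrightarrow>
     complete_at a I y = mpoly_eval Const (\<lambda>k. \<Sum>i\<in>I. y i ^ Suc k) P \<and>
     complete_at a J x = mpoly_eval Const (\<lambda>k. \<Sum>i\<in>J. x i ^ Suc k) P"
proof (induction a rule: less_induct)
  case (less a)
  show ?case
  proof (cases "a = 0")
    case True
    have "mpoly_eval Const z 1 = 1" for z :: "nat \<Rightarrow> (nat, rat) mpoly"
      by (rule mpoly_eval_one[OF ring_map_Const])
    then show ?thesis using True by (intro exI[of _ 1]) (simp add: complete_at_def)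
  next
    case False
    obtain P where P: "\<And>b (I :: 'i set) (y :: 'i \<Rightarrow> (nat, rat) mpoly). b < a \<Longrightarrow> finite I \<Longrightarrow>
        complete_at b I y = mpoly_eval Const (\<lambda>k. \<Sum>i\<in>I. y i ^ Suc k) (P b)"
      and P': "\<And>b (J :: 'j set) (x :: 'j \<Rightarrow> (nat, rat) mpoly). b < a \<Longrightarrow> finite J \<Longrightarrow>
        complete_at b J x = mpoly_eval Const (\<lambda>k. \<Sum>i\<in>J. x i ^ Suc k) (P b)"
    proof -
      have "\<forall>b. \<exists>P :: (nat, rat) mpoly. b < a \<longrightarrow> (\<forall>(I :: 'i set) (y :: 'i \<Rightarrow> (nat, rat) mpoly) (J :: 'j set) (x :: 'j \<Rightarrow> (nat, rat) mpoly).
          finite I \<longrightarrow> finite J \<longrightarrow>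
          complete_at b I y = mpoly_eval Const (\<lambda>k. \<Sum>i\<in>I. y i ^ Suc k) P \<and>
          complete_at b J x = mpoly_eval Const (\<lambda>k. \<Sum>i\<in>J. x i ^ Suc k) P)"
        using less.IH by blast
      then obtain P where "\<And>b (I :: 'i set) (y :: 'i \<Rightarrow> (nat, rat) mpoly) (J :: 'j set) (x :: 'j \<Rightarrow> (nat, rat) mpoly).
          b < a \<Longrightarrow> finite I \<Longrightarrow> finite J \<Longrightarrow>
          complete_at b I y = mpoly_eval Const (\<lambda>k. \<Sum>i\<in>I. y i ^ Suc k) (P b) \<and>
          complete_at b J x = mpoly_eval Const (\<lambda>k. \<Sum>i\<in>J. x i ^ Suc k) (P b)"
        by metis
      then show thesis using that[of P] by (meson finite.emptyI)
    qed
    define Q :: "(nat, rat) mpoly" where "Q = Const (1 / of_nat a) * (\<Sum>r<a. Var r * P (a - Suc r))"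
    have Q: "complete_at a I y = mpoly_eval Const (\<lambda>k. \<Sum>i\<in>I. y i ^ Suc k) Q"
      if I: "finite I" and IH: "\<And>b. b < a \<Longrightarrow> complete_at b I y = mpoly_eval Const (\<lambda>k. \<Sum>i\<in>I. y i ^ Suc k) (P b)"
      for I :: "'k set" and y :: "'k \<Rightarrow> (nat, rat) mpoly"
    proof -
      note hom = ring_map_mpoly_eval[OF ring_map_Const]
      let ?p = "\<lambda>k. \<Sum>i\<in>I. y i ^ Suc k"
      have "mpoly_eval Const ?p Q = Const (1 / of_nat a) * (\<Sum>r<a. ?p r * complete_at (a - Suc r) I y)"
        unfolding Q_def mpoly_eval_mult[OF ring_map_Const] ring_map_sum[OF hom]
          mpoly_eval_Const[OF ring_map_Const] mpoly_eval_Var[OF ring_map_Const]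
        using False by (simp add: IH)
      also have "\<dots> = Const (1 / of_nat a) * (of_nat a * complete_at a I y)"
        by (simp only: newton_identity[OF I])
      also have "\<dots> = complete_at a I y"
        using Const_mult_of_nat[of a, where 'v = nat] False by (simp add: mult.assoc[symmetric])
      finally show ?thesis by simp
    qed
    show ?thesis
    proof (intro exI[of _ Q] allI impI conjI)
      fix I :: "'i set" and y :: "'i \<Rightarrow> (nat, rat) mpoly" and J :: "'j set" and x :: "'j \<Rightarrow> (nat, rat) mpoly"
      assume "finite I" "finite J"
      show "complete_at a I y = mpoly_eval Const (\<lambda>k. \<Sum>i\<in>I. y i ^ Suc k) Q"
        by (rule Q[OF \<open>finite I\<close> P[OF _ \<open>finite I\<close>]])
      show "complete_at a J x = mpoly_eval Const (\<lambda>k. \<Sum>i\<in>J. x i ^ Suc k) Q"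
        by (rule Q[OF \<open>finite J\<close> P'[OF _ \<open>finite J\<close>]])
    qed
  qed
qed

text \<open>Multisets of variables are the same as monomials: complete homogeneous functions are sums over the
  latter, Newton's identity counts the former.\<close>

definition exponent :: "nat multiset \<Rightarrow> (nat \<Rightarrow>\<^sub>0 nat)" where
  "exponent M = (\<Sum>i\<in>#M. Poly_Mapping.single i 1)"

lemma lookup_exponent: "Poly_Mapping.lookup (exponent M) i = count M i"
  unfolding exponent_def by (induction M) (simp_all add: lookup_add lookup_single when_def)

lemma keys_exponent: "Poly_Mapping.keys (exponent M) = set_mset M"
  by (auto simp: in_keys_iff lookup_exponent simp flip: count_greater_zero_iff)

lemma monom_deg_exponent: "monom_deg (exponent M) = size M"
  by (simp add: monom_deg_def keys_exponent lookup_exponent size_multiset_overloaded_eq)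

definition monomials :: "nat \<Rightarrow> nat \<Rightarrow> (nat \<Rightarrow>\<^sub>0 nat) set" where
  "monomials N b = {m. Poly_Mapping.keys m \<subseteq> {..<N} \<and> monom_deg m = b}"

lemma bij_betw_exponent: "bij_betw exponent (multisets_of_size {..<N} b) (monomials N b)"
proof (rule bij_betwI')
  fix M M' show "exponent M = exponent M' \<longleftrightarrow> M = M'"
    by (metis lookup_exponent multiset_eq_iff)
next
  fix M assume "M \<in> multisets_of_size {..<N} b"
  then show "exponent M \<in> monomials N b"
    by (auto simp: monomials_def multisets_of_size_def keys_exponent monom_deg_exponent)
next
  fix m assume m: "m \<in> monomials N b"
  define M where "M = Abs_multiset (Poly_Mapping.lookup m)"
  have "count M = Poly_Mapping.lookup m"
    unfolding M_def by (rule count_Abs_multiset) simp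
  then have mM: "m = exponent M" by (intro poly_mapping_eqI) (simp add: lookup_exponent)
  have "M \<in> multisets_of_size {..<N} b"
    using m unfolding mM
    by (auto simp: monomials_def multisets_of_size_def keys_exponent monom_deg_exponent)
  then show "\<exists>M\<in>multisets_of_size {..<N} b. m = exponent M" using mM by blast
qed

lemma finite_monomials: "finite (monomials N b)"
  using bij_betw_finite[OF bij_betw_exponent, of N b] finite_multisets_of_size by blast

lemma prod_mset_single:
  "(\<Prod>i\<in>#M. Poly_Mapping.single (f i) (1::rat)) = Poly_Mapping.single (\<Sum>i\<in>#M. f i) 1"
  by (induction M) (simp_all add: mult_single)

lemma complete_hom_monomials: "complete_hom b N = (\<Sum>m\<in>monomials N b. Poly_Mapping.single m 1)"
  by (simp add: complete_hom_def monomials_def)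

lemma complete_hom_eq_complete_at: "complete_hom b N = complete_at b {..<N} Var"
proof -
  have "complete_at b {..<N} Var = (\<Sum>M\<in>multisets_of_size {..<N} b. Poly_Mapping.single (exponent M) (1::rat))"
    by (simp add: complete_at_def Var_def prod_mset_single exponent_def)
  also have "\<dots> = complete_hom b N"
    unfolding complete_hom_monomials by (rule sum.reindex_bij_betw[OF bij_betw_exponent])
  finally show ?thesis ..
qed

lemma power_plethysm_complete_hom:
  "power_plethysm k (complete_hom b) N = (\<Sum>m\<in>monomials N b. Poly_Mapping.single m 1 ^ k)"
proof -
  have v: "monom_value (\<lambda>i. Var i ^ k) m = Poly_Mapping.single m (1::rat) ^ k" for m :: "nat \<Rightarrow>\<^sub>0 nat"
  proof -
    have s: "Var i ^ e = Poly_Mapping.single (Poly_Mapping.single i e) (1::rat)" for i :: nat and e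
    proof (induction e)
      case (Suc e)
      have "Poly_Mapping.single i 1 + Poly_Mapping.single i e = Poly_Mapping.single i (Suc e)"
        using single_add[of i 1 e] by (metis plus_1_eq_Suc)
      then show ?case using Suc by (simp add: Var_def mult_single)
    qed simp
    have "monom_value (\<lambda>i. Var i ^ k) m = (\<Prod>i\<in>Poly_Mapping.keys m. (Var i :: (nat, rat) mpoly) ^ Poly_Mapping.lookup m i) ^ k"
      by (simp add: monom_value_def prod_power_distrib power_mult[symmetric] mult.commute)
    also have "(\<Prod>i\<in>Poly_Mapping.keys m. (Var i :: (nat, rat) mpoly) ^ Poly_Mapping.lookup m i)
        = Poly_Mapping.single (\<Sum>i\<in>Poly_Mapping.keys m. Poly_Mapping.single i (Poly_Mapping.lookup m i)) 1"
      unfolding s using prod_mset_single[of "\<lambda>i. Poly_Mapping.single i (Poly_Mapping.lookup m i)" "mset_set (Poly_Mapping.keys m)"]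
      by (simp add: prod_unfold_prod_mset sum_unfold_sum_mset)
    also have "(\<Sum>i\<in>Poly_Mapping.keys m. Poly_Mapping.single i (Poly_Mapping.lookup m i)) = m"
      by (rule sum_singles[symmetric])
    finally show ?thesis .
  qed
  have c: "Const (0::rat) = 0" "Const (1::rat) = 1" by (simp_all add: Const_def)
  show ?thesis
    unfolding power_plethysm_def complete_hom_monomials mpoly_eval_sum[OF ring_map_Const]
    by (intro sum.cong refl) (simp add: mpoly_eval_single[where k = Const, OF c(1)] v c(2))
qed

text \<open>\<open>h\<^sub>a\<close> is a polynomial in power sums, unique by algebraic independence. Plethysm replaces the \<open>k\<close>-th
  power sum by the sum of the \<open>k\<close>-th powers of the monomials of degree \<open>b\<close>, which is the \<open>k\<close>-th power
  sum of the alphabet of these monomials.\<close>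

lemma plethysm_complete_hom:
  "plethysm (complete_hom a) (complete_hom b) N =
     complete_at a (monomials N b) (\<lambda>m. Poly_Mapping.single m 1)"
proof -
  obtain P :: "(nat, rat) mpoly" where P:
    "\<And>(I :: nat set) (y :: nat \<Rightarrow> (nat, rat) mpoly). finite I \<Longrightarrow>
       complete_at a I y = mpoly_eval Const (\<lambda>k. \<Sum>i\<in>I. y i ^ Suc k) P"
    "\<And>(J :: (nat \<Rightarrow>\<^sub>0 nat) set) (x :: _ \<Rightarrow> (nat, rat) mpoly). finite J \<Longrightarrow>
       complete_at a J x = mpoly_eval Const (\<lambda>k. \<Sum>i\<in>J. x i ^ Suc k) P"
    using complete_at_polynomial_in_power_sums[of a, where 'i = nat and 'j = "nat \<Rightarrow>\<^sub>0 nat"]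
    by (metis finite.emptyI)
  have F: "complete_hom a = mpoly_eval (\<lambda>c N. Const c) (\<lambda>k. power_sum (Suc k)) P"
    by (rule ext) (simp only: symfun_eval_apply complete_hom_eq_complete_at P(1)[OF finite_lessThan] power_sum_def)
  have "plethysm (complete_hom a) (complete_hom b) =
      mpoly_eval (\<lambda>c N. Const c) (\<lambda>k. power_plethysm (Suc k) (complete_hom b)) P"
    unfolding plethysm_def
  proof (rule the_equality)
    show "\<exists>P'. complete_hom a = mpoly_eval (\<lambda>c N. Const c) (\<lambda>k. power_sum (Suc k)) P' \<and>
      mpoly_eval (\<lambda>c N. Const c) (\<lambda>k. power_plethysm (Suc k) (complete_hom b)) P =
      mpoly_eval (\<lambda>c N. Const c) (\<lambda>k. power_plethysm (Suc k) (complete_hom b)) P'"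
      using F by blast
  next
    fix H assume "\<exists>P. complete_hom a = mpoly_eval (\<lambda>c N. Const c) (\<lambda>k. power_sum (Suc k)) P \<and>
       H = mpoly_eval (\<lambda>c N. Const c) (\<lambda>k. power_plethysm (Suc k) (complete_hom b)) P"
    then show "H = mpoly_eval (\<lambda>c N. Const c) (\<lambda>k. power_plethysm (Suc k) (complete_hom b)) P"
      using F power_sums_algebraically_independent by metis
  qed
  then show ?thesis
    by (simp only: symfun_eval_apply power_plethysm_complete_hom P(2)[OF finite_monomials])
qed

section \<open>Coefficients of the symmetric functions\<close>

definition monomial_multisets :: "nat list \<Rightarrow> nat \<Rightarrow> (nat \<Rightarrow>\<^sub>0 nat) multiset set" where
  "monomial_multisets la N =
     {Q. (\<forall>m\<in>#Q. Poly_Mapping.keys m \<subseteq> {..<N}) \<and> image_mset monom_deg Q = mset la}"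

lemma size_filter_fibre: "size (filter_mset (\<lambda>m. f m = b) Q) = count (image_mset f Q) b"
  by (induction Q) auto

text \<open>A multiset of monomials is the same as the family of its submultisets of given degree. This turns
  the product over the distinct parts in \<open>SF\<close> into one sum.\<close>

lemma bij_betw_graded_parts:
  "bij_betw (\<lambda>f. \<Sum>b\<in>set la. f b)
     (PiE (set la) (\<lambda>b. multisets_of_size (monomials N b) (count_list la b))) (monomial_multisets la N)"
  (is "bij_betw ?S ?A ?B")
proof (rule bij_betwI[where g = "\<lambda>Q. \<lambda>b\<in>set la. filter_mset (\<lambda>m. monom_deg m = b) Q"])
  have deg: "monom_deg m = b \<and> Poly_Mapping.keys m \<subseteq> {..<N}" if "f \<in> ?A" "b \<in> set la" "m \<in># f b" for f b m
    using that by (auto simp: PiE_iff multisets_of_size_def monomials_def)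
  show "?S \<in> ?A \<rightarrow> ?B"
  proof
    fix f assume f: "f \<in> ?A"
    have "image_mset monom_deg (?S f) = (\<Sum>b\<in>set la. image_mset monom_deg (f b))"
    proof -
      have "image_mset monom_deg (\<Sum>b\<in>B. f b) = (\<Sum>b\<in>B. image_mset monom_deg (f b))" if "finite B" for B
        using that by (induction B) auto
      then show ?thesis by simp
    qed
    also have "\<dots> = (\<Sum>b\<in>set la. replicate_mset (count_list la b) b)"
    proof (rule sum.cong[OF refl])
      fix b assume b: "b \<in> set la"
      have "image_mset monom_deg (f b) = image_mset (\<lambda>_. b) (f b)"
        using deg[OF f b] by (intro image_mset_cong) blast
      also have "\<dots> = replicate_mset (count_list la b) b"
        using f b by (simp add: image_mset_const_eq PiE_iff multisets_of_size_def)
      finally show "image_mset monom_deg (f b) = replicate_mset (count_list la b) b" .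
    qed
    also have "\<dots> = mset la"
      by (rule multiset_eqI) (auto simp: count_sum count_mset count_list_eq_length_filter filter_empty_conv
          if_distrib cong: if_cong)
    finally have "image_mset monom_deg (?S f) = mset la" .
    moreover have "Poly_Mapping.keys m \<subseteq> {..<N}" if "m \<in># ?S f" for m
      using that deg[OF f] by (auto simp: set_mset_sum)
    ultimately show "?S f \<in> ?B" by (simp add: monomial_multisets_def)
  qed
  show "(\<lambda>Q. \<lambda>b\<in>set la. filter_mset (\<lambda>m. monom_deg m = b) Q) \<in> ?B \<rightarrow> ?A"
  proof
    fix Q assume Q: "Q \<in> ?B"
    then have "size (filter_mset (\<lambda>m. monom_deg m = b) Q) = count_list la b" for b
      unfolding size_filter_fibre
      by (simp add: monomial_multisets_def count_mset count_list_eq_length_filter)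
    then show "(\<lambda>b\<in>set la. filter_mset (\<lambda>m. monom_deg m = b) Q) \<in> ?A"
      using Q by (auto simp: multisets_of_size_def monomials_def monomial_multisets_def)
  qed
  show "(\<lambda>b\<in>set la. filter_mset (\<lambda>m. monom_deg m = b) (?S f)) = f" if f: "f \<in> ?A" for f
  proof (rule extensionalityI[of _ "set la"])
    fix b assume b: "b \<in> set la"
    have "count (filter_mset (\<lambda>m. monom_deg m = b) (?S f)) m = count (f b) m" for m
    proof -
      have "(\<Sum>b'\<in>set la. count (f b') m) = (\<Sum>b'\<in>set la. if b' = monom_deg m then count (f b') m else 0)"
        using deg[OF f] by (intro sum.cong refl) (auto simp: count_eq_zero_iff)
      moreover have "count (f b) m = 0" if "monom_deg m \<noteq> b"
        using deg[OF f b] that by (auto simp: count_eq_zero_iff)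
      ultimately show ?thesis using b by (auto simp: count_sum)
    qed
    then show "(\<lambda>b\<in>set la. filter_mset (\<lambda>m. monom_deg m = b) (?S f)) b = f b"
      using b by (simp add: multiset_eq_iff)
  qed (use f in \<open>auto simp: PiE_def\<close>)
  show "?S (\<lambda>b\<in>set la. filter_mset (\<lambda>m. monom_deg m = b) Q) = Q" if Q: "Q \<in> ?B" for Q
  proof (rule multiset_eqI)
    fix m
    have "monom_deg m \<in> set la" if "m \<in># Q"
    proof -
      have "image_mset monom_deg Q = mset la" using Q by (simp add: monomial_multisets_def)
      then have "set la = monom_deg ` set_mset Q" by (metis set_image_mset set_mset_mset)
      then show ?thesis using that by simp
    qed
    then show "count (?S (\<lambda>b\<in>set la. filter_mset (\<lambda>m. monom_deg m = b) Q)) m = count Q m"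
      by (auto simp: count_sum count_eq_zero_iff)
  qed
qed

lemma finite_monomial_multisets: "finite (monomial_multisets la N)"
proof -
  have "finite (PiE (set la) (\<lambda>b. multisets_of_size (monomials N b) (count_list la b)))"
    by (intro finite_PiE finite_multisets_of_size finite_monomials) simp
  then show ?thesis using bij_betw_finite[OF bij_betw_graded_parts[of la N]] by simp
qed

lemma SF_expansion: "SF la N = (\<Sum>Q\<in>monomial_multisets la N. Poly_Mapping.single (\<Sum>\<^sub># Q) 1)"
proof -
  let ?MS = "\<lambda>b. multisets_of_size (monomials N b) (count_list la b)"
  have prod1: "(\<Prod>b\<in>B. Poly_Mapping.single (g b) (1::rat)) = Poly_Mapping.single (\<Sum>b\<in>B. g b) 1"
    if "finite B" for B :: "nat set" and g :: "nat \<Rightarrow> (nat \<Rightarrow>\<^sub>0 nat)"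
    using that by (induction B) (auto simp: mult_single)
  have sum_mset_sum: "\<Sum>\<^sub># (\<Sum>b\<in>B. f b) = (\<Sum>b\<in>B. \<Sum>\<^sub># (f b))" if "finite B"
    for B :: "nat set" and f :: "nat \<Rightarrow> (nat \<Rightarrow>\<^sub>0 nat) multiset"
    using that by (induction B) auto
  have "SF la N = (\<Prod>b\<in>set la. plethysm (complete_hom (count_list la b)) (complete_hom b) N)"
    unfolding SF_def by (rule ring_map_prod[OF ring_map_apply])
  also have "\<dots> = (\<Prod>b\<in>set la. \<Sum>M\<in>?MS b. Poly_Mapping.single (\<Sum>\<^sub># M) 1)"
    unfolding plethysm_complete_hom complete_at_def by (simp add: prod_mset_single[of "\<lambda>m. m", simplified])
  also have "\<dots> = (\<Sum>f\<in>PiE (set la) ?MS. \<Prod>b\<in>set la. Poly_Mapping.single (\<Sum>\<^sub># (f b)) 1)"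
    by (rule prod_sum_PiE) (simp_all add: finite_multisets_of_size finite_monomials)
  also have "\<dots> = (\<Sum>f\<in>PiE (set la) ?MS. Poly_Mapping.single (\<Sum>\<^sub># (\<Sum>b\<in>set la. f b)) 1)"
    by (simp add: prod1 sum_mset_sum)
  also have "\<dots> = (\<Sum>Q\<in>monomial_multisets la N. Poly_Mapping.single (\<Sum>\<^sub># Q) 1)"
    by (rule sum.reindex_bij_betw[OF bij_betw_graded_parts])
  finally show ?thesis .
qed

lemma lookup_sum_of_singles:
  assumes "finite S"
  shows "Poly_Mapping.lookup (\<Sum>x\<in>S. Poly_Mapping.single (f x) (1::rat)) \<nu> = of_nat (card {x \<in> S. f x = \<nu>})"
proof -
  have "Poly_Mapping.lookup (\<Sum>x\<in>S. Poly_Mapping.single (f x) (1::rat)) \<nu> = (\<Sum>x\<in>S. if f x = \<nu> then 1 else 0)"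
    by (simp add: lookup_sum lookup_single when_def)
  also have "\<dots> = of_nat (card {x \<in> S. f x = \<nu>})"
    using assms by (simp add: sum.If_cases Int_def)
  finally show ?thesis .
qed

text \<open>The possible multisets of colour contents of the blocks of a set partition into \<open>n - d\<close> blocks of
  size at most \<open>m\<close>, for a colouring with content \<open>\<nu>\<close>.\<close>

definition coloured_types :: "nat \<Rightarrow> nat \<Rightarrow> nat \<Rightarrow> nat \<Rightarrow> (nat \<Rightarrow>\<^sub>0 nat) \<Rightarrow> (nat \<Rightarrow>\<^sub>0 nat) multiset set" where
  "coloured_types n m d N \<nu> = {Q. (\<forall>e\<in>#Q. Poly_Mapping.keys e \<subseteq> {..<N} \<and> 1 \<le> monom_deg e \<and> monom_deg e \<le> m) \<and>
     size Q + d = n \<and> (\<Sum>e\<in>#Q. monom_deg e) = n \<and> \<Sum>\<^sub># Q = \<nu>}"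

lemma int_partition_mset_iff:
  "(\<exists>la\<in>{la \<in> int_partitions n. largest_part la \<le> m \<and> int (length la) = int n - int d}. D = mset la) \<longleftrightarrow>
    (\<forall>b\<in>#D. 1 \<le> b \<and> b \<le> m) \<and> size D + d = n \<and> \<Sum>\<^sub># D = n" (is "?L \<longleftrightarrow> ?R")
proof
  assume ?L
  then obtain la where la: "la \<in> int_partitions n" "largest_part la \<le> m" "int (length la) = int n - int d" "D = mset la"
    by blast
  have "b \<le> largest_part la" if "b \<in> set la" for b
    using that la(1) by (cases la) (auto simp: int_partitions_def largest_part_def)
  moreover have "1 \<le> b" if "b \<in> set la" for b
    using that la(1) by (cases "b = 0") (auto simp: int_partitions_def)
  moreover have "sum_list la = n" using la(1) by (simp add: int_partitions_def)
  ultimately show ?R using la(2-4) by (fastforce simp: sum_mset_sum_list)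
next
  assume R: ?R
  define la where "la = rev (sorted_list_of_multiset D)"
  have mset: "mset la = D" by (simp add: la_def)
  have "sorted_wrt (\<ge>) la" by (simp add: la_def sorted_wrt_rev)
  moreover have set: "set la = set_mset D" using mset by (metis set_mset_mset)
  moreover have "sum_list la = n" using R mset by (metis sum_mset_sum_list)
  ultimately have "la \<in> int_partitions n" using R by (auto simp: int_partitions_def)
  moreover have "largest_part la \<le> m" using R set by (cases la) (auto simp: largest_part_def)
  moreover have "int (length la) = int n - int d" using R mset by (metis add_diff_cancel_right' of_nat_add size_mset)
  ultimately show ?L using mset by blast
qed

lemma int_partition_eq_if_mset_eq:
  assumes "la \<in> int_partitions n" "la' \<in> int_partitions n'" "mset la = mset la'"
  shows "la = la'"
proof -
  have "sorted (rev la)" "sorted (rev la')" using assms by (simp_all add: int_partitions_def sorted_wrt_rev)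
  then have "rev la = rev la'" using assms(3) by (metis mset_rev properties_for_sort)
  then show ?thesis by simp
qed

lemma finite_int_partitions: "finite (int_partitions n)"
proof (rule finite_subset)
  show "int_partitions n \<subseteq> {la. set la \<subseteq> {..n} \<and> length la \<le> n}"
  proof
    fix la assume la: "la \<in> int_partitions n"
    have "b \<le> n" if "b \<in> set la" for b using member_le_sum_list[of b la] that la by (simp add: int_partitions_def)
    moreover have "(\<Sum>b\<leftarrow>la. 1) \<le> (\<Sum>b\<leftarrow>la. b)"
    proof (rule sum_list_mono)
      fix b assume "b \<in> set la"
      then show "1 \<le> b" using la by (cases "b = 0") (auto simp: int_partitions_def)
    qed
    ultimately show "la \<in> {la. set la \<subseteq> {..n} \<and> length la \<le> n}"
      using la by (auto simp: int_partitions_def sum_list_triv)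
  qed
qed (rule finite_lists_length_le, simp)

lemma lookup_sum_SF:
  "Poly_Mapping.lookup ((\<Sum>la\<in>{la \<in> int_partitions n. largest_part la \<le> m \<and> int (length la) = int n - int d}. SF la) N) \<nu>
    = of_nat (card (coloured_types n m d N \<nu>))"
proof -
  define L where "L = {la \<in> int_partitions n. largest_part la \<le> m \<and> int (length la) = int n - int d}"
  define S where "S la = {Q \<in> monomial_multisets la N. \<Sum>\<^sub># Q = \<nu>}" for la
  have finL: "finite L" using finite_int_partitions by (simp add: L_def)
  have "Poly_Mapping.lookup ((\<Sum>la\<in>L. SF la) N) \<nu> = (\<Sum>la\<in>L. of_nat (card (S la)))"
  proof -
    have "Poly_Mapping.lookup (SF la N) \<nu> = of_nat (card (S la))" for la
      unfolding SF_expansion S_def by (rule lookup_sum_of_singles[OF finite_monomial_multisets])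
    then show ?thesis by (simp add: ring_map_sum[OF ring_map_apply] lookup_sum)
  qed
  also have "\<dots> = of_nat (\<Sum>la\<in>L. card (S la))" by simp
  also have "(\<Sum>la\<in>L. card (S la)) = card (\<Union>la\<in>L. S la)"
  proof (rule card_UN_disjoint[symmetric, OF finL])
    show "\<forall>la\<in>L. finite (S la)" by (simp add: S_def finite_monomial_multisets)
    show "\<forall>la\<in>L. \<forall>la'\<in>L. la \<noteq> la' \<longrightarrow> S la \<inter> S la' = {}"
    proof (intro ballI impI)
      fix la la' assume "la \<in> L" "la' \<in> L" "la \<noteq> la'"
      then have "mset la \<noteq> mset la'" using int_partition_eq_if_mset_eq by (auto simp: L_def)
      then show "S la \<inter> S la' = {}" by (auto simp: S_def monomial_multisets_def)
    qed
  qed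
  also have "(\<Union>la\<in>L. S la) = coloured_types n m d N \<nu>"
  proof (rule Set.set_eqI)
    fix Q
    have "Q \<in> (\<Union>la\<in>L. S la) \<longleftrightarrow> (\<forall>e\<in>#Q. Poly_Mapping.keys e \<subseteq> {..<N}) \<and> \<Sum>\<^sub># Q = \<nu> \<and>
        (\<exists>la\<in>L. image_mset monom_deg Q = mset la)"
      by (auto simp: S_def monomial_multisets_def)
    also have "\<dots> \<longleftrightarrow> Q \<in> coloured_types n m d N \<nu>"
      unfolding L_def int_partition_mset_iff by (auto simp: coloured_types_def)
    finally show "Q \<in> (\<Union>la\<in>L. S la) \<longleftrightarrow> Q \<in> coloured_types n m d N \<nu>" .
  qed
  finally show ?thesis by (simp add: L_def)
qed

lemma lookup_schur:
  "Poly_Mapping.lookup (schur la N) \<nu> =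
     of_nat (card {A \<in> ssyt la N. (\<Sum>p\<in>cells la. Poly_Mapping.single (A p) 1) = \<nu>})"
proof -
  have fin: "finite (ssyt la N)"
    by (rule finite_subset[of _ "cells la \<rightarrow>\<^sub>E {..<N}"]) (auto simp: ssyt_def finite_PiE finite_cells)
  have *: "(\<Prod>p\<in>cells la. Var (A p)) = Poly_Mapping.single (\<Sum>p\<in>cells la. Poly_Mapping.single (A p) 1) (1::rat)" for A
    using prod_mset_single[of "\<lambda>p. Poly_Mapping.single (A p) 1" "mset_set (cells la)"]
    by (simp add: Var_def prod_unfold_prod_mset sum_unfold_sum_mset)
  show ?thesis unfolding schur_def * by (rule lookup_sum_of_singles[OF fin])
qed

section \<open>Colourings and their contents\<close>

text \<open>The monomial of a coloured set: its exponents are the numbers of elements of each colour.\<close>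

definition content :: "('x \<Rightarrow> nat) \<Rightarrow> 'x set \<Rightarrow> (nat \<Rightarrow>\<^sub>0 nat)" where
  "content c S = (\<Sum>x\<in>S. Poly_Mapping.single (c x) 1)"

lemma lookup_content:
  assumes "finite S"
  shows "Poly_Mapping.lookup (content c S) k = card {x \<in> S. c x = k}"
proof -
  have "Poly_Mapping.lookup (content c S) k = (\<Sum>x\<in>S. if c x = k then 1 else 0)"
    by (simp add: content_def lookup_sum lookup_single when_def)
  also have "\<dots> = card {x \<in> S. c x = k}" using assms by (simp add: sum.If_cases Int_def)
  finally show ?thesis .
qed

lemma keys_content: "finite S \<Longrightarrow> Poly_Mapping.keys (content c S) = c ` S"
  by (auto simp: in_keys_iff lookup_content card_eq_0_iff)

lemma monom_deg_content:
  assumes "finite S"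
  shows "monom_deg (content c S) = card S"
proof -
  have "monom_deg (content c S) = (\<Sum>k\<in>c ` S. card {x \<in> S. c x = k})"
    by (simp add: monom_deg_def keys_content assms lookup_content)
  also have "\<dots> = card (\<Union>k\<in>c ` S. {x \<in> S. c x = k})"
    using assms by (intro card_UN_disjoint[symmetric]) auto
  also have "(\<Union>k\<in>c ` S. {x \<in> S. c x = k}) = S" by auto
  finally show ?thesis .
qed

lemma content_reindex:
  assumes "bij_betw h S S'"
  shows "content c S' = content (\<lambda>x. c (h x)) S"
  unfolding content_def by (rule sum.reindex_bij_betw[OF assms, symmetric])

lemma count_colours:
  "finite S \<Longrightarrow> count (image_mset c (mset_set S)) k = Poly_Mapping.lookup (content c S) k"
  by (simp add: lookup_content count_image_mset_eq_card_vimage)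

lemma content_eq_iff_image_mset:
  assumes "finite S" "finite S'"
  shows "content c S = content c' S' \<longleftrightarrow> image_mset c (mset_set S) = image_mset c' (mset_set S')"
  using assms by (simp add: poly_mapping_eq_iff fun_eq_iff multiset_eq_iff count_colours)

lemma bij_betw_if_image_mset_eq:
  assumes "finite A" "finite B" "image_mset f (mset_set A) = image_mset g (mset_set B)"
  shows "\<exists>h. bij_betw h A B \<and> (\<forall>a\<in>A. g (h a) = f a)"
  using assms
proof (induction A arbitrary: B)
  case empty
  then have "B = {}" by (simp add: mset_set_empty_iff)
  then show ?case by (simp add: bij_betw_def)
next
  case (insert a A)
  have "f a \<in># image_mset g (mset_set B)"
    unfolding insert.prems(2)[symmetric] using insert.hyps by simp
  then obtain b where b: "b \<in> B" "g b = f a" using insert.prems(1) by auto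
  have "image_mset g (mset_set B) = add_mset (g b) (image_mset g (mset_set (B - {b})))"
    using mset_set.remove[OF insert.prems(1) b(1)] by simp
  then have "image_mset f (mset_set A) = image_mset g (mset_set (B - {b}))"
    using insert.prems(2) insert.hyps b(2) by simp
  then obtain h where h: "bij_betw h A (B - {b})" "\<forall>a\<in>A. g (h a) = f a"
    using insert.IH[of "B - {b}"] insert.prems(1) by auto
  have "bij_betw (h(a := b)) (insert a A) (insert b (B - {b}))"
  proof -
    have "bij_betw (h(a := b)) A (B - {b})"
      using h(1) insert.hyps by (subst bij_betw_cong[where g = h]) auto
    moreover have "bij_betw (h(a := b)) {a} {b}" by (simp add: bij_betw_def)
    ultimately have "bij_betw (h(a := b)) ({a} \<union> A) ({b} \<union> (B - {b}))"
      by (intro bij_betw_combine) auto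
    then show ?thesis by simp
  qed
  moreover have "insert b (B - {b}) = B" using b(1) by blast
  ultimately have "bij_betw (h(a := b)) (insert a A) B" by simp
  moreover have "\<forall>x\<in>insert a A. g ((h(a := b)) x) = f x" using h(2) b(2) insert.hyps by auto
  ultimately show ?case by blast
qed

lemma colouring_with_content:
  assumes "monom_deg \<nu> = n" "Poly_Mapping.keys \<nu> \<subseteq> {..<N}"
  obtains c :: "nat \<Rightarrow> nat" where "\<And>x. x \<in> {1..n} \<Longrightarrow> c x < N" "content c {1..n} = \<nu>"
proof -
  have "\<nu> \<in> monomials N n" using assms by (simp add: monomials_def)
  then obtain M where M: "M \<in> multisets_of_size {..<N} n" "\<nu> = exponent M"
    using bij_betw_exponent[of N n] by (auto simp: bij_betw_def)
  obtain xs where xs: "mset xs = M" using ex_mset by blast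
  define c where "c x = xs ! (x - 1)" for x
  have len: "length xs = n" using M(1) xs by (auto simp: multisets_of_size_def)
  have "c x < N" if "x \<in> {1..n}" for x
  proof -
    have "c x \<in> set xs" unfolding c_def using that len by (intro nth_mem) auto
    then show ?thesis using M(1) xs by (auto simp: multisets_of_size_def)
  qed
  moreover have "content c {1..n} = \<nu>"
  proof -
    have "content c {1..n} = (\<Sum>x\<in>{1..n}. Poly_Mapping.single (xs ! (x - 1)) 1)"
      by (simp add: content_def c_def)
    also have "\<dots> = (\<Sum>i<n. Poly_Mapping.single (xs ! i) 1)"
      by (rule sum.reindex_bij_witness[where i = Suc and j = "\<lambda>x. x - 1"]) auto
    also have "\<dots> = (\<Sum>x\<leftarrow>xs. Poly_Mapping.single x 1)"
      using len by (simp add: sum_list_sum_nth atLeast0LessThan)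
    also have "\<dots> = exponent M"
      unfolding exponent_def xs[symmetric] by (simp add: sum_mset_sum_list flip: mset_map)
    finally show ?thesis using M(2) by simp
  qed
  ultimately show thesis using that by blast
qed

context shape
begin

lemma colour_arrays_eq:
  assumes "\<And>x. x \<in> {1..n} \<Longrightarrow> c x < N"
  shows "colour_arrays c = {A \<in> ssyt la N. content A (cells la) = content c {1..n}}"
proof (intro equalityI subsetI)
  fix A assume "A \<in> colour_arrays c"
  then obtain T where T: "T \<in> tableaux la" "semistandard la (c \<circ> T)" "A = restrict (c \<circ> T) (cells la)"
    by (auto simp: colour_arrays_def ssyt_tableaux_def colour_array_def)
  have app: "A p = c (T p)" if "p \<in> cells la" for p using that T(3) by simp
  have "A \<in> cells la \<rightarrow>\<^sub>E {..<N}"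
    using T(3) assms tableau_mem[OF T(1)] by (simp add: PiE_def Pi_def)
  moreover have "A (i, j) \<le> A (i, Suc j)" if "(i, Suc j) \<in> cells la" for i j
    using T(2) that app[OF that] app[OF cells_left[OF that, of j]] by (simp add: semistandard_def)
  moreover have "A (i, j) < A (Suc i, j)" if "(Suc i, j) \<in> cells la" for i j
    using T(2) that app[OF that] app[OF cells_up[OF that, of i]] by (simp add: semistandard_def)
  moreover have "content A (cells la) = content c {1..n}"
  proof -
    have "content A (cells la) = content (\<lambda>p. c (T p)) (cells la)"
      unfolding content_def using app by (intro sum.cong refl) simp
    then show ?thesis using content_reindex[OF tableau_bij[OF T(1)], of c] by simp
  qed
  ultimately show "A \<in> {A \<in> ssyt la N. content A (cells la) = content c {1..n}}"
    by (simp add: ssyt_def)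
next
  fix A assume "A \<in> {A \<in> ssyt la N. content A (cells la) = content c {1..n}}"
  then have A: "A \<in> ssyt la N" and eq: "content A (cells la) = content c {1..n}" by auto
  have "image_mset A (mset_set (cells la)) = image_mset c (mset_set {1..n})"
    using eq content_eq_iff_image_mset[OF finite_cells, of "{1..n}" A la c] by simp
  then obtain h where h: "bij_betw h (cells la) {1..n}" "\<And>p. p \<in> cells la \<Longrightarrow> c (h p) = A p"
    using bij_betw_if_image_mset_eq[OF finite_cells, of "{1..n}" A la c] by auto
  define T where "T = restrict h (cells la)"
  have "bij_betw T (cells la) {1..n}"
    unfolding T_def using h(1) by (subst bij_betw_cong[where g = h]) auto
  then have T: "T \<in> tableaux la" by (simp add: tableaux_def sum_la) (simp add: T_def)
  have app: "c (T p) = A p" if "p \<in> cells la" for p using that h(2) by (simp add: T_def)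
  have "semistandard la (c \<circ> T)"
    unfolding semistandard_def
  proof (intro conjI allI impI)
    fix i j assume ij: "(i, Suc j) \<in> cells la"
    then show "(c \<circ> T) (i, j) \<le> (c \<circ> T) (i, Suc j)"
      using A app[OF ij] app[OF cells_left[OF ij, of j]] by (simp add: ssyt_def)
  next
    fix i j assume ij: "(Suc i, j) \<in> cells la"
    then show "(c \<circ> T) (i, j) < (c \<circ> T) (Suc i, j)"
      using A app[OF ij] app[OF cells_up[OF ij, of i]] by (simp add: ssyt_def)
  qed
  moreover have "colour_array c T = A"
    using A app by (auto simp: colour_array_def fun_eq_iff restrict_def ssyt_def PiE_def extensional_def)
  ultimately show "A \<in> colour_arrays c"
    using T by (auto simp: colour_arrays_def ssyt_tableaux_def)
qed

end

section \<open>Orbits of Young subgroups on set partitions\<close>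

definition partition_act :: "(nat \<Rightarrow> nat) \<Rightarrow> nat set set \<Rightarrow> nat set set" where
  "partition_act w P = (`) ((`) w) P"

definition level_partitions :: "nat \<Rightarrow> nat \<Rightarrow> nat \<Rightarrow> nat set set set" where
  "level_partitions n m d = {P. partition_on {1..n} P \<and> (\<forall>B\<in>P. card B \<le> m) \<and> card P + d = n}"

lemma partition_on_act:
  assumes "w permutes S" "partition_on S P"
  shows "partition_on S (partition_act w P)"
proof -
  have "\<Union> ((`) ((`) w) P) = w ` \<Union> P" by blast
  then have "\<Union> (partition_act w P) = S"
    using assms by (simp add: partition_act_def partition_on_def permutes_image)
  moreover have "disjoint (partition_act w P)"
    unfolding disjoint_def partition_act_def
  proof (intro ballI impI)
    fix a b assume "a \<in> (`) ((`) w) P" "b \<in> (`) ((`) w) P" "a \<noteq> b"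
    then obtain A B where AB: "A \<in> P" "B \<in> P" "a = w ` A" "b = w ` B" "A \<noteq> B" by blast
    then have "A \<inter> B = {}" using assms(2) by (auto simp: partition_on_def disjoint_def)
    then show "a \<inter> b = {}" using AB permutes_inj[OF assms(1)] by (simp add: image_Int[symmetric])
  qed
  ultimately show ?thesis using assms(2) by (auto simp: partition_on_def partition_act_def)
qed

lemma inj_image_sets: "inj w \<Longrightarrow> inj_on ((`) w) A"
  by (auto simp: inj_on_def inj_image_eq_iff)

lemma partition_block_finite: "partition_on {1..n::nat} P \<Longrightarrow> B \<in> P \<Longrightarrow> finite B \<and> B \<noteq> {} \<and> B \<subseteq> {1..n}"
  by (metis finite_atLeastAtMost finite_subset partition_onD1 partition_onD3 Union_upper)

lemma partition_block_unique:
  assumes "partition_on S P" "x \<in> S"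
  shows "\<exists>!B. B \<in> P \<and> x \<in> B"
proof -
  have "x \<in> \<Union> P" using assms partition_onD1 by blast
  then obtain B where "B \<in> P" "x \<in> B" by blast
  then show ?thesis using partition_onD2[OF assms(1)] unfolding disjoint_def by blast
qed

lemma partition_finite: "partition_on {1..n::nat} P \<Longrightarrow> finite P"
  by (rule finite_elements) auto

lemma level_partitions_action: "perm_action n (level_partitions n m d) partition_act"
proof
  show "finite (level_partitions n m d)"
    by (rule finite_subset[of _ "Pow (Pow {1..n})"]) (auto simp: level_partitions_def partition_on_def)
  show "partition_act w P \<in> level_partitions n m d"
    if w: "w permutes {1..n}" and P: "P \<in> level_partitions n m d" for w P
  proof -
    have "card (partition_act w P) = card P"
      unfolding partition_act_def using permutes_inj[OF w] by (intro card_image inj_image_sets)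
    moreover have "card (w ` B) = card B" for B
      using permutes_inj_on[OF w] by (rule card_image)
    ultimately show ?thesis
      using P partition_on_act[OF w] by (auto simp: level_partitions_def) (auto simp: partition_act_def)
  qed
qed (auto simp: partition_act_def image_comp)

definition partition_type :: "(nat \<Rightarrow> nat) \<Rightarrow> nat set set \<Rightarrow> (nat \<Rightarrow>\<^sub>0 nat) multiset" where
  "partition_type c P = image_mset (content c) (mset_set P)"

lemma partition_type_stab:
  assumes h: "h \<in> colour_stab n c"
  shows "partition_type c (partition_act h P) = partition_type c P"
proof -
  have inj: "inj h" using permutes_inj[OF colour_stab_perm[OF h]] .
  have "content c (h ` B) = content c B" for B
  proof -
    have "bij_betw h B (h ` B)" using inj_on_subset[OF inj subset_UNIV] by (simp add: bij_betw_def)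
    from content_reindex[OF this, of c] show ?thesis using h by (simp add: colour_stab_def)
  qed
  then show ?thesis
    unfolding partition_type_def partition_act_def
    by (simp add: image_mset_mset_set[OF inj_image_sets[OF inj], symmetric] multiset.map_comp comp_def)
qed

text \<open>Match the blocks with equal content, and extend the matching to the elements: as multisets of
  pairs of a block and a colour both partitions are the same.\<close>

lemma same_type_conjugate:
  assumes P: "partition_on {1..n} P" and P': "partition_on {1..n} P'"
    and eq: "partition_type c P = partition_type c P'"
  shows "\<exists>h\<in>colour_stab n c. partition_act h P = P'"
proof -
  obtain \<beta> where \<beta>: "bij_betw \<beta> P P'" "\<And>B. B \<in> P \<Longrightarrow> content c (\<beta> B) = content c B"
    using bij_betw_if_image_mset_eq[OF partition_finite[OF P] partition_finite[OF P']] eq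
    unfolding partition_type_def by metis
  define blk where "blk P x = (THE B. B \<in> P \<and> x \<in> B)" for P :: "nat set set" and x
  have blk: "blk P x = B \<longleftrightarrow> x \<in> B" if "partition_on {1..n} P" "x \<in> {1..n}" "B \<in> P" for P x B
  proof -
    have "\<exists>!B. B \<in> P \<and> x \<in> B" using that(1,2) by (rule partition_block_unique)
    from theI'[OF this] have "blk P x \<in> P \<and> x \<in> blk P x" unfolding blk_def .
    with \<open>\<exists>!B. B \<in> P \<and> x \<in> B\<close> that(3) show ?thesis by blast
  qed
  have blk_in: "blk P x \<in> P" if "partition_on {1..n} P" "x \<in> {1..n}" for P x
    using theI'[OF partition_block_unique[OF that]] unfolding blk_def by blast
  have "image_mset (\<lambda>x. (\<beta> (blk P x), c x)) (mset_set {1..n}) = image_mset (\<lambda>x. (blk P' x, c x)) (mset_set {1..n})"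
  proof (rule multiset_eqI)
    fix y :: "nat set \<times> nat"
    obtain B' k where y: "y = (B', k)" by (cases y)
    have L: "count (image_mset (\<lambda>x. (\<beta> (blk P x), c x)) (mset_set {1..n})) y
        = card {x \<in> {1..n}. \<beta> (blk P x) = B' \<and> c x = k}"
      by (simp add: count_image_mset_eq_card_vimage y)
    have R: "count (image_mset (\<lambda>x. (blk P' x, c x)) (mset_set {1..n})) y
        = card {x \<in> {1..n}. blk P' x = B' \<and> c x = k}"
      by (simp add: count_image_mset_eq_card_vimage y)
    show "count (image_mset (\<lambda>x. (\<beta> (blk P x), c x)) (mset_set {1..n})) y
        = count (image_mset (\<lambda>x. (blk P' x, c x)) (mset_set {1..n})) y"
    proof (cases "B' \<in> P'")
      case True
      then obtain B where B: "B \<in> P" "\<beta> B = B'" using \<beta>(1) by (auto simp: bij_betw_def)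
      note finB = partition_block_finite[OF P B(1)] and finB' = partition_block_finite[OF P' True]
      have "\<beta> (blk P x) = B' \<longleftrightarrow> x \<in> B" if "x \<in> {1..n}" for x
        using blk[OF P that B(1)] blk_in[OF P that] B \<beta>(1) by (metis bij_betw_inv_into_left)
      then have 1: "{x \<in> {1..n}. \<beta> (blk P x) = B' \<and> c x = k} = {x \<in> B. c x = k}" using finB by blast
      have 2: "{x \<in> {1..n}. blk P' x = B' \<and> c x = k} = {x \<in> B'. c x = k}"
        using finB' blk[OF P' _ True] by blast
      show ?thesis
        unfolding L R 1 2 using \<beta>(2)[OF B(1)] finB finB' B(2) lookup_content by metis
    next
      case False
      then have "{x \<in> {1..n}. \<beta> (blk P x) = B' \<and> c x = k} = {}" "{x \<in> {1..n}. blk P' x = B' \<and> c x = k} = {}"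
        using blk_in[OF P] blk_in[OF P'] \<beta>(1) by (auto dest: bij_betwE)
      then show ?thesis unfolding L R by (simp only:)
    qed
  qed
  from image_mset_eq_implies_permutes[OF finite_atLeastAtMost this]
  obtain p where p: "p permutes {1..n}"
    and "\<forall>x\<in>{1..n}. (\<beta> (blk P x), c x) = (blk P' (p x), c (p x))" .
  then have p2: "\<beta> (blk P x) = blk P' (p x) \<and> c x = c (p x)" if "x \<in> {1..n}" for x
    using that by blast
  have "c (p x) = c x" for x
    using p2[of x] permutes_not_in[OF p, of x] by (cases "x \<in> {1..n}") auto
  then have "p \<in> colour_stab n c" using p by (simp add: colour_stab_def)
  moreover have "p ` B = \<beta> B" if B: "B \<in> P" for B
  proof (intro equalityI subsetI)
    have \<beta>B: "\<beta> B \<in> P'" using \<beta>(1) B by (auto dest: bij_betwE)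
    fix y assume "y \<in> p ` B"
    then obtain x where x: "x \<in> B" "y = p x" by blast
    have xn: "x \<in> {1..n}" using x(1) partition_block_finite[OF P B] by blast
    then have pn: "p x \<in> {1..n}" using permutes_in_image[OF p] by blast
    have "blk P x = B" using blk[OF P xn B] x(1) by blast
    then have "blk P' (p x) = \<beta> B" using p2[OF xn] by simp
    then show "y \<in> \<beta> B" using blk[OF P' pn \<beta>B] x(2) by simp
  next
    have \<beta>B: "\<beta> B \<in> P'" using \<beta>(1) B by (auto dest: bij_betwE)
    fix y assume y: "y \<in> \<beta> B"
    then have yn: "y \<in> {1..n}" using partition_block_finite[OF P' \<beta>B] by blast
    define x where "x = inv' p y"
    have px: "p x = y" by (simp add: x_def permutes_inverses[OF p])
    have xn: "x \<in> {1..n}" using yn px permutes_in_image[OF p] by metis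
    have "\<beta> (blk P x) = \<beta> B" using p2[OF xn] blk[OF P' yn \<beta>B] y px by simp
    then have "blk P x = B"
      using \<beta>(1) blk_in[OF P xn] B by (auto simp: bij_betw_def dest: inj_onD)
    then show "y \<in> p ` B" using blk[OF P xn B] px by blast
  qed
  then have "partition_act p P = \<beta> ` P" unfolding partition_act_def by (intro image_cong) auto
  then have "partition_act p P = P'" using \<beta>(1) by (simp add: bij_betw_def)
  ultimately show ?thesis by blast
qed

text \<open>Remove blocks with the prescribed contents from \<open>S\<close> one after the other. No prescribed content is
  empty, as blocks are not.\<close>

lemma partition_with_type:
  assumes "finite S" "content c S = \<Sum>\<^sub># Q" "\<forall>e\<in>#Q. 1 \<le> monom_deg e"
  shows "\<exists>P. partition_on S P \<and> partition_type c P = Q"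
  using assms
proof (induction Q arbitrary: S)
  case empty
  then have "monom_deg (content c S) = 0" by (simp add: monom_deg_def)
  then have "S = {}" using empty.prems(1) by (simp add: monom_deg_content)
  then show ?case by (intro exI[of _ "{}"]) (simp add: partition_on_def partition_type_def)
next
  case (add q Q)
  have le: "Poly_Mapping.lookup q k \<le> card {x \<in> S. c x = k}" for k
    using add.prems(1,2) by (simp add: lookup_content[symmetric] lookup_add)
  have "\<forall>k. \<exists>B. B \<subseteq> {x \<in> S. c x = k} \<and> card B = Poly_Mapping.lookup q k"
    using le obtain_subset_with_card_n by metis
  then obtain F where F: "\<And>k. F k \<subseteq> {x \<in> S. c x = k}" "\<And>k. card (F k) = Poly_Mapping.lookup q k" by metis
  define B where "B = {x \<in> S. x \<in> F (c x)}"
  have finB: "finite B" using add.prems(1) by (simp add: B_def)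
  have "{x \<in> B. c x = k} = F k" for k using F(1)[of k] by (auto simp: B_def)
  then have q: "content c B = q" using finB F(2) by (intro poly_mapping_eqI) (simp add: lookup_content)
  have BS: "B \<subseteq> S" by (auto simp: B_def)
  have "content c S = content c B + content c (S - B)"
    unfolding content_def using add.prems(1) BS by (metis add.commute sum.subset_diff)
  then have "content c (S - B) = \<Sum>\<^sub># Q" using add.prems(2) q by simp
  then obtain P where P: "partition_on (S - B) P" "partition_type c P = Q"
    using add.IH[of "S - B"] add.prems(1,3) by auto
  have ne: "B \<noteq> {}"
  proof
    assume "B = {}"
    then have "monom_deg q = 0" using q by (simp add: content_def monom_deg_def flip: q)
    then show False using add.prems(3) by simp
  qed
  have BP: "B \<notin> P" using P(1) ne by (auto simp: partition_on_def)
  have finP: "finite P" using P(1) add.prems(1) by (intro finite_elements[of "S - B"]) auto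
  have "partition_on S (insert B P)"
    using P(1) BS ne by (auto simp: partition_on_def disjoint_def)
  moreover have "partition_type c (insert B P) = add_mset q Q"
    using BP finP q P(2) by (simp add: partition_type_def)
  ultimately show ?case by blast
qed

lemma partition_type_in_coloured_types:
  assumes c: "\<And>x. x \<in> {1..n} \<Longrightarrow> c x < N" and P: "P \<in> level_partitions n m d"
  shows "partition_type c P \<in> coloured_types n m d N (content c {1..n})"
proof -
  have part: "partition_on {1..n} P" and m: "\<And>B. B \<in> P \<Longrightarrow> card B \<le> m" and d: "card P + d = n"
    using P by (auto simp: level_partitions_def)
  note fin = partition_finite[OF part] and blk = partition_block_finite[OF part]
  have sum: "(\<Sum>B\<in>P. g B) = (\<Sum>B\<in>#mset_set P. g B)" for g :: "nat set \<Rightarrow> 'z::comm_monoid_add"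
    by (simp add: sum_unfold_sum_mset)
  have un: "(\<Sum>B\<in>P. \<Sum>x\<in>B. g x) = (\<Sum>x\<in>{1..n}. g x)" for g :: "nat \<Rightarrow> 'z::comm_monoid_add"
  proof -
    have "(\<Sum>x\<in>\<Union>P. g x) = (\<Sum>B\<in>P. \<Sum>x\<in>B. g x)"
      using part blk by (intro sum.Union_disjoint[unfolded comp_def])
        (auto simp: partition_on_def disjoint_def)
    then show ?thesis using partition_onD1[OF part] by simp
  qed
  have "Poly_Mapping.keys (content c B) \<subseteq> {..<N} \<and> 1 \<le> monom_deg (content c B) \<and> monom_deg (content c B) \<le> m"
    if B: "B \<in> P" for B
  proof -
    have "0 < card B" using blk[OF B] by (simp add: card_gt_0_iff)
    moreover have "c ` B \<subseteq> {..<N}" using blk[OF B] c by blast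
    ultimately show ?thesis using blk[OF B] m[OF B] by (simp add: keys_content monom_deg_content)
  qed
  moreover have "size (partition_type c P) + d = n" using d by (simp add: partition_type_def)
  moreover have "(\<Sum>e\<in>#partition_type c P. monom_deg e) = n"
  proof -
    have "(\<Sum>e\<in>#partition_type c P. monom_deg e) = (\<Sum>B\<in>P. monom_deg (content c B))"
      by (simp add: partition_type_def sum multiset.map_comp comp_def)
    also have "\<dots> = (\<Sum>B\<in>P. \<Sum>x\<in>B. 1)" using blk by (intro sum.cong) (simp_all add: monom_deg_content)
    finally show ?thesis using un[of "\<lambda>_. 1::nat"] by simp
  qed
  moreover have "\<Sum>\<^sub># (partition_type c P) = content c {1..n}"
    using un[of "\<lambda>x. Poly_Mapping.single (c x) (1::nat)"]
    by (simp add: partition_type_def content_def[abs_def] sum)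
  ultimately show ?thesis using fin by (auto simp: coloured_types_def partition_type_def)
qed

lemma partition_types_onto:
  assumes Q: "Q \<in> coloured_types n m d N (content c {1..n})"
  obtains P where "P \<in> level_partitions n m d" "partition_type c P = Q"
proof -
  obtain P where P: "partition_on {1..n} P" "partition_type c P = Q"
    using partition_with_type[of "{1..n}" c Q] Q by (auto simp: coloured_types_def)
  have fin: "finite P" by (rule partition_finite[OF P(1)])
  have "card B \<le> m" if B: "B \<in> P" for B
  proof -
    have "content c B \<in># Q" unfolding P(2)[symmetric] using B fin by (simp add: partition_type_def)
    then have "monom_deg (content c B) \<le> m" using Q by (auto simp: coloured_types_def)
    then show ?thesis using partition_block_finite[OF P(1) B] by (simp add: monom_deg_content)
  qed
  moreover have "card P + d = n"
    using Q unfolding P(2)[symmetric] by (simp add: coloured_types_def partition_type_def)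
  ultimately show thesis using P that by (auto simp: level_partitions_def)
qed

text \<open>An invariant function is constant on the orbits, and the orbits correspond to the types.\<close>

lemma level_partitions_coords:
  assumes c: "\<And>x. x \<in> {1..n} \<Longrightarrow> c x < N"
  shows "has_coords (colour_stab n c) (fun_module partition_act (supported_on (level_partitions n m d)))
    (coloured_types n m d N (content c {1..n}))"
proof (rule has_coords_fun_moduleI)
  let ?X = "level_partitions n m d" and ?H = "colour_stab n c"
  let ?I = "coloured_types n m d N (content c {1..n})"
  interpret perm_action n ?X partition_act by (rule level_partitions_action)
  define r where "r Q = (SOME P. P \<in> ?X \<and> partition_type c P = Q)" for Q
  have r: "r Q \<in> ?X" "partition_type c (r Q) = Q" if "Q \<in> ?I" for Q
  proof -
    have "\<exists>P. P \<in> ?X \<and> partition_type c P = Q" using partition_types_onto[OF that] by blast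
    from someI_ex[OF this] show "r Q \<in> ?X" "partition_type c (r Q) = Q" by (simp_all add: r_def)
  qed
  define ev where "ev f Q = (if Q \<in> ?I then f (r Q) else 0)" for f :: "nat set set \<Rightarrow> complex" and Q
  show "fs.subspace (supported_on ?X)" by (rule supported_on_subspace)
  show "ev (f + g) = ev f + ev g" for f g by (auto simp: ev_def fun_eq_iff)
  show "ev (fscale k f) = fscale k (ev f)" for k f by (auto simp: ev_def fun_eq_iff)
  have inv: "f (r (partition_type c P)) = f P"
    if f: "f \<in> invariants ?H (fun_module partition_act (supported_on ?X))" and P: "P \<in> ?X" for f P
  proof -
    have Q: "partition_type c P \<in> ?I" using partition_type_in_coloured_types[OF c P] .
    obtain h where h: "h \<in> ?H" "partition_act h (r (partition_type c P)) = P"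
      using same_type_conjugate[of n "r (partition_type c P)" P c] r[OF Q] P
      by (auto simp: level_partitions_def)
    have "fun_act partition_act h f (partition_act h (r (partition_type c P))) = f (r (partition_type c P))"
      by (rule fun_act_apply_act[OF colour_stab_perm[OF h(1)]])
    moreover have "fun_act partition_act h f = f" using f h(1) by (simp add: invariants_def)
    ultimately show ?thesis using h(2) by simp
  qed
  show "bij_betw ev (invariants ?H (fun_module partition_act (supported_on ?X))) (supported_on ?I)"
  proof (rule bij_betwI')
    fix f g assume fg: "f \<in> invariants ?H (fun_module partition_act (supported_on ?X))"
      "g \<in> invariants ?H (fun_module partition_act (supported_on ?X))"
    show "ev f = ev g \<longleftrightarrow> f = g"
    proof
      assume eq: "ev f = ev g"
      show "f = g"
      proof
        fix P show "f P = g P"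
        proof (cases "P \<in> ?X")
          case True
          have "ev f (partition_type c P) = ev g (partition_type c P)" using eq by simp
          then show ?thesis
            using inv[OF fg(1) True] inv[OF fg(2) True] partition_type_in_coloured_types[OF c True]
            by (simp add: ev_def)
        next
          case False
          then show ?thesis using fg by (simp add: invariants_def supported_on_def)
        qed
      qed
    qed simp
  next
    fix f show "ev f \<in> supported_on ?I" by (simp add: ev_def supported_on_def)
  next
    fix y assume y: "y \<in> supported_on ?I"
    define f where "f P = (if P \<in> ?X then y (partition_type c P) else 0)" for P
    have "fun_act partition_act h f = f" if h: "h \<in> ?H" for h
    proof
      fix P
      have h': "inv' h \<in> ?H" using h by (rule colour_stab_inv)
      show "fun_act partition_act h f P = f P"
        using partition_type_stab[OF h', of P] mem_X_iff[OF colour_stab_perm[OF h'], of P]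
        by (simp add: fun_act_def f_def)
    qed
    then have "f \<in> invariants ?H (fun_module partition_act (supported_on ?X))"
      by (simp add: invariants_def supported_on_def f_def)
    moreover have "y = ev f"
    proof
      fix Q show "y Q = ev f Q" using y r by (cases "Q \<in> ?I") (auto simp: ev_def f_def supported_on_def)
    qed
    ultimately show "\<exists>f\<in>invariants ?H (fun_module partition_act (supported_on ?X)). y = ev f" by blast
  qed
qed

section \<open>The Frobenius image of a permutation module on set partitions\<close>

lemma lookup_of_nat_mult:
  "Poly_Mapping.lookup (of_nat k * p) \<nu> = of_nat k * Poly_Mapping.lookup p \<nu>"
  for p :: "('v, rat) mpoly"
  by (induction k) (simp_all add: distrib_right lookup_add)

lemma coloured_types_finite: "finite (coloured_types n m d N \<nu>)"
proof (rule finite_subset)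
  let ?M = "\<Union>b\<le>m. monomials N b"
  show "coloured_types n m d N \<nu> \<subseteq> (\<Union>k\<le>n. multisets_of_size ?M k)"
    by (auto simp: coloured_types_def multisets_of_size_def monomials_def)
  show "finite (\<Union>k\<le>n. multisets_of_size ?M k)"
    by (intro finite_UN_I finite_multisets_of_size) (auto simp: finite_monomials)
qed

text \<open>Taking the dimension of the invariants of the Young subgroup of a colouring with content \<open>\<nu>\<close> on
  both sides of an isomorphism with a sum of Specht modules yields the equation for the coefficients
  of \<open>x\<^sup>\<nu>\<close>. It determines the Frobenius image, and \<open>specht_decomposition\<close> provides an isomorphism.\<close>

lemma frobenius_set_partitions:
  assumes V: "sn_iso n (fun_module partition_act (supported_on (level_partitions n m d))) V"
  shows "frobenius n V =
    (\<Sum>la\<in>{la \<in> int_partitions n. largest_part la \<le> m \<and> int (length la) = int n - int d}. SF la)"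
proof -
  let ?X = "level_partitions n m d"
  let ?P = "fun_module partition_act (supported_on ?X)"
  let ?D = "\<lambda>k :: nat list \<Rightarrow> nat. direct_sum (SIGMA la : int_partitions n. {..<k la}) (\<lambda>(la, _). specht la)"
  let ?F = "\<Sum>la\<in>{la \<in> int_partitions n. largest_part la \<le> m \<and> int (length la) = int n - int d}. SF la"
  interpret perm_action n ?X partition_act by (rule level_partitions_action)
  have closed: "sn_closed n ?P" by (rule submodule_closed[OF submodule_supported])
  have VP: "sn_iso n V ?P" using V closed by (rule sn_iso_sym)
  obtain k0 where k0: "sn_iso n ?P (?D k0)" using specht_decomposition[OF submodule_supported] by blast
  have unique: "(\<Sum>la\<in>int_partitions n. of_nat (k la) * schur la) = ?F" if k: "sn_iso n V (?D k)" for k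
  proof (intro ext poly_mapping_eqI)
    fix N \<nu>
    have PD: "sn_iso n ?P (?D k)" using V k by (rule sn_iso_trans)
    define K where "K la = {A \<in> ssyt la N. content A (cells la) = \<nu>}" for la
    have "Poly_Mapping.lookup ((\<Sum>la\<in>int_partitions n. of_nat (k la) * schur la) N) \<nu>
        = (\<Sum>la\<in>int_partitions n. of_nat (k la) * Poly_Mapping.lookup (schur la N) \<nu>)"
      by (simp add: sum_fun_apply lookup_sum lookup_of_nat_mult)
    also have "\<dots> = of_nat (\<Sum>la\<in>int_partitions n. k la * card (K la))"
      by (simp add: lookup_schur K_def content_def)
    also have "(\<Sum>la\<in>int_partitions n. k la * card (K la)) = card (coloured_types n m d N \<nu>)"
    proof (cases "monom_deg \<nu> = n \<and> Poly_Mapping.keys \<nu> \<subseteq> {..<N}")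
      case True
      then obtain c where c: "\<And>x. x \<in> {1..n} \<Longrightarrow> c x < N" "content c {1..n} = \<nu>"
        using colouring_with_content[of \<nu> n N] by metis
      let ?H = "colour_stab n c"
      have H: "?H \<subseteq> {w. w permutes {1..n}}" using colour_stab_perm by blast
      have "has_coords ?H (?D k) (coloured_types n m d N \<nu>)"
        using has_coords_iso[OF level_partitions_coords[OF c(1)] PD closed H] by (simp add: c(2))
      moreover have "has_coords ?H (?D k) (SIGMA j:(SIGMA la : int_partitions n. {..<k la}). K (fst j))"
      proof (rule has_coords_direct_sum)
        fix j assume "j \<in> (SIGMA la : int_partitions n. {..<k la})"
        then obtain la i where j: "j = (la, i)" "la \<in> int_partitions n" by auto
        interpret shape n la by unfold_locales (rule j(2))
        show "has_coords ?H (case j of (la, _) \<Rightarrow> specht la) (K (fst j))"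
          using specht_coords[of c] colour_arrays_eq[of c N, OF c(1)] c(2) by (simp add: j(1) K_def)
      qed
      moreover have finK: "finite (K la)" if "la \<in> int_partitions n" for la
      proof -
        interpret shape n la by unfold_locales (rule that)
        show ?thesis using finite_colour_arrays[of c] colour_arrays_eq[of c N, OF c(1)] c(2) by (simp add: K_def)
      qed
      moreover have "finite (SIGMA la : int_partitions n. {..<k la})"
        using finite_int_partitions by simp
      ultimately have "card (SIGMA j:(SIGMA la : int_partitions n. {..<k la}). K (fst j)) = card (coloured_types n m d N \<nu>)"
        by (intro has_coords_card_unique[of _ ?H "?D k"] coloured_types_finite finite_SigmaI)
             (auto simp: finite_int_partitions)
      moreover have "card (SIGMA j:(SIGMA la : int_partitions n. {..<k la}). K (fst j))
          = (\<Sum>la\<in>int_partitions n. k la * card (K la))"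
      proof -
        have "card (SIGMA j:(SIGMA la : int_partitions n. {..<k la}). K (fst j))
            = (\<Sum>j\<in>(SIGMA la : int_partitions n. {..<k la}). card (K (fst j)))"
          using finK finite_int_partitions by (intro card_SigmaI) auto
        also have "\<dots> = (\<Sum>(la, i)\<in>(SIGMA la : int_partitions n. {..<k la}). card (K la))"
          by (intro sum.cong) auto
        also have "\<dots> = (\<Sum>la\<in>int_partitions n. \<Sum>i<k la. card (K la))"
          using finite_int_partitions by (intro sum.Sigma[symmetric]) auto
        finally show ?thesis by simp
      qed
      ultimately show ?thesis by simp
    next
      case False
      \<comment> \<open>no colouring has this content, and both sides vanish\<close>
      have "K la = {}" if la: "la \<in> int_partitions n" for la
      proof (rule equals0I)
        fix A assume "A \<in> K la"
        then have A: "A \<in> ssyt la N" "content A (cells la) = \<nu>" by (auto simp: K_def)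
        have "monom_deg \<nu> = n"
          using A(2) la by (auto simp: monom_deg_content finite_cells card_cells int_partitions_def)
        moreover have "Poly_Mapping.keys \<nu> \<subseteq> {..<N}"
          using A by (auto simp: keys_content finite_cells ssyt_def PiE_def Pi_def)
        ultimately show False using False by blast
      qed
      moreover have "coloured_types n m d N \<nu> = {}"
      proof (rule equals0I)
        fix Q assume Q: "Q \<in> coloured_types n m d N \<nu>"
        have "Poly_Mapping.keys (\<Sum>\<^sub># Q) \<subseteq> {..<N}" if "\<forall>e\<in>#Q. Poly_Mapping.keys e \<subseteq> {..<N}" for Q
          using that
        proof (induction Q)
          case (add e Q)
          then show ?case using keys_add[of e "\<Sum>\<^sub># Q"] by auto
        qed simp
        moreover have "monom_deg (\<Sum>\<^sub># Q) = (\<Sum>e\<in>#Q. monom_deg e)" for Q :: "(nat \<Rightarrow>\<^sub>0 nat) multiset"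
          by (induction Q) (simp_all add: monom_deg_add, simp add: monom_deg_def)
        ultimately show False using Q False by (auto simp: coloured_types_def)
      qed
      ultimately show ?thesis by simp
    qed
    finally show "Poly_Mapping.lookup ((\<Sum>la\<in>int_partitions n. of_nat (k la) * schur la) N) \<nu>
        = Poly_Mapping.lookup (?F N) \<nu>"
      by (simp only: lookup_sum_SF)
  qed
  show ?thesis
    unfolding frobenius_def
  proof (rule the_equality)
    have "sn_iso n V (?D k0)" using VP k0 by (rule sn_iso_trans)
    then show "\<exists>k. sn_iso n V (?D k) \<and> ?F = (\<Sum>la\<in>int_partitions n. of_nat (k la) * schur la)"
      using unique[of k0] by (intro exI[of _ k0]) simp
    show "F = ?F" if "\<exists>k. sn_iso n V (?D k) \<and> F = (\<Sum>la\<in>int_partitions n. of_nat (k la) * schur la)" for F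
      using that unique by blast
  qed
qed

section \<open>Partitions, edges and spanning forests\<close>

definition inner_edges :: "nat \<Rightarrow> nat set set \<Rightarrow> nat set set" where
  "inner_edges n P = {e \<in> edges n. \<exists>B\<in>P. e \<subseteq> B}"

definition bounded_partitions :: "nat \<Rightarrow> nat \<Rightarrow> nat set set set" where
  "bounded_partitions n m = {P. partition_on {1..n} P \<and> (\<forall>B\<in>P. card B \<le> m)}"

text \<open>A spanning forest: each block is spanned by the star at its least element. Any spanning forest
  would do.\<close>

definition star_forest :: "nat set set \<Rightarrow> nat set set" where
  "star_forest P = (\<Union>B\<in>P. (\<lambda>x. {Min B, x}) ` (B - {Min B}))"

lemma bounded_points_image: "bounded_partition_points n m = partition_point n ` bounded_partitions n m"
  by (simp add: bounded_partition_points_def bounded_partitions_def)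

lemma level_partitions_bounded: "level_partitions n m d = {P \<in> bounded_partitions n m. card P + d = n}"
  by (auto simp: level_partitions_def bounded_partitions_def)

lemma bounded_partitions_finite: "finite (bounded_partitions n m)"
  by (rule finite_subset[of _ "Pow (Pow {1..n})"]) (auto simp: bounded_partitions_def partition_on_def)

lemma edges_finite: "finite (edges n)"
  by (rule finite_subset[of _ "Pow {1..n}"]) (auto simp: edges_def)

lemma edge_obtain:
  assumes "e \<in> edges n"
  obtains a b where "e = {a, b}" "a \<noteq> b" "a \<in> {1..n}" "b \<in> {1..n}"
  using assms by (auto simp: edges_def card_2_iff)

lemma star_forest_edges:
  assumes "partition_on {1..n} P"
  shows "star_forest P \<subseteq> edges n"
proof
  fix e assume "e \<in> star_forest P"
  then obtain B x where B: "B \<in> P" "x \<in> B" "x \<noteq> Min B" "e = {Min B, x}" by (auto simp: star_forest_def)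
  have "Min B \<in> B" using partition_block_finite[OF assms B(1)] by (intro Min_in) auto
  then have "{Min B, x} \<subseteq> {1..n}" using B(2) partition_block_finite[OF assms B(1)] by blast
  then show "e \<in> edges n" using B(3,4) by (simp add: edges_def)
qed

lemma card_star_forest:
  assumes P: "partition_on {1..n} P"
  shows "card (star_forest P) + card P = n"
proof -
  have card1: "card ((\<lambda>x. {Min B, x}) ` (B - {Min B})) + 1 = card B" if B: "B \<in> P" for B
  proof -
    note fin = partition_block_finite[OF P B]
    have "inj_on (\<lambda>x. {Min B, x}) (B - {Min B})" by (auto simp: inj_on_def doubleton_eq_iff)
    then have "card ((\<lambda>x. {Min B, x}) ` (B - {Min B})) = card (B - {Min B})" by (rule card_image)
    also have "\<dots> + 1 = card B"
      using fin Min_in[of B] card_gt_0_iff[of B] by (simp add: card_Diff_singleton)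
    finally show ?thesis .
  qed
  have "card (star_forest P) = (\<Sum>B\<in>P. card ((\<lambda>x. {Min B, x}) ` (B - {Min B})))"
    unfolding star_forest_def
  proof (rule card_UN_disjoint[OF partition_finite[OF P]])
    show "\<forall>B\<in>P. finite ((\<lambda>x. {Min B, x}) ` (B - {Min B}))" using partition_block_finite[OF P] by simp
    show "\<forall>B\<in>P. \<forall>C\<in>P. B \<noteq> C \<longrightarrow>
        (\<lambda>x. {Min B, x}) ` (B - {Min B}) \<inter> (\<lambda>x. {Min C, x}) ` (C - {Min C}) = {}"
    proof (intro ballI impI equals0I)
      fix B C e assume BC: "B \<in> P" "C \<in> P" "B \<noteq> C"
        and "e \<in> (\<lambda>x. {Min B, x}) ` (B - {Min B}) \<inter> (\<lambda>x. {Min C, x}) ` (C - {Min C})"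
      then obtain x y where xy: "x \<in> B" "y \<in> C" "e = {Min B, x}" "e = {Min C, y}" by auto
      have "Min B \<in> B" "Min C \<in> C"
        using partition_block_finite[OF P] BC by (auto intro!: Min_in)
      moreover have "Min B \<in> {Min C, y}" using xy by blast
      ultimately have "Min B \<in> B \<inter> C" using xy(2) by auto
      then show False using BC partition_onD2[OF P] by (auto simp: disjoint_def)
    qed
  qed
  then have "card (star_forest P) + card P = (\<Sum>B\<in>P. card ((\<lambda>x. {Min B, x}) ` (B - {Min B})) + 1)"
    by (simp only: sum.distrib) simp
  also have "\<dots> = (\<Sum>B\<in>P. card B)" using card1 by (rule sum.cong[OF refl])
  also have "\<dots> = card (\<Union>P)"
    using partition_block_finite[OF P] partition_onD2[OF P] by (intro card_Union_disjoint[symmetric]) (auto simp: disjoint_def pairwise_def disjnt_def)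
  also have "\<dots> = n" using partition_onD1[OF P, symmetric] by simp
  finally show ?thesis .
qed

text \<open>A star lies inside the blocks of \<open>Q\<close> if and only if the block that it spans does.\<close>

lemma star_forest_refines:
  assumes P: "partition_on {1..n} P" and Q: "partition_on {1..n} Q"
  shows "star_forest P \<subseteq> inner_edges n Q \<longleftrightarrow> refines {1..n} P Q"
proof
  assume L: "star_forest P \<subseteq> inner_edges n Q"
  have "\<exists>C\<in>Q. B \<subseteq> C" if B: "B \<in> P" for B
  proof -
    note fin = partition_block_finite[OF P B]
    have m: "Min B \<in> B" using fin by (intro Min_in) auto
    then have "Min B \<in> {1..n}" using fin by blast
    then obtain C where C: "C \<in> Q" "Min B \<in> C" using partition_block_unique[OF Q] by blast
    have "x \<in> C" if x: "x \<in> B" for x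
    proof (cases "x = Min B")
      case False
      then have "{Min B, x} \<in> star_forest P" using B x by (auto simp: star_forest_def)
      then obtain D where D: "D \<in> Q" "{Min B, x} \<subseteq> D" using L by (auto simp: inner_edges_def)
      then have "D = C" using C partition_block_unique[OF Q \<open>Min B \<in> {1..n}\<close>] by blast
      then show ?thesis using D by blast
    qed (use C in simp)
    then show ?thesis using C by blast
  qed
  then show "refines {1..n} P Q" using P Q by (simp add: refines_def)
next
  assume R: "refines {1..n} P Q"
  show "star_forest P \<subseteq> inner_edges n Q"
  proof
    fix e assume e: "e \<in> star_forest P"
    then obtain B x where B: "B \<in> P" "x \<in> B" "e = {Min B, x}" by (auto simp: star_forest_def)
    have "Min B \<in> B" using partition_block_finite[OF P B(1)] by (intro Min_in) auto
    moreover obtain C where "C \<in> Q" "B \<subseteq> C" using R B(1) by (auto simp: refines_def)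
    ultimately show "e \<in> inner_edges n Q"
      using e B star_forest_edges[OF P] by (auto simp: inner_edges_def)
  qed
qed

text \<open>\<open>P\<close> consists of the connected components of the graph \<open>E\<close>. Adding an edge merges at most two of
  them, so there are at least \<open>n - card E\<close>.\<close>

lemma components_exist:
  assumes "finite E" "E \<subseteq> edges n"
  shows "\<exists>P. partition_on {1..n} P \<and> n \<le> card P + card E \<and>
    (\<forall>Q. partition_on {1..n} Q \<longrightarrow> (E \<subseteq> inner_edges n Q \<longleftrightarrow> refines {1..n} P Q))"
  using assms
proof (induction E)
  case empty
  let ?P = "(\<lambda>x. {x}) ` {1..n}"
  have "card ?P = n" by (subst card_image) auto
  moreover have part: "partition_on {1..n} ?P" by (rule partition_on_singletons)
  moreover have "refines {1..n} ?P Q" if Q: "partition_on {1..n} Q" for Q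
    unfolding refines_def
  proof (intro conjI ballI part Q)
    fix B assume "B \<in> ?P"
    then obtain x where x: "x \<in> {1..n}" "B = {x}" by blast
    obtain C where "C \<in> Q" "x \<in> C" using partition_block_unique[OF Q x(1)] by blast
    then show "\<exists>C\<in>Q. B \<subseteq> C" using x(2) by blast
  qed
  ultimately show ?case by (intro exI[of _ ?P]) simp
next
  case (insert e E)
  then obtain P where P: "partition_on {1..n} P" "n \<le> card P + card E"
    "\<And>Q. partition_on {1..n} Q \<Longrightarrow> E \<subseteq> inner_edges n Q \<longleftrightarrow> refines {1..n} P Q"
    by auto
  obtain a b where e: "e = {a, b}" "a \<noteq> b" "a \<in> {1..n}" "b \<in> {1..n}"
    using insert.prems edge_obtain[of e n] by blast
  obtain A where A: "A \<in> P" "a \<in> A" using partition_block_unique[OF P(1) e(3)] by blast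
  obtain B where B: "B \<in> P" "b \<in> B" using partition_block_unique[OF P(1) e(4)] by blast
  have en: "e \<in> edges n" using insert.prems by simp
  have e_iff: "e \<in> inner_edges n Q \<longleftrightarrow> (\<exists>C\<in>Q. a \<in> C \<and> b \<in> C)" for Q
    using en e(1) by (auto simp: inner_edges_def)
  define P' where "P' = insert (A \<union> B) (P - {A, B})"
  have disj: "C \<inter> D = {}" if "C \<in> P" "D \<in> P" "C \<noteq> D" for C D
    using that partition_onD2[OF P(1)] by (auto simp: disjoint_def)
  have "partition_on {1..n} P'"
  proof (rule partition_onI)
    show "\<Union> P' = {1..n}" using A(1) B(1) partition_onD1[OF P(1)] by (auto simp: P'_def)
    show "{} \<notin> P'" using A B partition_onD3[OF P(1)] by (auto simp: P'_def)
    show "disjnt p q" if pq: "p \<in> P'" "q \<in> P'" "p \<noteq> q" for p q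
    proof -
      have AB: "(A \<union> B) \<inter> C = {}" if "C \<in> P - {A, B}" for C
        using disj[OF A(1), of C] disj[OF B(1), of C] that by blast
      consider "p = A \<union> B" "q \<in> P - {A, B}" | "q = A \<union> B" "p \<in> P - {A, B}"
        | "p \<in> P - {A, B}" "q \<in> P - {A, B}"
        using pq unfolding P'_def by (elim insertE) simp_all
      then show ?thesis
      proof cases
        case 1 then show ?thesis using AB[of q] by (simp only: disjnt_def)
      next
        case 2 then show ?thesis using AB[of p] by (simp only: disjnt_def Int_commute)
      next
        case 3 then show ?thesis using disj[of p q] pq(3) by (simp add: disjnt_def)
      qed
    qed
  qed
  moreover have "n \<le> card P' + card (insert e E)"
  proof -
    have finP: "finite P" by (rule partition_finite[OF P(1)])
    have "card P \<le> card P' + 1"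
    proof -
      have "A \<union> B \<notin> P - {A, B}" using disj[OF A(1), of "A \<union> B"] A(2) by blast
      then have P': "card P' = Suc (card (P - {A, B}))" using finP by (simp add: P'_def)
      have "P \<subseteq> insert A (insert B (P - {A, B}))" by blast
      then have "card P \<le> card (insert A (insert B (P - {A, B})))"
        using finP by (intro card_mono) auto
      also have "\<dots> \<le> Suc (Suc (card (P - {A, B})))"
      proof -
        have "card (insert A (insert B S)) \<le> Suc (Suc (card S))" if "finite S" for S
          using that by (simp add: card_insert_if)
        then show ?thesis using finP by blast
      qed
      also have "\<dots> = Suc (card P')" using P' by simp
      finally show ?thesis by simp
    qed
    then show ?thesis using P(2) insert.hyps by simp
  qed
  moreover have "insert e E \<subseteq> inner_edges n Q \<longleftrightarrow> refines {1..n} P' Q" if Q: "partition_on {1..n} Q" for Q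
  proof
    assume "insert e E \<subseteq> inner_edges n Q"
    then have R: "refines {1..n} P Q" and "\<exists>C\<in>Q. a \<in> C \<and> b \<in> C" using P(3)[OF Q] e_iff by auto
    then obtain C where C: "C \<in> Q" "a \<in> C" "b \<in> C" by blast
    have "\<exists>Y\<in>Q. A \<subseteq> Y" "\<exists>Y\<in>Q. B \<subseteq> Y" using R A(1) B(1) unfolding refines_def by blast+
    then obtain C1 C2 where C12: "C1 \<in> Q" "A \<subseteq> C1" "C2 \<in> Q" "B \<subseteq> C2" by blast
    have "C1 = C" "C2 = C"
      using C C12 A(2) B(2) partition_block_unique[OF Q e(3)] partition_block_unique[OF Q e(4)] by blast+
    then have "A \<union> B \<subseteq> C" using C12 by blast
    then show "refines {1..n} P' Q"
      using R C(1) calculation(1) Q by (auto simp: refines_def P'_def)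
  next
    assume R: "refines {1..n} P' Q"
    then obtain C where C: "C \<in> Q" "A \<union> B \<subseteq> C" by (auto simp: refines_def P'_def)
    have "\<exists>Y\<in>Q. D \<subseteq> Y" if "D \<in> P" for D
    proof (cases "D \<in> {A, B}")
      case True
      then show ?thesis using C by blast
    next
      case False
      then have "D \<in> P'" using that by (simp add: P'_def)
      then show ?thesis using R by (auto simp: refines_def)
    qed
    then have "refines {1..n} P Q" using P(1) Q by (auto simp: refines_def)
    moreover have "e \<in> inner_edges n Q" unfolding e_iff using C A(2) B(2) by blast
    ultimately show "insert e E \<subseteq> inner_edges n Q" using P(3)[OF Q] by simp
  qed
  ultimately show ?case by blast
qed

text \<open>At a finest partition \<open>Q\<close> with nonzero coefficient only that coefficient contributes to the sum.\<close>

lemma refinement_independent: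
  fixes c :: "nat set set \<Rightarrow> complex"
  assumes S: "finite S" "\<And>P. P \<in> S \<Longrightarrow> partition_on {1..n} P"
    and sum0: "\<And>Q. Q \<in> S \<Longrightarrow> (\<Sum>P\<in>S. c P * (if refines {1..n} P Q then 1 else 0)) = 0"
    and P: "P \<in> S"
  shows "c P = 0"
proof (rule ccontr)
  assume "c P \<noteq> 0"
  then obtain Q where Q: "Q \<in> S" "c Q \<noteq> 0"
    and min: "\<And>R. R \<in> S \<Longrightarrow> c R \<noteq> 0 \<Longrightarrow> card (inner_edges n Q) \<le> card (inner_edges n R)"
    using ex_has_least_nat[of "\<lambda>R. R \<in> S \<and> c R \<noteq> 0" P "\<lambda>R. card (inner_edges n R)"] P by blast
  have "c R * (if refines {1..n} R Q then 1 else 0) = (if R = Q then c Q else 0)" if R: "R \<in> S" for R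
  proof (cases "R = Q")
    case True
    then show ?thesis using refines_refl[OF S(2)[OF R]] by simp
  next
    case False
    have "c R = 0" if ref: "refines {1..n} R Q"
    proof (rule ccontr)
      assume "c R \<noteq> 0"
      then have le: "card (inner_edges n Q) \<le> card (inner_edges n R)" using min R by blast
      have sub: "inner_edges n R \<subseteq> inner_edges n Q"
      proof
        fix e assume "e \<in> inner_edges n R"
        then obtain B where B: "e \<in> edges n" "B \<in> R" "e \<subseteq> B" by (auto simp: inner_edges_def)
        have "\<exists>C\<in>Q. B \<subseteq> C" using ref B(2) unfolding refines_def by (elim conjE) (erule bspec)
        then show "e \<in> inner_edges n Q" using B(1,3) unfolding inner_edges_def by blast
      qed
      have fin: "finite (inner_edges n Q)"
        by (rule finite_subset[OF _ edges_finite[of n]]) (auto simp: inner_edges_def)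
      have "inner_edges n R = inner_edges n Q" using card_seteq[OF fin sub le] .
      then have "star_forest Q \<subseteq> inner_edges n R"
        using star_forest_refines[OF S(2)[OF Q(1)] S(2)[OF Q(1)]] refines_refl[OF S(2)[OF Q(1)]] by simp
      then have "refines {1..n} Q R" using star_forest_refines[OF S(2)[OF Q(1)] S(2)[OF R]] by simp
      then show False using refines_asym[OF ref] False by blast
    qed
    then show ?thesis using False by auto
  qed
  then have "(\<Sum>R\<in>S. c R * (if refines {1..n} R Q then 1 else 0)) = (\<Sum>R\<in>S. if R = Q then c Q else 0)"
    by (rule sum.cong[OF refl])
  then show False using sum0[OF Q(1)] Q S(1) by simp
qed

section \<open>The associated graded ideal\<close>

lemma lookup_hom_component:
  "Poly_Mapping.lookup (hom_component d p) m = (if monom_deg m = d then Poly_Mapping.lookup p m else 0)"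
proof -
  have "Poly_Mapping.lookup (hom_component d p) m
      = (\<Sum>m'\<in>{m' \<in> Poly_Mapping.keys p. monom_deg m' = d}. if m' = m then Poly_Mapping.lookup p m' else 0)"
    by (simp add: hom_component_def lookup_sum lookup_single when_def)
  also have "\<dots> = (if monom_deg m = d then Poly_Mapping.lookup p m else 0)"
    by (simp add: in_keys_iff)
  finally show ?thesis .
qed

lemma hom_component_add: "hom_component d (p + q) = hom_component d p + hom_component d q"
  by (rule poly_mapping_eqI) (simp add: lookup_hom_component lookup_add)

lemma hom_component_sum: "hom_component d (\<Sum>i\<in>A. f i) = (\<Sum>i\<in>A. hom_component d (f i))"
  by (rule poly_mapping_eqI) (simp add: lookup_hom_component lookup_sum)

lemma hom_component_uminus: "hom_component d (- p) = - hom_component d (p :: ('v, complex) mpoly)"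
  by (rule poly_mapping_eqI) (simp add: lookup_hom_component)

lemma hom_component_single:
  "hom_component d (Poly_Mapping.single m a) = (if monom_deg m = d then Poly_Mapping.single m a else 0)"
  by (rule poly_mapping_eqI) (auto simp: lookup_hom_component lookup_single when_def)

lemma hom_component_homogeneous: "homogeneous d f \<Longrightarrow> hom_component d f = f"
  by (rule poly_mapping_eqI) (auto simp: lookup_hom_component homogeneous_def in_keys_iff)

lemma homogeneous_hom_component: "homogeneous d (hom_component d f)"
  by (auto simp: homogeneous_def in_keys_iff lookup_hom_component split: if_splits)

lemma hom_component_single_mult:
  fixes f :: "('v, complex) mpoly"
  shows "hom_component d (Poly_Mapping.single m a * f) =
    (if monom_deg m \<le> d then Poly_Mapping.single m a * hom_component (d - monom_deg m) f else 0)"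
proof -
  have 1: "hom_component d (Poly_Mapping.single m a * Poly_Mapping.single m' b) =
    (if monom_deg m \<le> d then Poly_Mapping.single m a * hom_component (d - monom_deg m) (Poly_Mapping.single m' b) else 0)"
    for m' b
    by (auto simp: mult_single hom_component_single monom_deg_add)
  have "hom_component d (Poly_Mapping.single m a * f) = (\<Sum>m'\<in>Poly_Mapping.keys f.
      hom_component d (Poly_Mapping.single m a * Poly_Mapping.single m' (Poly_Mapping.lookup f m')))"
    by (subst sum_singles[of f]) (simp only: sum_distrib_left hom_component_sum)
  also have "\<dots> = (if monom_deg m \<le> d then Poly_Mapping.single m a * hom_component (d - monom_deg m)
      (\<Sum>m'\<in>Poly_Mapping.keys f. Poly_Mapping.single m' (Poly_Mapping.lookup f m')) else 0)"
    by (simp add: 1 hom_component_sum sum_distrib_left)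
  also have "(\<Sum>m'\<in>Poly_Mapping.keys f. Poly_Mapping.single m' (Poly_Mapping.lookup f m')) = f"
    by (rule sum_singles[symmetric])
  finally show ?thesis .
qed

definition edge_polys :: "nat \<Rightarrow> (nat set, complex) mpoly set" where
  "edge_polys n = {p. \<forall>m\<in>Poly_Mapping.keys p. Poly_Mapping.keys m \<subseteq> edges n}"

lemma edge_ring_simps [simp]:
  "carrier (edge_poly_ring n) = edge_polys n" "x \<otimes>\<^bsub>edge_poly_ring n\<^esub> y = x * y"
  "\<one>\<^bsub>edge_poly_ring n\<^esub> = 1" "\<zero>\<^bsub>edge_poly_ring n\<^esub> = 0" "x \<oplus>\<^bsub>edge_poly_ring n\<^esub> y = x + y"
  by (simp_all add: edge_poly_ring_def edge_polys_def)

lemma edge_polys_add: "p \<in> edge_polys n \<Longrightarrow> q \<in> edge_polys n \<Longrightarrow> p + q \<in> edge_polys n"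
  using keys_add[of p q] by (auto simp: edge_polys_def)

lemma edge_polys_uminus: "p \<in> edge_polys n \<Longrightarrow> - p \<in> edge_polys n"
  by (auto simp: edge_polys_def in_keys_iff)

lemma edge_polys_diff: "p \<in> edge_polys n \<Longrightarrow> q \<in> edge_polys n \<Longrightarrow> p - q \<in> edge_polys n"
  using edge_polys_add[of p n "- q"] edge_polys_uminus[of q n] by simp

lemma edge_polys_mult: "p \<in> edge_polys n \<Longrightarrow> q \<in> edge_polys n \<Longrightarrow> p * q \<in> edge_polys n"
  unfolding edge_polys_def
proof (intro CollectI ballI)
  fix m assume pq: "p \<in> {p. \<forall>m\<in>Poly_Mapping.keys p. Poly_Mapping.keys m \<subseteq> edges n}"
    "q \<in> {p. \<forall>m\<in>Poly_Mapping.keys p. Poly_Mapping.keys m \<subseteq> edges n}" and "m \<in> Poly_Mapping.keys (p * q)"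
  then obtain a b where "a \<in> Poly_Mapping.keys p" "b \<in> Poly_Mapping.keys q" "m = a + b"
    using keys_mult[of p q] by blast
  then show "Poly_Mapping.keys m \<subseteq> edges n" using pq keys_add[of a b] by blast
qed

lemma edge_polys_zero: "0 \<in> edge_polys n" and edge_polys_one: "1 \<in> edge_polys n"
  by (simp_all add: edge_polys_def)

lemma edge_polys_sum: "(\<And>i. i \<in> A \<Longrightarrow> f i \<in> edge_polys n) \<Longrightarrow> (\<Sum>i\<in>A. f i) \<in> edge_polys n"
  by (induction A rule: infinite_finite_induct) (auto simp: edge_polys_zero edge_polys_add)

lemma edge_polys_single: "Poly_Mapping.keys m \<subseteq> edges n \<Longrightarrow> Poly_Mapping.single m a \<in> edge_polys n"
  by (cases "a = 0") (auto simp: edge_polys_def)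

lemma edge_polys_hom_component: "f \<in> edge_polys n \<Longrightarrow> hom_component d f \<in> edge_polys n"
  by (auto simp: edge_polys_def in_keys_iff lookup_hom_component split: if_splits)

lemma edge_poly_cring: "cring (edge_poly_ring n)"
proof (rule cringI)
  show "abelian_group (edge_poly_ring n)"
  proof (rule abelian_groupI)
    fix x assume "x \<in> carrier (edge_poly_ring n)"
    then show "\<exists>y\<in>carrier (edge_poly_ring n). y \<oplus>\<^bsub>edge_poly_ring n\<^esub> x = \<zero>\<^bsub>edge_poly_ring n\<^esub>"
      by (intro bexI[of _ "- x"]) (simp_all add: edge_polys_uminus)
  qed (simp_all add: edge_polys_add edge_polys_zero algebra_simps)
  show "comm_monoid (edge_poly_ring n)"
    by (rule comm_monoidI) (simp_all add: edge_polys_mult edge_polys_one algebra_simps)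
qed (simp_all add: distrib_right)

lemma edge_ring_a_inv:
  assumes "x \<in> edge_polys n"
  shows "\<ominus>\<^bsub>edge_poly_ring n\<^esub> x = - x"
proof -
  interpret cring "edge_poly_ring n" by (rule edge_poly_cring)
  have "- x \<oplus>\<^bsub>edge_poly_ring n\<^esub> x = \<zero>\<^bsub>edge_poly_ring n\<^esub>" by simp
  from minus_equality[OF this] assms edge_polys_uminus show ?thesis by simp
qed

lemma edge_ring_minus:
  "x \<in> edge_polys n \<Longrightarrow> y \<in> edge_polys n \<Longrightarrow> x \<ominus>\<^bsub>edge_poly_ring n\<^esub> y = x - y"
  by (simp add: a_minus_def edge_ring_a_inv)

abbreviation point_value :: "(nat set \<Rightarrow> complex) \<Rightarrow> (nat set, complex) mpoly \<Rightarrow> complex" where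
  "point_value \<equiv> mpoly_eval (\<lambda>c. c)"

lemma ring_map_id: "ring_map (\<lambda>c :: complex. c)"
  by (simp add: ring_map_def)

lemma point_value_uminus: "point_value z (- f) = - point_value z f"
  using mpoly_eval_add[OF ring_map_id, of z f "- f"] by (simp add: eq_neg_iff_add_eq_0 add.commute)

lemma point_value_diff: "point_value z (f - g) = point_value z f - point_value z g"
  using mpoly_eval_add[OF ring_map_id, of z f "- g"] by (simp add: point_value_uminus)

definition low_degree :: "nat \<Rightarrow> (nat set, complex) mpoly \<Rightarrow> bool" where
  "low_degree d g \<longleftrightarrow> (\<forall>m\<in>Poly_Mapping.keys g. monom_deg m < d)"

lemma low_degree_add: "low_degree d f \<Longrightarrow> low_degree d g \<Longrightarrow> low_degree d (f + g)"
  using keys_add[of f g] by (auto simp: low_degree_def)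

lemma low_degree_uminus: "low_degree d f \<Longrightarrow> low_degree d (- f)"
  by (auto simp: low_degree_def in_keys_iff)

lemma low_degree_sum: "(\<And>i. i \<in> A \<Longrightarrow> low_degree d (f i)) \<Longrightarrow> low_degree d (\<Sum>i\<in>A. f i)"
  by (induction A rule: infinite_finite_induct) (auto simp: low_degree_add, auto simp: low_degree_def)

text \<open>For \<open>f\<close> homogeneous of degree \<open>d\<close> this is membership in the associated graded ideal
  (\<open>homogeneous_graded_iff\<close>), expressed by the values on \<open>Z\<close>: then \<open>f\<close> is the top component of
  \<open>f - g\<close>, which vanishes on \<open>Z\<close>.\<close>

definition degree_drops :: "nat \<Rightarrow> (nat set \<Rightarrow> complex) set \<Rightarrow> nat \<Rightarrow> (nat set, complex) mpoly \<Rightarrow> bool" where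
  "degree_drops n Z d f \<longleftrightarrow>
     (\<exists>g\<in>edge_polys n. low_degree d g \<and> (\<forall>z\<in>Z. point_value z f = point_value z g))"

lemma degree_drops_add:
  assumes "degree_drops n Z d f" "degree_drops n Z d f'"
  shows "degree_drops n Z d (f + f')"
proof -
  obtain g g' where "g \<in> edge_polys n" "low_degree d g" "\<forall>z\<in>Z. point_value z f = point_value z g"
    "g' \<in> edge_polys n" "low_degree d g'" "\<forall>z\<in>Z. point_value z f' = point_value z g'"
    using assms unfolding degree_drops_def by blast
  then show ?thesis unfolding degree_drops_def
    by (intro bexI[of _ "g + g'"]) (simp_all add: mpoly_eval_add[OF ring_map_id] low_degree_add edge_polys_add)
qed

lemma degree_drops_zero: "degree_drops n Z d 0"
  unfolding degree_drops_def by (intro bexI[of _ 0]) (simp_all add: low_degree_def edge_polys_zero)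

lemma degree_drops_uminus:
  assumes "degree_drops n Z d f"
  shows "degree_drops n Z d (- f)"
proof -
  obtain g where "g \<in> edge_polys n" "low_degree d g" "\<forall>z\<in>Z. point_value z f = point_value z g"
    using assms unfolding degree_drops_def by blast
  then show ?thesis unfolding degree_drops_def
    by (intro bexI[of _ "- g"]) (simp_all add: point_value_uminus low_degree_uminus edge_polys_uminus)
qed

lemma degree_drops_single_mult:
  assumes m: "Poly_Mapping.keys m \<subseteq> edges n" and f: "degree_drops n Z d f"
  shows "degree_drops n Z (d + monom_deg m) (Poly_Mapping.single m a * f)"
proof -
  obtain g where g: "g \<in> edge_polys n" "low_degree d g" "\<forall>z\<in>Z. point_value z f = point_value z g"
    using f unfolding degree_drops_def by blast
  have "low_degree (d + monom_deg m) (Poly_Mapping.single m a * g)"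
    unfolding low_degree_def
  proof
    fix k assume "k \<in> Poly_Mapping.keys (Poly_Mapping.single m a * g)"
    then obtain k1 k2 where "k1 \<in> Poly_Mapping.keys (Poly_Mapping.single m a)" "k2 \<in> Poly_Mapping.keys g" "k = k1 + k2"
      using keys_mult[of "Poly_Mapping.single m a" g] by blast
    then show "monom_deg k < d + monom_deg m"
      using g(2) by (auto simp: low_degree_def monom_deg_add split: if_splits)
  qed
  then show ?thesis
    unfolding degree_drops_def using g m
    by (intro bexI[of _ "Poly_Mapping.single m a * g"])
       (simp_all add: mpoly_eval_mult[OF ring_map_id] edge_polys_mult edge_polys_single)
qed

text \<open>An explicit description of the associated graded ideal. That it is an ideal yields one inclusion in
  \<open>gr_ideal_eq\<close>; the other inclusion holds because every homogeneous component is a top component of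
  an element of the vanishing ideal.\<close>

definition graded_ideal :: "nat \<Rightarrow> (nat set \<Rightarrow> complex) set \<Rightarrow> (nat set, complex) mpoly set" where
  "graded_ideal n Z = {f \<in> edge_polys n. \<forall>d. degree_drops n Z d (hom_component d f)}"

lemma graded_ideal_add: "f \<in> graded_ideal n Z \<Longrightarrow> g \<in> graded_ideal n Z \<Longrightarrow> f + g \<in> graded_ideal n Z"
  by (simp add: graded_ideal_def edge_polys_add hom_component_add degree_drops_add)

lemma graded_ideal_uminus: "f \<in> graded_ideal n Z \<Longrightarrow> - f \<in> graded_ideal n Z"
  by (simp add: graded_ideal_def edge_polys_uminus hom_component_uminus degree_drops_uminus)

lemma graded_ideal_zero: "0 \<in> graded_ideal n Z"
proof -
  have "hom_component d 0 = (0 :: (nat set, complex) mpoly)" for d by (simp add: hom_component_def)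
  then show ?thesis by (simp add: graded_ideal_def edge_polys_zero degree_drops_zero)
qed

lemma graded_ideal_sum: "(\<And>i. i \<in> A \<Longrightarrow> f i \<in> graded_ideal n Z) \<Longrightarrow> (\<Sum>i\<in>A. f i) \<in> graded_ideal n Z"
  by (induction A rule: infinite_finite_induct) (auto simp: graded_ideal_zero graded_ideal_add)

lemma graded_ideal_mult:
  assumes p: "p \<in> edge_polys n" and f: "f \<in> graded_ideal n Z"
  shows "p * f \<in> graded_ideal n Z"
proof -
  have single: "Poly_Mapping.single m a * f \<in> graded_ideal n Z" if m: "Poly_Mapping.keys m \<subseteq> edges n" for m a
  proof -
    have "degree_drops n Z d (hom_component d (Poly_Mapping.single m a * f))" for d
    proof (cases "monom_deg m \<le> d")
      case True
      have "degree_drops n Z (d - monom_deg m + monom_deg m)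
          (Poly_Mapping.single m a * hom_component (d - monom_deg m) f)"
        using f by (intro degree_drops_single_mult[OF m]) (simp add: graded_ideal_def)
      then show ?thesis using True by (simp add: hom_component_single_mult)
    next
      case False
      then show ?thesis by (simp add: hom_component_single_mult degree_drops_zero)
    qed
    then show ?thesis
      using f m by (simp add: graded_ideal_def edge_polys_mult edge_polys_single)
  qed
  have "p * f = (\<Sum>m\<in>Poly_Mapping.keys p. Poly_Mapping.single m (Poly_Mapping.lookup p m) * f)"
    by (subst sum_singles[of p]) (rule sum_distrib_right)
  also have "\<dots> \<in> graded_ideal n Z"
    using p by (intro graded_ideal_sum single) (auto simp: edge_polys_def)
  finally show ?thesis .
qed

lemma graded_ideal_ideal: "ideal (graded_ideal n Z) (edge_poly_ring n)"
proof (rule idealI)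
  interpret cring "edge_poly_ring n" by (rule edge_poly_cring)
  show "ring (edge_poly_ring n)" by (rule ring_axioms)
  have sub: "graded_ideal n Z \<subseteq> edge_polys n" by (auto simp: graded_ideal_def)
  show "subgroup (graded_ideal n Z) (add_monoid (edge_poly_ring n))"
  proof
    show "graded_ideal n Z \<subseteq> carrier (add_monoid (edge_poly_ring n))" using sub by simp
    show "x \<otimes>\<^bsub>add_monoid (edge_poly_ring n)\<^esub> y \<in> graded_ideal n Z"
      if "x \<in> graded_ideal n Z" "y \<in> graded_ideal n Z" for x y
      using that graded_ideal_add by simp
    show "\<one>\<^bsub>add_monoid (edge_poly_ring n)\<^esub> \<in> graded_ideal n Z" by (simp add: graded_ideal_zero)
    show "inv\<^bsub>add_monoid (edge_poly_ring n)\<^esub> x \<in> graded_ideal n Z" if x: "x \<in> graded_ideal n Z" for x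
    proof -
      have "inv\<^bsub>add_monoid (edge_poly_ring n)\<^esub> x = - x"
        using edge_ring_a_inv[of x n] x sub by (auto simp: a_inv_def)
      then show ?thesis using graded_ideal_uminus[OF x] by simp
    qed
  qed
next
  fix f p assume f: "f \<in> graded_ideal n Z" and p: "p \<in> carrier (edge_poly_ring n)"
  then show "p \<otimes>\<^bsub>edge_poly_ring n\<^esub> f \<in> graded_ideal n Z" by (simp add: graded_ideal_mult)
  then show "f \<otimes>\<^bsub>edge_poly_ring n\<^esub> p \<in> graded_ideal n Z" by (simp add: mult.commute)
qed

lemma top_in_edge_polys: "f \<in> edge_polys n \<Longrightarrow> top_component f \<in> edge_polys n"
  by (simp add: top_component_def edge_polys_hom_component)

lemma monom_deg_le_total_deg: "m \<in> Poly_Mapping.keys f \<Longrightarrow> monom_deg m \<le> total_deg f"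
  by (simp add: total_deg_def)

lemma top_component_graded:
  assumes "f \<in> vanishing_ideal n Z"
  shows "top_component f \<in> graded_ideal n Z"
proof -
  have f: "f \<in> edge_polys n" "\<forall>z\<in>Z. point_value z f = 0" using assms by (auto simp: vanishing_ideal_def)
  let ?t = "top_component f"
  have t: "?t \<in> edge_polys n" using f(1) by (rule top_in_edge_polys)
  have "degree_drops n Z d (hom_component d ?t)" for d
  proof (cases "d = total_deg f")
    case True
    have "low_degree d (?t - f)"
      unfolding low_degree_def
    proof
      fix m assume m: "m \<in> Poly_Mapping.keys (?t - f)"
      then have "Poly_Mapping.lookup f m \<noteq> 0 \<and> monom_deg m \<noteq> total_deg f"
        by (auto simp: in_keys_iff lookup_minus top_component_def lookup_hom_component split: if_splits)
      then show "monom_deg m < d"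
        using monom_deg_le_total_deg[of m f] True by (auto simp: in_keys_iff)
    qed
    moreover have "hom_component d ?t = ?t"
      unfolding True top_component_def by (rule hom_component_homogeneous[OF homogeneous_hom_component])
    ultimately show ?thesis
      unfolding degree_drops_def using f t
      by (intro bexI[of _ "?t - f"]) (simp_all add: point_value_diff edge_polys_diff)
  next
    case False
    then have "hom_component d ?t = 0"
      by (intro poly_mapping_eqI) (simp add: lookup_hom_component top_component_def)
    then show ?thesis by (simp add: degree_drops_zero)
  qed
  then show ?thesis using t by (simp add: graded_ideal_def)
qed

lemma gr_ideal_eq: "gr_ideal n Z = graded_ideal n Z"
proof (intro equalityI subsetI)
  interpret cring "edge_poly_ring n" by (rule edge_poly_cring)
  let ?T = "top_component ` (vanishing_ideal n Z - {0})"
  have T: "?T \<subseteq> carrier (edge_poly_ring n)"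
    using top_in_edge_polys by (auto simp: vanishing_ideal_def)
  interpret gr: ideal "gr_ideal n Z" "edge_poly_ring n"
    unfolding gr_ideal_def by (rule genideal_ideal[OF T])
  {
    fix f assume "f \<in> gr_ideal n Z"
    moreover have "gr_ideal n Z \<subseteq> graded_ideal n Z"
      unfolding gr_ideal_def
      by (rule genideal_minimal[OF graded_ideal_ideal]) (auto simp: top_component_graded)
    ultimately show "f \<in> graded_ideal n Z" by blast
  next
    fix f assume f: "f \<in> graded_ideal n Z"
    have hom: "hom_component d f \<in> gr_ideal n Z" for d
    proof (cases "hom_component d f = 0")
      case True
      then show ?thesis using additive_subgroup.zero_closed[OF gr.additive_subgroup_axioms] by simp
    next
      case False
      let ?h = "hom_component d f"
      obtain g where g: "g \<in> edge_polys n" "low_degree d g" "\<forall>z\<in>Z. point_value z ?h = point_value z g"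
        using f unfolding graded_ideal_def degree_drops_def by blast
      have h: "?h \<in> edge_polys n" using f by (simp add: graded_ideal_def edge_polys_hom_component)
      have look: "Poly_Mapping.lookup (?h - g) m = (if monom_deg m = d then Poly_Mapping.lookup f m else - Poly_Mapping.lookup g m)" for m
      proof -
        have "Poly_Mapping.lookup g m = 0" if "monom_deg m = d"
          using g(2) that unfolding low_degree_def by (cases "m \<in> Poly_Mapping.keys g") (auto simp: in_keys_iff)
        then show ?thesis by (simp add: lookup_minus lookup_hom_component)
      qed
      obtain m where "Poly_Mapping.lookup ?h m \<noteq> 0" using False by (auto simp: poly_mapping_eq_iff fun_eq_iff)
      then have m: "monom_deg m = d" "Poly_Mapping.lookup f m \<noteq> 0"
        by (auto simp: lookup_hom_component split: if_splits)
      have mk: "m \<in> Poly_Mapping.keys (?h - g)" using m by (simp add: in_keys_iff look)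
      have le: "monom_deg m' \<le> d" if "m' \<in> Poly_Mapping.keys (?h - g)" for m'
      proof (cases "monom_deg m' = d")
        case False
        then have "m' \<in> Poly_Mapping.keys g" using that by (simp add: in_keys_iff look)
        then show ?thesis using g(2) by (auto simp: low_degree_def)
      qed simp
      have "total_deg (?h - g) = d"
        unfolding total_deg_def
      proof (rule Max_eqI)
        show "d \<in> monom_deg ` Poly_Mapping.keys (?h - g)" using mk m(1) by (auto intro: rev_image_eqI)
      qed (use le in auto)
      then have "top_component (?h - g) = ?h"
        by (intro poly_mapping_eqI) (simp add: top_component_def lookup_hom_component[of _ "?h - g"] look, simp add: lookup_hom_component)
      moreover have "?h - g \<in> vanishing_ideal n Z - {0}"
        using g h mk by (auto simp: vanishing_ideal_def point_value_diff edge_polys_diff)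
      ultimately have "?h \<in> ?T" by (intro rev_image_eqI[of "?h - g"]) simp_all
      then show ?thesis unfolding gr_ideal_def using genideal_self[OF T] by blast
    qed
    have split: "f = (\<Sum>d\<in>monom_deg ` Poly_Mapping.keys f. hom_component d f)"
      by (rule poly_mapping_eqI) (auto simp: lookup_sum lookup_hom_component in_keys_iff)
    have "(\<Sum>d\<in>D. hom_component d f) \<in> gr_ideal n Z" if "finite D" for D
      using that
    proof (induction D)
      case empty
      then show ?case using additive_subgroup.zero_closed[OF gr.additive_subgroup_axioms] by simp
    next
      case (insert d D)
      then show ?case
        using additive_subgroup.a_closed[OF gr.additive_subgroup_axioms hom[of d], of "\<Sum>d\<in>D. hom_component d f"] by simp
    qed
    then have "(\<Sum>d\<in>monom_deg ` Poly_Mapping.keys f. hom_component d f) \<in> gr_ideal n Z"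
      using finite_imageI[OF finite_keys[of f], of monom_deg] by blast
    then show "f \<in> gr_ideal n Z" using split by metis
  }
qed

lemma homogeneous_graded_iff:
  assumes "f \<in> edge_polys n" "homogeneous d f"
  shows "f \<in> graded_ideal n Z \<longleftrightarrow> degree_drops n Z d f"
proof
  assume "f \<in> graded_ideal n Z"
  then have "degree_drops n Z d (hom_component d f)" by (simp add: graded_ideal_def)
  then show "degree_drops n Z d f" by (simp add: hom_component_homogeneous[OF assms(2)])
next
  assume f: "degree_drops n Z d f"
  have "degree_drops n Z e (hom_component e f)" for e
  proof (cases "e = d")
    case True
    then show ?thesis using f by (simp add: hom_component_homogeneous[OF assms(2)])
  next
    case False
    then have "hom_component e f = 0"
      using assms(2) by (intro poly_mapping_eqI) (auto simp: lookup_hom_component homogeneous_def in_keys_iff)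
    then show ?thesis by (simp add: degree_drops_zero)
  qed
  then show "f \<in> graded_ideal n Z" using assms(1) by (simp add: graded_ideal_def)
qed

section \<open>The graded pieces of the orbit harmonics ring\<close>

lemma lookup_edge_sum:
  "finite E \<Longrightarrow> Poly_Mapping.lookup (\<Sum>e\<in>E. Poly_Mapping.single e (1::nat)) x = (if x \<in> E then 1 else 0)"
  by (simp add: lookup_sum lookup_single when_def)

definition forest_monom :: "nat set set \<Rightarrow> nat set \<Rightarrow>\<^sub>0 nat" where
  "forest_monom P = (\<Sum>e\<in>star_forest P. Poly_Mapping.single e 1)"

lemma forest_monom_props:
  assumes "partition_on {1..n} P"
  shows "Poly_Mapping.keys (forest_monom P) = star_forest P" "monom_deg (forest_monom P) + card P = n"
proof -
  have fin: "finite (star_forest P)"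
    using star_forest_edges[OF assms] edges_finite finite_subset by blast
  show keys: "Poly_Mapping.keys (forest_monom P) = star_forest P"
    using lookup_edge_sum[OF fin] by (auto simp: forest_monom_def in_keys_iff split: if_splits)
  have "monom_deg (forest_monom P) = (\<Sum>e\<in>star_forest P. 1)"
    unfolding monom_deg_def keys by (intro sum.cong) (simp_all add: forest_monom_def lookup_edge_sum[OF fin])
  then show "monom_deg (forest_monom P) + card P = n" using card_star_forest[OF assms] by simp
qed

lemma forest_monom_edges: "partition_on {1..n} P \<Longrightarrow> Poly_Mapping.keys (forest_monom P) \<subseteq> edges n"
  using forest_monom_props(1) star_forest_edges by blast

lemma partition_point_edge:
  "e \<in> edges n \<Longrightarrow> partition_point n Q e = (if e \<in> inner_edges n Q then 1 else 0)"
  by (simp add: partition_point_def inner_edges_def)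

lemma value_monomial:
  assumes "Poly_Mapping.keys k \<subseteq> edges n"
  shows "point_value (partition_point n Q) (Poly_Mapping.single k a) =
    (if Poly_Mapping.keys k \<subseteq> inner_edges n Q then a else 0)"
proof -
  have "monom_value (partition_point n Q) k = (if Poly_Mapping.keys k \<subseteq> inner_edges n Q then 1 else 0)"
  proof (cases "Poly_Mapping.keys k \<subseteq> inner_edges n Q")
    case True
    have "partition_point n Q e = 1" if e: "e \<in> Poly_Mapping.keys k" for e
    proof -
      have "e \<in> edges n" "e \<in> inner_edges n Q" using e True assms by blast+
      then show ?thesis by (simp add: partition_point_edge)
    qed
    then show ?thesis using True by (simp add: monom_value_def)
  next
    case False
    then obtain e where e: "e \<in> Poly_Mapping.keys k" "e \<notin> inner_edges n Q" by blast
    have "e \<in> edges n" using e assms by blast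
    then have "partition_point n Q e ^ Poly_Mapping.lookup k e = 0"
      using e by (simp add: partition_point_edge in_keys_iff zero_power)
    then have "monom_value (partition_point n Q) k = 0"
      unfolding monom_value_def using e(1) by (intro prod_zero) auto
    then show ?thesis using False by simp
  qed
  then show ?thesis by (simp add: mpoly_eval_single)
qed

lemma value_forest:
  assumes "partition_on {1..n} P" "partition_on {1..n} Q"
  shows "point_value (partition_point n Q) (Poly_Mapping.single (forest_monom P) a) =
    (if refines {1..n} P Q then a else 0)"
  using value_monomial[OF forest_monom_edges[OF assms(1)], of Q a]
    star_forest_refines[OF assms] forest_monom_props(1)[OF assms(1)] by simp

lemma bounded_partitions_on: "P \<in> bounded_partitions n m \<Longrightarrow> partition_on {1..n} P"
  by (simp add: bounded_partitions_def)

lemma refines_bounded: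
  assumes "refines {1..n} P Q" "Q \<in> bounded_partitions n m"
  shows "P \<in> bounded_partitions n m"
proof -
  have "card B \<le> m" if B: "B \<in> P" for B
  proof -
    obtain C where C: "C \<in> Q" "B \<subseteq> C" using assms(1) B by (auto simp: refines_def)
    have "card B \<le> card C"
      using partition_block_finite[OF bounded_partitions_on[OF assms(2)] C(1)] C(2) by (intro card_mono) auto
    then show ?thesis using assms(2) C(1) by (auto simp: bounded_partitions_def)
  qed
  then show ?thesis using assms(1) by (simp add: bounded_partitions_def refines_def)
qed

text \<open>\<open>P\<close> is the partition into the components of the support of the monomial. If one of them is too
  large, \<open>P\<close> refines no bounded partition.\<close>

lemma monomial_reduction:
  assumes k: "Poly_Mapping.keys k \<subseteq> edges n"
  shows "(\<forall>Q\<in>bounded_partitions n m. \<forall>a. point_value (partition_point n Q) (Poly_Mapping.single k a) = 0) \<or>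
    (\<exists>P\<in>bounded_partitions n m. n \<le> card P + monom_deg k \<and> (\<forall>Q\<in>bounded_partitions n m. \<forall>a.
      point_value (partition_point n Q) (Poly_Mapping.single k a) = (if refines {1..n} P Q then a else 0)))"
proof -
  obtain P where P: "partition_on {1..n} P" "n \<le> card P + card (Poly_Mapping.keys k)"
    "\<And>Q. partition_on {1..n} Q \<Longrightarrow> Poly_Mapping.keys k \<subseteq> inner_edges n Q \<longleftrightarrow> refines {1..n} P Q"
    using components_exist[OF finite_keys k] by blast
  have val: "point_value (partition_point n Q) (Poly_Mapping.single k a) = (if refines {1..n} P Q then a else 0)"
    if "Q \<in> bounded_partitions n m" for Q a
    using P(3)[OF bounded_partitions_on[OF that]] value_monomial[OF k] by simp
  have "card (Poly_Mapping.keys k) \<le> monom_deg k"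
  proof -
    have "(\<Sum>e\<in>Poly_Mapping.keys k. 1) \<le> (\<Sum>e\<in>Poly_Mapping.keys k. Poly_Mapping.lookup k e)"
    proof (rule sum_mono)
      fix e assume "e \<in> Poly_Mapping.keys k"
      then have "0 < Poly_Mapping.lookup k e" by (simp add: in_keys_iff)
      then show "1 \<le> Poly_Mapping.lookup k e" by linarith
    qed
    then show ?thesis by (simp add: monom_deg_def)
  qed
  then have "n \<le> card P + monom_deg k" using P(2) by simp
  show ?thesis
  proof (cases "P \<in> bounded_partitions n m")
    case True
    then show ?thesis
      using val \<open>n \<le> card P + monom_deg k\<close> by (intro disjI2 bexI[of _ P] conjI ballI allI)
  next
    case False
    then have "\<not> refines {1..n} P Q" if "Q \<in> bounded_partitions n m" for Q
      using refines_bounded[of n P Q m] that by blast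
    then show ?thesis by (intro disjI1 ballI allI) (simp add: val)
  qed
qed

text \<open>A monomial of degree below \<open>d\<close> has more than \<open>n - d\<close> components.\<close>

lemma low_degree_values:
  assumes g: "g \<in> edge_polys n" "low_degree d g"
  shows "\<exists>c. \<forall>Q\<in>bounded_partitions n m. point_value (partition_point n Q) g =
    (\<Sum>P\<in>{P \<in> bounded_partitions n m. n < card P + d}. c P * (if refines {1..n} P Q then 1 else 0))"
proof -
  let ?L = "{P \<in> bounded_partitions n m. n < card P + d}"
  have finL: "finite ?L" using bounded_partitions_finite by simp
  have "\<exists>c. \<forall>Q\<in>bounded_partitions n m.
      point_value (partition_point n Q) (\<Sum>k\<in>K. Poly_Mapping.single k (Poly_Mapping.lookup g k)) =
      (\<Sum>P\<in>?L. c P * (if refines {1..n} P Q then 1 else 0))"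
    if "finite K" "K \<subseteq> Poly_Mapping.keys g" for K
    using that
  proof (induction K)
    case empty
    then show ?case by (intro exI[of _ "\<lambda>_. 0"]) simp
  next
    case (insert k K)
    then obtain c where c: "\<And>Q. Q \<in> bounded_partitions n m \<Longrightarrow>
      point_value (partition_point n Q) (\<Sum>k\<in>K. Poly_Mapping.single k (Poly_Mapping.lookup g k)) =
      (\<Sum>P\<in>?L. c P * (if refines {1..n} P Q then 1 else 0))" by auto
    have kk: "Poly_Mapping.keys k \<subseteq> edges n" and kd: "monom_deg k < d"
      using g insert.prems by (auto simp: edge_polys_def low_degree_def)
    let ?a = "Poly_Mapping.lookup g k"
    have split: "point_value (partition_point n Q) (\<Sum>k\<in>insert k K. Poly_Mapping.single k (Poly_Mapping.lookup g k))
      = point_value (partition_point n Q) (Poly_Mapping.single k ?a)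
        + (\<Sum>P\<in>?L. c P * (if refines {1..n} P Q then 1 else 0))" if "Q \<in> bounded_partitions n m" for Q
      using insert.hyps c[OF that] by (simp add: mpoly_eval_add[OF ring_map_id])
    from monomial_reduction[OF kk, of m] show ?case
    proof
      assume "\<forall>Q\<in>bounded_partitions n m. \<forall>a. point_value (partition_point n Q) (Poly_Mapping.single k a) = 0"
      then show ?thesis using split by (intro exI[of _ c]) simp
    next
      assume "\<exists>P\<in>bounded_partitions n m. n \<le> card P + monom_deg k \<and> (\<forall>Q\<in>bounded_partitions n m. \<forall>a.
        point_value (partition_point n Q) (Poly_Mapping.single k a) = (if refines {1..n} P Q then a else 0))"
      then obtain P0 where P0: "P0 \<in> ?L" "\<And>Q a. Q \<in> bounded_partitions n m \<Longrightarrow>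
        point_value (partition_point n Q) (Poly_Mapping.single k a) = (if refines {1..n} P0 Q then a else 0)"
      proof (elim bexE conjE)
        fix P assume P: "P \<in> bounded_partitions n m" "n \<le> card P + monom_deg k"
          "\<forall>Q\<in>bounded_partitions n m. \<forall>a. point_value (partition_point n Q) (Poly_Mapping.single k a) =
            (if refines {1..n} P Q then a else 0)"
        show thesis
        proof (rule that)
          show "P \<in> ?L" using P(1,2) kd by simp
        qed (use P(3) in blast)
      qed
      define c' where "c' P = c P + (if P = P0 then ?a else 0)" for P
      have "(\<Sum>P\<in>?L. c' P * (if refines {1..n} P Q then 1 else 0)) =
        (if refines {1..n} P0 Q then ?a else 0) + (\<Sum>P\<in>?L. c P * (if refines {1..n} P Q then 1 else 0))" for Q
      proof -
        have "(\<Sum>P\<in>?L. c' P * (if refines {1..n} P Q then 1 else 0)) =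
          (\<Sum>P\<in>?L. (if P = P0 then (if refines {1..n} P0 Q then ?a else 0) else 0)
             + c P * (if refines {1..n} P Q then 1 else 0))"
          by (intro sum.cong) (auto simp: c'_def)
        also have "\<dots> = (\<Sum>P\<in>?L. if P = P0 then (if refines {1..n} P0 Q then ?a else 0) else 0)
             + (\<Sum>P\<in>?L. c P * (if refines {1..n} P Q then 1 else 0))"
          by (rule sum.distrib)
        also have "(\<Sum>P\<in>?L. if P = P0 then (if refines {1..n} P0 Q then ?a else 0) else 0)
            = (if refines {1..n} P0 Q then ?a else 0)"
          using P0(1) finL by (simp only: sum.delta if_True)
        finally show ?thesis .
      qed
      then show ?thesis using split P0(2) by (intro exI[of _ c']) simp
    qed
  qed
  from this[OF finite_keys order_refl] show ?thesis using sum_singles[of g] by simp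
qed

text \<open>This maps the delta function of \<open>P\<close> to the forest monomial of \<open>P\<close>. Modulo the graded ideal it is
  the isomorphism of \<open>orbit_module_iso\<close>.\<close>

definition forest_poly :: "nat \<Rightarrow> nat \<Rightarrow> nat \<Rightarrow> (nat set set \<Rightarrow> complex) \<Rightarrow> (nat set, complex) mpoly" where
  "forest_poly n m d f = (\<Sum>P\<in>level_partitions n m d. Poly_Mapping.single (forest_monom P) (f P))"

lemma level_partition_on: "P \<in> level_partitions n m d \<Longrightarrow> partition_on {1..n} P"
  by (simp add: level_partitions_def)

lemma forest_poly_mem: "forest_poly n m d f \<in> edge_polys n"
  unfolding forest_poly_def by (intro edge_polys_sum edge_polys_single forest_monom_edges level_partition_on)

lemma homogeneous_sum: "(\<And>i. i \<in> A \<Longrightarrow> homogeneous d (f i)) \<Longrightarrow> homogeneous d (\<Sum>i\<in>A. f i)"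
proof (induction A rule: infinite_finite_induct)
  case (insert x F)
  then show ?case using keys_add[of "f x" "sum f F"] by (auto simp: homogeneous_def)
qed (simp_all add: homogeneous_def)

lemma homogeneous_diff: "homogeneous d f \<Longrightarrow> homogeneous d g \<Longrightarrow> homogeneous d (f - g)"
  for f g :: "('v, complex) mpoly"
  by (metis hom_component_add hom_component_homogeneous hom_component_uminus homogeneous_hom_component
      uminus_add_conv_diff add.commute)

lemma homogeneous_single: "monom_deg k = d \<Longrightarrow> homogeneous d (Poly_Mapping.single k a)"
  by (simp add: homogeneous_def)

lemma forest_poly_homogeneous: "homogeneous d (forest_poly n m d f)"
  unfolding forest_poly_def
proof (intro homogeneous_sum homogeneous_single)
  fix P assume "P \<in> level_partitions n m d"
  then show "monom_deg (forest_monom P) = d"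
    using forest_monom_props(2)[OF level_partition_on, of P n m d] by (auto simp: level_partitions_def)
qed

lemma forest_poly_value:
  assumes "Q \<in> bounded_partitions n m"
  shows "point_value (partition_point n Q) (forest_poly n m d f) =
    (\<Sum>P\<in>level_partitions n m d. f P * (if refines {1..n} P Q then 1 else 0))"
  unfolding forest_poly_def mpoly_eval_sum[OF ring_map_id]
  by (intro sum.cong refl)
     (simp add: value_forest[OF level_partition_on bounded_partitions_on[OF assms]])

text \<open>A polynomial of smaller degree takes the values of a combination of forest monomials of partitions
  with more blocks, and no nontrivial combination of forest monomials of distinct partitions vanishes
  on all points.\<close>

lemma forest_poly_injective:
  assumes f: "f \<in> supported_on (level_partitions n m d)"
    and mem: "forest_poly n m d f \<in> graded_ideal n (bounded_partition_points n m)"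
  shows "f = 0"
proof -
  let ?B = "bounded_partitions n m" and ?X = "level_partitions n m d"
  let ?L = "{P \<in> ?B. n < card P + d}"
  have "degree_drops n (bounded_partition_points n m) d (forest_poly n m d f)"
    using mem homogeneous_graded_iff[OF forest_poly_mem forest_poly_homogeneous] by blast
  then obtain g where g: "g \<in> edge_polys n" "low_degree d g"
    "\<And>Q. Q \<in> ?B \<Longrightarrow> point_value (partition_point n Q) (forest_poly n m d f) = point_value (partition_point n Q) g"
    unfolding degree_drops_def bounded_points_image by blast
  obtain c where c: "\<And>Q. Q \<in> ?B \<Longrightarrow> point_value (partition_point n Q) g =
      (\<Sum>P\<in>?L. c P * (if refines {1..n} P Q then 1 else 0))"
    using low_degree_values[OF g(1,2), of m] by blast
  define e where "e P = (if P \<in> ?X then f P else if P \<in> ?L then - c P else 0)" for P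
  have XL: "?X \<inter> ?L = {}" "?X \<union> ?L \<subseteq> ?B" by (auto simp: level_partitions_bounded)
  have finB: "finite ?B" by (rule bounded_partitions_finite)
  have sum0: "(\<Sum>P\<in>?B. e P * (if refines {1..n} P Q then 1 else 0)) = 0" if Q: "Q \<in> ?B" for Q
  proof -
    let ?r = "\<lambda>P. if refines {1..n} P Q then 1 else (0::complex)"
    have "(\<Sum>P\<in>?B. e P * ?r P) = (\<Sum>P\<in>?X \<union> ?L. e P * ?r P)"
      using finB XL(2) by (intro sum.mono_neutral_right) (auto simp: e_def)
    also have "\<dots> = (\<Sum>P\<in>?X. e P * ?r P) + (\<Sum>P\<in>?L. e P * ?r P)"
      using finB XL finite_subset by (intro sum.union_disjoint) blast+
    also have "(\<Sum>P\<in>?X. e P * ?r P) = (\<Sum>P\<in>?X. f P * ?r P)"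
      by (intro sum.cong) (auto simp: e_def)
    also have "(\<Sum>P\<in>?L. e P * ?r P) = (\<Sum>P\<in>?L. - (c P * ?r P))"
    proof (rule sum.cong[OF refl])
      fix P assume "P \<in> ?L"
      then have "e P = - c P" using XL(1) by (auto simp: e_def)
      then show "e P * ?r P = - (c P * ?r P)" by simp
    qed
    also have "(\<Sum>P\<in>?X. f P * ?r P) = (\<Sum>P\<in>?L. c P * ?r P)"
      using forest_poly_value[OF Q, of d f] g(3)[OF Q] c[OF Q] by simp
    finally show ?thesis by (simp only: sum_negf) simp
  qed
  show ?thesis
  proof
    fix P show "f P = 0 P"
    proof (cases "P \<in> ?X")
      case True
      then have "P \<in> ?B" using XL(2) by blast
      then have "e P = 0" using refinement_independent[of ?B n e P] finB bounded_partitions_on sum0 by blast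
      then show ?thesis using True by (simp add: e_def)
    qed (use f in \<open>simp add: supported_on_def\<close>)
  qed
qed

lemma forest_poly_add: "forest_poly n m d (f + g) = forest_poly n m d f + forest_poly n m d g"
  by (simp add: forest_poly_def single_add sum.distrib)

lemma forest_poly_scale: "forest_poly n m d (fscale c f) = Const c * forest_poly n m d f"
  by (simp add: forest_poly_def sum_distrib_left Const_def mult_single)

lemma graded_if_values_agree:
  assumes "f \<in> edge_polys n" "g \<in> edge_polys n" "homogeneous d f" "homogeneous d g"
    and "\<And>Q. Q \<in> bounded_partitions n m \<Longrightarrow> point_value (partition_point n Q) f = point_value (partition_point n Q) g"
  shows "f - g \<in> graded_ideal n (bounded_partition_points n m)"
proof -
  have "degree_drops n (bounded_partition_points n m) d (f - g)"
    unfolding degree_drops_def bounded_points_image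
    using assms(5) by (intro bexI[of _ 0]) (auto simp: point_value_diff low_degree_def edge_polys_zero)
  then show ?thesis
    using homogeneous_graded_iff[OF edge_polys_diff[OF assms(1,2)] homogeneous_diff[OF assms(3,4)]] by blast
qed

text \<open>Monomial by monomial. Let \<open>P\<close> be the partition into components. If it has more than \<open>n - d\<close> blocks or
  is not bounded, the monomial lies in the graded ideal; otherwise it is congruent to the forest
  monomial of \<open>P\<close>, since both have degree \<open>d\<close> and the same values.\<close>

lemma forest_poly_surjective:
  assumes h: "h \<in> edge_polys n" "homogeneous d h"
  shows "\<exists>f\<in>supported_on (level_partitions n m d).
    h - forest_poly n m d f \<in> graded_ideal n (bounded_partition_points n m)"
proof -
  let ?I = "graded_ideal n (bounded_partition_points n m)" and ?X = "level_partitions n m d"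
  have one: "\<exists>f\<in>supported_on ?X. Poly_Mapping.single k a - forest_poly n m d f \<in> ?I"
    if k: "Poly_Mapping.keys k \<subseteq> edges n" "monom_deg k = d" for k a
  proof -
    have mono: "Poly_Mapping.single k a \<in> edge_polys n" "homogeneous d (Poly_Mapping.single k a)"
      using k by (simp_all add: edge_polys_single homogeneous_single)
    have fp0: "forest_poly n m d 0 = 0" by (simp add: forest_poly_def)
    have drop: "\<exists>f\<in>supported_on ?X. Poly_Mapping.single k a - forest_poly n m d f \<in> ?I"
      if "degree_drops n (bounded_partition_points n m) d (Poly_Mapping.single k a)"
      using that homogeneous_graded_iff[OF mono] fp0
      by (intro bexI[of _ 0]) (simp_all add: supported_on_def)
    from monomial_reduction[OF k(1), of m] show ?thesis
    proof
      assume "\<forall>Q\<in>bounded_partitions n m. \<forall>a. point_value (partition_point n Q) (Poly_Mapping.single k a) = 0"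
      then have "degree_drops n (bounded_partition_points n m) d (Poly_Mapping.single k a)"
        unfolding degree_drops_def bounded_points_image
        by (intro bexI[of _ 0]) (auto simp: low_degree_def edge_polys_zero)
      then show ?thesis by (rule drop)
    next
      assume "\<exists>P\<in>bounded_partitions n m. n \<le> card P + monom_deg k \<and> (\<forall>Q\<in>bounded_partitions n m. \<forall>a.
        point_value (partition_point n Q) (Poly_Mapping.single k a) = (if refines {1..n} P Q then a else 0))"
      then obtain P where P: "P \<in> bounded_partitions n m" "n \<le> card P + d"
        and val: "\<And>Q. Q \<in> bounded_partitions n m \<Longrightarrow>
          point_value (partition_point n Q) (Poly_Mapping.single k a) =
          point_value (partition_point n Q) (Poly_Mapping.single (forest_monom P) a)"
        using value_forest[OF bounded_partitions_on bounded_partitions_on] k(2) by auto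
      note part = bounded_partitions_on[OF P(1)]
      have deg: "monom_deg (forest_monom P) + card P = n" by (rule forest_monom_props(2)[OF part])
      have mono': "Poly_Mapping.single (forest_monom P) a \<in> edge_polys n"
        by (intro edge_polys_single forest_monom_edges part)
      show ?thesis
      proof (cases "card P + d = n")
        case True
        then have PX: "P \<in> ?X" using P(1) by (simp add: level_partitions_bounded)
        define f where "f = fscale a (delta P)"
        have fX: "f \<in> supported_on ?X"
          unfolding f_def by (intro fs.subspace_scale supported_on_subspace delta_in_supported PX)
        have "forest_poly n m d f = (\<Sum>P'\<in>?X. if P' = P then Poly_Mapping.single (forest_monom P) a else 0)"
          unfolding forest_poly_def by (intro sum.cong) (auto simp: f_def delta_def)
        also have "\<dots> = Poly_Mapping.single (forest_monom P) a"
          using PX bounded_partitions_finite[of n m] by (simp add: level_partitions_bounded)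
        finally have "forest_poly n m d f = Poly_Mapping.single (forest_monom P) a" .
        moreover have "Poly_Mapping.single k a - Poly_Mapping.single (forest_monom P) a \<in> ?I"
          using mono mono' val deg True k(2)
          by (intro graded_if_values_agree[of _ _ _ d] homogeneous_single) auto
        ultimately show ?thesis using fX by (intro bexI[of _ f]) simp_all
      next
        case False
        then have "low_degree d (Poly_Mapping.single (forest_monom P) a)"
          using deg P(2) by (simp add: low_degree_def)
        then have "degree_drops n (bounded_partition_points n m) d (Poly_Mapping.single k a)"
          unfolding degree_drops_def bounded_points_image using mono' val
          by (intro bexI[of _ "Poly_Mapping.single (forest_monom P) a"]) auto
        then show ?thesis by (rule drop)
      qed
    qed
  qed
  have "\<exists>f\<in>supported_on ?X. (\<Sum>k\<in>K. Poly_Mapping.single k (Poly_Mapping.lookup h k)) - forest_poly n m d f \<in> ?I"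
    if "finite K" "K \<subseteq> Poly_Mapping.keys h" for K
    using that
  proof (induction K)
    case empty
    have fp0: "forest_poly n m d 0 = 0" by (simp add: forest_poly_def)
    have "(\<Sum>k\<in>{}. Poly_Mapping.single k (Poly_Mapping.lookup h k)) - forest_poly n m d 0 \<in> ?I"
      unfolding fp0 by (simp add: graded_ideal_zero)
    then show ?case using fs.subspace_0[OF supported_on_subspace] by blast
  next
    case (insert k K)
    let ?s = "\<Sum>k\<in>K. Poly_Mapping.single k (Poly_Mapping.lookup h k)"
    let ?k = "Poly_Mapping.single k (Poly_Mapping.lookup h k)"
    obtain f where f: "f \<in> supported_on ?X" "?s - forest_poly n m d f \<in> ?I" using insert by auto
    have kk: "Poly_Mapping.keys k \<subseteq> edges n" "monom_deg k = d"
      using h insert.prems by (auto simp: edge_polys_def homogeneous_def)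
    obtain f' where f': "f' \<in> supported_on ?X" "?k - forest_poly n m d f' \<in> ?I"
      using one[OF kk, of "Poly_Mapping.lookup h k"] by blast
    have "(?k - forest_poly n m d f') + (?s - forest_poly n m d f) \<in> ?I"
      using f'(2) f(2) by (rule graded_ideal_add)
    moreover have "(\<Sum>k\<in>insert k K. Poly_Mapping.single k (Poly_Mapping.lookup h k)) = ?k + ?s"
      using insert.hyps by simp
    ultimately have "(\<Sum>k\<in>insert k K. Poly_Mapping.single k (Poly_Mapping.lookup h k)) - forest_poly n m d (f' + f) \<in> ?I"
      by (simp only: forest_poly_add) (simp add: algebra_simps)
    moreover have "f' + f \<in> supported_on ?X" using f'(1) f(1) by (intro fs.subspace_add supported_on_subspace)
    ultimately show ?case by blast
  qed
  from this[OF finite_keys order_refl] show ?thesis using sum_singles[of h] by simp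
qed

section \<open>The action of the symmetric group\<close>

lemma Var_power:
  "(Var v :: ('v, 'a::comm_ring_1) mpoly) ^ e = Poly_Mapping.single (Poly_Mapping.single v e) 1"
proof (induction e)
  case (Suc e)
  have "Poly_Mapping.single v 1 + Poly_Mapping.single v e = Poly_Mapping.single v (Suc e)"
    using single_add[of v 1 e] by (metis plus_1_eq_Suc)
  then show ?case using Suc by (simp add: Var_def mult_single)
qed simp

definition monom_act :: "(nat \<Rightarrow> nat) \<Rightarrow> (nat set \<Rightarrow>\<^sub>0 nat) \<Rightarrow> nat set \<Rightarrow>\<^sub>0 nat" where
  "monom_act w k = (\<Sum>e\<in>Poly_Mapping.keys k. Poly_Mapping.single (w ` e) (Poly_Mapping.lookup k e))"

lemma poly_act_single: "poly_act w (Poly_Mapping.single k a) = Poly_Mapping.single (monom_act w k) a"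
proof -
  have prod_single: "(\<Prod>e\<in>A. Poly_Mapping.single (g e) (1::complex)) = Poly_Mapping.single (\<Sum>e\<in>A. g e) 1"
    if "finite A" for A and g :: "nat set \<Rightarrow> (nat set \<Rightarrow>\<^sub>0 nat)"
    using that by (induction A) (auto simp: mult_single)
  have "monom_value (\<lambda>e. Var (w ` e)) k = Poly_Mapping.single (monom_act w k) (1::complex)"
    by (simp add: monom_value_def Var_power prod_single monom_act_def)
  moreover have "Const (0::complex) = 0" by (simp add: Const_def)
  ultimately have "poly_act w (Poly_Mapping.single k a) = Const a * Poly_Mapping.single (monom_act w k) 1"
    unfolding poly_act_def using mpoly_eval_single[of Const "\<lambda>e. Var (w ` e)" k a] by simp
  then show ?thesis by (simp add: Const_def mult_single)
qed

lemma ring_map_poly_act: "ring_map (poly_act w)"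
  unfolding poly_act_def by (rule ring_map_mpoly_eval[OF ring_map_Const])

lemma poly_act_add: "poly_act w (f + g) = poly_act w f + poly_act w g"
  using ring_map_poly_act[of w] by (simp add: ring_map_def)

lemma poly_act_expand:
  "poly_act w f = (\<Sum>k\<in>Poly_Mapping.keys f. Poly_Mapping.single (monom_act w k) (Poly_Mapping.lookup f k))"
proof -
  have "poly_act w f = poly_act w (\<Sum>k\<in>Poly_Mapping.keys f. Poly_Mapping.single k (Poly_Mapping.lookup f k))"
    using sum_singles[of f] by simp
  then show ?thesis by (simp add: ring_map_sum[OF ring_map_poly_act] poly_act_single)
qed

lemma monom_deg_act: "monom_deg (monom_act w k) = monom_deg k"
proof -
  have "monom_deg (\<Sum>e\<in>A. g e) = (\<Sum>e\<in>A. monom_deg (g e))" if "finite A"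
    for A and g :: "nat set \<Rightarrow> (nat set \<Rightarrow>\<^sub>0 nat)"
    using that by (induction A) (simp_all add: monom_deg_add, simp add: monom_deg_def)
  moreover have "monom_deg (Poly_Mapping.single x i) = i" for x :: "nat set" and i
    by (simp add: monom_deg_def)
  ultimately show ?thesis by (simp add: monom_act_def) (simp add: monom_deg_def)
qed

lemma keys_monom_act: "Poly_Mapping.keys (monom_act w k) \<subseteq> (`) w ` Poly_Mapping.keys k"
proof -
  have "Poly_Mapping.keys (\<Sum>e\<in>A. Poly_Mapping.single (w ` e) (Poly_Mapping.lookup k e)) \<subseteq> (`) w ` A"
    if "finite A" for A
    using that
  proof (induction A)
    case (insert e A)
    let ?s = "\<Sum>e\<in>A. Poly_Mapping.single (w ` e) (Poly_Mapping.lookup k e)"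
    have "Poly_Mapping.keys (Poly_Mapping.single (w ` e) (Poly_Mapping.lookup k e) + ?s) \<subseteq>
        Poly_Mapping.keys (Poly_Mapping.single (w ` e) (Poly_Mapping.lookup k e)) \<union> Poly_Mapping.keys ?s"
      by (rule keys_add)
    also have "\<dots> \<subseteq> insert (w ` e) ((`) w ` A)" using insert.IH by (auto split: if_splits)
    finally show ?case using insert.hyps by simp
  qed simp
  then show ?thesis by (simp add: monom_act_def)
qed

lemma edges_act:
  assumes "w permutes {1..n}" "e \<in> edges n"
  shows "w ` e \<in> edges n"
proof -
  have "w ` e \<subseteq> {1..n}" using assms permutes_in_image[OF assms(1)] by (auto simp: edges_def)
  moreover have "card (w ` e) = card e" using permutes_inj_on[OF assms(1)] by (rule card_image)
  ultimately show ?thesis using assms(2) by (simp add: edges_def)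
qed

lemma poly_act_mem:
  assumes "w permutes {1..n}" "f \<in> edge_polys n"
  shows "poly_act w f \<in> edge_polys n"
  unfolding poly_act_expand
proof (intro edge_polys_sum edge_polys_single)
  fix k assume "k \<in> Poly_Mapping.keys f"
  then have "Poly_Mapping.keys k \<subseteq> edges n" using assms(2) by (simp add: edge_polys_def)
  then show "Poly_Mapping.keys (monom_act w k) \<subseteq> edges n"
    using keys_monom_act[of w k] edges_act[OF assms(1)] by blast
qed

lemma hom_component_poly_act: "hom_component d (poly_act w f) = poly_act w (hom_component d f)"
proof -
  have 1: "hom_component d (poly_act w (Poly_Mapping.single k a)) = poly_act w (hom_component d (Poly_Mapping.single k a))" for k a
    using ring_map_poly_act[of w] by (simp add: poly_act_single hom_component_single monom_deg_act ring_map_def)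
  have "hom_component d (poly_act w (\<Sum>k\<in>K. Poly_Mapping.single k (Poly_Mapping.lookup f k)))
    = poly_act w (hom_component d (\<Sum>k\<in>K. Poly_Mapping.single k (Poly_Mapping.lookup f k)))" for K
    by (simp only: ring_map_sum[OF ring_map_poly_act] hom_component_sum 1)
  from this[of "Poly_Mapping.keys f"] show ?thesis using sum_singles[of f] by simp
qed

lemma homogeneous_poly_act: "homogeneous d f \<Longrightarrow> homogeneous d (poly_act w f)"
  by (metis hom_component_homogeneous hom_component_poly_act homogeneous_hom_component)

lemma low_degree_poly_act: "low_degree d f \<Longrightarrow> low_degree d (poly_act w f)"
  unfolding poly_act_expand by (intro low_degree_sum) (simp add: low_degree_def monom_deg_act)

lemma bounded_partitions_act:
  assumes "w permutes {1..n}" "P \<in> bounded_partitions n m"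
  shows "partition_act w P \<in> bounded_partitions n m"
proof -
  have "P \<in> level_partitions n m (n - card P)"
    using assms(2) card_star_forest[OF bounded_partitions_on[OF assms(2)]] by (simp add: level_partitions_bounded)
  then have "partition_act w P \<in> level_partitions n m (n - card P)"
    using perm_action.mem_X[OF level_partitions_action assms(1)] by blast
  then show ?thesis by (simp add: level_partitions_bounded)
qed

lemma partition_act_inverse:
  assumes "w permutes {1..n::nat}"
  shows "partition_act w (partition_act (inv' w) P) = P" "partition_act (inv' w) (partition_act w P) = P"
  using perm_action.inv_cancel[OF level_partitions_action assms] by blast+

lemma value_poly_act:
  assumes w: "w permutes {1..n}" and f: "f \<in> edge_polys n"
  shows "point_value (partition_point n Q) (poly_act w f) = point_value (partition_point n (partition_act (inv' w) Q)) f"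
proof -
  note hom = ring_map_mpoly_eval[OF ring_map_id, of "partition_point n Q"]
  have "point_value (partition_point n Q) (poly_act w f) = mpoly_eval (\<lambda>c. c) (\<lambda>e. partition_point n Q (w ` e)) f"
    unfolding poly_act_def ring_map_mpoly_eval_comp[OF hom] mpoly_eval_Const[OF ring_map_id] mpoly_eval_Var[OF ring_map_id] ..
  also have "\<dots> = mpoly_eval (\<lambda>c. c) (partition_point n (partition_act (inv' w) Q)) f"
  proof (rule mpoly_eval_cong)
    fix k e assume "k \<in> Poly_Mapping.keys f" "e \<in> Poly_Mapping.keys k"
    then have e: "e \<in> edges n" using f by (auto simp: edge_polys_def)
    have sub: "w ` e \<subseteq> B \<longleftrightarrow> e \<subseteq> inv' w ` B" for B
    proof
      assume "w ` e \<subseteq> B"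
      then have "inv' w ` w ` e \<subseteq> inv' w ` B" by (rule image_mono)
      then show "e \<subseteq> inv' w ` B" by (simp add: image_image permutes_inverses[OF w])
    next
      assume "e \<subseteq> inv' w ` B"
      then have "w ` e \<subseteq> w ` inv' w ` B" by (rule image_mono)
      then show "w ` e \<subseteq> B" by (simp add: image_image permutes_inverses[OF w])
    qed
    have "(\<exists>B\<in>Q. w ` e \<subseteq> B) \<longleftrightarrow> (\<exists>B\<in>partition_act (inv' w) Q. e \<subseteq> B)"
      by (simp add: sub partition_act_def)
    then show "partition_point n Q (w ` e) = partition_point n (partition_act (inv' w) Q) e"
      using e edges_act[OF w e] by (simp add: partition_point_def)
  qed
  finally show ?thesis .
qed

text \<open>The set of points is stable under the symmetric group, and the action preserves the degree.\<close>

lemma graded_ideal_poly_act: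
  assumes w: "w permutes {1..n}" and f: "f \<in> graded_ideal n (bounded_partition_points n m)"
  shows "poly_act w f \<in> graded_ideal n (bounded_partition_points n m)"
proof -
  let ?Z = "bounded_partition_points n m"
  have fe: "f \<in> edge_polys n" using f by (simp add: graded_ideal_def)
  have "degree_drops n ?Z d (hom_component d (poly_act w f))" for d
  proof -
    have he: "hom_component d f \<in> edge_polys n" using fe by (rule edge_polys_hom_component)
    obtain g where g: "g \<in> edge_polys n" "low_degree d g" "\<forall>z\<in>?Z. point_value z (hom_component d f) = point_value z g"
      using f unfolding graded_ideal_def degree_drops_def by blast
    have "point_value (partition_point n Q) (poly_act w (hom_component d f)) = point_value (partition_point n Q) (poly_act w g)"
      if "Q \<in> bounded_partitions n m" for Q
      using g(3) bounded_partitions_act[OF permutes_inv[OF w] that]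
      by (simp add: value_poly_act[OF w he] value_poly_act[OF w g(1)] bounded_points_image)
    then show ?thesis
      unfolding degree_drops_def hom_component_poly_act
      using g(1,2) by (intro bexI[of _ "poly_act w g"]) (auto simp: bounded_points_image low_degree_poly_act poly_act_mem[OF w])
  qed
  then show ?thesis using poly_act_mem[OF w fe] by (simp add: graded_ideal_def)
qed

lemma poly_act_inverse:
  assumes w: "w permutes {1..n::nat}"
  shows "poly_act w (poly_act (inv' w) f) = f"
proof -
  have "poly_act w (poly_act (inv' w) f) = mpoly_eval (\<lambda>c. poly_act w (Const c)) (\<lambda>e. poly_act w (Var (inv' w ` e))) f"
    unfolding poly_act_def[of "inv' w"] by (rule ring_map_mpoly_eval_comp[OF ring_map_poly_act])
  also have "\<dots> = mpoly_eval Const Var f"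
    unfolding poly_act_def mpoly_eval_Const[OF ring_map_Const] mpoly_eval_Var[OF ring_map_Const]
    by (simp add: image_image permutes_inverses[OF w])
  also have "\<dots> = f"
  proof -
    have prod_single: "(\<Prod>e\<in>A. Poly_Mapping.single (g e) (1::complex)) = Poly_Mapping.single (\<Sum>e\<in>A. g e) 1"
      if "finite A" for A and g :: "nat set \<Rightarrow> (nat set \<Rightarrow>\<^sub>0 nat)"
      using that by (induction A) (auto simp: mult_single)
    have "monom_value Var k = Poly_Mapping.single k (1::complex)" for k :: "nat set \<Rightarrow>\<^sub>0 nat"
      using sum_singles[of k] by (simp add: monom_value_def Var_power prod_single)
    then have "mpoly_eval Const Var f = (\<Sum>k\<in>Poly_Mapping.keys f. Poly_Mapping.single k (Poly_Mapping.lookup f k))"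
      by (simp add: mpoly_eval_alt Const_def mult_single)
    then show ?thesis using sum_singles[of f] by simp
  qed
  finally show ?thesis .
qed

lemma refines_act:
  assumes w: "w permutes {1..n}" and R: "refines {1..n} P Q"
  shows "refines {1..n} (partition_act w P) (partition_act w Q)"
proof -
  have "\<exists>Y\<in>partition_act w Q. X \<subseteq> Y" if X: "X \<in> partition_act w P" for X
  proof -
    obtain B where B: "B \<in> P" "X = w ` B" using X by (auto simp: partition_act_def)
    have "\<exists>C\<in>Q. B \<subseteq> C" using R B(1) unfolding refines_def by (elim conjE) (erule bspec)
    then obtain C where "C \<in> Q" "B \<subseteq> C" by blast
    then show ?thesis using B(2) by (auto simp: partition_act_def)
  qed
  then show ?thesis
    using R partition_on_act[OF w] unfolding refines_def by (intro conjI ballI) auto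
qed

lemma refines_act_iff:
  assumes w: "w permutes {1..n}"
  shows "refines {1..n} (partition_act w P) Q \<longleftrightarrow> refines {1..n} P (partition_act (inv' w) Q)"
  using refines_act[OF w, of P "partition_act (inv' w) Q"] refines_act[OF permutes_inv[OF w], of "partition_act w P" Q]
  by (auto simp: partition_act_inverse[OF w])

text \<open>A partition corresponds to the class of its forest monomial. This is equivariant, although a
  permutation need not map the chosen spanning forests to each other: two forest monomials of the
  same partition have the same degree and the same values.\<close>

theorem orbit_module_iso:
  "sn_iso n (fun_module partition_act (supported_on (level_partitions n m d)))
     (orbit_module n (bounded_partition_points n m) d)"
proof -
  let ?X = "level_partitions n m d" and ?Z = "bounded_partition_points n m"
  let ?R = "edge_poly_ring n"
  define I where "I = graded_ideal n ?Z"
  interpret X: perm_action n ?X partition_act by (rule level_partitions_action)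
  interpret R: cring ?R by (rule edge_poly_cring)
  interpret I: ideal I ?R unfolding I_def by (rule graded_ideal_ideal)
  have gr: "gr_ideal n ?Z = I" by (simp add: I_def gr_ideal_eq)
  define \<phi> where "\<phi> f = I +>\<^bsub>?R\<^esub> forest_poly n m d f" for f
  have car: "carrier (orbit_module n ?Z d) = {I +>\<^bsub>?R\<^esub> f | f. f \<in> edge_polys n \<and> homogeneous d f}"
    by (simp add: orbit_module_def gr)
  have coset: "I +>\<^bsub>?R\<^esub> x = I +>\<^bsub>?R\<^esub> y \<longleftrightarrow> x - y \<in> I" if "x \<in> edge_polys n" "y \<in> edge_polys n" for x y
    using R.quotient_eq_iff_same_a_r_cos[OF I.ideal_axioms, of x y] that by (simp add: edge_ring_minus)
  have ops: "(I +>\<^bsub>?R\<^esub> x) \<oplus>\<^bsub>orbit_module n ?Z d\<^esub> (I +>\<^bsub>?R\<^esub> y) = I +>\<^bsub>?R\<^esub> (x + y)"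
    if "x \<in> edge_polys n" "y \<in> edge_polys n" for x y
    using I.a_rcos_sum[of x y] that by (simp add: orbit_module_def orbit_ring_def gr FactRing_def)
  have Const_mem: "Const c \<in> edge_polys n" for c
    unfolding Const_def by (rule edge_polys_single) simp
  have smult: "c \<odot>\<^bsub>orbit_module n ?Z d\<^esub> (I +>\<^bsub>?R\<^esub> x) = I +>\<^bsub>?R\<^esub> (Const c * x)"
    if "x \<in> edge_polys n" for c x
    using I.rcoset_mult_add[of "Const c" x] that Const_mem
    by (simp add: orbit_module_def orbit_ring_def gr FactRing_def)
  have act: "act (orbit_module n ?Z d) w (I +>\<^bsub>?R\<^esub> x) = I +>\<^bsub>?R\<^esub> poly_act w x"
    if w: "w permutes {1..n}" for w x
  proof -
    have "poly_act w ` I = I"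
    proof (intro equalityI subsetI)
      fix h assume "h \<in> poly_act w ` I"
      then show "h \<in> I" using graded_ideal_poly_act[OF w, of _ m] by (auto simp: I_def)
    next
      fix h assume "h \<in> I"
      then have "poly_act (inv' w) h \<in> I"
        using graded_ideal_poly_act[OF permutes_inv[OF w], of h m] by (simp add: I_def)
      then show "h \<in> poly_act w ` I" using poly_act_inverse[OF w, of h] by (metis imageI)
    qed
    moreover have "poly_act w ` (I +>\<^bsub>?R\<^esub> x) = (\<lambda>h. h + poly_act w x) ` (poly_act w ` I)"
      by (auto simp: a_r_coset_def' poly_act_add image_iff)
    moreover have "I +>\<^bsub>?R\<^esub> poly_act w x = (\<lambda>h. h + poly_act w x) ` I"
      by (auto simp: a_r_coset_def')
    ultimately show ?thesis by (simp add: orbit_module_def)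
  qed
  note mem = forest_poly_mem[of n m d] and homog = forest_poly_homogeneous[of d n m]
  have "sn_hom n (fun_module partition_act (supported_on ?X)) (orbit_module n ?Z d) \<phi>"
    unfolding sn_hom_def
  proof (intro conjI ballI allI impI)
    show "\<phi> \<in> carrier (fun_module partition_act (supported_on ?X)) \<rightarrow> carrier (orbit_module n ?Z d)"
      using mem homog unfolding car \<phi>_def by blast
    fix f
    show "\<phi> (f \<oplus>\<^bsub>fun_module partition_act (supported_on ?X)\<^esub> g) = \<phi> f \<oplus>\<^bsub>orbit_module n ?Z d\<^esub> \<phi> g" for g
      unfolding \<phi>_def ops[OF mem mem] by (simp only: fun_module_simps forest_poly_add)
    show "\<phi> (c \<odot>\<^bsub>fun_module partition_act (supported_on ?X)\<^esub> f) = c \<odot>\<^bsub>orbit_module n ?Z d\<^esub> \<phi> f" for c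
      unfolding \<phi>_def smult[OF mem] by (simp only: fun_module_simps forest_poly_scale)
    fix w assume w: "w permutes {1..n}"
    have "forest_poly n m d (fun_act partition_act w f) - poly_act w (forest_poly n m d f) \<in> I"
      unfolding I_def
    proof (rule graded_if_values_agree[OF mem poly_act_mem[OF w mem] homog homogeneous_poly_act[OF homog]])
      fix Q assume Q: "Q \<in> bounded_partitions n m"
      have Q': "partition_act (inv' w) Q \<in> bounded_partitions n m"
        using bounded_partitions_act[OF permutes_inv[OF w] Q] .
      have "point_value (partition_point n Q) (forest_poly n m d (fun_act partition_act w f))
          = (\<Sum>P\<in>?X. fun_act partition_act w f P * (if refines {1..n} P Q then 1 else 0))"
        by (rule forest_poly_value[OF Q])
      also have "\<dots> = (\<Sum>P\<in>?X. fun_act partition_act w f (partition_act w P) *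
          (if refines {1..n} (partition_act w P) Q then 1 else 0))"
        by (rule sum.reindex_bij_betw[OF X.bij_betw_act[OF w], symmetric])
      also have "\<dots> = (\<Sum>P\<in>?X. f P * (if refines {1..n} P (partition_act (inv' w) Q) then 1 else 0))"
        by (simp only: X.fun_act_apply_act[OF w] refines_act_iff[OF w])
      also have "\<dots> = point_value (partition_point n (partition_act (inv' w) Q)) (forest_poly n m d f)"
        by (rule forest_poly_value[OF Q', symmetric])
      also have "\<dots> = point_value (partition_point n Q) (poly_act w (forest_poly n m d f))"
        by (rule value_poly_act[OF w mem, symmetric])
      finally show "point_value (partition_point n Q) (forest_poly n m d (fun_act partition_act w f))
        = point_value (partition_point n Q) (poly_act w (forest_poly n m d f))" .
    qed
    then show "\<phi> (act (fun_module partition_act (supported_on ?X)) w f) = act (orbit_module n ?Z d) w (\<phi> f)"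
      unfolding \<phi>_def act[OF w] fun_module_simps coset[OF mem poly_act_mem[OF w mem]] .
  qed
  moreover have "bij_betw \<phi> (supported_on ?X) (carrier (orbit_module n ?Z d))"
  proof (rule bij_betwI')
    fix f g assume fg: "f \<in> supported_on ?X" "g \<in> supported_on ?X"
    show "\<phi> f = \<phi> g \<longleftrightarrow> f = g"
    proof
      assume "\<phi> f = \<phi> g"
      then have "forest_poly n m d f - forest_poly n m d g \<in> I" unfolding \<phi>_def coset[OF mem mem] .
      moreover have "forest_poly n m d (f - g) + forest_poly n m d g = forest_poly n m d f"
        unfolding forest_poly_add[symmetric] by simp
      ultimately have "forest_poly n m d (f - g) \<in> I" by (metis add_diff_cancel_right')
      then have "f - g = 0"
        using fg unfolding I_def by (intro forest_poly_injective fs.subspace_diff supported_on_subspace)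
      then show "f = g" by simp
    qed simp
  next
    fix f show "\<phi> f \<in> carrier (orbit_module n ?Z d)"
      using mem homog unfolding car \<phi>_def by blast
  next
    fix C assume "C \<in> carrier (orbit_module n ?Z d)"
    then obtain h where h: "h \<in> edge_polys n" "homogeneous d h" "C = I +>\<^bsub>?R\<^esub> h" unfolding car by blast
    obtain f where f: "f \<in> supported_on ?X" "h - forest_poly n m d f \<in> I"
      using forest_poly_surjective[OF h(1,2), of m] unfolding I_def by blast
    have "C = \<phi> f" unfolding h(3) \<phi>_def coset[OF h(1) mem] by (rule f(2))
    then show "\<exists>f\<in>supported_on ?X. C = \<phi> f" using f(1) by blast
  qed
  ultimately show ?thesis unfolding sn_iso_iff by auto
qed

theorem proposition3p29:
  fixes n m d :: nat
  assumes "m \<le> n"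
  shows "frobenius n (orbit_module n (bounded_partition_points n m) d) =
    (\<Sum>la\<in>{la \<in> int_partitions n. largest_part la \<le> m \<and> int (length la) = int n - int d}. SF la)"
  by (rule frobenius_set_partitions[OF orbit_module_iso])

end
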